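(* Let $s \in L_2(0,\pi)$ be real-valued, and let $$f(\lambda) = h_0 \lambda + h + \sum_{k=1}^d \frac{\delta_k}{h_k - \lambda}, \qquad F(\lambda) = H_0 \lambda + H + \sum_{k=1}^D \frac{\Delta_k}{H_k - \lambda},$$ where $d, D \ge 0$ are integers, $h_0, H_0 \ge 0$, $h, H \in \mathbb{R}$, $\delta_k, \Delta_k > 0$, $h_1 < \ldots < h_d$ and $H_1 < \ldots < H_D$ are real. Consider the boundary value problem $$-\left(y^{[1]}\right)'(x) - s(x) y^{[1]}(x) - s^2(x) y(x) = \lambda y(x), \quad x \in (0,\pi), \qquad \frac{y^{[1]}(0)}{y(0)} = -f(\lambda), \qquad \frac{y^{[1]}(\pi)}{y(\pi)} = F(\lambda),$$ where $y^{[1]} := y' - s y$. Let $\lambda_n$, $n \in \mathbb{N} \cup \{0\}$, be its eigenvalues, and let $\psi_n$ be corresponding real-valued eigenfunctions, normalized as described in the context, with associated vectors $\widehat{\psi}_n \in \mathbb{C}^N$, where $$N := \left\lceil \frac{\operatorname{ind} f}{2} \right\rceil + \left\lceil \frac{\operatorname{ind} F}{2} \right\rceil.$$ Let $\Theta = \{n_1, \ldots, n_N\} \subset \mathbb{N} \cup \{0\}$ be a set of $N$ distinct indices, and let $M_\Theta$ be the $N \times N$ matrix whose $k$-th row consists of the entries of the vector $\widehat{\psi}_{n_k}$, $k = 1, \ldots, N$. Then the sequence $\{\psi_n\}_{n \in (\mathbb{N} \cup \{0\}) \setminus \Theta}$ is a Riesz basis for $L_2(0,\pi)$ if and only if the matrix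 $M_\Theta$ is invertible.
   Context: **Solutions and boundary conditions.** A solution of the differential equation is a function $y$ such that $y$ and its quasi-derivative $y^{[1]} := y' - s y$ are absolutely continuous on $[0,\pi]$ and the equation holds almost everywhere. The boundary conditions are understood in the usual sense of clearing denominators: writing $f = f_\uparrow / f_\downarrow$ and $F = F_\uparrow / F_\downarrow$ with polynomials $f_\uparrow, F_\uparrow$ and $f_\downarrow(\lambda) = c \prod_{k=1}^d (h_k - \lambda)$, $F_\downarrow(\lambda) = C \prod_{k=1}^D (H_k - \lambda)$ (with nonzero constants $c, C$), they read $$f_\downarrow(\lambda) y^{[1]}(0) + f_\uparrow(\lambda) y(0) = 0, \qquad F_\downarrow(\lambda) y^{[1]}(\pi) - F_\uparrow(\lambda) y(\pi) = 0.$$ In particular, if $\lambda = h_k$ the first condition means $y(0) = 0$, and if $\lambda = H_k$ the second means $y(\pi) = 0$. An eigenvalue is a number $\lambda$ for which there is a nonzero solution (an eigenfunction) satisfying both conditions. The eigenvalues are real and simple and form an infinite discrete set bounded below; they are enumerated as $\lambda_0 < \lambda_1 < \lambda_2 < \ldots$. **Index.** $\operatorname{ind} f := 2d+1$ if $h_0 > 0$, and $\operatorname{ind} f := 2d$ if $h_0 = 0$; similarly $\operatorname{ind} F := 2D+1$ if $H_0 > 0$, and $\operatorname{ind} F := 2D$ if $H_0 = 0$. Thus $N$ equals $d + D$ plus the number of nonzero numbers among $h_0, H_0$. **The Hilbert space.** Let $W$ be the $N \times N$ diagonal matrix with diagonal entries $\delta_1^{-1}, \ldots, \delta_d^{-1},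 h_0^{-1}, \Delta_1^{-1}, \ldots, \Delta_D^{-1}, H_0^{-1}$, where the entry $h_0^{-1}$ (respectively, $H_0^{-1}$) is omitted if $h_0 = 0$ (respectively, $H_0 = 0$). Let $\mathcal{H} = L_2(0,\pi) \oplus \mathbb{C}^N$ with inner product $$\left\langle \begin{pmatrix} y \\ \widehat{y} \end{pmatrix}, \begin{pmatrix} z \\ \widehat{z} \end{pmatrix} \right\rangle_{\mathcal{H}} := \int_0^\pi y(x) \overline{z(x)} \, \mathrm{d}x + \widehat{z}^{\dagger} W \widehat{y},$$ where $^\dagger$ denotes the conjugate transpose. **The vectors $\widehat{\psi}_n$ and the normalization.** For an eigenfunction $\psi_n$ corresponding to $\lambda_n$, $\widehat{\psi}_n \in \mathbb{C}^N$ is the column vector with entries, in this order, $$\frac{\delta_1 \psi_n(0)}{\lambda_n - h_1}, \ \ldots, \ \frac{\delta_d \psi_n(0)}{\lambda_n - h_d}, \ -h_0 \psi_n(0), \ \frac{\Delta_1 \psi_n(\pi)}{H_1 - \lambda_n}, \ \ldots, \ \frac{\Delta_D \psi_n(\pi)}{H_D - \lambda_n}, \ H_0 \psi_n(\pi),$$ where the entry $-h_0 \psi_n(0)$ (respectively, $H_0 \psi_n(\pi)$) is omitted if $h_0 = 0$ (respectively, $H_0 = 0$). If $\lambda_n = h_k$ (so that $\psi_n(0) = 0$), the entry $\frac{\delta_k \psi_n(0)}{\lambda_n - h_k}$ is understood as $\psi_n^{[1]}(0)$; if $\lambda_n = H_k$ (so that $\psi_n(\pi) = 0$), the entry $\frac{\Delta_k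 \psi_n(\pi)}{H_k - \lambda_n}$ is understood as $\psi_n^{[1]}(\pi)$. The eigenfunctions $\psi_n$ are chosen real-valued and normalized so that the vector $\begin{pmatrix} \psi_n \\ \widehat{\psi}_n \end{pmatrix}$ has norm one in $\mathcal{H}$. **Known fact (standing background).** The boundary value problem is equivalent to the eigenvalue problem for a self-adjoint operator in $\mathcal{H}$ with discrete spectrum, having the same eigenvalues $\lambda_n$ and eigenvectors $\begin{pmatrix} \psi_n \\ \widehat{\psi}_n \end{pmatrix}$; when the real-valued eigenfunctions $\psi_n$ are normalized so that each vector $\begin{pmatrix} \psi_n \\ \widehat{\psi}_n \end{pmatrix}$ has norm one in $\mathcal{H}$, these vectors, $n \in \mathbb{N} \cup \{0\}$, form an orthonormal basis of $\mathcal{H}$. **Riesz basis.** A sequence in a Hilbert space is a Riesz basis if it is the image of an orthonormal basis of that space under a bounded invertible operator (with bounded inverse). *)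

theory Defs
  imports "HOL-Analysis.Analysis" "Jordan_Normal_Form.Matrix"
begin

section \<open>The complex Hilbert space of square-integrable functions on the interval from 0 to pi\<close>

text \<open>Elements are represented by functions; two functions represent the same element
  if they agree almost everywhere.\<close>

abbreviation I0pi :: "real measure" where
  "I0pi \<equiv> lebesgue_on {0<..<pi}"

definition square_integrable :: "(real \<Rightarrow> 'a::{real_normed_vector}) \<Rightarrow> bool" where
  "square_integrable g \<longleftrightarrow>
     g \<in> borel_measurable I0pi \<and> integrable I0pi (\<lambda>x. (norm (g x))\<^sup>2)"

definition L2 :: "(real \<Rightarrow> complex) set" where
  "L2 = {g. square_integrable g}"

definition L2_inner :: "(real \<Rightarrow> complex) \<Rightarrow> (real \<Rightarrow> complex) \<Rightarrow> complex" where
  "L2_inner y z = (LINT x|I0pi. y x * cnj (z x))"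

definition L2_norm :: "(real \<Rightarrow> complex) \<Rightarrow> real" where
  "L2_norm y = sqrt (Re (L2_inner y y))"

definition L2_orthonormal_basis :: "nat set \<Rightarrow> (nat \<Rightarrow> real \<Rightarrow> complex) \<Rightarrow> bool" where
  "L2_orthonormal_basis A e \<longleftrightarrow>
     (\<forall>n\<in>A. e n \<in> L2) \<and>
     (\<forall>m\<in>A. \<forall>n\<in>A. L2_inner (e m) (e n) = (if m = n then 1 else 0)) \<and>
     (\<forall>g\<in>L2. \<forall>\<epsilon>>0. \<exists>J c. finite J \<and> J \<subseteq> A \<and>
        L2_norm (\<lambda>x. g x - (\<Sum>n\<in>J. c n * e n x)) < \<epsilon>)"

text \<open>Boundedness and linearity together force the operator to respect equality almost
  everywhere.\<close>

definition L2_bounded_operator :: "((real \<Rightarrow> complex) \<Rightarrow> real \<Rightarrow> complex) \<Rightarrow> bool" where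
  "L2_bounded_operator T \<longleftrightarrow>
     (\<forall>g\<in>L2. T g \<in> L2) \<and>
     (\<forall>g\<in>L2. \<forall>k\<in>L2. \<forall>a b :: complex.
        AE x in I0pi. T (\<lambda>t. a * g t + b * k t) x = a * T g x + b * T k x) \<and>
     (\<exists>C. \<forall>g\<in>L2. L2_norm (T g) \<le> C * L2_norm g)"

definition L2_bounded_invertible :: "((real \<Rightarrow> complex) \<Rightarrow> real \<Rightarrow> complex) \<Rightarrow> bool" where
  "L2_bounded_invertible T \<longleftrightarrow>
     L2_bounded_operator T \<and>
     (\<exists>S. L2_bounded_operator S \<and>
        (\<forall>g\<in>L2. (AE x in I0pi. S (T g) x = g x) \<and> (AE x in I0pi. T (S g) x = g x)))"

definition L2_Riesz_basis :: "nat set \<Rightarrow> (nat \<Rightarrow> real \<Rightarrow> complex) \<Rightarrow> bool" where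
  "L2_Riesz_basis A \<phi> \<longleftrightarrow>
     (\<forall>n\<in>A. \<phi> n \<in> L2) \<and>
     (\<exists>e T. L2_orthonormal_basis A e \<and> L2_bounded_invertible T \<and>
        (\<forall>n\<in>A. AE x in I0pi. \<phi> n x = T (e n) x))"


section \<open>Absolutely continuous functions\<close>

definition abs_continuous_on :: "real \<Rightarrow> real \<Rightarrow> (real \<Rightarrow> 'a::real_normed_vector) \<Rightarrow> bool" where
  "abs_continuous_on a b g \<longleftrightarrow>
     (\<forall>\<epsilon>>0. \<exists>\<delta>>0. \<forall>(m::nat) l u.
        (\<forall>i<m. a \<le> l i \<and> l i \<le> u i \<and> u i \<le> b) \<longrightarrow>
        (\<forall>i<m. \<forall>j<m. i \<noteq> j \<longrightarrow> {l i<..<u i} \<inter> {l j<..<u j} = {}) \<longrightarrow>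
        (\<Sum>i<m. u i - l i) < \<delta> \<longrightarrow>
        (\<Sum>i<m. norm (g (u i) - g (l i))) < \<epsilon>)"


section \<open>The rational functions in the boundary conditions\<close>

text \<open>A record \<open>f\<close> stands for the function of \<open>z\<close> with value \<open>slope f * z + const_term f\<close> plus the
  sum of \<open>res f k / (pole f k - z)\<close> over \<open>1 \<le> k \<le> npoles f\<close>. Values of \<open>res f\<close> and \<open>pole f\<close> at
  other indices are irrelevant.\<close>

record bc_function =
  slope :: real
  const_term :: real
  npoles :: nat
  res :: "nat \<Rightarrow> real"
  pole :: "nat \<Rightarrow> real"

definition bc_admissible :: "bc_function \<Rightarrow> bool" where
  "bc_admissible f \<longleftrightarrow>
     0 \<le> slope f \<and> (\<forall>k\<in>{1..npoles f}. 0 < res f k) \<and> strict_mono_on {1..npoles f} (pole f)"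

definition bc_value :: "bc_function \<Rightarrow> complex \<Rightarrow> complex" where
  "bc_value f z = of_real (slope f) * z + of_real (const_term f)
     + (\<Sum>k=1..npoles f. of_real (res f k) / (of_real (pole f k) - z))"

text \<open>The boundary conditions are homogeneous, so the constant factor of the denominator
  may be taken to be 1.\<close>

definition bc_den :: "bc_function \<Rightarrow> complex poly" where
  "bc_den f = (\<Prod>k=1..npoles f. [:of_real (pole f k), -1:])"

definition bc_num :: "bc_function \<Rightarrow> complex poly" where
  "bc_num f = [:of_real (const_term f), of_real (slope f):] * bc_den f
     + (\<Sum>k=1..npoles f. Polynomial.smult (of_real (res f k))
          (\<Prod>j\<in>{1..npoles f} - {k}. [:of_real (pole f j), -1:]))"

lemma bc_num_eq_value_mult_den:
  assumes "\<And>k. k \<in> {1..npoles f} \<Longrightarrow> z \<noteq> of_real (pole f k)"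
  shows "poly (bc_num f) z = bc_value f z * poly (bc_den f) z"
proof -
  let ?P = "\<lambda>A. \<Prod>j\<in>A. complex_of_real (pole f j) - z"
  have "of_real (res f k) * ?P ({1..npoles f} - {k})
      = of_real (res f k) / (of_real (pole f k) - z) * ?P {1..npoles f}"
    if k: "k \<in> {1..npoles f}" for k
  proof -
    have "?P {1..npoles f} = (of_real (pole f k) - z) * ?P ({1..npoles f} - {k})"
      using k by (intro prod.remove) auto
    then show ?thesis using assms[OF k] by simp
  qed
  then have *: "(\<Sum>k=1..npoles f. of_real (res f k) * ?P ({1..npoles f} - {k}))
      = (\<Sum>k=1..npoles f. of_real (res f k) / (of_real (pole f k) - z)) * ?P {1..npoles f}"
    by (simp only: sum_distrib_right cong: sum.cong)
  have "poly (bc_num f) z = (of_real (slope f) * z + of_real (const_term f)) * ?P {1..npoles f}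
      + (\<Sum>k=1..npoles f. of_real (res f k) * ?P ({1..npoles f} - {k}))"
    by (simp add: bc_num_def bc_den_def poly_sum poly_prod algebra_simps)
  also have "\<dots> = bc_value f z * ?P {1..npoles f}"
    unfolding * bc_value_def by (simp only: distrib_right)
  finally show ?thesis
    by (simp add: bc_den_def poly_prod)
qed

definition bc_ind :: "bc_function \<Rightarrow> nat" where
  "bc_ind f = (if 0 < slope f then 2 * npoles f + 1 else 2 * npoles f)"

definition bvp_dim :: "bc_function \<Rightarrow> bc_function \<Rightarrow> nat" where
  "bvp_dim f F = nat \<lceil>real (bc_ind f) / 2\<rceil> + nat \<lceil>real (bc_ind F) / 2\<rceil>"


section \<open>The boundary value problem\<close>

text \<open>In the following, \<open>q\<close> is the quasi-derivative of \<open>y\<close>. The expression \<open>y' - s y\<close> only makes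
  sense almost everywhere, so \<open>q\<close> denotes its continuous representative, which is
  unique on the closed interval.\<close>

definition is_quasi_derivative ::
  "(real \<Rightarrow> real) \<Rightarrow> (real \<Rightarrow> complex) \<Rightarrow> (real \<Rightarrow> complex) \<Rightarrow> bool" where
  "is_quasi_derivative s y q \<longleftrightarrow>
     abs_continuous_on 0 pi y \<and> abs_continuous_on 0 pi q \<and>
     (AE x in I0pi. \<exists>y'. (y has_vector_derivative y') (at x) \<and> q x = y' - of_real (s x) * y x)"

definition is_solution ::
  "(real \<Rightarrow> real) \<Rightarrow> complex \<Rightarrow> (real \<Rightarrow> complex) \<Rightarrow> (real \<Rightarrow> complex) \<Rightarrow> bool" where
  "is_solution s z y q \<longleftrightarrow>
     is_quasi_derivative s y q \<and>
     (AE x in I0pi. \<exists>q'. (q has_vector_derivative q') (at x) \<and>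
        - q' - of_real (s x) * q x - of_real ((s x)\<^sup>2) * y x = z * y x)"

definition is_eigenfunction ::
  "(real \<Rightarrow> real) \<Rightarrow> bc_function \<Rightarrow> bc_function \<Rightarrow> complex \<Rightarrow>
     (real \<Rightarrow> complex) \<Rightarrow> (real \<Rightarrow> complex) \<Rightarrow> bool" where
  "is_eigenfunction s f F z y q \<longleftrightarrow>
     is_solution s z y q \<and> (\<exists>x\<in>{0..pi}. y x \<noteq> 0) \<and>
     poly (bc_den f) z * q 0 + poly (bc_num f) z * y 0 = 0 \<and>
     poly (bc_den F) z * q pi - poly (bc_num F) z * y pi = 0"

definition eigenvalues :: "(real \<Rightarrow> real) \<Rightarrow> bc_function \<Rightarrow> bc_function \<Rightarrow> complex set" where
  "eigenvalues s f F = {z. \<exists>y q. is_eigenfunction s f F z y q}"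


section \<open>The extended Hilbert space\<close>

definition H_weight :: "bc_function \<Rightarrow> bc_function \<Rightarrow> complex mat" where
  "H_weight f F =
     (let w = map (\<lambda>k. inverse (res f k)) [1..<Suc (npoles f)]
            @ (if slope f = 0 then [] else [inverse (slope f)])
            @ map (\<lambda>k. inverse (res F k)) [1..<Suc (npoles F)]
            @ (if slope F = 0 then [] else [inverse (slope F)])
      in mat_diag (bvp_dim f F) (\<lambda>i. of_real (w ! i)))"

definition H_inner ::
  "bc_function \<Rightarrow> bc_function \<Rightarrow> (real \<Rightarrow> complex) \<times> complex vec \<Rightarrow>
     (real \<Rightarrow> complex) \<times> complex vec \<Rightarrow> complex" where
  "H_inner f F u v = L2_inner (fst u) (fst v) + (H_weight f F *\<^sub>v snd u) \<bullet>c snd v"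

definition H_norm ::
  "bc_function \<Rightarrow> bc_function \<Rightarrow> (real \<Rightarrow> complex) \<times> complex vec \<Rightarrow> real" where
  "H_norm f F u = sqrt (Re (H_inner f F u u))"

definition boundary_vec ::
  "bc_function \<Rightarrow> bc_function \<Rightarrow> real \<Rightarrow> (real \<Rightarrow> complex) \<Rightarrow> (real \<Rightarrow> complex) \<Rightarrow> complex vec" where
  "boundary_vec f F mu y q = vec_of_list
     (map (\<lambda>k. if mu = pole f k then q 0
               else of_real (res f k) * y 0 / of_real (mu - pole f k)) [1..<Suc (npoles f)]
      @ (if slope f = 0 then [] else [- of_real (slope f) * y 0])
      @ map (\<lambda>k. if mu = pole F k then q pi
               else of_real (res F k) * y pi / of_real (pole F k - mu)) [1..<Suc (npoles F)]
      @ (if slope F = 0 then [] else [of_real (slope F) * y pi]))"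

lemma bvp_dim_eq:
  assumes "bc_admissible f" "bc_admissible F"
  shows "bvp_dim f F = npoles f + (if slope f = 0 then 0 else 1)
                     + (npoles F + (if slope F = 0 then 0 else 1))"
proof -
  have "nat \<lceil>real (bc_ind g) / 2\<rceil> = npoles g + (if slope g = 0 then 0 else 1)"
    if "bc_admissible g" for g
  proof (cases "slope g = 0")
    case True
    then show ?thesis by (simp add: bc_ind_def)
  next
    case False
    then have "0 < slope g" using that by (simp add: bc_admissible_def)
    moreover have "\<lceil>real (2 * npoles g + 1) / 2\<rceil> = int (npoles g) + 1"
      by (rule ceiling_unique) auto
    ultimately show ?thesis by (simp add: bc_ind_def nat_add_distrib)
  qed
  then show ?thesis using assms by (simp add: bvp_dim_def)
qed

lemma dim_boundary_vec:
  assumes "bc_admissible f" "bc_admissible F"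
  shows "dim_vec (boundary_vec f F mu y q) = bvp_dim f F"
  using bvp_dim_eq[OF assms] by (simp add: boundary_vec_def)

end

theory Submission
  imports Defs "HOL-Library.Function_Algebras" "HOL-Complex_Analysis.Great_Picard"
    "Jordan_Normal_Form.Determinant"
begin

text \<open>Orthonormality and completeness of the vectors formed by \<open>\<psi> n\<close> and its boundary vector are
  proved variationally. The quadratic form of the problem, on pairs of a square-integrable derivative
  and finitely many boundary coordinates, is coercive relative to the extended Hilbert space, into which
  its domain embeds compactly. Hence it attains its minimum on the complement of finitely many
  eigenvectors, so the orthogonal complement of all weak eigenvectors is orthogonal to the domain of the
  form. The domain is dense, and weak eigenvectors correspond to eigenfunctions by the du Bois-Reymond
  lemma. Simplicity of the eigenvalues follows from a Gronwall argument.

  For the criterion, let \<open>(g, b)\<close> be a combination of the basis vectors with index outside \<open>\<Theta>\<close>.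
  Orthogonality to the remaining basis vectors is a linear system for \<open>b\<close> whose matrix is that of the
  theorem up to invertible factors and whose right hand side is controlled by \<open>g\<close>. If the matrix is
  invertible, then the norm of \<open>g\<close> dominates that of \<open>b\<close>, so passing to first components keeps the lower
  Riesz bound. Otherwise there is a vector \<open>(0, b)\<close> with \<open>b \<noteq> 0\<close> in the closed span of the basis
  vectors outside \<open>\<Theta>\<close>, and the lower Riesz bound for the first components fails.\<close>

section \<open>Spaces with a positive semidefinite Hermitian form\<close>

text \<open>Formally the equation is \<open>- y'' + s' y = \<lambda> y\<close>, with a potential
  that is only the derivative of an \<open>L2\<close> function. Integrating by parts against a test
  function \<open>z\<close> replaces \<open>s' y z\<close> by \<open>- s (y z)'\<close>, which makes
  sense as soon as \<open>y'\<close> and \<open>z'\<close> are square-integrable; this dictates the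
  treatment by quadratic forms. The boundary conditions are rational in the eigenvalue. With one
  extra unknown for each pole they become linear in it, and then they are the natural boundary
  conditions of a symmetric form. A vector of the form domain is stored as a derivative together
  with boundary data instead of as an element of a Sobolev space, so that completeness of the domain
  is that of \<open>L2\<close>. Functions represent elements of \<open>L2\<close> only up to null
  sets. Therefore all inner products are merely semidefinite, no quotient is formed, and equality of
  vectors is expressed by a difference of norm zero. Closed subspaces are avoided as well: the
  arguments use finite combinations and limits of explicit sequences.\<close>

locale hermitian_form = vector_space scale
  for scale :: "complex \<Rightarrow> 'v::ab_group_add \<Rightarrow> 'v" (infixr "*s" 75) +
  fixes X :: "'v set" and ip :: "'v \<Rightarrow> 'v \<Rightarrow> complex"
  assumes zero_mem: "0 \<in> X"
    and add_mem: "u \<in> X \<Longrightarrow> v \<in> X \<Longrightarrow> u + v \<in> X"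
    and scale_mem: "u \<in> X \<Longrightarrow> c *s u \<in> X"
    and ip_add_left: "u \<in> X \<Longrightarrow> v \<in> X \<Longrightarrow> w \<in> X \<Longrightarrow> ip (u + v) w = ip u w + ip v w"
    and ip_scale_left: "u \<in> X \<Longrightarrow> v \<in> X \<Longrightarrow> ip (c *s u) v = c * ip u v"
    and ip_cnj: "u \<in> X \<Longrightarrow> v \<in> X \<Longrightarrow> ip v u = cnj (ip u v)"
begin

lemma diff_mem: "u \<in> X \<Longrightarrow> v \<in> X \<Longrightarrow> u - v \<in> X"
  using add_mem[of u "(-1) *s v"] scale_mem[of v "-1"] by (simp add: scale_minus_left)

lemma sum_mem: "(\<And>i. i \<in> A \<Longrightarrow> u i \<in> X) \<Longrightarrow> (\<Sum>i\<in>A. u i) \<in> X"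
  by (induction A rule: infinite_finite_induct) (auto intro: zero_mem add_mem)

lemma lincomb_mem: "(\<And>i. i \<in> A \<Longrightarrow> u i \<in> X) \<Longrightarrow> (\<Sum>i\<in>A. c i *s u i) \<in> X"
  by (intro sum_mem scale_mem)

lemma ip_add_right: "u \<in> X \<Longrightarrow> v \<in> X \<Longrightarrow> w \<in> X \<Longrightarrow> ip w (u + v) = ip w u + ip w v"
  by (metis add_mem complex_cnj_add ip_add_left ip_cnj)

lemma ip_scale_right: "u \<in> X \<Longrightarrow> v \<in> X \<Longrightarrow> ip u (c *s v) = cnj c * ip u v"
  by (metis scale_mem complex_cnj_mult ip_scale_left ip_cnj)

lemma ip_zero_left: "u \<in> X \<Longrightarrow> ip 0 u = 0"
  using ip_scale_left[of 0 u 0] zero_mem by simp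

lemma ip_diff_left: "u \<in> X \<Longrightarrow> v \<in> X \<Longrightarrow> w \<in> X \<Longrightarrow> ip (u - v) w = ip u w - ip v w"
  using ip_add_left[of "u - v" v w] diff_mem[of u v] by simp

lemma ip_diff_right: "u \<in> X \<Longrightarrow> v \<in> X \<Longrightarrow> w \<in> X \<Longrightarrow> ip w (u - v) = ip w u - ip w v"
  using ip_add_right[of "u - v" v w] diff_mem[of u v] by simp

lemma ip_sum_left:
  "(\<And>i. i \<in> A \<Longrightarrow> u i \<in> X) \<Longrightarrow> v \<in> X \<Longrightarrow> ip (\<Sum>i\<in>A. u i) v = (\<Sum>i\<in>A. ip (u i) v)"
  by (induction A rule: infinite_finite_induct)
    (auto simp: ip_zero_left ip_add_left sum_mem)

lemma ip_lincomb_left: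
  "(\<And>i. i \<in> A \<Longrightarrow> u i \<in> X) \<Longrightarrow> v \<in> X \<Longrightarrow>
    ip (\<Sum>i\<in>A. c i *s u i) v = (\<Sum>i\<in>A. c i * ip (u i) v)"
  by (simp add: ip_sum_left scale_mem ip_scale_left)

lemma ip_lincomb_right:
  assumes "\<And>i. i \<in> A \<Longrightarrow> u i \<in> X" "v \<in> X"
  shows "ip v (\<Sum>i\<in>A. c i *s u i) = (\<Sum>i\<in>A. cnj (c i) * ip v (u i))"
proof -
  have "ip v (\<Sum>i\<in>A. c i *s u i) = cnj (ip (\<Sum>i\<in>A. c i *s u i) v)"
    using ip_cnj[of "\<Sum>i\<in>A. c i *s u i" v] lincomb_mem[of A u c] assms by auto
  also have "\<dots> = (\<Sum>i\<in>A. cnj (c i) * ip v (u i))"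
    using assms by (simp add: ip_lincomb_left) (intro sum.cong refl, metis ip_cnj)
  finally show ?thesis .
qed

lemma Im_ip_self: "u \<in> X \<Longrightarrow> Im (ip u u) = 0"
  using ip_cnj[of u u] by (metis complex_cnj cancel_comm_monoid_add_class.diff_cancel
    cnj.simps(2) eq_neg_iff_add_eq_0 mult_2 mult_eq_0_iff zero_neq_numeral)

lemma Re_ip_add_self:
  "u \<in> X \<Longrightarrow> v \<in> X \<Longrightarrow> Re (ip (u + v) (u + v)) = Re (ip u u) + Re (ip v v) + 2 * Re (ip u v)"
  using ip_cnj[of u v] by (simp add: ip_add_left ip_add_right add_mem)

lemma Re_ip_scale_self: "u \<in> X \<Longrightarrow> Re (ip (c *s u) (c *s u)) = (norm c)\<^sup>2 * Re (ip u u)"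
proof -
  assume u: "u \<in> X"
  have "ip (c *s u) (c *s u) = (c * cnj c) * ip u u"
    using u by (simp add: ip_scale_left ip_scale_right scale_mem)
  also have "c * cnj c = of_real ((norm c)\<^sup>2)" by (metis complex_norm_square)
  finally show ?thesis by simp
qed

lemma Re_ip_diff_self:
  "u \<in> X \<Longrightarrow> v \<in> X \<Longrightarrow> Re (ip (u - v) (u - v)) = Re (ip u u) + Re (ip v v) - 2 * Re (ip u v)"
  using ip_cnj[of u v] by (simp add: ip_diff_left ip_diff_right diff_mem)

lemma ip_parallelogram:
  "u \<in> X \<Longrightarrow> v \<in> X \<Longrightarrow>
    Re (ip (u - v) (u - v)) = 2 * Re (ip u u) + 2 * Re (ip v v) - Re (ip (u + v) (u + v))"
  by (simp add: Re_ip_diff_self Re_ip_add_self)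

end

locale semi_inner = hermitian_form +
  assumes ip_ge0: "u \<in> X \<Longrightarrow> 0 \<le> Re (ip u u)"
begin

definition nrm :: "'a \<Rightarrow> real" where "nrm u = sqrt (Re (ip u u))"

lemma nrm_sq: "u \<in> X \<Longrightarrow> (nrm u)\<^sup>2 = Re (ip u u)"
  by (simp add: nrm_def ip_ge0)

lemma nrm_ge0: "u \<in> X \<Longrightarrow> 0 \<le> nrm u"
  by (simp add: nrm_def ip_ge0)

lemma ip_self: "u \<in> X \<Longrightarrow> ip u u = of_real ((nrm u)\<^sup>2)"
  by (simp add: nrm_sq complex_eq_iff Im_ip_self)

lemma nrm_scale: "u \<in> X \<Longrightarrow> nrm (c *s u) = norm c * nrm u"
  by (simp add: nrm_def Re_ip_scale_self real_sqrt_mult)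

lemma nrm_diff_commute: "u \<in> X \<Longrightarrow> v \<in> X \<Longrightarrow> nrm (u - v) = nrm (v - u)"
  using nrm_scale[of "u - v" "-1"] diff_mem[of u v] by (simp add: scale_minus_left)

lemma cauchy_schwarz:
  assumes u: "u \<in> X" and v: "v \<in> X"
  shows "norm (ip u v) \<le> nrm u * nrm v"
proof -
  define a where "a = (norm (ip u v))\<^sup>2"
  have *: "0 \<le> (nrm u)\<^sup>2 + t\<^sup>2 * a * (nrm v)\<^sup>2 - 2 * t * a" for t :: real
  proof -
    let ?c = "of_real t * ip u v"
    have "0 \<le> Re (ip (u - ?c *s v) (u - ?c *s v))"
      using u v by (intro ip_ge0 diff_mem scale_mem)
    also have "\<dots> = Re (ip u u) + (norm ?c)\<^sup>2 * Re (ip v v) - 2 * Re (cnj ?c * ip u v)"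
      using u v by (simp only: Re_ip_diff_self Re_ip_scale_self scale_mem ip_scale_right[OF u v])
    also have "cnj ?c * ip u v = of_real (t * a)"
      by (simp add: a_def) (metis complex_norm_square mult.commute of_real_power)
    finally show ?thesis
      using u v by (simp add: nrm_sq a_def norm_mult power_mult_distrib algebra_simps)
  qed
  have "a \<le> (nrm u)\<^sup>2 * (nrm v)\<^sup>2"
  \<comment> \<open>When \<open>nrm v = 0\<close> the quadratic in \<open>t\<close> above
    degenerates to a linear function, which stays nonnegative only if \<open>a = 0\<close>.
    Otherwise the choice \<open>t = 1 / (nrm v)\<^sup>2\<close> minimizes it.\<close>
  proof (cases "nrm v = 0")
    case True
    have "a = 0"
    proof (rule ccontr)
      assume "a \<noteq> 0"
      then show False
        using *[of "((nrm u)\<^sup>2 + 1) / (2 * a)"] True by simp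
    qed
    then show ?thesis by simp
  next
    case False
    have "(1 / b)\<^sup>2 * a * b - 2 * (1 / b) * a = - (a / b)" if "b \<noteq> 0" for b :: real
      using that by (simp add: field_simps power2_eq_square)
    from this[of "(nrm v)\<^sup>2"] *[of "1 / (nrm v)\<^sup>2"] False
    have "a / (nrm v)\<^sup>2 \<le> (nrm u)\<^sup>2" by (simp del: power_divide)
    then show ?thesis using False by (simp add: pos_divide_le_eq)
  qed
  then have "(norm (ip u v))\<^sup>2 \<le> (nrm u * nrm v)\<^sup>2"
    by (simp add: a_def power_mult_distrib)
  then show ?thesis
    using u v by (meson mult_nonneg_nonneg nrm_ge0 power2_le_imp_le)
qed

lemma nrm_triangle: assumes u: "u \<in> X" and v: "v \<in> X" shows "nrm (u + v) \<le> nrm u + nrm v"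
proof (rule power2_le_imp_le)
  have "Re (ip u v) \<le> nrm u * nrm v"
    using cauchy_schwarz[OF u v] complex_Re_le_cmod[of "ip u v"] by linarith
  then show "(nrm (u + v))\<^sup>2 \<le> (nrm u + nrm v)\<^sup>2"
    using u v by (simp add: nrm_sq add_mem Re_ip_add_self power2_sum)
qed (use u v in \<open>simp add: nrm_ge0\<close>)

lemma nrm_triangle_diff: "u \<in> X \<Longrightarrow> v \<in> X \<Longrightarrow> nrm u \<le> nrm v + nrm (u - v)"
  using nrm_triangle[of v "u - v"] diff_mem[of u v] by simp

lemma nrm_triangle_via:
  "u \<in> X \<Longrightarrow> v \<in> X \<Longrightarrow> w \<in> X \<Longrightarrow> nrm (u - w) \<le> nrm (u - v) + nrm (v - w)"
  using nrm_triangle[of "u - v" "v - w"] by (simp add: diff_mem)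

lemma nrm_zero: "nrm 0 = 0"
  by (simp add: nrm_def ip_zero_left zero_mem)

lemma ip_eq_0_of_nrm: "u \<in> X \<Longrightarrow> v \<in> X \<Longrightarrow> nrm u = 0 \<Longrightarrow> ip u v = 0"
  using cauchy_schwarz[of u v] by simp

lemma ip_tendsto_left:
  assumes "\<And>n::nat. u n \<in> X" "v \<in> X" "z \<in> X" "(\<lambda>n. nrm (u n - v)) \<longlonglongrightarrow> 0"
  shows "(\<lambda>n. ip (u n) z) \<longlonglongrightarrow> ip v z"
proof (rule Lim_transform_bound[THEN Lim_null[THEN iffD2]])
  show "\<forall>\<^sub>F n in sequentially. norm (ip (u n) z - ip v z) \<le> norm (nrm (u n - v) * nrm z)"
    using assms by (intro always_eventually allI)
      (auto simp: ip_diff_left[symmetric] intro!: order.trans[OF cauchy_schwarz] diff_mem)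
  show "(\<lambda>n. nrm (u n - v) * nrm z) \<longlonglongrightarrow> 0"
    using tendsto_mult_right[OF assms(4), of "nrm z"] by simp
qed

lemma nrm_tendsto:
  assumes "\<And>n::nat. u n \<in> X" "v \<in> X" "(\<lambda>n. nrm (u n - v)) \<longlonglongrightarrow> 0"
  shows "(\<lambda>n. nrm (u n)) \<longlonglongrightarrow> nrm v"
proof (rule Lim_transform_bound[THEN Lim_null[THEN iffD2]])
  show "\<forall>\<^sub>F n in sequentially. norm (nrm (u n) - nrm v) \<le> norm (nrm (u n - v))"
  proof (intro always_eventually allI)
    fix n
    show "norm (nrm (u n) - nrm v) \<le> norm (nrm (u n - v))"
      using nrm_triangle_diff[of "u n" v] nrm_triangle_diff[of v "u n"]
        nrm_diff_commute[of "u n" v] assms(1)[of n] assms(2) by simp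
  qed
qed (rule assms(3))

subsection \<open>Orthonormal families\<close>

definition orthonormal :: "nat set \<Rightarrow> (nat \<Rightarrow> 'a) \<Rightarrow> bool" where
  "orthonormal A e \<longleftrightarrow> (\<forall>n\<in>A. e n \<in> X) \<and> (\<forall>m\<in>A. \<forall>n\<in>A. ip (e m) (e n) = (if m = n then 1 else 0))"

lemma orthonormal_subset: "orthonormal A e \<Longrightarrow> B \<subseteq> A \<Longrightarrow> orthonormal B e"
  unfolding orthonormal_def by blast

lemma orthonormal_mem: "orthonormal A e \<Longrightarrow> n \<in> A \<Longrightarrow> e n \<in> X"
  by (simp add: orthonormal_def)

lemma ip_lincomb_orthonormal:
  assumes e: "orthonormal A e" and J: "finite J" "J \<subseteq> A" and n: "n \<in> A"
  shows "ip (\<Sum>j\<in>J. c j *s e j) (e n) = (if n \<in> J then c n else 0)"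
proof -
  have "ip (\<Sum>j\<in>J. c j *s e j) (e n) = (\<Sum>j\<in>J. c j * ip (e j) (e n))"
    using e J n by (intro ip_lincomb_left) (auto simp: orthonormal_def)
  also have "\<dots> = (\<Sum>j\<in>J. if j = n then c n else 0)"
    using e J n by (intro sum.cong) (auto simp: orthonormal_def)
  finally show ?thesis using J by simp
qed

lemma nrm_lincomb_orthonormal:
  assumes e: "orthonormal A e" and J: "finite J" "J \<subseteq> A"
  shows "(nrm (\<Sum>j\<in>J. c j *s e j))\<^sup>2 = (\<Sum>j\<in>J. (norm (c j))\<^sup>2)"
proof -
  let ?v = "\<Sum>j\<in>J. c j *s e j"
  have mem: "\<And>j. j \<in> J \<Longrightarrow> e j \<in> X" "?v \<in> X"
    using e J by (auto simp: orthonormal_def intro!: lincomb_mem)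
  have "ip ?v ?v = (\<Sum>j\<in>J. cnj (c j) * ip ?v (e j))"
    using mem by (intro ip_lincomb_right)
  also have "\<dots> = (\<Sum>j\<in>J. of_real ((norm (c j))\<^sup>2))"
  proof (intro sum.cong refl)
    fix j assume "j \<in> J"
    then have "ip ?v (e j) = c j" using J by (subst ip_lincomb_orthonormal[OF e J]) auto
    then show "cnj (c j) * ip ?v (e j) = of_real ((norm (c j))\<^sup>2)"
      by (metis complex_norm_square mult.commute)
  qed
  finally show ?thesis using mem by (simp add: nrm_sq)
qed

lemma nrm_minus_lincomb_orthonormal:
  assumes e: "orthonormal A e" and J: "finite J" "J \<subseteq> A" and u: "u \<in> X"
  shows "(nrm (u - (\<Sum>j\<in>J. ip u (e j) *s e j)))\<^sup>2 = (nrm u)\<^sup>2 - (\<Sum>j\<in>J. (norm (ip u (e j)))\<^sup>2)"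
proof -
  let ?v = "\<Sum>j\<in>J. ip u (e j) *s e j"
  have mem: "\<And>j. j \<in> J \<Longrightarrow> e j \<in> X" "?v \<in> X"
    using e J by (auto simp: orthonormal_def intro!: lincomb_mem)
  have "ip u ?v = (\<Sum>j\<in>J. cnj (ip u (e j)) * ip u (e j))"
    using mem u by (intro ip_lincomb_right)
  then have "Re (ip u ?v) = (\<Sum>j\<in>J. (norm (ip u (e j)))\<^sup>2)"
    by (simp only: mult.commute[of "cnj _"] complex_norm_square[symmetric] of_real_sum[symmetric] Re_complex_of_real)
  moreover have "(nrm ?v)\<^sup>2 = (\<Sum>j\<in>J. (norm (ip u (e j)))\<^sup>2)"
    by (rule nrm_lincomb_orthonormal[OF e J])
  ultimately show ?thesis
    using u mem by (simp add: nrm_sq Re_ip_diff_self diff_mem)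
qed

lemma bessel:
  assumes "orthonormal A e" "finite J" "J \<subseteq> A" "u \<in> X"
  shows "(\<Sum>j\<in>J. (norm (ip u (e j)))\<^sup>2) \<le> (nrm u)\<^sup>2"
  using nrm_minus_lincomb_orthonormal[OF assms] zero_le_power2 by (metis diff_ge_0_iff_ge)

end

locale semi_hilbert = semi_inner +
  assumes complete: "\<And>u. (\<And>n::nat. u n \<in> X) \<Longrightarrow>
     (\<And>\<epsilon>. 0 < \<epsilon> \<Longrightarrow> \<exists>N. \<forall>m\<ge>N. \<forall>n\<ge>N. sqrt (Re (ip (u m - u n) (u m - u n))) < \<epsilon>) \<Longrightarrow>
     \<exists>v\<in>X. (\<lambda>n. sqrt (Re (ip (u n - v) (u n - v)))) \<longlonglongrightarrow> 0"
begin

lemma Cauchy_limit: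
  assumes "\<And>n::nat. u n \<in> X" "\<And>\<epsilon>. 0 < \<epsilon> \<Longrightarrow> \<exists>N. \<forall>m\<ge>N. \<forall>n\<ge>N. nrm (u m - u n) < \<epsilon>"
  obtains v where "v \<in> X" "(\<lambda>n. nrm (u n - v)) \<longlonglongrightarrow> 0"
  using complete[of u] assms unfolding nrm_def by blast

text \<open>An almost orthogonal expansion is all that the series argument needs: it applies both to
  orthonormal families and to their images under bounded operators.\<close>

lemma bessel_series_converges:
  fixes e :: "nat \<Rightarrow> 'a" and c :: "nat \<Rightarrow> complex"
  assumes e: "\<And>n. n \<in> A \<Longrightarrow> e n \<in> X"
    and bound: "\<And>J c. finite J \<Longrightarrow> J \<subseteq> A \<Longrightarrow> (nrm (\<Sum>j\<in>J. c j *s e j))\<^sup>2 \<le> (\<Sum>j\<in>J. (norm (c j))\<^sup>2)"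
    and c: "\<And>J. finite J \<Longrightarrow> J \<subseteq> A \<Longrightarrow> (\<Sum>j\<in>J. (norm (c j))\<^sup>2) \<le> R"
  obtains v where "v \<in> X" "(\<lambda>n. nrm ((\<Sum>j\<in>A \<inter> {..<n}. c j *s e j) - v)) \<longlonglongrightarrow> 0"
proof -
  let ?u = "\<lambda>n. \<Sum>j\<in>A \<inter> {..<n}. c j *s e j"
  let ?a = "\<lambda>j. if j \<in> A then (norm (c j))\<^sup>2 else 0"
  have sum_a: "(\<Sum>j\<in>J. ?a j) = (\<Sum>j\<in>A \<inter> J. (norm (c j))\<^sup>2)" if "finite J" for J
    using sum.inter_restrict[OF that, of "\<lambda>j. (norm (c j))\<^sup>2" A] by (simp only: Int_commute)
  have "summable ?a"
  proof (rule summableI_nonneg_bounded)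
    show "(\<Sum>j<n. ?a j) \<le> R" for n
      using sum_a[of "{..<n}"] c[of "A \<inter> {..<n}"] by simp
  qed auto
  then have cauchy: "\<exists>N. \<forall>m\<ge>N. \<forall>n. norm (sum ?a {m..<n}) < \<epsilon>" if "\<epsilon> > 0" for \<epsilon>
    using that unfolding summable_Cauchy by blast
  have mem: "?u n \<in> X" for n using e by (intro lincomb_mem) auto
  have le: "(nrm (?u n - ?u m))\<^sup>2 \<le> sum ?a {m..<n}" if "m \<le> n" for m n
  proof -
    have "A \<inter> {..<n} = (A \<inter> {..<m}) \<union> (A \<inter> {m..<n})" using that by auto
    moreover have "(\<Sum>j\<in>(A \<inter> {..<m}) \<union> (A \<inter> {m..<n}). c j *s e j) =
        ?u m + (\<Sum>j\<in>A \<inter> {m..<n}. c j *s e j)"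
      by (rule sum.union_disjoint) auto
    ultimately have "?u n = ?u m + (\<Sum>j\<in>A \<inter> {m..<n}. c j *s e j)" by metis
    then have "(nrm (?u n - ?u m))\<^sup>2 = (nrm (\<Sum>j\<in>A \<inter> {m..<n}. c j *s e j))\<^sup>2" by simp
    also have "\<dots> \<le> sum ?a {m..<n}"
      using bound[of "A \<inter> {m..<n}" c] by (simp add: sum_a)
    finally show ?thesis .
  qed
  have "\<exists>N. \<forall>m\<ge>N. \<forall>n\<ge>N. nrm (?u m - ?u n) < \<epsilon>" if \<epsilon>: "\<epsilon> > 0" for \<epsilon>
  proof -
    obtain N where N: "\<And>m n. m \<ge> N \<Longrightarrow> norm (sum ?a {m..<n}) < \<epsilon>\<^sup>2"
      using cauchy[OF zero_less_power[OF \<epsilon>, of 2]] by blast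
    have *: "nrm (?u n - ?u m) < \<epsilon>" if "N \<le> m" "m \<le> n" for m n
    proof (rule power2_less_imp_less)
      show "(nrm (?u n - ?u m))\<^sup>2 < \<epsilon>\<^sup>2"
        using le[OF that(2)] N[OF that(1), of n] by simp
    qed (use \<open>\<epsilon> > 0\<close> in simp)
    show ?thesis
    proof (intro exI[of _ N] allI impI)
      fix m n assume "N \<le> m" "N \<le> n"
      then show "nrm (?u m - ?u n) < \<epsilon>"
        using *[of m n] *[of n m] nrm_diff_commute[OF mem mem, of m n] by (cases "m \<le> n") auto
    qed
  qed
  then obtain v where "v \<in> X" "(\<lambda>n. nrm (?u n - v)) \<longlonglongrightarrow> 0"
    using Cauchy_limit[of ?u] mem by blast
  then show ?thesis by (rule that)
qed

text \<open>By Bessel's inequality the partial sums converge to some \<open>v\<close>. The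
  difference \<open>v - u\<close> is orthogonal to every \<open>e n\<close>, so totality puts
  \<open>v\<close> at distance zero from \<open>u\<close>.\<close>

lemma orthonormal_expansion:
  assumes e: "orthonormal A e"
    and total: "\<And>u. u \<in> X \<Longrightarrow> (\<And>n. n \<in> A \<Longrightarrow> ip u (e n) = 0) \<Longrightarrow> nrm u = 0"
    and u: "u \<in> X"
  shows "(\<lambda>n. nrm ((\<Sum>j\<in>A \<inter> {..<n}. ip u (e j) *s e j) - u)) \<longlonglongrightarrow> 0"
proof -
  let ?s = "\<lambda>n. \<Sum>j\<in>A \<inter> {..<n}. ip u (e j) *s e j"
  have mem: "?s n \<in> X" for n
    using e by (intro lincomb_mem) (auto simp: orthonormal_def)
  obtain v where v: "v \<in> X" and lim: "(\<lambda>n. nrm (?s n - v)) \<longlonglongrightarrow> 0"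
  proof (rule bessel_series_converges[of A e "\<lambda>j. ip u (e j)" "(nrm u)\<^sup>2"])
    show "\<And>J. finite J \<Longrightarrow> J \<subseteq> A \<Longrightarrow> (\<Sum>j\<in>J. (norm (ip u (e j)))\<^sup>2) \<le> (nrm u)\<^sup>2"
      by (rule bessel[OF e _ _ u])
    show "\<And>J c. finite J \<Longrightarrow> J \<subseteq> A \<Longrightarrow> (nrm (\<Sum>j\<in>J. c j *s e j))\<^sup>2 \<le> (\<Sum>j\<in>J. (norm (c j))\<^sup>2)"
      by (simp add: nrm_lincomb_orthonormal[OF e])
  qed (use e in \<open>auto simp: orthonormal_def\<close>)
  have "ip (v - u) (e k) = 0" if k: "k \<in> A" for k
  proof -
    have ek: "e k \<in> X" using e k by (rule orthonormal_mem)
    have "(\<lambda>n. ip (?s n) (e k)) \<longlonglongrightarrow> ip v (e k)"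
      by (rule ip_tendsto_left[OF mem v ek lim])
    moreover have "(\<lambda>n. ip (?s n) (e k)) \<longlonglongrightarrow> ip u (e k)"
    proof (rule tendsto_eventually)
      show "\<forall>\<^sub>F n in sequentially. ip (?s n) (e k) = ip u (e k)"
        using eventually_gt_at_top[of k]
        by eventually_elim (subst ip_lincomb_orthonormal[OF e], use k in auto)
    qed
    ultimately show ?thesis using LIMSEQ_unique u v ek by (fastforce simp: ip_diff_left)
  qed
  then have vu: "nrm (v - u) = 0" using total u v diff_mem by blast
  have "nrm (?s n - u) \<le> nrm (?s n - v)" for n
    using nrm_triangle_via[OF mem v u, of n] vu by simp
  moreover have "0 \<le> nrm (?s n - u)" for n by (intro nrm_ge0 diff_mem mem u)
  ultimately show ?thesis by (intro tendsto_sandwich[OF _ _ tendsto_const lim]) (auto intro: always_eventually)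
qed

end

section \<open>Weak eigenvectors of a coercive form\<close>

text \<open>\<open>XV\<close> is the form domain, \<open>XH\<close> the ambient space and
  \<open>J\<close> the embedding between them. The inequality \<open>coercive\<close> is of Garding
  type: the form controls the norm of \<open>XV\<close> only after a multiple of the ambient norm
  has been added, so finitely many negative eigenvalues are allowed. Compactness is phrased by
  Cauchy subsequences because \<open>XH\<close> carries just a semi-inner product here.\<close>

locale compact_form =
  V: semi_hilbert sV XV ipV + H: semi_inner sH XH ipH + B: hermitian_form sV XV B
  for sV :: "complex \<Rightarrow> 'v::ab_group_add \<Rightarrow> 'v" and XV ipV
    and sH :: "complex \<Rightarrow> 'w::ab_group_add \<Rightarrow> 'w" and XH ipH
    and B :: "'v \<Rightarrow> 'v \<Rightarrow> complex" +
  fixes J :: "'v \<Rightarrow> 'w" and K K' \<alpha> C :: real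
  assumes J_mem: "u \<in> XV \<Longrightarrow> J u \<in> XH"
    and J_add: "u \<in> XV \<Longrightarrow> v \<in> XV \<Longrightarrow> J (u + v) = J u + J v"
    and J_scale: "u \<in> XV \<Longrightarrow> J (sV c u) = sH c (J u)"
    and J_bound: "u \<in> XV \<Longrightarrow> H.nrm (J u) \<le> K' * V.nrm u"
    and B_bound: "u \<in> XV \<Longrightarrow> v \<in> XV \<Longrightarrow> norm (B u v) \<le> K * V.nrm u * V.nrm v"
    and \<alpha>_pos: "\<alpha> > 0"
    and coercive: "u \<in> XV \<Longrightarrow> \<alpha> * (V.nrm u)\<^sup>2 \<le> Re (B u u) + C * (H.nrm (J u))\<^sup>2"
    and compact_embedding: "(\<And>n::nat. w n \<in> XV) \<Longrightarrow> (\<And>n. V.nrm (w n) \<le> R) \<Longrightarrow>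
      \<exists>r :: nat \<Rightarrow> nat. strict_mono r \<and> (\<forall>\<epsilon>>0. \<exists>N. \<forall>m\<ge>N. \<forall>n\<ge>N. H.nrm (J (w (r m)) - J (w (r n))) < \<epsilon>)"
begin

lemma J_diff: "u \<in> XV \<Longrightarrow> v \<in> XV \<Longrightarrow> J (u - v) = J u - J v"
  using J_add[of "u - v" v] V.diff_mem[of u v] by simp

lemma J_zero: "J 0 = 0"
  using J_add[of 0 0] V.zero_mem by simp

lemma J_lincomb:
  "(\<And>i. i \<in> A \<Longrightarrow> u i \<in> XV) \<Longrightarrow> J (\<Sum>i\<in>A. sV (c i) (u i)) = (\<Sum>i\<in>A. sH (c i) (J (u i)))"
  by (induction A rule: infinite_finite_induct)
    (auto simp: J_zero J_add J_scale V.scale_mem V.lincomb_mem)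

definition weak_eigenvector :: "real \<Rightarrow> 'v \<Rightarrow> bool" where
  "weak_eigenvector \<nu> v \<longleftrightarrow> v \<in> XV \<and> (\<forall>z\<in>XV. B v z = \<nu> * ipH (J v) (J z))"

lemma weak_eigenvector_mem: "weak_eigenvector \<nu> v \<Longrightarrow> v \<in> XV"
  by (simp add: weak_eigenvector_def)

lemma weak_eigenvector_B: "weak_eigenvector \<nu> v \<Longrightarrow> z \<in> XV \<Longrightarrow> B v z = \<nu> * ipH (J v) (J z)"
  by (simp add: weak_eigenvector_def)

lemma B_weak_eigenvector:
  "weak_eigenvector \<nu> v \<Longrightarrow> z \<in> XV \<Longrightarrow> B z v = \<nu> * ipH (J z) (J v)"
  using B.ip_cnj[of v z] H.ip_cnj[of "J v" "J z"] weak_eigenvector_B[of \<nu> v z]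
  by (simp add: J_mem weak_eigenvector_mem)

lemma weak_eigenvectors_orthogonal:
  assumes "weak_eigenvector \<mu> u" "weak_eigenvector \<nu> v" "\<mu> \<noteq> \<nu>"
  shows "ipH (J u) (J v) = 0"
  using weak_eigenvector_B[OF assms(1), of v] B_weak_eigenvector[OF assms(2), of u] assms
  by (auto simp: weak_eigenvector_mem)

lemma B_tendsto_left:
  assumes "\<And>n::nat. u n \<in> XV" "v \<in> XV" "z \<in> XV" "(\<lambda>n. V.nrm (u n - v)) \<longlonglongrightarrow> 0"
  shows "(\<lambda>n. B (u n) z) \<longlonglongrightarrow> B v z"
proof (rule Lim_transform_bound[THEN Lim_null[THEN iffD2]])
  show "\<forall>\<^sub>F n in sequentially. norm (B (u n) z - B v z) \<le> norm (K * V.nrm (u n - v) * V.nrm z)"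
  proof (intro always_eventually allI)
    fix n
    show "norm (B (u n) z - B v z) \<le> norm (K * V.nrm (u n - v) * V.nrm z)"
      using B_bound[of "u n - v" z] assms V.diff_mem[OF assms(1,2), of n]
      by (simp add: B.ip_diff_left)
  qed
  show "(\<lambda>n. K * V.nrm (u n - v) * V.nrm z) \<longlonglongrightarrow> 0"
    using tendsto_mult_right[OF tendsto_mult_left[OF assms(4), of K], of "V.nrm z"] by simp
qed

lemma B_self_tendsto:
  assumes u: "\<And>n::nat. u n \<in> XV" "v \<in> XV" and lim: "(\<lambda>n. V.nrm (u n - v)) \<longlonglongrightarrow> 0"
  shows "(\<lambda>n. Re (B (u n) (u n))) \<longlonglongrightarrow> Re (B v v)"
proof -
  have eq: "Re (B (u n) (u n)) = Re (B (u n - v) (u n - v)) + 2 * Re (B (u n) v) - Re (B v v)" for n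
    using u by (simp add: B.Re_ip_diff_self)
  have "(\<lambda>n. Re (B (u n - v) (u n - v))) \<longlonglongrightarrow> 0"
  proof (rule Lim_null_comparison)
    show "\<forall>\<^sub>F n in sequentially. norm (Re (B (u n - v) (u n - v))) \<le> K * V.nrm (u n - v) * V.nrm (u n - v)"
      using u by (intro always_eventually allI) (metis B_bound V.diff_mem abs_Re_le_cmod order_trans real_norm_def)
    show "(\<lambda>n. K * V.nrm (u n - v) * V.nrm (u n - v)) \<longlonglongrightarrow> 0"
      using tendsto_mult[OF tendsto_mult_left[OF lim, of K] lim] by simp
  qed
  moreover have "(\<lambda>n. Re (B (u n) v)) \<longlonglongrightarrow> Re (B v v)"
    by (intro tendsto_Re B_tendsto_left u lim)
  ultimately have "(\<lambda>n. Re (B (u n - v) (u n - v)) + 2 * Re (B (u n) v) - Re (B v v))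
      \<longlonglongrightarrow> 0 + 2 * Re (B v v) - Re (B v v)"
    by (intro tendsto_diff tendsto_add tendsto_mult_left tendsto_const)
  then show ?thesis unfolding eq by simp
qed

lemma J_tendsto:
  assumes "\<And>n::nat. u n \<in> XV" "v \<in> XV" and lim: "(\<lambda>n. V.nrm (u n - v)) \<longlonglongrightarrow> 0"
  shows "(\<lambda>n. H.nrm (J (u n) - J v)) \<longlonglongrightarrow> 0"
proof (rule Lim_null_comparison)
  show "\<forall>\<^sub>F n in sequentially. norm (H.nrm (J (u n) - J v)) \<le> K' * V.nrm (u n - v)"
    using assms
    by (intro always_eventually allI) (simp add: H.nrm_ge0 J_mem H.diff_mem J_diff[symmetric] V.diff_mem J_bound)
  show "(\<lambda>n. K' * V.nrm (u n - v)) \<longlonglongrightarrow> 0"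
    using tendsto_mult_left[OF lim, of K'] by simp
qed

section \<open>Minimization of the form on orthogonal complements\<close>

definition complement :: "'v set \<Rightarrow> 'v set" where
  "complement S = {v\<in>XV. \<forall>w\<in>S. ipH (J v) (J w) = 0}"

lemma complement_mem: "v \<in> complement S \<Longrightarrow> v \<in> XV"
  by (simp add: complement_def)

lemma complement_add: "S \<subseteq> XV \<Longrightarrow> u \<in> complement S \<Longrightarrow> v \<in> complement S \<Longrightarrow> u + v \<in> complement S"
  by (auto simp: complement_def V.add_mem J_add H.ip_add_left J_mem subset_iff)

lemma complement_scale: "S \<subseteq> XV \<Longrightarrow> u \<in> complement S \<Longrightarrow> sV c u \<in> complement S"
  by (auto simp: complement_def V.scale_mem J_scale H.ip_scale_left J_mem subset_iff)

text \<open>Direct method for the Rayleigh quotient. Coercivity bounds the quotient below and bounds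
  a minimizing sequence in \<open>XV\<close>; a subsequence is Cauchy in \<open>XH\<close>, and
  minimality improves this to Cauchy in \<open>XV\<close>. The convergence is strong, so no weak
  topology or lower semicontinuity enters.\<close>

lemma minimizer_exists:
  assumes S: "S \<subseteq> XV" and v0: "v0 \<in> complement S" "H.nrm (J v0) \<noteq> 0"
  obtains v \<nu> where "v \<in> complement S" "H.nrm (J v) = 1" "Re (B v v) = \<nu>"
    "\<And>u. u \<in> complement S \<Longrightarrow> \<nu> * (H.nrm (J u))\<^sup>2 \<le> Re (B u u)"
proof -
  define U where "U = {u \<in> complement S. H.nrm (J u) = 1}"
  define \<nu> where "\<nu> = (INF u\<in>U. Re (B u u))"
  have normalize: "sV (inverse (of_real (H.nrm (J u)))) u \<in> U"
    if "u \<in> complement S" "H.nrm (J u) \<noteq> 0" for u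
    using that S complement_mem[OF that(1)]
    by (simp add: U_def complement_scale J_scale H.nrm_scale J_mem norm_inverse H.nrm_ge0)
  have U_ne: "U \<noteq> {}" using normalize[OF v0] by auto
  have coercive': "- C * (H.nrm (J u))\<^sup>2 \<le> Re (B u u)" if "u \<in> complement S" for u
  proof -
    have "0 \<le> \<alpha> * (V.nrm u)\<^sup>2" using \<alpha>_pos by simp
    then show ?thesis using coercive[OF complement_mem[OF that]] by linarith
  qed
  have lower: "- C \<le> Re (B u u)" if "u \<in> U" for u
    using coercive'[of u] that by (simp add: U_def)
  have bdd: "bdd_below ((\<lambda>u. Re (B u u)) ` U)"
    using lower by (intro bdd_belowI[of _ "- C"]) auto
  have \<nu>_le: "\<nu> * (H.nrm (J u))\<^sup>2 \<le> Re (B u u)" if u: "u \<in> complement S" for u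
  proof (cases "H.nrm (J u) = 0")
    case True
    then show ?thesis using coercive'[OF u] by simp
  next
    case False
    let ?c = "inverse (complex_of_real (H.nrm (J u)))"
    have "\<nu> \<le> Re (B (sV ?c u) (sV ?c u))"
      unfolding \<nu>_def by (rule cINF_lower[OF bdd normalize[OF u False]])
    also have "\<dots> = (inverse (H.nrm (J u)))\<^sup>2 * Re (B u u)"
      using complement_mem[OF u] by (simp add: B.Re_ip_scale_self norm_inverse power_inverse)
    finally have "\<nu> \<le> Re (B u u) / (H.nrm (J u))\<^sup>2"
      by (simp add: power_inverse divide_inverse mult.commute)
    then show ?thesis using False by (simp add: pos_le_divide_eq)
  qed
  have "\<exists>u\<in>U. Re (B u u) < \<nu> + 1 / real (Suc n)" for n
    using cINF_less_iff[OF U_ne bdd, of "\<nu> + 1 / real (Suc n)"] unfolding \<nu>_def[symmetric] by simp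
  then obtain u where u: "\<And>n. u n \<in> U" and u_lt: "\<And>n. Re (B (u n) (u n)) < \<nu> + 1 / real (Suc n)"
    by metis
  have uV: "u n \<in> XV" and uS: "u n \<in> complement S" and uH: "H.nrm (J (u n)) = 1" for n
    using u[of n] complement_mem by (auto simp: U_def)
  have u_ge: "\<nu> \<le> Re (B (u n) (u n))" for n using \<nu>_le[OF uS, of n] uH by simp
  have u_lim: "(\<lambda>n. Re (B (u n) (u n))) \<longlonglongrightarrow> \<nu>"
  proof (rule tendsto_sandwich[OF _ _ tendsto_const])
    show "(\<lambda>n. \<nu> + 1 / real (Suc n)) \<longlonglongrightarrow> \<nu>"
      using tendsto_add[OF tendsto_const LIMSEQ_inverse_real_of_nat, of \<nu>] by (simp add: divide_inverse)
  qed (use u_ge u_lt in \<open>auto intro!: always_eventually less_imp_le\<close>)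
  have "V.nrm (u n) \<le> sqrt ((\<bar>\<nu>\<bar> + 1 + \<bar>C\<bar>) / \<alpha>)" for n
  proof (rule real_le_rsqrt)
    have "1 / real (Suc n) \<le> 1" by simp
    then have "Re (B (u n) (u n)) \<le> \<nu> + 1" using u_lt[of n] by linarith
    then have "\<alpha> * (V.nrm (u n))\<^sup>2 \<le> \<bar>\<nu>\<bar> + 1 + \<bar>C\<bar>"
      using coercive[OF uV, of n] uH[of n] by simp
    then show "(V.nrm (u n))\<^sup>2 \<le> (\<bar>\<nu>\<bar> + 1 + \<bar>C\<bar>) / \<alpha>"
      using \<alpha>_pos by (simp add: field_simps)
  qed
  from compact_embedding[of u, OF uV this] obtain r :: "nat \<Rightarrow> nat" where r: "strict_mono r"
    and cauchy: "\<forall>\<epsilon>>0. \<exists>N. \<forall>m\<ge>N. \<forall>n\<ge>N. H.nrm (J (u (r m)) - J (u (r n))) < \<epsilon>"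
    by blast
  define w where "w n = u (r n)" for n
  have wV: "w n \<in> XV" and wS: "w n \<in> complement S" and wH: "H.nrm (J (w n)) = 1" for n
    using uV uS uH by (auto simp: w_def)
  have w_lim: "(\<lambda>n. Re (B (w n) (w n))) \<longlonglongrightarrow> \<nu>"
    using LIMSEQ_subseq_LIMSEQ[OF u_lim r] by (simp add: w_def o_def)
  text \<open>The parallelogram identity turns minimality into the Cauchy property for the form.\<close>
  have key: "\<alpha> * (V.nrm (w m - w n))\<^sup>2 \<le>
      2 * (Re (B (w m) (w m)) - \<nu>) + 2 * (Re (B (w n) (w n)) - \<nu>) + (\<bar>\<nu>\<bar> + \<bar>C\<bar>) * (H.nrm (J (w m) - J (w n)))\<^sup>2"
    for m n
  proof -
    let ?d = "(H.nrm (J (w m) - J (w n)))\<^sup>2"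
    have HJ: "J (w m) \<in> XH" "J (w n) \<in> XH" using wV J_mem by auto
    have "?d = 2 * (H.nrm (J (w m)))\<^sup>2 + 2 * (H.nrm (J (w n)))\<^sup>2 - (H.nrm (J (w m) + J (w n)))\<^sup>2"
      using HJ by (simp only: H.nrm_sq H.diff_mem H.add_mem H.ip_parallelogram)
    then have par: "?d = 4 - (H.nrm (J (w m + w n)))\<^sup>2"
      using wH[of m] wH[of n] by (simp add: J_add wV)
    have "\<nu> * (4 - ?d) \<le> Re (B (w m + w n) (w m + w n))"
      using \<nu>_le[OF complement_add[OF S wS wS], of m n] par by simp
    then have "Re (B (w m - w n) (w m - w n)) \<le>
        2 * (Re (B (w m) (w m)) - \<nu>) + 2 * (Re (B (w n) (w n)) - \<nu>) + \<nu> * ?d"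
      by (simp add: B.ip_parallelogram wV algebra_simps)
    moreover have "\<nu> * ?d + C * ?d \<le> (\<bar>\<nu>\<bar> + \<bar>C\<bar>) * ?d"
      unfolding distrib_right[symmetric] by (intro mult_right_mono) auto
    ultimately show ?thesis
      using coercive[OF V.diff_mem[OF wV wV], of m n] by (simp add: J_diff wV)
  qed
  have "\<exists>N. \<forall>m\<ge>N. \<forall>n\<ge>N. V.nrm (w m - w n) < \<epsilon>" if \<epsilon>: "\<epsilon> > 0" for \<epsilon>
  proof -
    \<comment> \<open>Once each form difference and the embedding term in \<open>key\<close> are
      controlled by \<open>\<eta>\<close>, the right-hand side of \<open>key\<close> is below
      \<open>5 * \<eta>\<close>, and \<open>8 * \<eta> = \<alpha> * \<epsilon>\<^sup>2\<close>
      leaves room.\<close>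
    define \<eta> where "\<eta> = \<alpha> * \<epsilon>\<^sup>2 / 8"
    have \<eta>: "\<eta> > 0" using \<epsilon> \<alpha>_pos by (simp add: \<eta>_def)
    define \<delta> where "\<delta> = sqrt (\<eta> / (\<bar>\<nu>\<bar> + \<bar>C\<bar> + 1))"
    have \<delta>: "\<delta> > 0" using \<eta> by (simp add: \<delta>_def add_nonneg_pos)
    obtain N1 where N1: "\<And>n. n \<ge> N1 \<Longrightarrow> \<bar>Re (B (w n) (w n)) - \<nu>\<bar> < \<eta>"
      using LIMSEQ_D[OF w_lim \<eta>] by (auto simp: real_norm_def)
    obtain N2 where N2: "\<And>m n. m \<ge> N2 \<Longrightarrow> n \<ge> N2 \<Longrightarrow> H.nrm (J (w m) - J (w n)) < \<delta>"
      using cauchy \<delta> unfolding w_def by blast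
    show ?thesis
    proof (intro exI[of _ "max N1 N2"] allI impI)
      fix m n assume mn: "max N1 N2 \<le> m" "max N1 N2 \<le> n"
      have "(H.nrm (J (w m) - J (w n)))\<^sup>2 \<le> \<delta>\<^sup>2"
        using N2[of m n] mn by (intro power_mono H.nrm_ge0 H.diff_mem J_mem wV) auto
      then have "(\<bar>\<nu>\<bar> + \<bar>C\<bar>) * (H.nrm (J (w m) - J (w n)))\<^sup>2 \<le> (\<bar>\<nu>\<bar> + \<bar>C\<bar> + 1) * \<delta>\<^sup>2"
        by (intro mult_mono) auto
      also have "\<delta>\<^sup>2 = \<eta> / (\<bar>\<nu>\<bar> + \<bar>C\<bar> + 1)"
        unfolding \<delta>_def using \<eta> by (intro real_sqrt_pow2) simp
      also have "(\<bar>\<nu>\<bar> + \<bar>C\<bar> + 1) * (\<eta> / (\<bar>\<nu>\<bar> + \<bar>C\<bar> + 1)) = \<eta>"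
        by simp
      finally have le: "(\<bar>\<nu>\<bar> + \<bar>C\<bar>) * (H.nrm (J (w m) - J (w n)))\<^sup>2 \<le> \<eta>" .
      have "\<alpha> * (V.nrm (w m - w n))\<^sup>2 < \<alpha> * \<epsilon>\<^sup>2"
      proof -
        have close: "\<bar>Re (B (w m) (w m)) - \<nu>\<bar> < \<eta>" "\<bar>Re (B (w n) (w n)) - \<nu>\<bar> < \<eta>"
          using N1 mn by auto
        have "\<alpha> * \<epsilon>\<^sup>2 = 8 * \<eta>" by (simp add: \<eta>_def)
        moreover have "x < 8 * h"
          if "x \<le> 2 * a + 2 * b + c" "\<bar>a\<bar> < h" "\<bar>b\<bar> < h" "c \<le> h" "0 < h" for x a b c h :: real
          using that by linarith
        from this[OF key close le \<eta>] have "\<alpha> * (V.nrm (w m - w n))\<^sup>2 < 8 * \<eta>" .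
        ultimately show ?thesis by simp
      qed
      then have "(V.nrm (w m - w n))\<^sup>2 < \<epsilon>\<^sup>2"
        by (simp only: mult_less_cancel_left_pos[OF \<alpha>_pos])
      then show "V.nrm (w m - w n) < \<epsilon>"
        by (rule power2_less_imp_less) (use \<epsilon> in simp)
    qed
  qed
  then obtain v where v: "v \<in> XV" and lim: "(\<lambda>n. V.nrm (w n - v)) \<longlonglongrightarrow> 0"
    using V.Cauchy_limit[of w] wV by blast
  have Jlim: "(\<lambda>n. H.nrm (J (w n) - J v)) \<longlonglongrightarrow> 0" by (rule J_tendsto[OF wV v lim])
  show ?thesis
  proof (rule that[of v \<nu>])
    have "ipH (J v) (J z) = 0" if z: "z \<in> S" for z
    proof (rule LIMSEQ_unique)
      show "(\<lambda>n. ipH (J (w n)) (J z)) \<longlonglongrightarrow> ipH (J v) (J z)"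
        using z S wV v by (intro H.ip_tendsto_left Jlim J_mem) auto
      show "(\<lambda>n. ipH (J (w n)) (J z)) \<longlonglongrightarrow> 0"
        using z wS by (simp add: complement_def)
    qed
    then show "v \<in> complement S" using v by (simp add: complement_def)
    have "(\<lambda>n. H.nrm (J (w n))) \<longlonglongrightarrow> H.nrm (J v)"
      by (intro H.nrm_tendsto Jlim J_mem wV v)
    then show "H.nrm (J v) = 1" by (simp add: wH LIMSEQ_const_iff)
    show "Re (B v v) = \<nu>"
      by (rule LIMSEQ_unique[OF B_self_tendsto[OF wV v lim] w_lim])
  qed (rule \<nu>_le)
qed

text \<open>First variation: along \<open>v + t z\<close> the excess of the form over its minimal
  value is \<open>2 t b + t\<^sup>2 q\<close>, nonnegative for all real \<open>t\<close>, which
  forces \<open>b = 0\<close>. This is the real part of the claim; the imaginary part follows by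
  inserting \<open>\<i> z\<close> for \<open>z\<close>.\<close>

lemma minimizer_weak_eigenvector_complement:
  assumes S: "S \<subseteq> XV" and v: "v \<in> complement S" "H.nrm (J v) = 1"
    and min: "\<And>u. u \<in> complement S \<Longrightarrow> Re (B v v) * (H.nrm (J u))\<^sup>2 \<le> Re (B u u)"
    and z: "z \<in> complement S"
  shows "B v z = Re (B v v) * ipH (J v) (J z)"
proof -
  define \<nu> where "\<nu> = Re (B v v)"
  have vV: "v \<in> XV" using v complement_mem by blast
  have Re0: "Re (B v z - \<nu> * ipH (J v) (J z)) = 0" if z: "z \<in> complement S" for z
  proof -
    define b where "b = Re (B v z - \<nu> * ipH (J v) (J z))"
    define q where "q = Re (B z z) - \<nu> * (H.nrm (J z))\<^sup>2"
    have zV: "z \<in> XV" using z complement_mem by blast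
    have q: "q \<ge> 0" using min[OF z] by (simp add: q_def \<nu>_def)
    have *: "0 \<le> 2 * t * b + t\<^sup>2 * q" for t :: real
    proof -
      let ?u = "v + sV (of_real t) z"
      have "?u \<in> complement S" using S v z by (intro complement_add complement_scale)
      then have "\<nu> * (H.nrm (J ?u))\<^sup>2 \<le> Re (B ?u ?u)" using min by (simp add: \<nu>_def)
      moreover have "Re (B ?u ?u) = \<nu> + t\<^sup>2 * Re (B z z) + 2 * t * Re (B v z)"
        using vV zV
        by (simp add: B.Re_ip_add_self V.scale_mem B.Re_ip_scale_self B.ip_scale_right[OF vV zV] \<nu>_def)
      moreover have "(H.nrm (J ?u))\<^sup>2 = 1 + t\<^sup>2 * (H.nrm (J z))\<^sup>2 + 2 * t * Re (ipH (J v) (J z))"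
      proof -
        have "Re (ipH (J v) (J v)) = 1" using v(2) H.nrm_sq[OF J_mem[OF vV]] by simp
        then show ?thesis
          using vV zV by (simp add: H.nrm_sq J_mem H.add_mem H.scale_mem J_add J_scale V.scale_mem
            H.Re_ip_add_self H.Re_ip_scale_self
            H.ip_scale_right[OF J_mem[OF vV] J_mem[OF zV]])
      qed
      ultimately show ?thesis by (simp add: b_def q_def algebra_simps)
    qed
    show ?thesis
    proof (rule ccontr)
      assume "Re (B v z - \<nu> * ipH (J v) (J z)) \<noteq> 0"
      then have b: "b \<noteq> 0" by (simp add: b_def)
      \<comment> \<open>The denominator is positive since \<open>q \<ge> 0\<close>, and at
        \<open>t = - w\<close> the quadratic takes the negative value
        \<open>- (w\<^sup>2 * (q + 2))\<close>.\<close>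
      define w where "w = b / (q + 1)"
      have b_eq: "b = w * (q + 1)" using q by (simp add: w_def)
      have "2 * (- w) * b + (- w)\<^sup>2 * q = - (w\<^sup>2 * (q + 2))"
        by (simp add: b_eq algebra_simps power2_eq_square)
      moreover have "0 < w\<^sup>2 * (q + 2)" using b q b_eq by (intro mult_pos_pos) auto
      ultimately show False using *[of "- w"] by linarith
    qed
  qed
  have zV: "z \<in> XV" using z complement_mem by blast
  have "Re (B v (sV \<i> z) - \<nu> * ipH (J v) (J (sV \<i> z))) = 0"
    by (intro Re0 complement_scale S z)
  then have "Im (B v z - \<nu> * ipH (J v) (J z)) = 0"
    using vV zV by (simp add: J_scale B.ip_scale_right H.ip_scale_right J_mem)
  with Re0[OF z] show ?thesis by (simp add: complex_eq_iff \<nu>_def)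
qed

text \<open>The eigenvalue equation is known so far only for test vectors in the complement. An
  arbitrary \<open>z\<close> is split into its projection \<open>p\<close> onto the earlier
  eigenvectors and a remainder in the complement. Both sides vanish at \<open>p\<close>:
  orthogonality to an eigenvector in \<open>XH\<close> entails orthogonality for the form.\<close>

lemma next_weak_eigenvector:
  fixes \<phi> :: "nat \<Rightarrow> 'v" and lam :: "nat \<Rightarrow> real"
  assumes eig: "\<And>i. i < m \<Longrightarrow> weak_eigenvector (lam i) (\<phi> i)"
    and orth: "H.orthonormal {..<m} (\<lambda>i. J (\<phi> i))"
    and v0: "v0 \<in> complement (\<phi> ` {..<m})" "H.nrm (J v0) \<noteq> 0"
  obtains v \<nu> where "weak_eigenvector \<nu> v" "v \<in> complement (\<phi> ` {..<m})" "H.nrm (J v) = 1"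
    "\<And>u. u \<in> complement (\<phi> ` {..<m}) \<Longrightarrow> \<nu> * (H.nrm (J u))\<^sup>2 \<le> Re (B u u)"
proof -
  let ?S = "\<phi> ` {..<m}"
  have S: "?S \<subseteq> XV" using eig weak_eigenvector_mem by blast
  obtain v \<nu> where v: "v \<in> complement ?S" "H.nrm (J v) = 1" "Re (B v v) = \<nu>"
    and min: "\<And>u. u \<in> complement ?S \<Longrightarrow> \<nu> * (H.nrm (J u))\<^sup>2 \<le> Re (B u u)"
    by (rule minimizer_exists[OF S v0]) blast
  have vV: "v \<in> XV" using v complement_mem by blast
  have "B v z = \<nu> * ipH (J v) (J z)" if z: "z \<in> XV" for z
  proof -
    define c where "c i = ipH (J z) (J (\<phi> i))" for i
    define p where "p = (\<Sum>i<m. sV (c i) (\<phi> i))"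
    have \<phi>V: "\<And>i. i < m \<Longrightarrow> \<phi> i \<in> XV" using eig weak_eigenvector_mem by blast
    have pV: "p \<in> XV" using \<phi>V by (auto simp: p_def intro!: V.lincomb_mem)
    have Jp: "J p = (\<Sum>i<m. sH (c i) (J (\<phi> i)))"
      unfolding p_def using \<phi>V by (intro J_lincomb) auto
    have "z - p \<in> complement ?S"
    proof -
      have "ipH (J p) (J (\<phi> i)) = c i" if "i < m" for i
        unfolding Jp using that by (subst H.ip_lincomb_orthonormal[OF orth]) auto
      then show ?thesis
        using z pV \<phi>V by (auto simp: complement_def V.diff_mem J_diff H.ip_diff_left J_mem c_def)
    qed
    then have "B v (z - p) = \<nu> * ipH (J v) (J (z - p))"
      using minimizer_weak_eigenvector_complement[OF S v(1,2) _ , of "z - p"] min v(3) by auto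
    moreover have "ipH (J v) (J p) = 0"
      using v \<phi>V vV unfolding Jp
      by (subst H.ip_lincomb_right) (auto simp: J_mem complement_def)
    moreover have "B v p = 0"
    proof -
      have "B v p = (\<Sum>i<m. cnj (c i) * B v (\<phi> i))"
        unfolding p_def using \<phi>V vV by (intro B.ip_lincomb_right) auto
      also have "\<dots> = 0"
        using v by (intro sum.neutral ballI) (auto simp: B_weak_eigenvector[OF eig vV] complement_def)
      finally show ?thesis .
    qed
    ultimately show ?thesis
      using z pV vV by (simp add: B.ip_diff_right J_diff H.ip_diff_right J_mem)
  qed
  then have "weak_eigenvector \<nu> v" using vV by (simp add: weak_eigenvector_def)
  then show ?thesis using that v min by blast
qed

text \<open>Eigenvalues bounded by \<open>L\<close> would, by coercivity, bound the eigenvectors in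
  \<open>XV\<close>. Their images would then have a Cauchy subsequence, although any two of them are
  at distance \<open>sqrt 2\<close>.\<close>

lemma eigenvalues_unbounded:
  fixes \<phi> :: "nat \<Rightarrow> 'v" and lam :: "nat \<Rightarrow> real"
  assumes eig: "\<And>i. weak_eigenvector (lam i) (\<phi> i)"
    and orth: "H.orthonormal UNIV (\<lambda>i. J (\<phi> i))"
  shows "\<exists>n. L < lam n"
proof (rule ccontr)
  assume "\<nexists>n. L < lam n"
  then have L: "lam n \<le> L" for n by (simp add: not_less)
  have \<phi>V: "\<phi> n \<in> XV" for n using eig weak_eigenvector_mem by blast
  have J\<phi>: "J (\<phi> n) \<in> XH" for n using \<phi>V J_mem by blast
  have one: "ipH (J (\<phi> n)) (J (\<phi> n)) = 1" for n using orth by (simp add: H.orthonormal_def)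
  have "V.nrm (\<phi> n) \<le> sqrt ((L + C) / \<alpha>)" for n
  proof (rule real_le_rsqrt)
    have "\<alpha> * (V.nrm (\<phi> n))\<^sup>2 \<le> L + C"
      using coercive[OF \<phi>V, of n] L[of n] by (simp add: weak_eigenvector_B[OF eig \<phi>V] one H.nrm_sq J\<phi>)
    then show "(V.nrm (\<phi> n))\<^sup>2 \<le> (L + C) / \<alpha>" using \<alpha>_pos by (simp add: field_simps)
  qed
  from compact_embedding[of \<phi>, OF \<phi>V this] obtain r :: "nat \<Rightarrow> nat" where r: "strict_mono r"
    and cauchy: "\<forall>\<epsilon>>0. \<exists>N. \<forall>m\<ge>N. \<forall>n\<ge>N. H.nrm (J (\<phi> (r m)) - J (\<phi> (r n))) < \<epsilon>"
    by blast
  obtain N where N: "\<And>m n. m \<ge> N \<Longrightarrow> n \<ge> N \<Longrightarrow> H.nrm (J (\<phi> (r m)) - J (\<phi> (r n))) < 1"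
    using cauchy[THEN spec, of 1] by auto
  have "r N \<noteq> r (Suc N)" using strict_monoD[OF r, of N "Suc N"] by simp
  then have "ipH (J (\<phi> (r N))) (J (\<phi> (r (Suc N)))) = 0"
    using orth by (simp add: H.orthonormal_def)
  then have "(H.nrm (J (\<phi> (r N)) - J (\<phi> (r (Suc N)))))\<^sup>2 = 2"
    using J\<phi> by (simp add: H.nrm_sq H.diff_mem H.Re_ip_diff_self one)
  moreover have "(H.nrm (J (\<phi> (r N)) - J (\<phi> (r (Suc N)))))\<^sup>2 \<le> 1\<^sup>2"
    using N[of N "Suc N"] by (intro power_mono H.nrm_ge0 H.diff_mem J\<phi>) auto
  ultimately show False by simp
qed

text \<open>For the remainder \<open>u - p m\<close> after \<open>m\<close> eigenvectors the form is
  bounded by \<open>D\<close> uniformly in \<open>m\<close>, while it dominates \<open>lam m\<close>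
  times the squared ambient norm. Since \<open>lam\<close> is unbounded, the remainders tend to zero
  in \<open>XH\<close>, and \<open>w\<close> is orthogonal to every \<open>p m\<close>. The
  assumption \<open>exhaust\<close> identifies the minimum on the complement with some
  \<open>lam j\<close>.\<close>

lemma orthogonal_to_eigenvectors:
  fixes \<phi> :: "nat \<Rightarrow> 'v" and lam :: "nat \<Rightarrow> real"
  assumes eig: "\<And>i. weak_eigenvector (lam i) (\<phi> i)"
    and orth: "H.orthonormal UNIV (\<lambda>i. J (\<phi> i))"
    and mono: "mono lam"
    and exhaust: "\<And>\<nu> v. weak_eigenvector \<nu> v \<Longrightarrow> H.nrm (J v) = 1 \<Longrightarrow>
      \<exists>j c. \<nu> = lam j \<and> H.nrm (J v - sH c (J (\<phi> j))) = 0"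
    and w: "w \<in> XH" and perp: "\<And>n. ipH w (J (\<phi> n)) = 0"
    and u: "u \<in> XV"
  shows "ipH w (J u) = 0"
proof -
  have \<phi>V: "\<phi> n \<in> XV" for n using eig weak_eigenvector_mem by blast
  have J\<phi>: "J (\<phi> n) \<in> XH" for n using \<phi>V J_mem by blast
  define c where "c i = ipH (J u) (J (\<phi> i))" for i
  define p where "p m = (\<Sum>i<m. sV (c i) (\<phi> i))" for m
  have pV: "p m \<in> XV" for m using \<phi>V by (auto simp: p_def intro!: V.lincomb_mem)
  have Jp: "J (p m) = (\<Sum>i<m. sH (c i) (J (\<phi> i)))" for m
    unfolding p_def using \<phi>V by (intro J_lincomb) auto
  have perp': "ipH (J (u - p m)) (J (\<phi> i)) = 0" if "i < m" for i m
  proof -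
    have "ipH (J (p m)) (J (\<phi> i)) = c i"
      unfolding Jp using that by (subst H.ip_lincomb_orthonormal[OF orth]) auto
    then show ?thesis
      using u pV \<phi>V by (simp add: J_diff H.ip_diff_left J_mem c_def)
  qed
  then have compl: "u - p m \<in> complement (\<phi> ` {..<m})" for m
    using u pV by (auto simp: complement_def V.diff_mem)
  \<comment> \<open>The form of the remainder is \<open>B u u\<close> minus the sum of
    \<open>lam i * (norm (c i))\<^sup>2\<close>. Only negative \<open>lam i\<close> can increase it;
    they are at least \<open>lam 0\<close>, and Bessel's inequality bounds the sum of the
    coefficients.\<close>
  define D where "D = \<bar>Re (B u u)\<bar> + \<bar>lam 0\<bar> * (H.nrm (J u))\<^sup>2"
  have upper: "Re (B (u - p m) (u - p m)) \<le> D" for m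
  proof -
    have "B (p m) (u - p m) = (\<Sum>i<m. c i * B (\<phi> i) (u - p m))"
      unfolding p_def[of m] using \<phi>V u pV[unfolded p_def]
      by (intro B.ip_lincomb_left V.diff_mem) auto
    also have "\<dots> = 0"
    proof (intro sum.neutral ballI)
      fix i assume "i \<in> {..<m}"
      then have "ipH (J (\<phi> i)) (J (u - p m)) = 0"
        using perp'[of i m] H.ip_cnj[of "J (u - p m)" "J (\<phi> i)"] u pV J\<phi> by (simp add: J_mem V.diff_mem)
      then show "c i * B (\<phi> i) (u - p m) = 0"
        using weak_eigenvector_B[OF eig, of "u - p m" i] u pV by (simp add: V.diff_mem)
    qed
    finally have 1: "B (p m) (u - p m) = 0" .
    have "B (p m) u = (\<Sum>i<m. c i * B (\<phi> i) u)"
      unfolding p_def using \<phi>V u by (intro B.ip_lincomb_left) auto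
    also have "\<dots> = (\<Sum>i<m. of_real (lam i * (norm (c i))\<^sup>2))"
    proof (intro sum.cong refl)
      fix i
      have "ipH (J (\<phi> i)) (J u) = cnj (c i)"
        unfolding c_def using H.ip_cnj[of "J u" "J (\<phi> i)"] u J\<phi> J_mem by blast
      then show "c i * B (\<phi> i) u = of_real (lam i * (norm (c i))\<^sup>2)"
        using weak_eigenvector_B[OF eig u, of i] by (simp add: complex_norm_square flip: of_real_power)
    qed
    finally have 2: "Re (B (p m) u) = (\<Sum>i<m. lam i * (norm (c i))\<^sup>2)" by simp
    have 3: "Re (B (u - p m) (u - p m)) = Re (B u u) - Re (B (p m) u)"
    proof -
      have "B u (p m) = cnj (B (p m) u)" using u pV by (intro B.ip_cnj)
      then show ?thesis using 1 u pV by (simp add: B.ip_diff_left B.ip_diff_right V.diff_mem)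
    qed
    have 4: "- Re (B (p m) u) \<le> \<bar>lam 0\<bar> * (\<Sum>i<m. (norm (c i))\<^sup>2)"
    proof -
      have "- (lam i * (norm (c i))\<^sup>2) \<le> \<bar>lam 0\<bar> * (norm (c i))\<^sup>2" for i
        using mult_right_mono[of "- lam i" "\<bar>lam 0\<bar>" "(norm (c i))\<^sup>2"] monoD[OF mono, of 0 i] by simp
      then show ?thesis unfolding 2 sum_negf[symmetric] sum_distrib_left by (intro sum_mono)
    qed
    have "(\<Sum>i<m. (norm (c i))\<^sup>2) \<le> (H.nrm (J u))\<^sup>2"
      unfolding c_def using H.bessel[OF orth, of "{..<m}" "J u"] u J_mem by simp
    then have "\<bar>lam 0\<bar> * (\<Sum>i<m. (norm (c i))\<^sup>2) \<le> \<bar>lam 0\<bar> * (H.nrm (J u))\<^sup>2"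
      by (intro mult_left_mono) auto
    then show ?thesis using 3 4 unfolding D_def by linarith
  qed
  have lower: "lam m * (H.nrm (J (u - p m)))\<^sup>2 \<le> Re (B (u - p m) (u - p m))" for m
  proof (cases "H.nrm (J (u - p m)) = 0")
    case True
    have "0 \<le> \<alpha> * (V.nrm (u - p m))\<^sup>2" using \<alpha>_pos by simp
    then show ?thesis
      using coercive[OF V.diff_mem[OF u pV], of m] True by simp
  next
    case False
    obtain v \<nu> where v: "weak_eigenvector \<nu> v" "v \<in> complement (\<phi> ` {..<m})" "H.nrm (J v) = 1"
      and min: "\<And>z. z \<in> complement (\<phi> ` {..<m}) \<Longrightarrow> \<nu> * (H.nrm (J z))\<^sup>2 \<le> Re (B z z)"
      using next_weak_eigenvector[OF eig H.orthonormal_subset[OF orth] compl False] by blast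
    obtain j c' where j: "\<nu> = lam j" "H.nrm (J v - sH c' (J (\<phi> j))) = 0"
      using exhaust[OF v(1,3)] by blast
    have vV: "J v \<in> XH" using v weak_eigenvector_mem J_mem by blast
    \<comment> \<open>Up to a factor the minimizer is the eigenvector with number \<open>j\<close>.
      It is orthogonal to the first \<open>m\<close> eigenvectors but not null, so \<open>j\<close>
      cannot be one of their indices.\<close>
    have "m \<le> j"
    proof (rule ccontr)
      assume "\<not> m \<le> j"
      then have "ipH (J v) (J (\<phi> j)) = 0" using v(2) by (auto simp: complement_def)
      moreover have "ipH (J v - sH c' (J (\<phi> j))) (J (\<phi> j)) = 0"
        using vV J\<phi> j(2) by (intro H.ip_eq_0_of_nrm H.diff_mem H.scale_mem)
      moreover have "ipH (J (\<phi> j)) (J (\<phi> j)) = 1" using orth by (simp add: H.orthonormal_def)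
      ultimately have "c' = 0"
        using vV J\<phi> by (simp add: H.ip_diff_left H.scale_mem H.ip_scale_left)
      then show False using j(2) v(3) by simp
    qed
    then have "lam m * (H.nrm (J (u - p m)))\<^sup>2 \<le> \<nu> * (H.nrm (J (u - p m)))\<^sup>2"
      using monoD[OF mono] j(1) by (intro mult_right_mono) auto
    then show ?thesis using min[OF compl] by linarith
  qed
  have small: "norm (ipH w (J u)) \<le> H.nrm w * \<epsilon>" if \<epsilon>: "\<epsilon> > 0" for \<epsilon>
  proof -
    obtain m where m: "D / \<epsilon>\<^sup>2 < lam m" using eigenvalues_unbounded[OF eig orth] by blast
    have D: "D \<ge> 0" by (simp add: D_def)
    have "0 \<le> D / \<epsilon>\<^sup>2" using D by simp
    then have "lam m > 0" using m by linarith
    have "lam m * (H.nrm (J (u - p m)))\<^sup>2 \<le> D" using lower[of m] upper[of m] by linarith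
    also have "D \<le> lam m * \<epsilon>\<^sup>2" using m \<epsilon> by (simp add: field_simps)
    finally have "lam m * (H.nrm (J (u - p m)))\<^sup>2 \<le> lam m * \<epsilon>\<^sup>2" .
    then have "(H.nrm (J (u - p m)))\<^sup>2 \<le> \<epsilon>\<^sup>2"
      using \<open>lam m > 0\<close> by (rule mult_left_le_imp_le)
    then have le: "H.nrm (J (u - p m)) \<le> \<epsilon>"
      by (rule power2_le_imp_le) (use \<epsilon> in simp)
    have "ipH w (J (p m)) = 0"
      unfolding Jp using w J\<phi> perp by (subst H.ip_lincomb_right) auto
    then have "ipH w (J u) = ipH w (J (u - p m))"
      using u pV w by (simp add: J_diff H.ip_diff_right J_mem)
    also have "norm \<dots> \<le> H.nrm w * H.nrm (J (u - p m))"
      using w u pV by (intro H.cauchy_schwarz J_mem V.diff_mem)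
    also have "\<dots> \<le> H.nrm w * \<epsilon>" using le w by (intro mult_left_mono H.nrm_ge0)
    finally show ?thesis .
  qed
  have "norm (ipH w (J u)) \<le> 0"
  proof (rule field_le_epsilon)
    fix e :: real assume e: "e > 0"
    have pos: "H.nrm w + 1 > 0" using H.nrm_ge0[OF w] by simp
    have "norm (ipH w (J u)) \<le> H.nrm w * (e / (H.nrm w + 1))"
      using e pos by (intro small) simp
    also have "\<dots> = e * (H.nrm w / (H.nrm w + 1))" by simp
    also have "\<dots> \<le> e * 1" using e pos by (intro mult_left_mono) auto
    finally show "norm (ipH w (J u)) \<le> 0 + e" by simp
  qed
  then show ?thesis by simp
qed

end

section \<open>Absolutely continuous functions and the Lebesgue integral\<close>

lemma integral_diff_eq_integral:
  fixes f :: "real \<Rightarrow> 'a::banach"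
  assumes f: "f integrable_on {a..b}" and xy: "a \<le> x" "x \<le> y" "y \<le> b"
  shows "integral {a..y} f - integral {a..x} f = integral {x..y} f"
proof -
  have "f integrable_on {a..y}"
    using f xy by (rule_tac integrable_subinterval_real[OF f]) auto
  from Henstock_Kurzweil_Integration.integral_combine[OF xy(1,2) this] show ?thesis
    by (simp add: algebra_simps)
qed

text \<open>Around a point where the difference quotients stay away from \<open>f x\<close> there are arbitrarily
  short intervals with an endpoint at \<open>x\<close> on which the Riemann sum is far from the integral.
  Henstock's lemma bounds the total length of disjoint such intervals, and Vitali's covering
  lemma turns this into a bound for the outer measure of the set of these points.\<close>

lemma negligible_bad_difference_quotients:
  fixes f :: "real \<Rightarrow> 'a::euclidean_space"
  assumes f: "f integrable_on {a..b}" and c: "c > 0"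
  shows "negligible {x \<in> {a<..<b}. \<forall>d>0. \<exists>y\<in>{a..b}. y \<noteq> x \<and> \<bar>y - x\<bar> < d \<and>
    norm (integral {a..y} f - integral {a..x} f - (y - x) *\<^sub>R f x) > c * \<bar>y - x\<bar>}" (is "negligible ?E")
  unfolding negligible_outer_le
proof (intro allI impI)
  fix e :: real assume e: "e > 0"
  have "f integrable_on cbox a b" using f by (simp add: box_real)
  \<comment> \<open>The factor five compensates the enlargement in Vitali's covering lemma, and
    \<open>c\<close> is the least deviation per unit length on a bad interval.\<close>
  moreover have "c * e / 5 > 0" using c e by simp
  ultimately obtain \<gamma> where \<gamma>: "gauge \<gamma>" and
    henstock: "\<And>p. p tagged_partial_division_of (cbox a b) \<Longrightarrow> \<gamma> fine p \<Longrightarrow>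
      (\<Sum>(x,K)\<in>p. norm (measure lborel K *\<^sub>R f x - integral K f)) < c * e / 5"
    by (rule Henstock_lemma) blast
  \<comment> \<open>The covering lemma deals with balls, so the interval between \<open>x\<close>
    and \<open>y\<close> is written as a ball about its midpoint. The tag \<open>x\<close> is an
    endpoint of it, not the centre.\<close>
  have K0: "cball ((x + y) / 2) (\<bar>y - x\<bar> / 2) = {min x y..max x y}" for x y :: real
    by (auto simp: cball_eq_atLeastAtMost min_def max_def abs_if field_simps)
  have "\<forall>x\<in>?E. \<exists>y. y \<in> {a..b} \<and> y \<noteq> x \<and> \<bar>y - x\<bar> < 1 \<and> cball ((x + y) / 2) (\<bar>y - x\<bar> / 2) \<subseteq> \<gamma> x \<and>
      norm (integral {a..y} f - integral {a..x} f - (y - x) *\<^sub>R f x) > c * \<bar>y - x\<bar>"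
  proof
    fix x assume x: "x \<in> ?E"
    obtain d where d: "d > 0" "ball x d \<subseteq> \<gamma> x"
      using \<gamma> gauge_def openE by (metis (no_types, lifting))
    obtain y where y: "y \<in> {a..b}" "y \<noteq> x" "\<bar>y - x\<bar> < min d 1"
      "norm (integral {a..y} f - integral {a..x} f - (y - x) *\<^sub>R f x) > c * \<bar>y - x\<bar>"
      using x d(1) by (auto dest!: spec[of _ "min d 1"])
    have "cball ((x + y) / 2) (\<bar>y - x\<bar> / 2) \<subseteq> ball x d"
      unfolding K0 using y(3) by (auto simp: ball_eq_greaterThanLessThan)
    then have "cball ((x + y) / 2) (\<bar>y - x\<bar> / 2) \<subseteq> \<gamma> x" using d(2) by (rule order_trans)
    with y show "\<exists>y. y \<in> {a..b} \<and> y \<noteq> x \<and> \<bar>y - x\<bar> < 1 \<and>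
      cball ((x + y) / 2) (\<bar>y - x\<bar> / 2) \<subseteq> \<gamma> x \<and>
      norm (integral {a..y} f - integral {a..x} f - (y - x) *\<^sub>R f x) > c * \<bar>y - x\<bar>"
      by (intro exI[of _ y]) auto
  qed
  then obtain g where "\<forall>x\<in>?E. g x \<in> {a..b} \<and> g x \<noteq> x \<and> \<bar>g x - x\<bar> < 1 \<and>
      cball ((x + g x) / 2) (\<bar>g x - x\<bar> / 2) \<subseteq> \<gamma> x \<and>
      norm (integral {a..g x} f - integral {a..x} f - (g x - x) *\<^sub>R f x) > c * \<bar>g x - x\<bar>"
    by (elim bchoice[THEN exE]) 
  note g = this[THEN bspec]
  define m where "m x = (x + g x) / 2" for x
  define r where "r x = \<bar>g x - x\<bar> / 2" for x
  have K: "cball (m x) (r x) = {min x (g x)..max x (g x)}" for x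
    unfolding m_def r_def by (rule K0)
  have r: "0 < r x \<and> r x \<le> 1" if "x \<in> ?E" for x
    using g[OF that] by (auto simp: r_def)
  have sub: "?E \<subseteq> (\<Union>x\<in>?E. cball (m x) (r x))"
    unfolding K by auto
  obtain C where C: "countable C" "C \<subseteq> ?E"
    and disj: "pairwise (\<lambda>i j. disjnt (cball (m i) (r i)) (cball (m j) (r j))) C"
    and cover: "?E \<subseteq> (\<Union>i\<in>C. cball (m i) (5 * r i))"
    by (rule Vitali_covering_lemma_cballs[OF sub, of 1]) (use r in blast)+
  have fin: "(\<Sum>x\<in>D. 2 * r x) \<le> e / 5" if D: "finite D" "D \<subseteq> C" for D
  proof -
    define p where "p = (\<lambda>x. (x, cball (m x) (r x))) ` D"
    have inj: "inj_on (\<lambda>x. (x, cball (m x) (r x))) D" by (auto simp: inj_on_def)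
    have "p tagged_partial_division_of (cbox a b)"
      unfolding tagged_partial_division_of_def
    proof (intro conjI allI impI)
      show "finite p" using D by (simp add: p_def)
    next
      fix x k assume "(x, k) \<in> p"
      then have x: "x \<in> D" and k: "k = cball (m x) (r x)" by (auto simp: p_def)
      have xE: "x \<in> ?E" using x D C by blast
      show "x \<in> k" unfolding k K by auto
      show "k \<subseteq> cbox a b" unfolding k K using g[OF xE] xE by (auto simp: box_real)
      show "\<exists>a b. k = cbox a b" unfolding k K by (metis box_real(2))
    next
      fix x1 k1 x2 k2 assume a: "(x1, k1) \<in> p \<and> (x2, k2) \<in> p \<and> (x1, k1) \<noteq> (x2, k2)"
      then have "x1 \<in> C" "x2 \<in> C" "x1 \<noteq> x2" "k1 = cball (m x1) (r x1)" "k2 = cball (m x2) (r x2)"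
        using D by (auto simp: p_def)
      then have "disjnt k1 k2" using disj by (auto simp: pairwise_def)
      then show "interior k1 \<inter> interior k2 = {}"
        using interior_subset by (fastforce simp: disjnt_def)
    qed
    moreover have "\<gamma> fine p"
    proof (rule fineI)
      fix x k assume "(x, k) \<in> p"
      then have "x \<in> ?E" "k = cball (m x) (r x)" using D C by (auto simp: p_def)
      then show "k \<subseteq> \<gamma> x" using g[of x] by (simp add: m_def r_def)
    qed
    ultimately have "(\<Sum>(x,K)\<in>p. norm (measure lborel K *\<^sub>R f x - integral K f)) < c * e / 5"
      by (rule henstock)
    then have less: "(\<Sum>x\<in>D. norm (measure lborel (cball (m x) (r x)) *\<^sub>R f x - integral (cball (m x) (r x)) f)) < c * e / 5"
      unfolding p_def by (subst (asm) sum.reindex[OF inj]) (simp add: o_def)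
    have "c * (2 * r x) \<le> norm (measure lborel (cball (m x) (r x)) *\<^sub>R f x - integral (cball (m x) (r x)) f)"
      if x: "x \<in> D" for x
    proof -
      have xE: "x \<in> ?E" using x D C by blast
      then have ab: "a \<le> x" "x \<le> b" "a \<le> g x" "g x \<le> b" using g[OF xE] by auto
      have bad: "norm (integral {a..g x} f - integral {a..x} f - (g x - x) *\<^sub>R f x) > c * \<bar>g x - x\<bar>"
        using g[OF xE] by blast
      have rx: "2 * r x = \<bar>g x - x\<bar>" by (simp add: r_def)
      show ?thesis
      proof (cases "x \<le> g x")
        case True
        then have "integral {a..g x} f - integral {a..x} f = integral {x..g x} f"
          using ab by (intro integral_diff_eq_integral[OF f])
        then show ?thesis
          using bad True unfolding K rx
          by (simp add: min_def max_def norm_minus_commute)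
      next
        case False
        then have "integral {a..x} f - integral {a..g x} f = integral {g x..x} f"
          using ab by (intro integral_diff_eq_integral[OF f]) auto
        then have "integral {a..g x} f - integral {a..x} f - (g x - x) *\<^sub>R f x =
            (x - g x) *\<^sub>R f x - integral {g x..x} f"
          by (simp add: algebra_simps)
        then show ?thesis
          using bad False unfolding K rx
          by (simp add: min_def max_def)
      qed
    qed
    then have "c * (\<Sum>x\<in>D. 2 * r x) \<le> c * e / 5"
      unfolding sum_distrib_left using less by (smt (verit) sum_mono)
    then show ?thesis using c by (simp add: field_simps)
  qed
  have meas: "measure lebesgue (cball (m x) (5 * r x)) = 5 * (2 * r x)" if "x \<in> C" for x
  proof -
    have "0 < r x" using r that C by blast
    then show ?thesis by (simp add: cball_eq_atLeastAtMost)
  qed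
  have bound: "measure lebesgue (\<Union>i\<in>D. cball (m i) (5 * r i)) \<le> e" if D: "D \<subseteq> C" "finite D" for D
  proof -
    have "measure lebesgue (\<Union>i\<in>D. cball (m i) (5 * r i)) \<le> (\<Sum>i\<in>D. measure lebesgue (cball (m i) (5 * r i)))"
      using D by (intro measure_UNION_le) auto
    also have "\<dots> = 5 * (\<Sum>i\<in>D. 2 * r i)"
      unfolding sum_distrib_left using D meas by (intro sum.cong) auto
    also have "\<dots> \<le> e" using fin[OF D(2,1)] by simp
    finally show ?thesis .
  qed
  show "\<exists>T. ?E \<subseteq> T \<and> T \<in> lmeasurable \<and> measure lebesgue T \<le> e"
  proof (intro exI conjI)
    show "?E \<subseteq> (\<Union>i\<in>C. cball (m i) (5 * r i))" by (rule cover)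
    show "(\<Union>i\<in>C. cball (m i) (5 * r i)) \<in> lmeasurable"
      by (rule fmeasurable_UN_bound[OF C(1) _ bound]) auto
    show "measure lebesgue (\<Union>i\<in>C. cball (m i) (5 * r i)) \<le> e"
      by (rule measure_UN_bound[OF C(1) _ bound]) auto
  qed
qed

text \<open>If the difference quotients at \<open>x\<close> do not tend to \<open>f x\<close>, they
  stay off by some rate \<open>1 / (k + 1)\<close> at arbitrarily small scale. The exceptional set
  is thus a countable union of the null sets of the preceding lemma.\<close>

theorem indefinite_integral_has_vector_derivative_ae:
  fixes f :: "real \<Rightarrow> 'a::euclidean_space"
  assumes f: "f integrable_on {a..b}"
  obtains N where "negligible N"
    "\<And>x. x \<in> {a<..<b} - N \<Longrightarrow> ((\<lambda>u. integral {a..u} f) has_vector_derivative f x) (at x)"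
proof -
  define E where "E k = {x \<in> {a<..<b}. \<forall>d>0. \<exists>y\<in>{a..b}. y \<noteq> x \<and> \<bar>y - x\<bar> < d \<and>
    norm (integral {a..y} f - integral {a..x} f - (y - x) *\<^sub>R f x) > 1 / real (Suc k) * \<bar>y - x\<bar>}" for k
  have "negligible (\<Union>k. E k)"
    unfolding E_def by (intro negligible_Union_nat negligible_bad_difference_quotients f) simp
  moreover have "((\<lambda>u. integral {a..u} f) has_vector_derivative f x) (at x)"
    if x: "x \<in> {a<..<b} - (\<Union>k. E k)" for x
    unfolding has_vector_derivative_def has_derivative_within_alt2
  proof (intro conjI allI impI)
    show "bounded_linear (\<lambda>h. h *\<^sub>R f x)" by (rule bounded_linear_scaleR_left)
    fix e :: real assume "e > 0"
    then obtain k where k: "1 / real (Suc k) < e" using nat_approx_posE by blast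
    have "x \<notin> E k" and xab: "a < x" "x < b" using x by auto
    then have "\<not> (\<forall>d>0. \<exists>y\<in>{a..b}. y \<noteq> x \<and> \<bar>y - x\<bar> < d \<and>
        norm (integral {a..y} f - integral {a..x} f - (y - x) *\<^sub>R f x) > 1 / real (Suc k) * \<bar>y - x\<bar>)"
      unfolding E_def by simp
    then obtain d where d: "d > 0" and
      bad: "\<not> (\<exists>y\<in>{a..b}. y \<noteq> x \<and> \<bar>y - x\<bar> < d \<and>
        norm (integral {a..y} f - integral {a..x} f - (y - x) *\<^sub>R f x) > 1 / real (Suc k) * \<bar>y - x\<bar>)"
      by blast
    have good: "norm (integral {a..y} f - integral {a..x} f - (y - x) *\<^sub>R f x) \<le> 1 / real (Suc k) * \<bar>y - x\<bar>"
      if "y \<in> {a..b}" "y \<noteq> x" "\<bar>y - x\<bar> < d" for y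
      using bad that by (meson not_less)
    have "\<forall>\<^sub>F y in at x. y \<in> {a<..<b}"
      using xab by (intro eventually_at_in_open') auto
    moreover have "\<forall>\<^sub>F y in at x. \<bar>y - x\<bar> < d \<and> y \<noteq> x"
      using d by (auto simp: eventually_at dist_real_def intro!: exI[of _ d])
    ultimately show "\<forall>\<^sub>F y in at x. norm (integral {a..y} f - integral {a..x} f - (y - x) *\<^sub>R f x) \<le> e * norm (y - x)"
    proof eventually_elim
      case (elim y)
      then have "norm (integral {a..y} f - integral {a..x} f - (y - x) *\<^sub>R f x) \<le> 1 / real (Suc k) * \<bar>y - x\<bar>"
        by (intro good) auto
      also have "\<dots> \<le> e * norm (y - x)" unfolding real_norm_def by (rule mult_right_mono) (use k in auto)
      finally show ?case .
    qed
  qed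
  ultimately show ?thesis using that by blast
qed

text \<open>Truncation at height \<open>n\<close>: the norm of \<open>f\<close> is at most
  \<open>n + g n\<close>, and the integral of \<open>g n\<close> tends to zero by dominated
  convergence. A family of intervals of total length below \<open>\<epsilon> / (2 * (n + 1))\<close>
  collects at most \<open>\<epsilon> / 2\<close> from the bounded part and less than
  \<open>\<epsilon> / 2\<close> from \<open>g n\<close>.\<close>

lemma abs_continuous_on_indefinite_integral:
  fixes f :: "real \<Rightarrow> 'a::euclidean_space"
  assumes f: "f absolutely_integrable_on {a..b}"
  shows "abs_continuous_on a b (\<lambda>x. c + integral {a..x} f)"
  unfolding abs_continuous_on_def
proof (intro allI impI)
  fix \<epsilon> :: real assume \<epsilon>: "\<epsilon> > 0"
  define g where "g n x = max 0 (norm (f x) - real n)" for n x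
  have nf: "(\<lambda>x. norm (f x)) absolutely_integrable_on {a..b}"
    using absolutely_integrable_norm[OF f] by (simp add: o_def)
  have const: "(\<lambda>x. c) absolutely_integrable_on {a..b}" for c :: real
    by (intro absolutely_integrable_continuous_real continuous_intros)
  have gI: "g n absolutely_integrable_on {a..b}" for n
    unfolding g_def by (intro absolutely_integrable_max_1 const set_integral_diff(1) nf)
  have "(\<lambda>n. integral {a..b} (g n)) \<longlonglongrightarrow> integral {a..b} (\<lambda>x. 0)"
  proof (rule dominated_convergence)
    show "g n integrable_on {a..b}" for n using gI set_lebesgue_integral_eq_integral(1) by blast
    show "(\<lambda>x. norm (f x)) integrable_on {a..b}" using nf set_lebesgue_integral_eq_integral(1) by blast
    show "norm (g n x) \<le> norm (f x)" for n x by (simp add: g_def)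
    show "(\<lambda>n. g n x) \<longlonglongrightarrow> 0" for x
    proof (rule tendsto_eventually)
      obtain N where "norm (f x) \<le> real N" using real_arch_simple by blast
      then show "\<forall>\<^sub>F n in sequentially. g n x = 0"
        unfolding eventually_sequentially by (intro exI[of _ N]) (auto simp: g_def)
    qed
  qed
  then have "(\<lambda>n. integral {a..b} (g n)) \<longlonglongrightarrow> 0" by simp
  then obtain n where "norm (integral {a..b} (g n) - 0) < \<epsilon> / 2"
    using \<epsilon> LIMSEQ_D[of _ 0 "\<epsilon> / 2"] by (metis half_gt_zero order_refl)
  then have n: "integral {a..b} (g n) < \<epsilon> / 2" by simp
  show "\<exists>\<delta>>0. \<forall>(m::nat) l u. (\<forall>i<m. a \<le> l i \<and> l i \<le> u i \<and> u i \<le> b) \<longrightarrow>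
      (\<forall>i<m. \<forall>j<m. i \<noteq> j \<longrightarrow> {l i<..<u i} \<inter> {l j<..<u j} = {}) \<longrightarrow>
      (\<Sum>i<m. u i - l i) < \<delta> \<longrightarrow>
      (\<Sum>i<m. norm (c + integral {a..u i} f - (c + integral {a..l i} f))) < \<epsilon>"
  proof (intro exI[of _ "\<epsilon> / (2 * (real n + 1))"] conjI allI impI)
    show "\<epsilon> / (2 * (real n + 1)) > 0" using \<epsilon> by simp
    fix m :: nat and l u :: "nat \<Rightarrow> real"
    assume lu: "\<forall>i<m. a \<le> l i \<and> l i \<le> u i \<and> u i \<le> b"
      and disj: "\<forall>i<m. \<forall>j<m. i \<noteq> j \<longrightarrow> {l i<..<u i} \<inter> {l j<..<u j} = {}"
      and small: "(\<Sum>i<m. u i - l i) < \<epsilon> / (2 * (real n + 1))"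
    have sub: "{l i..u i} \<subseteq> {a..b}" if "i < m" for i using lu that by auto
    have gi: "g n integrable_on {l i..u i}" and ni: "(\<lambda>x. norm (f x)) integrable_on {l i..u i}"
      and fi: "f integrable_on {l i..u i}" if "i < m" for i
      by (rule integrable_subinterval_real[OF set_lebesgue_integral_eq_integral(1) sub[OF that]], rule gI nf f)+
    have each: "norm (c + integral {a..u i} f - (c + integral {a..l i} f)) \<le>
        real n * (u i - l i) + integral {l i..u i} (g n)" if i: "i < m" for i
    proof -
      have "norm (c + integral {a..u i} f - (c + integral {a..l i} f)) = norm (integral {l i..u i} f)"
        using lu i integral_diff_eq_integral[of f a b "l i" "u i"] f
        by (simp add: set_lebesgue_integral_eq_integral(1))
      also have "\<dots> \<le> integral {l i..u i} (\<lambda>x. norm (f x))"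
        by (intro integral_norm_bound_integral fi ni i) auto
      also have "\<dots> \<le> integral {l i..u i} (\<lambda>x. real n + g n x)"
        using i by (intro integral_le ni integrable_add gi) (auto simp: g_def)
      also have "\<dots> = real n * (u i - l i) + integral {l i..u i} (g n)"
        using gi[OF i] lu i by (subst Henstock_Kurzweil_Integration.integral_add) auto
      finally show ?thesis .
    qed
    have "(g n has_integral (\<Sum>i<m. integral {l i..u i} (g n))) (\<Union>i<m. {l i<..<u i})"
    proof (rule has_integral_UN)
      show "(g n has_integral integral {l i..u i} (g n)) {l i<..<u i}" if "i \<in> {..<m}" for i
        using that by (intro has_integral_Icc_iff_Ioo[THEN iffD1] integrable_integral gi) simp
      show "pairwise (\<lambda>i j. negligible ({l i<..<u i} \<inter> {l j<..<u j})) {..<m}"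
        using disj by (auto simp: pairwise_def)
    qed simp
    then have "(\<Sum>i<m. integral {l i..u i} (g n)) \<le> integral {a..b} (g n)"
    proof (rule has_integral_subset_le[rotated])
      show "(g n has_integral integral {a..b} (g n)) {a..b}"
        using gI by (intro integrable_integral set_lebesgue_integral_eq_integral(1))
      show "(\<Union>i<m. {l i<..<u i}) \<subseteq> {a..b}" using lu by force
    qed (simp add: g_def)
    moreover have "(\<Sum>i<m. norm (c + integral {a..u i} f - (c + integral {a..l i} f))) \<le>
        (\<Sum>i<m. real n * (u i - l i) + integral {l i..u i} (g n))"
      using each by (intro sum_mono) auto
    moreover have "\<dots> = real n * (\<Sum>i<m. u i - l i) + (\<Sum>i<m. integral {l i..u i} (g n))"
      by (simp add: sum.distrib sum_distrib_left)
    moreover have "real n * (\<Sum>i<m. u i - l i) \<le> real n * (\<epsilon> / (2 * (real n + 1)))"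
      using small by (intro mult_left_mono) auto
    moreover have "real n * (\<epsilon> / (2 * (real n + 1))) \<le> \<epsilon> / 2"
      using \<epsilon> by (simp add: field_simps)
    ultimately show "(\<Sum>i<m. norm (c + integral {a..u i} f - (c + integral {a..l i} f))) < \<epsilon>"
      using n by linarith
  qed
qed

lemma division_content_le_measure:
  fixes U :: "real set"
  assumes "\<D> division_of S" "S \<subseteq> U" "U \<in> lmeasurable"
  shows "(\<Sum>K\<in>\<D>. measure lborel K) \<le> measure lebesgue U"
proof -
  have "(\<Sum>K\<in>\<D>. measure lborel K) = (\<Sum>K\<in>\<D>. measure lebesgue K)"
    using assms(1) by (intro sum.cong refl) (metis cbox_division_memE lborelD_Collect borel_closed
      closed_cbox measure_completion sets_lborel)
  also have "\<dots> = measure lebesgue S"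
    using content_division[OF assms(1)] by simp
  also have "\<dots> \<le> measure lebesgue U"
    using assms by (intro measure_mono_fmeasurable) (auto intro: lmeasurable_division fmeasurableD)
  finally show ?thesis .
qed

text \<open>Fine tagged intervals whose tags lie in a null set have small total length, so that absolute
  continuity makes their contribution to the increment of \<open>F\<close> small; the remaining intervals are
  treated as for a differentiable function.\<close>

theorem abs_continuous_on_has_integral:
  fixes F :: "real \<Rightarrow> 'a::euclidean_space"
  assumes ab: "a \<le> b" and F: "abs_continuous_on a b F" and N: "negligible N"
    and deriv: "\<And>x. x \<in> {a<..<b} - N \<Longrightarrow> (F has_vector_derivative f x) (at x)"
  shows "(f has_integral (F b - F a)) {a..b}"
proof -
  \<comment> \<open>The endpoints join the exceptional set since the derivative is given only in the
    open interval. Setting the integrand to zero on \<open>N'\<close> removes the contribution of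
    tags there from the Riemann sum.\<close>
  define N' where "N' = N \<union> {a, b}"
  define f' where "f' x = (if x \<in> N' then 0 else f x)" for x
  have N': "negligible N'" using N by (simp add: N'_def)
  have "(f' has_integral (F b - F a)) {a..b}"
    unfolding has_integral_real
  proof (intro allI impI)
    fix e :: real assume e: "e > 0"
    obtain \<delta> where \<delta>: "\<delta> > 0" and ac: "\<And>(m::nat) l u. (\<forall>i<m. a \<le> l i \<and> l i \<le> u i \<and> u i \<le> b) \<Longrightarrow>
        (\<forall>i<m. \<forall>j<m. i \<noteq> j \<longrightarrow> {l i<..<u i} \<inter> {l j<..<u j} = {}) \<Longrightarrow>
        (\<Sum>i<m. u i - l i) < \<delta> \<Longrightarrow> (\<Sum>i<m. norm (F (u i) - F (l i))) < e / 2"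
      using F[unfolded abs_continuous_on_def, rule_format, of "e / 2"] e by auto
    have N'_lm: "N' \<in> lmeasurable" "measure lebesgue N' = 0"
      using N' by (auto simp: negligible_imp_measurable negligible_imp_measure0)
    obtain U where U: "open U" "N' \<subseteq> U" "U \<in> lmeasurable" "measure lebesgue U < \<delta>"
    proof -
      obtain T where T: "open T" "N' \<subseteq> T" "T - N' \<in> lmeasurable" "emeasure lebesgue (T - N') < ennreal \<delta>"
        using sets_lebesgue_outer_open[OF fmeasurableD[OF N'_lm(1)] \<delta>] by blast
      have eq: "T = (T - N') \<union> N'" using T by auto
      have "T \<in> lmeasurable" using fmeasurable.Un[OF T(3) N'_lm(1)] eq by simp
      moreover have "measure lebesgue (T - N') < \<delta>"
        using T(3,4) \<delta> by (simp add: emeasure_eq_measure2 ennreal_less_iff)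
      moreover have "measure lebesgue T \<le> measure lebesgue (T - N') + measure lebesgue N'"
        using measure_Un_le[of "T - N'" lebesgue N'] T(3) N'_lm(1) eq by (metis fmeasurableD)
      ultimately show ?thesis using that T N'_lm(2) by simp
    qed
    \<comment> \<open>The summand \<open>1\<close> covers the case \<open>a = b\<close>. The
      differentiable part then contributes at most \<open>e / 4\<close>, hence strictly less than
      the \<open>e / 2\<close> allotted to it.\<close>
    define \<epsilon> where "\<epsilon> = e / (4 * (b - a + 1))"
    have \<epsilon>: "\<epsilon> > 0" using e ab by (simp add: \<epsilon>_def)
    have "\<exists>d>0. \<forall>y. \<bar>y - x\<bar> < d \<longrightarrow> norm (F y - F x - (y - x) *\<^sub>R f x) \<le> \<epsilon> * \<bar>y - x\<bar>"
      if x: "x \<in> {a..b}" "x \<notin> N'" for x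
    proof -
      have "x \<in> {a<..<b} - N" using x by (auto simp: N'_def)
      from deriv[OF this] have "(F has_derivative (\<lambda>h. h *\<^sub>R f x)) (at x within UNIV)"
        by (simp add: has_vector_derivative_def)
      then show ?thesis
        using \<epsilon> by (simp add: has_derivative_within_alt real_norm_def)
    qed
    then obtain d where d: "\<And>x. x \<in> {a..b} \<Longrightarrow> x \<notin> N' \<Longrightarrow> d x > 0"
      and dd: "\<And>x y. x \<in> {a..b} \<Longrightarrow> x \<notin> N' \<Longrightarrow> \<bar>y - x\<bar> < d x \<Longrightarrow>
        norm (F y - F x - (y - x) *\<^sub>R f x) \<le> \<epsilon> * \<bar>y - x\<bar>"
      by metis
    define \<gamma> where "\<gamma> x = (if x \<in> N' then U else if x \<in> {a..b} then ball x (d x) else ball x 1)" for x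
    have gauge: "gauge \<gamma>"
      unfolding gauge_def \<gamma>_def using U d by auto
    have main: "norm ((\<Sum>(x,K)\<in>p. measure lborel K *\<^sub>R f' x) - (F b - F a)) < e"
      if p: "p tagged_division_of {a..b}" "\<gamma> fine p" for p
    proof -
      note tag = tagged_division_ofD[OF p(1)]
      define D where "D K = F (Sup K) - F (Inf K)" for K :: "real set"
      define pN where "pN = {(x, K) \<in> p. x \<in> N'}"
      have fin: "finite p" using tag by simp
      have ivl: "\<exists>l u. K = {l..u} \<and> a \<le> l \<and> l \<le> x \<and> x \<le> u \<and> u \<le> b" if "(x, K) \<in> p" for x K
      proof -
        obtain l u where "K = cbox l u" using tag(4)[OF \<open>(x, K) \<in> p\<close>] by blast
        then show ?thesis
          using tag(2,3)[OF \<open>(x, K) \<in> p\<close>] by (intro exI[of _ l] exI[of _ u]) (auto simp: box_real)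
      qed
      have split: "(\<Sum>xK\<in>p. g xK) = (\<Sum>xK\<in>p - pN. g xK) + (\<Sum>xK\<in>pN. g xK)"
        for g :: "real \<times> real set \<Rightarrow> real"
        using fin by (intro sum.subset_diff) (auto simp: pN_def)
      have "(\<Sum>(x,K)\<in>p. measure lborel K *\<^sub>R f' x) - (F b - F a) =
          (\<Sum>(x,K)\<in>p. measure lborel K *\<^sub>R f' x - D K)"
        using additive_tagged_division_1[OF ab p(1), of F]
        by (simp add: D_def sum_subtractf case_prod_beta)
      also have "norm \<dots> \<le> (\<Sum>(x,K)\<in>p. norm (measure lborel K *\<^sub>R f' x - D K))"
        by (simp add: case_prod_beta norm_sum)
      also have "\<dots> = (\<Sum>(x,K)\<in>p - pN. norm (measure lborel K *\<^sub>R f' x - D K)) +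
          (\<Sum>(x,K)\<in>pN. norm (measure lborel K *\<^sub>R f' x - D K))"
        by (rule split)
      also have "(\<Sum>(x,K)\<in>p - pN. norm (measure lborel K *\<^sub>R f' x - D K)) \<le>
          (\<Sum>(x,K)\<in>p - pN. \<epsilon> * measure lborel K)"
      proof (rule sum_mono, clarify)
        fix x K assume xK: "(x, K) \<in> p" "(x, K) \<notin> pN"
        then have x: "x \<notin> N'" by (auto simp: pN_def)
        obtain l u where K: "K = {l..u}" and lu: "a \<le> l" "l \<le> x" "x \<le> u" "u \<le> b" using ivl[OF xK(1)] by blast
        have "K \<subseteq> ball x (d x)"
          using fineD[OF p(2) xK(1)] x lu by (auto simp: \<gamma>_def)
        moreover have "l \<in> K" "u \<in> K" using K lu by auto
        ultimately have "l \<in> ball x (d x)" "u \<in> ball x (d x)" by blast+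
        then have "norm (F u - F x - (u - x) *\<^sub>R f x) \<le> \<epsilon> * (u - x)"
          "norm (F l - F x - (l - x) *\<^sub>R f x) \<le> \<epsilon> * (x - l)"
          using dd[of x u] dd[of x l] x lu by (auto simp: dist_real_def abs_minus_commute)
        moreover have "measure lborel K *\<^sub>R f' x - D K =
            (F l - F x - (l - x) *\<^sub>R f x) - (F u - F x - (u - x) *\<^sub>R f x)"
          using K lu x by (simp add: D_def f'_def algebra_simps)
        ultimately have "norm (measure lborel K *\<^sub>R f' x - D K) \<le> \<epsilon> * (x - l) + \<epsilon> * (u - x)"
          by (metis norm_triangle_le_diff add_mono)
        also have "\<dots> = \<epsilon> * measure lborel K" using K lu by (simp add: algebra_simps)
        finally show "norm (measure lborel K *\<^sub>R f' x - D K) \<le> \<epsilon> * measure lborel K" .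
      qed
      also have "\<dots> \<le> (\<Sum>(x,K)\<in>p. \<epsilon> * measure lborel K)"
        using fin \<epsilon> by (intro sum_mono2) auto
      also have "\<dots> = \<epsilon> * (b - a)"
        using additive_content_tagged_division[of p a b] p(1) ab
        by (simp add: sum_distrib_left[symmetric] case_prod_beta box_real)
      also have "\<dots> \<le> \<epsilon> * (b - a + 1)" using \<epsilon> by simp
      also have "\<dots> = e / 4"
      proof -
        have "b - a + 1 \<noteq> 0" using ab by simp
        then show ?thesis
          unfolding \<epsilon>_def times_divide_eq_left by (rule nonzero_mult_divide_mult_cancel_right)
      qed
      also have "\<dots> < e / 2" using e by simp
      also have "(\<Sum>(x,K)\<in>pN. norm (measure lborel K *\<^sub>R f' x - D K)) < e / 2"
      proof -
        have finN: "finite pN" using fin by (rule finite_subset[rotated]) (auto simp: pN_def)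
        \<comment> \<open>Absolute continuity is formulated for intervals numbered by an initial
          segment of the naturals, so the intervals tagged in the null set are enumerated.\<close>
        obtain h where h: "bij_betw h {0..<card pN} pN" using ex_bij_betw_nat_finite[OF finN] by blast
        let ?l = "\<lambda>i. Inf (snd (h i))" and ?u = "\<lambda>i. Sup (snd (h i))"
        have hp: "h i \<in> pN" if "i < card pN" for i using h that by (auto simp: bij_betw_def)
        have pNp: "pN \<subseteq> p" by (auto simp: pN_def)
        have hK: "snd (h i) = {?l i..?u i} \<and> a \<le> ?l i \<and> ?l i \<le> ?u i \<and> ?u i \<le> b" if "i < card pN" for i
        proof -
          have "(fst (h i), snd (h i)) \<in> p" using hp[OF that] pNp by auto
          from ivl[OF this] obtain l u
            where "snd (h i) = {l..u}" "a \<le> l" "l \<le> fst (h i)" "fst (h i) \<le> u" "u \<le> b" by blast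
          then show ?thesis by simp
        qed
        have "(\<Sum>(x,K)\<in>pN. norm (measure lborel K *\<^sub>R f' x - D K)) = (\<Sum>xK\<in>pN. norm (D (snd xK)))"
          by (intro sum.cong) (auto simp: pN_def f'_def)
        also have "\<dots> = (\<Sum>i<card pN. norm (F (?u i) - F (?l i)))"
          using sum.reindex_bij_betw[OF h, of "\<lambda>xK. norm (D (snd xK))"]
          by (simp add: D_def atLeast0LessThan)
        also have "\<dots> < e / 2"
        proof (rule ac)
          show "\<forall>i<card pN. a \<le> ?l i \<and> ?l i \<le> ?u i \<and> ?u i \<le> b" using hK by blast
          show "\<forall>i<card pN. \<forall>j<card pN. i \<noteq> j \<longrightarrow> {?l i<..<?u i} \<inter> {?l j<..<?u j} = {}"
          proof (intro allI impI)
            fix i j assume ij: "i < card pN" "j < card pN" "i \<noteq> j"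
            then have "h i \<noteq> h j" using h by (auto simp: bij_betw_def inj_on_def)
            then have "interior (snd (h i)) \<inter> interior (snd (h j)) = {}"
              using tag(5)[of "fst (h i)" "snd (h i)" "fst (h j)" "snd (h j)"] hp ij pNp
              by (metis prod.collapse subsetD)
            then show "{?l i<..<?u i} \<inter> {?l j<..<?u j} = {}"
              using hK[OF ij(1)] hK[OF ij(2)] by (metis interior_atLeastAtMost_real)
          qed
          have part: "pN tagged_partial_division_of {a..b}"
            using p(1) pNp by (meson tagged_division_of_def tagged_partial_division_subset)
          note td = tagged_partial_division_of_Union_self[OF part]
          have "(\<Sum>i<card pN. ?u i - ?l i) = (\<Sum>i<card pN. measure lborel (snd (h i)))"
            using hK by (intro sum.cong refl) (metis lessThan_iff measure_lborel_Icc)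
          also have "\<dots> = (\<Sum>(x,K)\<in>pN. measure lborel K)"
            using sum.reindex_bij_betw[OF h, of "\<lambda>xK. measure lborel (snd xK)"]
            by (simp add: atLeast0LessThan case_prod_beta)
          \<comment> \<open>Two tags can share an interval only if its interior is empty, and then
            its length is zero.\<close>
          also have "\<dots> = (\<Sum>K\<in>snd ` pN. measure lborel K)"
            by (rule sum.over_tagged_division_lemma[OF td]) (simp add: content_eq_0_interior box_real interior_cbox)
          also have "\<dots> \<le> measure lebesgue U"
          proof (rule division_content_le_measure[OF division_of_tagged_division[OF td]])
            show "\<Union> (snd ` pN) \<subseteq> U"
              using fineD[OF p(2)] by (fastforce simp: pN_def \<gamma>_def)
          qed (rule U)
          also have "\<dots> < \<delta>" by (rule U)
          finally show "(\<Sum>i<card pN. ?u i - ?l i) < \<delta>" .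
        qed
        finally show ?thesis .
      qed
      finally show ?thesis by simp
    qed
    show "\<exists>\<gamma>. gauge \<gamma> \<and> (\<forall>\<D>. \<D> tagged_division_of {a..b} \<and> \<gamma> fine \<D> \<longrightarrow>
        norm ((\<Sum>(x,K)\<in>\<D>. measure lborel K *\<^sub>R f' x) - (F b - F a)) < e)"
      by (intro exI[of _ \<gamma>] conjI gauge allI impI, elim conjE) (rule main)
  qed
  then show ?thesis
    by (rule has_integral_spike[OF N', rotated]) (auto simp: f'_def)
qed

section \<open>The space of square-integrable functions\<close>

lemma emeasure_I0pi: "emeasure I0pi {0<..<pi} = ennreal pi"
  by (simp add: emeasure_restrict_space)

lemma finite_measure_I0pi: "finite_measure I0pi"
  by (rule finite_measureI) (simp add: emeasure_I0pi)

lemma square_integrable_measurable: "square_integrable g \<Longrightarrow> g \<in> borel_measurable I0pi"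
  by (simp add: square_integrable_def)

lemma square_integrable_sq: "square_integrable g \<Longrightarrow> integrable I0pi (\<lambda>x. (norm (g x))\<^sup>2)"
  by (simp add: square_integrable_def)

lemma square_integrable_prod_norm:
  assumes g: "square_integrable g" and h: "square_integrable h"
  shows "integrable I0pi (\<lambda>x. norm (g x) * norm (h x))"
proof (rule Bochner_Integration.integrable_bound)
  show "integrable I0pi (\<lambda>x. (norm (g x))\<^sup>2 + (norm (h x))\<^sup>2)"
    using g h by (intro Bochner_Integration.integrable_add square_integrable_sq)
  show "(\<lambda>x. norm (g x) * norm (h x)) \<in> borel_measurable I0pi"
    using square_integrable_measurable[OF g] square_integrable_measurable[OF h] by measurable
  have "norm (norm (g x) * norm (h x)) \<le> norm ((norm (g x))\<^sup>2 + (norm (h x))\<^sup>2)" for x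
  proof -
    have "2 * norm (g x) * norm (h x) \<le> (norm (g x))\<^sup>2 + (norm (h x))\<^sup>2" by (rule sum_squares_bound)
    moreover have "0 \<le> norm (g x) * norm (h x)" by simp
    ultimately have "norm (g x) * norm (h x) \<le> (norm (g x))\<^sup>2 + (norm (h x))\<^sup>2" by linarith
    then show ?thesis by simp
  qed
  then show "AE x in I0pi. norm (norm (g x) * norm (h x)) \<le> norm ((norm (g x))\<^sup>2 + (norm (h x))\<^sup>2)"
    by simp
qed

lemma square_integrable_bounded_product:
  fixes k :: "real \<Rightarrow> complex"
  assumes g: "square_integrable g" and h: "square_integrable h"
    and k: "k \<in> borel_measurable I0pi" "\<And>x. norm (k x) \<le> norm (g x) * norm (h x)"
  shows "integrable I0pi k"
  by (rule Bochner_Integration.integrable_bound[OF square_integrable_prod_norm[OF g h] k(1)])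
    (use k(2) in \<open>simp add: abs_mult\<close>)

lemma L2_mult_integrable:
  assumes g: "square_integrable (g :: real \<Rightarrow> complex)" and h: "square_integrable (h :: real \<Rightarrow> complex)"
  shows "integrable I0pi (\<lambda>x. g x * h x)"
  using g h by (intro square_integrable_bounded_product[OF g h] borel_measurable_times
      square_integrable_measurable) (simp_all add: norm_mult)

lemma square_integrable_cnj: "square_integrable g \<Longrightarrow> square_integrable (\<lambda>x. cnj (g x))"
  by (simp add: square_integrable_def borel_measurable_continuous_on[OF continuous_on_cnj[OF continuous_on_id]])

lemma square_integrable_of_real: "square_integrable s \<Longrightarrow> square_integrable (\<lambda>x. complex_of_real (s x))"
  by (simp add: square_integrable_def borel_measurable_continuous_on[OF continuous_on_of_real[OF continuous_on_id]])

lemma L2_ip_integrable: "g \<in> L2 \<Longrightarrow> h \<in> L2 \<Longrightarrow> integrable I0pi (\<lambda>x. g x * cnj (h x))"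
  using L2_mult_integrable[of g "\<lambda>x. cnj (h x)"] square_integrable_cnj by (simp add: L2_def)

lemma L2_add: assumes g: "g \<in> L2" and h: "h \<in> L2" shows "(\<lambda>x. g x + h x) \<in> L2"
  unfolding L2_def square_integrable_def
proof (intro CollectI conjI)
  have m: "g \<in> borel_measurable I0pi" "h \<in> borel_measurable I0pi"
    using g h by (auto simp: L2_def square_integrable_def)
  then show "(\<lambda>x. g x + h x) \<in> borel_measurable I0pi" by (intro borel_measurable_add)
  show "integrable I0pi (\<lambda>x. (norm (g x + h x))\<^sup>2)"
  proof (rule Bochner_Integration.integrable_bound)
    show "integrable I0pi (\<lambda>x. 2 * (norm (g x))\<^sup>2 + 2 * (norm (h x))\<^sup>2)"
      using g h by (auto simp: L2_def square_integrable_def)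
    show "(\<lambda>x. (norm (g x + h x))\<^sup>2) \<in> borel_measurable I0pi"
      using m by measurable
    have "(norm (g x + h x))\<^sup>2 \<le> 2 * (norm (g x))\<^sup>2 + 2 * (norm (h x))\<^sup>2" for x
    proof -
      have "(norm (g x + h x))\<^sup>2 \<le> (norm (g x) + norm (h x))\<^sup>2"
        by (intro power_mono norm_triangle_ineq) auto
      also have "\<dots> \<le> 2 * (norm (g x))\<^sup>2 + 2 * (norm (h x))\<^sup>2"
        using sum_squares_bound[of "norm (g x)" "norm (h x)"] by (simp add: power2_sum)
      finally show ?thesis .
    qed
    then show "AE x in I0pi. norm ((norm (g x + h x))\<^sup>2) \<le> norm (2 * (norm (g x))\<^sup>2 + 2 * (norm (h x))\<^sup>2)"
      by simp
  qed
qed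

lemma L2_scale: "g \<in> L2 \<Longrightarrow> (\<lambda>x. c * g x) \<in> L2"
  by (auto simp: L2_def square_integrable_def norm_mult power_mult_distrib)

lemma L2_diff: "g \<in> L2 \<Longrightarrow> h \<in> L2 \<Longrightarrow> (\<lambda>x. g x - h x) \<in> L2"
  using L2_add[of g "\<lambda>x. -1 * h x"] L2_scale[of h "-1"] by simp

lemma L2_inner_self: "L2_inner g g = of_real (LINT x|I0pi. (norm (g x))\<^sup>2)"
  unfolding L2_inner_def complex_norm_square[symmetric] by (simp only: integral_complex_of_real)

lemma Re_L2_inner_self: "Re (L2_inner g g) = (LINT x|I0pi. (norm (g x))\<^sup>2)"
  by (simp add: L2_inner_self)

lemma L2_norm_sq: "(L2_norm g)\<^sup>2 = (LINT x|I0pi. (norm (g x))\<^sup>2)"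
  by (simp add: L2_norm_def Re_L2_inner_self integral_nonneg_AE)

lemma nn_integral_L2: "g \<in> L2 \<Longrightarrow> (\<integral>\<^sup>+x. ennreal ((norm (g x))\<^sup>2) \<partial>I0pi) = ennreal ((L2_norm g)\<^sup>2)"
  unfolding L2_norm_sq by (intro nn_integral_eq_integral) (auto simp: L2_def square_integrable_def)

lemma L2_norm_eq_0_iff: "g \<in> L2 \<Longrightarrow> L2_norm g = 0 \<longleftrightarrow> (AE x in I0pi. g x = 0)"
proof -
  assume g: "g \<in> L2"
  have "L2_norm g = 0 \<longleftrightarrow> (LINT x|I0pi. (norm (g x))\<^sup>2) = 0"
    using L2_norm_sq[of g] by (metis power_zero_numeral zero_eq_power2)
  also have "\<dots> \<longleftrightarrow> (AE x in I0pi. (norm (g x))\<^sup>2 = 0)"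
    using g by (intro integral_nonneg_eq_0_iff_AE) (auto simp: L2_def square_integrable_def)
  finally show ?thesis by simp
qed

text \<open>A rapidly convergent subsequence converges almost everywhere, and Fatou's lemma identifies
  its pointwise limit as the limit in the mean.\<close>

lemma L2_complete:
  fixes u :: "nat \<Rightarrow> real \<Rightarrow> complex"
  assumes u: "\<And>n. u n \<in> L2"
    and cauchy: "\<And>\<epsilon>. 0 < \<epsilon> \<Longrightarrow> \<exists>N. \<forall>m\<ge>N. \<forall>n\<ge>N. L2_norm (\<lambda>x. u m x - u n x) < \<epsilon>"
  shows "\<exists>v\<in>L2. (\<lambda>n. L2_norm (\<lambda>x. u n x - v x)) \<longlonglongrightarrow> 0"
proof -
  have meas[measurable]: "u n \<in> borel_measurable I0pi" for n
    using u[of n] by (simp add: L2_def square_integrable_def)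
  have "\<exists>N. \<forall>m\<ge>N. \<forall>n\<ge>N. L2_norm (\<lambda>x. u m x - u n x) < (1/2)^k" for k :: nat
    by (rule cauchy) simp
  then obtain N where N: "\<And>k m n. m \<ge> N k \<Longrightarrow> n \<ge> N k \<Longrightarrow> L2_norm (\<lambda>x. u m x - u n x) < (1/2)^k"
    by metis
  \<comment> \<open>The maximum over all earlier thresholds guarantees that both \<open>r k\<close>
    and \<open>r (Suc k)\<close> lie beyond \<open>N k\<close>; the summand \<open>k\<close> makes
    the indices tend to infinity.\<close>
  define r where "r k = Max (N ` {..k}) + k" for k
  have r_N: "N j \<le> r k" if "j \<le> k" for j k
    unfolding r_def using that by (intro trans_le_add1 Max_ge) auto
  have r_ge: "r k \<ge> k" "r k \<ge> N k" "r (Suc k) \<ge> N k" for k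
    using r_N[of k k] r_N[of k "Suc k"] by (auto simp: r_def)
  define w where "w k = u (r k)" for k
  have wm[measurable]: "w k \<in> borel_measurable I0pi" for k by (simp add: w_def)
  have wL2: "w k \<in> L2" for k using u by (simp add: w_def)
  define d where "d k x = norm (w (Suc k) x - w k x)" for k x
  have dm[measurable]: "d k \<in> borel_measurable I0pi" for k
    unfolding d_def by measurable
  have dI: "(\<integral>\<^sup>+x. ennreal (d k x) \<partial>I0pi) \<le> ennreal ((1 + pi) * (1/2)^k)" for k
  proof -
    \<comment> \<open>A weighted arithmetic-geometric inequality in place of Cauchy-Schwarz: since
      the \<open>L2\<close> norm of \<open>d k\<close> is below \<open>(1/2)^k\<close>, the weights
      make both terms integrate to multiples of \<open>(1/2)^k\<close>, the second with the factor
      \<open>pi\<close>.\<close>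
    have "d k x \<le> 2^k * (d k x)\<^sup>2 + (1/2)^k" for x
    proof -
      have "2 * (d k x * 2^k) * 1 \<le> (d k x * 2^k)\<^sup>2 + 1\<^sup>2" by (rule sum_squares_bound)
      then have "d k x * 2^k \<le> (d k x * 2^k)\<^sup>2 + 1"
        by (smt (verit) d_def mult_nonneg_nonneg norm_ge_zero power_one zero_le_power)
      then have "d k x * 2^k * (1/2)^k \<le> ((d k x * 2^k)\<^sup>2 + 1) * (1/2)^k"
        by (intro mult_right_mono) auto
      then show ?thesis
        by (simp add: power_mult_distrib algebra_simps power2_eq_square power_one_over)
    qed
    then have "(\<integral>\<^sup>+x. ennreal (d k x) \<partial>I0pi) \<le> (\<integral>\<^sup>+x. ennreal (2^k) * ennreal ((d k x)\<^sup>2) + ennreal ((1/2)^k) \<partial>I0pi)"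
      by (intro nn_integral_mono) (simp add: ennreal_mult[symmetric] ennreal_plus[symmetric] del: ennreal_plus)
    also have "\<dots> = ennreal (2^k) * (\<integral>\<^sup>+x. ennreal ((d k x)\<^sup>2) \<partial>I0pi) + ennreal ((1/2)^k) * ennreal pi"
      by (subst nn_integral_add) (simp_all add: nn_integral_cmult emeasure_I0pi)
    also have "(\<integral>\<^sup>+x. ennreal ((d k x)\<^sup>2) \<partial>I0pi) = ennreal ((L2_norm (\<lambda>x. w (Suc k) x - w k x))\<^sup>2)"
      unfolding d_def by (intro nn_integral_L2 L2_diff wL2)
    also have "\<dots> \<le> ennreal (((1/2)^k)\<^sup>2)"
      using N[of k "r (Suc k)" "r k"] r_ge[of k]
      by (intro ennreal_leI power_mono) (auto simp: w_def L2_norm_def Re_L2_inner_self integral_nonneg_AE)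
    finally have "(\<integral>\<^sup>+x. ennreal (d k x) \<partial>I0pi) \<le> ennreal (2^k) * ennreal (((1/2)^k)\<^sup>2) + ennreal ((1/2)^k) * ennreal pi"
      by (simp add: add_right_mono mult_left_mono)
    also have "\<dots> = ennreal (2^k * ((1/2)^k)\<^sup>2 + (1/2)^k * pi)"
      by (simp add: ennreal_mult[symmetric] ennreal_plus[symmetric] del: ennreal_plus)
    also have "2^k * ((1/2)^k)\<^sup>2 + (1/2)^k * pi = (1 + pi) * (1/2)^k"
      by (simp add: power2_eq_square algebra_simps power_one_over add_divide_distrib)
    finally show ?thesis .
  qed
  have "(\<integral>\<^sup>+x. (\<Sum>k. ennreal (d k x)) \<partial>I0pi) = (\<Sum>k. \<integral>\<^sup>+x. ennreal (d k x) \<partial>I0pi)"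
    by (intro nn_integral_suminf) simp
  also have "\<dots> \<le> (\<Sum>k. ennreal ((1 + pi) * (1/2)^k))"
    by (intro suminf_le dI) auto
  also have "\<dots> = ennreal (\<Sum>k. (1 + pi) * (1/2)^k)"
    by (intro suminf_ennreal2 summable_mult summable_geometric) auto
  finally have "(\<integral>\<^sup>+x. (\<Sum>k. ennreal (d k x)) \<partial>I0pi) \<noteq> \<infinity>"
    by (metis ennreal_less_top infinity_ennreal_def leD)
  then have "AE x in I0pi. (\<Sum>k. ennreal (d k x)) \<noteq> \<infinity>"
    by (intro nn_integral_PInf_AE) auto
  then have conv: "AE x in I0pi. (\<lambda>k. w k x) \<longlonglongrightarrow> lim (\<lambda>k. w k x)"
  proof eventually_elim
    case (elim x)
    have "summable (\<lambda>k. d k x)"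
      using elim by (intro summable_suminf_not_top) (auto simp: d_def)
    then have "summable (\<lambda>k. w (Suc k) x - w k x)"
      unfolding d_def by (rule summable_norm_cancel)
    then have "convergent (\<lambda>n. \<Sum>k<n. w (Suc k) x - w k x)"
      by (simp add: summable_iff_convergent)
    then have "convergent (\<lambda>n. w n x - w 0 x)"
      unfolding sum_lessThan_telescope[of "\<lambda>k. w k x"] .
    then have "convergent (\<lambda>n. w n x)" by (simp only: convergent_diff_const_right_iff)
    then show ?case by (simp add: convergent_LIMSEQ_iff)
  qed
  define v where "v x = lim (\<lambda>k. w k x)" for x
  have vm[measurable]: "v \<in> borel_measurable I0pi"
    unfolding v_def by (rule borel_measurable_lim_metric) simp
  have small: "(\<integral>\<^sup>+x. ennreal ((norm (u m x - v x))\<^sup>2) \<partial>I0pi) \<le> ennreal (\<epsilon>\<^sup>2)"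
    if \<epsilon>: "\<epsilon> > 0" and M: "\<And>m n. m \<ge> M \<Longrightarrow> n \<ge> M \<Longrightarrow> L2_norm (\<lambda>x. u m x - u n x) < \<epsilon>" and m: "m \<ge> M"
    for \<epsilon> M m
  proof -
    have "(\<integral>\<^sup>+x. ennreal ((norm (u m x - v x))\<^sup>2) \<partial>I0pi) =
        (\<integral>\<^sup>+x. liminf (\<lambda>k. ennreal ((norm (u m x - w k x))\<^sup>2)) \<partial>I0pi)"
    proof (rule nn_integral_cong_AE)
      show "AE x in I0pi. ennreal ((norm (u m x - v x))\<^sup>2) = liminf (\<lambda>k. ennreal ((norm (u m x - w k x))\<^sup>2))"
        using conv
      proof eventually_elim
        case (elim x)
        then have "(\<lambda>k. ennreal ((norm (u m x - w k x))\<^sup>2)) \<longlonglongrightarrow> ennreal ((norm (u m x - v x))\<^sup>2)"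
          unfolding v_def by (intro tendsto_intros)
        then show ?case by (rule lim_imp_Liminf[OF trivial_limit_sequentially, symmetric])
      qed
    qed
    also have "\<dots> \<le> liminf (\<lambda>k. \<integral>\<^sup>+x. ennreal ((norm (u m x - w k x))\<^sup>2) \<partial>I0pi)"
      by (intro nn_integral_liminf) measurable
    also have "\<dots> \<le> liminf (\<lambda>k. ennreal (\<epsilon>\<^sup>2))"
    proof (rule Liminf_mono)
      show "\<forall>\<^sub>F k in sequentially. (\<integral>\<^sup>+x. ennreal ((norm (u m x - w k x))\<^sup>2) \<partial>I0pi) \<le> ennreal (\<epsilon>\<^sup>2)"
        unfolding eventually_sequentially
      proof (intro exI[of _ M] allI impI)
        fix k assume "M \<le> k"
        then have "L2_norm (\<lambda>x. u m x - u (r k) x) < \<epsilon>"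
          using M[of m "r k"] m r_ge(1)[of k] by simp
        then show "(\<integral>\<^sup>+x. ennreal ((norm (u m x - w k x))\<^sup>2) \<partial>I0pi) \<le> ennreal (\<epsilon>\<^sup>2)"
          unfolding w_def by (subst nn_integral_L2[OF L2_diff[OF u u]])
            (intro ennreal_leI power_mono, auto simp: L2_norm_def Re_L2_inner_self integral_nonneg_AE)
      qed
    qed
    also have "\<dots> = ennreal (\<epsilon>\<^sup>2)" by (simp add: Liminf_const)
    finally show ?thesis .
  qed
  have diffL2: "(\<lambda>x. u m x - v x) \<in> L2" if "(\<integral>\<^sup>+x. ennreal ((norm (u m x - v x))\<^sup>2) \<partial>I0pi) \<le> ennreal c" for m c
    unfolding L2_def square_integrable_def
  proof (intro CollectI conjI integrableI_bounded)
    show "(\<integral>\<^sup>+x. ennreal (norm ((norm (u m x - v x))\<^sup>2)) \<partial>I0pi) < \<infinity>"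
      using that by (simp add: order.strict_trans1)
  qed measurable
  obtain M1 where M1: "\<And>m n. m \<ge> M1 \<Longrightarrow> n \<ge> M1 \<Longrightarrow> L2_norm (\<lambda>x. u m x - u n x) < 1"
    using cauchy[of 1] by auto
  have "(\<lambda>x. u M1 x - (u M1 x - v x)) \<in> L2"
    by (rule L2_diff[OF u diffL2[OF small[OF _ M1]]]) auto
  then have vL2: "v \<in> L2" by simp
  have "(\<lambda>n. L2_norm (\<lambda>x. u n x - v x)) \<longlonglongrightarrow> 0"
  proof (rule LIMSEQ_I)
    fix \<epsilon> :: real assume \<epsilon>: "\<epsilon> > 0"
    obtain M where M: "\<And>m n. m \<ge> M \<Longrightarrow> n \<ge> M \<Longrightarrow> L2_norm (\<lambda>x. u m x - u n x) < \<epsilon> / 2"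
      using cauchy[of "\<epsilon> / 2"] \<epsilon> by auto
    show "\<exists>N. \<forall>n\<ge>N. norm (L2_norm (\<lambda>x. u n x - v x) - 0) < \<epsilon>"
    proof (intro exI[of _ M] allI impI)
      fix n assume n: "M \<le> n"
      have "ennreal ((L2_norm (\<lambda>x. u n x - v x))\<^sup>2) \<le> ennreal ((\<epsilon> / 2)\<^sup>2)"
        using small[OF _ M n] \<epsilon> by (subst nn_integral_L2[symmetric]) (auto intro: L2_diff u vL2)
      then have "(L2_norm (\<lambda>x. u n x - v x))\<^sup>2 \<le> (\<epsilon> / 2)\<^sup>2" by (simp add: ennreal_le_iff)
      then have "L2_norm (\<lambda>x. u n x - v x) \<le> \<epsilon> / 2" by (rule power2_le_imp_le) (use \<epsilon> in simp)
      then show "norm (L2_norm (\<lambda>x. u n x - v x) - 0) < \<epsilon>"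
        using \<epsilon> by (simp add: L2_norm_def Re_L2_inner_self integral_nonneg_AE)
    qed
  qed
  then show ?thesis using vL2 by blast
qed

lemma vector_space_fun: "vector_space (\<lambda>(c::complex) (f :: 'a \<Rightarrow> complex) x. c * f x)"
  by standard (auto simp: fun_eq_iff algebra_simps)

lemma zero_L2: "0 \<in> L2"
  by (simp add: L2_def square_integrable_def zero_fun_def)

interpretation L2s: semi_hilbert "\<lambda>c f x. c * f x" L2 L2_inner
proof -
  interpret vector_space "\<lambda>(c::complex) (f :: real \<Rightarrow> complex) x. c * f x" by (rule vector_space_fun)
  show "semi_hilbert (\<lambda>c f x. c * f x) L2 L2_inner"
  proof
    show "0 \<in> L2" by (rule zero_L2)
    show "u + v \<in> L2" if "u \<in> L2" "v \<in> L2" for u v using L2_add[OF that] by (simp add: plus_fun_def)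
    show "(\<lambda>x. c * u x) \<in> L2" if "u \<in> L2" for c u using that by (rule L2_scale)
    show "L2_inner (u + v) w = L2_inner u w + L2_inner v w" if "u \<in> L2" "v \<in> L2" "w \<in> L2" for u v w
      unfolding L2_inner_def using that
      by (simp add: distrib_right L2_ip_integrable flip: Bochner_Integration.integral_add)
    show "L2_inner (\<lambda>x. c * u x) v = c * L2_inner u v" for c u v
      unfolding L2_inner_def by (simp add: mult.assoc)
    show "L2_inner v u = cnj (L2_inner u v)" for u v
      unfolding L2_inner_def Bochner_Integration.integral_cnj[symmetric] by (simp add: mult.commute)
    show "0 \<le> Re (L2_inner u u)" for u
      unfolding Re_L2_inner_self by (rule integral_nonneg_AE) simp
    show "\<exists>v\<in>L2. (\<lambda>n. sqrt (Re (L2_inner (u n - v) (u n - v)))) \<longlonglongrightarrow> 0"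
      if "\<And>n::nat. u n \<in> L2"
        "\<And>\<epsilon>. 0 < \<epsilon> \<Longrightarrow> \<exists>N. \<forall>m\<ge>N. \<forall>n\<ge>N. sqrt (Re (L2_inner (u m - u n) (u m - u n))) < \<epsilon>" for u
      using L2_complete[of u] that unfolding L2_norm_def fun_diff_def by blast
  qed
qed

lemma L2s_nrm: "L2s.nrm = L2_norm"
  by (simp add: fun_eq_iff L2s.nrm_def L2_norm_def)

section \<open>Absolutely continuous functions on the interval from 0 to pi\<close>

lemma AE_I0pi_iff: "(AE x in I0pi. P x) \<longleftrightarrow> (\<exists>N. negligible N \<and> (\<forall>x\<in>{0<..<pi} - N. P x))"
proof -
  have "(AE x in I0pi. P x) \<longleftrightarrow> (AE x in lebesgue. x \<in> {0<..<pi} \<longrightarrow> P x)"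
    by (subst AE_restrict_space_iff) auto
  also have "\<dots> \<longleftrightarrow> (\<exists>N. negligible N \<and> (\<forall>x\<in>{0<..<pi} - N. P x))"
  proof
    assume "AE x in lebesgue. x \<in> {0<..<pi} \<longrightarrow> P x"
    then obtain N where "N \<in> null_sets lebesgue" "{x \<in> space lebesgue. \<not> (x \<in> {0<..<pi} \<longrightarrow> P x)} \<subseteq> N"
      by (auto simp: eventually_ae_filter)
    then show "\<exists>N. negligible N \<and> (\<forall>x\<in>{0<..<pi} - N. P x)"
      by (intro exI[of _ N]) (auto simp: negligible_iff_null_sets)
  next
    assume "\<exists>N. negligible N \<and> (\<forall>x\<in>{0<..<pi} - N. P x)"
    then obtain N where "N \<in> null_sets lebesgue" "\<forall>x\<in>{0<..<pi} - N. P x"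
      by (auto simp: negligible_iff_null_sets)
    then show "AE x in lebesgue. x \<in> {0<..<pi} \<longrightarrow> P x"
      by (intro AE_I'[of N]) auto
  qed
  finally show ?thesis .
qed

lemma I0pi_integrable_iff:
  fixes g :: "real \<Rightarrow> 'a::euclidean_space"
  shows "integrable I0pi g \<longleftrightarrow> g absolutely_integrable_on {0..pi}"
proof -
  have "integrable I0pi g \<longleftrightarrow> g absolutely_integrable_on {0<..<pi}"
    unfolding set_integrable_def by (rule integrable_restrict_space) simp
  then show ?thesis by (simp only: absolutely_integrable_on_Icc_iff_Ioo)
qed

lemma I0pi_integral:
  fixes g :: "real \<Rightarrow> 'a::euclidean_space"
  shows "integrable I0pi g \<Longrightarrow> integral\<^sup>L I0pi g = integral {0..pi} g"
  by (simp add: lebesgue_integral_eq_integral integral_open_interval_real)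

lemma continuous_L2: "continuous_on {0..pi} g \<Longrightarrow> g \<in> L2"
proof -
  assume g: "continuous_on {0..pi} g"
  have "continuous_on {0<..<pi} g" using g continuous_on_subset greaterThanLessThan_subseteq_atLeastAtMost_iff by blast
  then have "g \<in> borel_measurable I0pi" by (intro continuous_imp_measurable_on_sets_lebesgue) auto
  moreover have "integrable I0pi (\<lambda>x. (norm (g x))\<^sup>2)"
    unfolding I0pi_integrable_iff by (intro absolutely_integrable_continuous_real continuous_intros g)
  ultimately show ?thesis by (simp add: L2_def square_integrable_def)
qed

lemma L2_integrable: "p \<in> L2 \<Longrightarrow> integrable I0pi p"
  using L2_ip_integrable[of p "\<lambda>_. 1"] continuous_L2[of "\<lambda>_. 1"] by simp

lemma L2_absolutely_integrable: "p \<in> L2 \<Longrightarrow> p absolutely_integrable_on {0..pi}"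
  using L2_integrable I0pi_integrable_iff by blast

text \<open>Cauchy-Schwarz against the indicator function of the interval. The resulting Hoelder
  continuity of exponent one half supplies both the Sobolev inequality and the equicontinuity used
  for compactness.\<close>

lemma norm_integral_le_L2:
  assumes p: "p \<in> L2" and xy: "0 \<le> x" "x \<le> y" "y \<le> pi"
  shows "norm (integral {x..y} p) \<le> sqrt (y - x) * L2_norm p"
proof -
  define k where "k t = (if t \<in> {x..y} then 1 else 0 :: complex)" for t
  have km: "k \<in> borel_measurable I0pi"
    unfolding k_def by (intro measurable_restrict_space1 measurable_completion) measurable
  have "integrable I0pi (\<lambda>t. (norm (k t))\<^sup>2)"
  proof (rule Bochner_Integration.integrable_bound)
    show "integrable I0pi (\<lambda>t. 1 :: real)"
      using finite_measure_I0pi by (simp add: finite_measure.integrable_const)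
    show "(\<lambda>t. (norm (k t))\<^sup>2) \<in> borel_measurable I0pi"
      using km by measurable
  qed (auto simp: k_def)
  then have k: "k \<in> L2" using km by (simp add: L2_def square_integrable_def)
  have sub: "{x..y} \<subseteq> {0..pi}" using xy by auto
  have "L2_inner p k = integral {0..pi} (\<lambda>t. p t * cnj (k t))"
    unfolding L2_inner_def by (intro I0pi_integral L2_ip_integrable p k)
  also have "\<dots> = integral {0..pi} (\<lambda>t. if t \<in> {x..y} then p t else 0)"
    by (intro integral_cong) (simp add: k_def)
  also have "\<dots> = integral {x..y} p"
    using xy by (subst integral_restrict_Int) (simp add: max_absorb1 min_absorb1)
  finally have 1: "L2_inner p k = integral {x..y} p" .
  have "(L2_norm k)\<^sup>2 = integral {0..pi} (\<lambda>t. (norm (k t))\<^sup>2)"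
    unfolding L2_norm_sq using k by (intro I0pi_integral) (simp add: L2_def square_integrable_def)
  also have "\<dots> = integral {0..pi} (\<lambda>t. if t \<in> {x..y} then 1 else 0)"
    by (intro integral_cong) (simp add: k_def)
  also have "\<dots> = integral {x..y} (\<lambda>t. 1)"
    using xy by (subst integral_restrict_Int) (simp add: max_absorb1 min_absorb1)
  also have "\<dots> = y - x" using xy by simp
  finally have 2: "L2_norm k = sqrt (y - x)"
    using L2s.nrm_ge0[OF k] by (simp add: L2s_nrm real_sqrt_unique)
  show ?thesis
    using L2s.cauchy_schwarz[OF p k] by (simp add: L2s_nrm 1 2 mult.commute)
qed

lemma abs_continuous_on_imp_continuous_on:
  assumes "abs_continuous_on a b F"
  shows "continuous_on {a..b} F"
  unfolding continuous_on_iff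
proof (intro ballI allI impI)
  fix x and e :: real assume x: "x \<in> {a..b}" and e: "e > 0"
  obtain d where d: "d > 0" and ac: "\<And>(m::nat) l u. (\<forall>i<m. a \<le> l i \<and> l i \<le> u i \<and> u i \<le> b) \<Longrightarrow>
      (\<forall>i<m. \<forall>j<m. i \<noteq> j \<longrightarrow> {l i<..<u i} \<inter> {l j<..<u j} = {}) \<Longrightarrow>
      (\<Sum>i<m. u i - l i) < d \<Longrightarrow> (\<Sum>i<m. norm (F (u i) - F (l i))) < e"
    using assms[unfolded abs_continuous_on_def, rule_format, OF e] by blast
  have *: "norm (F y - F z) < e" if "a \<le> z" "z \<le> y" "y \<le> b" "y - z < d" for y z
    using ac[of 1 "\<lambda>_. z" "\<lambda>_. y"] that by simp
  show "\<exists>d>0. \<forall>x'\<in>{a..b}. dist x' x < d \<longrightarrow> dist (F x') (F x) < e"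
  proof (intro exI[of _ d] conjI d ballI impI)
    fix y assume "y \<in> {a..b}" "dist y x < d"
    then show "dist (F y) (F x) < e"
      using *[of x y] *[of y x] x by (cases "x \<le> y") (auto simp: dist_norm norm_minus_commute)
  qed
qed

lemma abs_continuous_on_add:
  assumes F: "abs_continuous_on a b F" and G: "abs_continuous_on a b G"
  shows "abs_continuous_on a b (\<lambda>x. F x + G x)"
  unfolding abs_continuous_on_def
proof (intro allI impI)
  fix e :: real assume e: "e > 0"
  obtain d1 where d1: "d1 > 0" and F': "\<And>(m::nat) l u. (\<forall>i<m. a \<le> l i \<and> l i \<le> u i \<and> u i \<le> b) \<Longrightarrow>
      (\<forall>i<m. \<forall>j<m. i \<noteq> j \<longrightarrow> {l i<..<u i} \<inter> {l j<..<u j} = {}) \<Longrightarrow>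
      (\<Sum>i<m. u i - l i) < d1 \<Longrightarrow> (\<Sum>i<m. norm (F (u i) - F (l i))) < e / 2"
    using F[unfolded abs_continuous_on_def, rule_format, OF half_gt_zero[OF e]] by blast
  obtain d2 where d2: "d2 > 0" and G': "\<And>(m::nat) l u. (\<forall>i<m. a \<le> l i \<and> l i \<le> u i \<and> u i \<le> b) \<Longrightarrow>
      (\<forall>i<m. \<forall>j<m. i \<noteq> j \<longrightarrow> {l i<..<u i} \<inter> {l j<..<u j} = {}) \<Longrightarrow>
      (\<Sum>i<m. u i - l i) < d2 \<Longrightarrow> (\<Sum>i<m. norm (G (u i) - G (l i))) < e / 2"
    using G[unfolded abs_continuous_on_def, rule_format, OF half_gt_zero[OF e]] by blast
  show "\<exists>d>0. \<forall>(m::nat) l u. (\<forall>i<m. a \<le> l i \<and> l i \<le> u i \<and> u i \<le> b) \<longrightarrow>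
      (\<forall>i<m. \<forall>j<m. i \<noteq> j \<longrightarrow> {l i<..<u i} \<inter> {l j<..<u j} = {}) \<longrightarrow>
      (\<Sum>i<m. u i - l i) < d \<longrightarrow> (\<Sum>i<m. norm (F (u i) + G (u i) - (F (l i) + G (l i)))) < e"
  proof (intro exI[of _ "min d1 d2"] conjI allI impI)
    fix m :: nat and l u assume lu: "\<forall>i<m. a \<le> l i \<and> l i \<le> u i \<and> u i \<le> b"
      "\<forall>i<m. \<forall>j<m. i \<noteq> j \<longrightarrow> {l i<..<u i} \<inter> {l j<..<u j} = {}" "(\<Sum>i<m. u i - l i) < min d1 d2"
    have "(\<Sum>i<m. norm (F (u i) + G (u i) - (F (l i) + G (l i)))) \<le>
        (\<Sum>i<m. norm (F (u i) - F (l i)) + norm (G (u i) - G (l i)))"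
      by (intro sum_mono) (metis add_diff_add norm_triangle_ineq)
    also have "\<dots> < e / 2 + e / 2"
      unfolding sum.distrib using F'[OF lu(1,2)] G'[OF lu(1,2)] lu(3) by (intro add_strict_mono) auto
    finally show "(\<Sum>i<m. norm (F (u i) + G (u i) - (F (l i) + G (l i)))) < e" by simp
  qed (use d1 d2 in simp)
qed

text \<open>A comparison of increments that yields negation, scaling, conjugation and squares at
  once. Replacing \<open>K\<close> by \<open>\<bar>K\<bar> + 1\<close> avoids any sign condition on
  \<open>K\<close>.\<close>

lemma abs_continuous_on_dominated:
  assumes F: "abs_continuous_on a b F" and K: "\<And>x y. x \<in> {a..b} \<Longrightarrow> y \<in> {a..b} \<Longrightarrow>
    norm (G y - G x) \<le> K * norm (F y - F x)"
  shows "abs_continuous_on a b G"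
  unfolding abs_continuous_on_def
proof (intro allI impI)
  fix e :: real assume e: "e > 0"
  have e': "e / (\<bar>K\<bar> + 1) > 0" using e by (simp add: add_nonneg_pos)
  obtain d where d: "d > 0" and F': "\<And>(m::nat) l u. (\<forall>i<m. a \<le> l i \<and> l i \<le> u i \<and> u i \<le> b) \<Longrightarrow>
      (\<forall>i<m. \<forall>j<m. i \<noteq> j \<longrightarrow> {l i<..<u i} \<inter> {l j<..<u j} = {}) \<Longrightarrow>
      (\<Sum>i<m. u i - l i) < d \<Longrightarrow> (\<Sum>i<m. norm (F (u i) - F (l i))) < e / (\<bar>K\<bar> + 1)"
    using F[unfolded abs_continuous_on_def, rule_format, OF e'] by blast
  show "\<exists>d>0. \<forall>(m::nat) l u. (\<forall>i<m. a \<le> l i \<and> l i \<le> u i \<and> u i \<le> b) \<longrightarrow>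
      (\<forall>i<m. \<forall>j<m. i \<noteq> j \<longrightarrow> {l i<..<u i} \<inter> {l j<..<u j} = {}) \<longrightarrow>
      (\<Sum>i<m. u i - l i) < d \<longrightarrow> (\<Sum>i<m. norm (G (u i) - G (l i))) < e"
  proof (intro exI[of _ d] conjI d allI impI)
    fix m :: nat and l u assume lu: "\<forall>i<m. a \<le> l i \<and> l i \<le> u i \<and> u i \<le> b"
      "\<forall>i<m. \<forall>j<m. i \<noteq> j \<longrightarrow> {l i<..<u i} \<inter> {l j<..<u j} = {}" "(\<Sum>i<m. u i - l i) < d"
    have "norm (G (u i) - G (l i)) \<le> (\<bar>K\<bar> + 1) * norm (F (u i) - F (l i))" if "i < m" for i
    proof -
      have "l i \<in> {a..b}" "u i \<in> {a..b}" using lu(1) that by force+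
      then have "norm (G (u i) - G (l i)) \<le> K * norm (F (u i) - F (l i))" by (rule K)
      also have "\<dots> \<le> (\<bar>K\<bar> + 1) * norm (F (u i) - F (l i))" by (intro mult_right_mono) auto
      finally show ?thesis .
    qed
    then have "(\<Sum>i<m. norm (G (u i) - G (l i))) \<le> (\<bar>K\<bar> + 1) * (\<Sum>i<m. norm (F (u i) - F (l i)))"
      unfolding sum_distrib_left by (intro sum_mono) auto
    also have "\<dots> < (\<bar>K\<bar> + 1) * (e / (\<bar>K\<bar> + 1))"
      using F'[OF lu] by (intro mult_strict_left_mono) auto
    also have "\<dots> = e" by simp
    finally show "(\<Sum>i<m. norm (G (u i) - G (l i))) < e" .
  qed
qed

lemma abs_continuous_on_transfer:
  "abs_continuous_on a b F \<Longrightarrow> (\<And>x. x \<in> {a..b} \<Longrightarrow> G x = F x) \<Longrightarrow> abs_continuous_on a b G"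
  by (rule abs_continuous_on_dominated[of _ _ F _ 1]) auto

lemma abs_continuous_on_initial_segment:
  assumes F: "abs_continuous_on a b F" and c: "c \<le> b"
  shows "abs_continuous_on a c F"
  unfolding abs_continuous_on_def
proof (intro allI impI)
  fix e :: real assume e: "e > 0"
  obtain d where d: "d > 0" and F': "\<And>(m::nat) l u. (\<forall>i<m. a \<le> l i \<and> l i \<le> u i \<and> u i \<le> b) \<Longrightarrow>
      (\<forall>i<m. \<forall>j<m. i \<noteq> j \<longrightarrow> {l i<..<u i} \<inter> {l j<..<u j} = {}) \<Longrightarrow>
      (\<Sum>i<m. u i - l i) < d \<Longrightarrow> (\<Sum>i<m. norm (F (u i) - F (l i))) < e"
    using F[unfolded abs_continuous_on_def, rule_format, OF e] by blast
  show "\<exists>d>0. \<forall>(m::nat) l u. (\<forall>i<m. a \<le> l i \<and> l i \<le> u i \<and> u i \<le> c) \<longrightarrow>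
      (\<forall>i<m. \<forall>j<m. i \<noteq> j \<longrightarrow> {l i<..<u i} \<inter> {l j<..<u j} = {}) \<longrightarrow>
      (\<Sum>i<m. u i - l i) < d \<longrightarrow> (\<Sum>i<m. norm (F (u i) - F (l i))) < e"
  proof (intro exI[of _ d] conjI d allI impI)
    fix m :: nat and l u assume lu: "\<forall>i<m. a \<le> l i \<and> l i \<le> u i \<and> u i \<le> c"
      "\<forall>i<m. \<forall>j<m. i \<noteq> j \<longrightarrow> {l i<..<u i} \<inter> {l j<..<u j} = {}" "(\<Sum>i<m. u i - l i) < d"
    have "\<forall>i<m. a \<le> l i \<and> l i \<le> u i \<and> u i \<le> b" using lu(1) c by (meson order_trans)
    then show "(\<Sum>i<m. norm (F (u i) - F (l i))) < e" by (rule F'[OF _ lu(2,3)])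
  qed
qed

lemma abs_continuous_on_minus: "abs_continuous_on a b F \<Longrightarrow> abs_continuous_on a b (\<lambda>x. - F x)"
  by (rule abs_continuous_on_dominated[of _ _ F _ 1]) (auto simp: norm_minus_commute)

lemma abs_continuous_on_cmult:
  "abs_continuous_on a b F \<Longrightarrow> abs_continuous_on a b (\<lambda>x. c * F x :: complex)"
  by (rule abs_continuous_on_dominated[of _ _ F _ "norm c"])
    (auto simp: norm_mult simp flip: right_diff_distrib)

lemma abs_continuous_on_cnj:
  "abs_continuous_on a b F \<Longrightarrow> abs_continuous_on a b (\<lambda>x. cnj (F x))"
  by (rule abs_continuous_on_dominated[of _ _ F _ 1]) (auto simp flip: complex_cnj_diff)

lemma abs_continuous_on_square:
  fixes F :: "real \<Rightarrow> complex"
  assumes F: "abs_continuous_on a b F"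
  shows "abs_continuous_on a b (\<lambda>x. F x * F x)"
proof -
  have "compact (F ` {a..b})"
    by (intro compact_continuous_image abs_continuous_on_imp_continuous_on F compact_Icc)
  then obtain K where K: "\<And>x. x \<in> {a..b} \<Longrightarrow> norm (F x) \<le> K"
    by (meson bounded_iff compact_imp_bounded imageI)
  show ?thesis
  proof (rule abs_continuous_on_dominated[OF F, of _ "2 * K"])
    fix x y assume xy: "x \<in> {a..b}" "y \<in> {a..b}"
    have "F y * F y - F x * F x = (F y + F x) * (F y - F x)" by (simp add: algebra_simps)
    then have "norm (F y * F y - F x * F x) = norm (F y + F x) * norm (F y - F x)"
      by (simp add: norm_mult)
    also have "norm (F y + F x) \<le> 2 * K" using K[OF xy(1)] K[OF xy(2)] norm_triangle_ineq[of "F y" "F x"] by linarith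
    finally show "norm (F y * F y - F x * F x) \<le> 2 * K * norm (F y - F x)"
      by (simp add: mult_right_mono)
  qed
qed

text \<open>Polarization writes the product as a quarter of the difference of the squares of
  \<open>F + G\<close> and \<open>F - G\<close>, which reduces the claim to squares.\<close>

lemma abs_continuous_on_mult:
  fixes F G :: "real \<Rightarrow> complex"
  assumes F: "abs_continuous_on a b F" and G: "abs_continuous_on a b G"
  shows "abs_continuous_on a b (\<lambda>x. F x * G x)"
proof -
  have "abs_continuous_on a b (\<lambda>x. (1/4) * ((F x + G x) * (F x + G x)) + - ((1/4) * ((F x + - G x) * (F x + - G x))))"
    by (intro abs_continuous_on_add abs_continuous_on_minus abs_continuous_on_cmult abs_continuous_on_square F G)
  then show ?thesis by (simp add: algebra_simps)
qed

lemma integration_by_parts_abs_continuous: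
  fixes F G :: "real \<Rightarrow> complex"
  assumes F: "abs_continuous_on 0 pi F" and G: "abs_continuous_on 0 pi G"
    and F': "AE x in I0pi. (F has_vector_derivative F' x) (at x)"
    and G': "AE x in I0pi. (G has_vector_derivative G' x) (at x)"
  shows "((\<lambda>x. F x * G' x + F' x * G x) has_integral (F pi * G pi - F 0 * G 0)) {0..pi}"
proof -
  have "AE x in I0pi. ((\<lambda>x. F x * G x) has_vector_derivative (F x * G' x + F' x * G x)) (at x)"
    using F' G' by eventually_elim (rule has_vector_derivative_mult)
  then obtain N where "negligible N"
    "\<And>x. x \<in> {0<..<pi} - N \<Longrightarrow> ((\<lambda>x. F x * G x) has_vector_derivative (F x * G' x + F' x * G x)) (at x)"
    unfolding AE_I0pi_iff by blast
  then show ?thesis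
    by (intro abs_continuous_on_has_integral[of 0 pi "\<lambda>x. F x * G x"] abs_continuous_on_mult F G) auto
qed

text \<open>Cutting off at \<open>pi\<close> keeps every integral inside the interval on which
  \<open>p\<close> is integrable; for negative arguments the interval of integration is empty.
  Additivity therefore holds at every real point without side conditions.\<close>

definition prim :: "(real \<Rightarrow> complex) \<Rightarrow> real \<Rightarrow> complex" where
  "prim p x = integral {0..min x pi} p"

lemma prim_0: "prim p 0 = 0"
  by (simp add: prim_def)

lemma prim_eq: "x \<le> pi \<Longrightarrow> prim p x = integral {0..x} p"
  by (simp add: prim_def min_absorb1)

lemma integrable_prim:
  fixes p :: "real \<Rightarrow> complex"
  assumes "p absolutely_integrable_on {0..pi}"
  shows "p integrable_on {0..min x pi}"
  using assms by (rule integrable_subinterval_real[OF set_lebesgue_integral_eq_integral(1)]) auto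

lemma prim_add:
  "p absolutely_integrable_on {0..pi} \<Longrightarrow> q absolutely_integrable_on {0..pi} \<Longrightarrow>
    prim (p + q) x = prim p x + prim q x"
  unfolding prim_def plus_fun_def by (intro Henstock_Kurzweil_Integration.integral_add integrable_prim)

lemma prim_scale: "prim (\<lambda>x. c * p x) y = c * prim p y"
  unfolding prim_def by (rule integral_mult_right)

lemma prim_diff:
  assumes "p absolutely_integrable_on {0..pi}" "0 \<le> x" "x \<le> y" "y \<le> pi"
  shows "prim p y - prim p x = integral {x..y} p"
  using integral_diff_eq_integral[OF set_lebesgue_integral_eq_integral(1)[OF assms(1)] assms(2-4)] assms(2-4)
  by (simp add: prim_eq)

lemma abs_continuous_on_prim:
  assumes "p absolutely_integrable_on {0..pi}"
  shows "abs_continuous_on 0 pi (\<lambda>x. c + prim p x)"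
  using abs_continuous_on_indefinite_integral[OF assms, of c]
  by (rule abs_continuous_on_transfer) (simp add: prim_eq)

lemma prim_has_vector_derivative:
  assumes "p absolutely_integrable_on {0..pi}"
  shows "AE x in I0pi. ((\<lambda>x. c + prim p x) has_vector_derivative p x) (at x)"
proof -
  have "p integrable_on {0..pi}" using assms set_lebesgue_integral_eq_integral(1) by blast
  then obtain N where N: "negligible N"
    "\<And>x. x \<in> {0<..<pi} - N \<Longrightarrow> ((\<lambda>u. integral {0..u} p) has_vector_derivative p x) (at x)"
    by (rule indefinite_integral_has_vector_derivative_ae) blast
  have "((\<lambda>x. c + prim p x) has_vector_derivative p x) (at x)" if x: "x \<in> {0<..<pi} - N" for x
  proof (rule has_vector_derivative_transform_within_open)
    have "((\<lambda>u. c + integral {0..u} p) has_vector_derivative (0 + p x)) (at x)"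
      by (intro has_vector_derivative_add has_vector_derivative_const N x)
    then show "((\<lambda>u. c + integral {0..u} p) has_vector_derivative p x) (at x)" by simp
    show "open {0<..<pi}" "x \<in> {0<..<pi}" using x by auto
    show "\<And>u. u \<in> {0<..<pi} \<Longrightarrow> c + integral {0..u} p = c + prim p u" by (simp add: prim_eq)
  qed
  then show ?thesis unfolding AE_I0pi_iff using N(1) by blast
qed

lemma abs_continuous_eq_prim:
  assumes F: "abs_continuous_on 0 pi F" and F': "AE x in I0pi. (F has_vector_derivative f x) (at x)"
    and x: "x \<in> {0..pi}"
  shows "F x = F 0 + prim f x"
proof -
  obtain N where N: "negligible N" "\<And>x. x \<in> {0<..<pi} - N \<Longrightarrow> (F has_vector_derivative f x) (at x)"
    using F' unfolding AE_I0pi_iff by blast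
  have "abs_continuous_on 0 x F"
    using F by (rule abs_continuous_on_initial_segment) (use x in simp)
  then have "(f has_integral (F x - F 0)) {0..x}"
    using x by (intro abs_continuous_on_has_integral[of 0 x F N] N) auto
  then show ?thesis using x by (simp add: prim_eq integral_unique)
qed

lemma continuous_on_prim: "p absolutely_integrable_on {0..pi} \<Longrightarrow> continuous_on {0..pi} (\<lambda>x. c + prim p x)"
  by (intro abs_continuous_on_imp_continuous_on abs_continuous_on_prim)

lemma norm_prim_diff_le:
  assumes p: "p \<in> L2" and "x \<in> {0..pi}" "y \<in> {0..pi}"
  shows "norm (prim p y - prim p x) \<le> sqrt \<bar>y - x\<bar> * L2_norm p"
proof -
  have *: "norm (prim p y - prim p x) \<le> sqrt \<bar>y - x\<bar> * L2_norm p" if "0 \<le> x" "x \<le> y" "y \<le> pi" for x y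
    using norm_integral_le_L2[OF p that] that p by (simp add: prim_diff L2_absolutely_integrable)
  show ?thesis
    using *[of x y] *[of y x] assms
    by (cases "x \<le> y") (auto simp: norm_minus_commute abs_minus_commute)
qed

section \<open>Square-integrable functions with finitely many extra coordinates\<close>

definition pair_scale :: "complex \<Rightarrow> (real \<Rightarrow> complex) \<times> ('k \<Rightarrow> complex) \<Rightarrow> (real \<Rightarrow> complex) \<times> ('k \<Rightarrow> complex)" where
  "pair_scale c u = ((\<lambda>x. c * fst u x), (\<lambda>k. c * snd u k))"

lemma pair_scale_simps [simp]:
  "fst (pair_scale c u) = (\<lambda>x. c * fst u x)" "snd (pair_scale c u) = (\<lambda>k. c * snd u k)"
  by (simp_all add: pair_scale_def)

definition pair_carrier :: "((real \<Rightarrow> complex) \<times> ('k \<Rightarrow> complex)) set" where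
  "pair_carrier = {u. fst u \<in> L2}"

text \<open>Coordinates outside \<open>I\<close> are invisible to this form. Besides null functions
  they are a second source of vectors of norm zero.\<close>

definition pair_ip :: "'k set \<Rightarrow> ('k \<Rightarrow> real) \<Rightarrow> (real \<Rightarrow> complex) \<times> ('k \<Rightarrow> complex) \<Rightarrow>
    (real \<Rightarrow> complex) \<times> ('k \<Rightarrow> complex) \<Rightarrow> complex" where
  "pair_ip I w u v = L2_inner (fst u) (fst v) + (\<Sum>k\<in>I. of_real (w k) * snd u k * cnj (snd v k))"

lemma Re_pair_ip_self:
  "Re (pair_ip I w u u) = (L2_norm (fst u))\<^sup>2 + (\<Sum>k\<in>I. w k * (norm (snd u k))\<^sup>2)"
proof -
  have *: "of_real (w k) * snd u k * cnj (snd u k) = of_real (w k * (norm (snd u k))\<^sup>2)" for k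
    by (simp only: of_real_mult complex_norm_square mult.assoc)
  have "pair_ip I w u u = of_real ((L2_norm (fst u))\<^sup>2 + (\<Sum>k\<in>I. w k * (norm (snd u k))\<^sup>2))"
    unfolding pair_ip_def L2_inner_self L2_norm_sq by (simp only: * of_real_sum of_real_add)
  then show ?thesis by (simp only: Re_complex_of_real)
qed

lemma vector_space_pair:
  "vector_space (pair_scale :: complex \<Rightarrow> (real \<Rightarrow> complex) \<times> ('k \<Rightarrow> complex) \<Rightarrow> _)"
proof
  fix a b :: complex and x y :: "(real \<Rightarrow> complex) \<times> ('k \<Rightarrow> complex)"
  show "pair_scale a (x + y) = pair_scale a x + pair_scale a y"
    by (simp add: pair_scale_def plus_prod_def plus_fun_def distrib_left)
  show "pair_scale (a + b) x = pair_scale a x + pair_scale b x"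
    by (simp add: pair_scale_def plus_prod_def plus_fun_def distrib_right)
  show "pair_scale a (pair_scale b x) = pair_scale (a * b) x"
    unfolding pair_scale_def fst_conv snd_conv mult.assoc by (rule refl)
  show "pair_scale 1 x = x"
    by (simp add: pair_scale_def)
qed

lemma semi_hilbert_pair:
  assumes I: "finite I" and w: "\<And>k. k \<in> I \<Longrightarrow> 0 < w k"
  shows "semi_hilbert pair_scale pair_carrier (pair_ip I w)"
proof -
  interpret vector_space "pair_scale :: complex \<Rightarrow> (real \<Rightarrow> complex) \<times> ('a \<Rightarrow> complex) \<Rightarrow> _"
    by (rule vector_space_pair)
  show ?thesis
  proof
    show "(0 :: (real \<Rightarrow> complex) \<times> ('a \<Rightarrow> complex)) \<in> pair_carrier"
      by (simp add: pair_carrier_def zero_L2)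
    show "u + v \<in> pair_carrier" if "u \<in> pair_carrier" "v \<in> pair_carrier" for u v :: "(real \<Rightarrow> complex) \<times> ('a \<Rightarrow> complex)"
      using that by (simp add: pair_carrier_def L2s.add_mem)
    show "pair_scale c u \<in> pair_carrier" if "u \<in> pair_carrier" for c and u :: "(real \<Rightarrow> complex) \<times> ('a \<Rightarrow> complex)"
      using that by (simp add: pair_carrier_def L2_scale)
    show "pair_ip I w (u + v) x = pair_ip I w u x + pair_ip I w v x"
      if "u \<in> pair_carrier" "v \<in> pair_carrier" "x \<in> pair_carrier" for u v x :: "(real \<Rightarrow> complex) \<times> ('a \<Rightarrow> complex)"
      using that unfolding pair_ip_def pair_carrier_def
      by (simp add: L2s.ip_add_left distrib_left distrib_right sum.distrib)
    show "pair_ip I w (pair_scale c u) v = c * pair_ip I w u v"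
      if "u \<in> pair_carrier" "v \<in> pair_carrier" for c and u v :: "(real \<Rightarrow> complex) \<times> ('a \<Rightarrow> complex)"
      using that unfolding pair_ip_def pair_carrier_def
      by (simp add: L2s.ip_scale_left distrib_left sum_distrib_left mult_ac)
    show "pair_ip I w v u = cnj (pair_ip I w u v)"
      if "u \<in> pair_carrier" "v \<in> pair_carrier" for u v :: "(real \<Rightarrow> complex) \<times> ('a \<Rightarrow> complex)"
      using that L2s.ip_cnj[of "fst u" "fst v"] unfolding pair_ip_def pair_carrier_def
      by (simp add: cnj_sum mult_ac)
    show "0 \<le> Re (pair_ip I w u u)" for u :: "(real \<Rightarrow> complex) \<times> ('a \<Rightarrow> complex)"
      unfolding Re_pair_ip_self using w by (intro add_nonneg_nonneg sum_nonneg) (auto simp: less_imp_le)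
    show "\<exists>v\<in>pair_carrier. (\<lambda>n. sqrt (Re (pair_ip I w (u n - v) (u n - v)))) \<longlonglongrightarrow> 0"
      if u: "\<And>n. u n \<in> pair_carrier" and
        cauchy: "\<And>\<epsilon>. 0 < \<epsilon> \<Longrightarrow> \<exists>N. \<forall>m\<ge>N. \<forall>n\<ge>N. sqrt (Re (pair_ip I w (u m - u n) (u m - u n))) < \<epsilon>"
      for u :: "nat \<Rightarrow> (real \<Rightarrow> complex) \<times> ('a \<Rightarrow> complex)"
    proof -
      have fst_L2: "fst (u n) \<in> L2" for n using u[of n] by (simp add: pair_carrier_def)
      have w0: "0 \<le> w k * (norm (snd z k))\<^sup>2" if "k \<in> I" for k and z :: "(real \<Rightarrow> complex) \<times> ('a \<Rightarrow> complex)"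
        using w[OF that] by simp
      have s0: "0 \<le> (\<Sum>k\<in>I. w k * (norm (snd z k))\<^sup>2)" for z :: "(real \<Rightarrow> complex) \<times> ('a \<Rightarrow> complex)"
        by (intro sum_nonneg w0)
      have le1: "L2_norm (fst z) \<le> sqrt (Re (pair_ip I w z z))" for z :: "(real \<Rightarrow> complex) \<times> ('a \<Rightarrow> complex)"
        unfolding Re_pair_ip_self using s0[of z] by (intro real_le_rsqrt) simp
      have le2: "sqrt (w k) * norm (snd z k) \<le> sqrt (Re (pair_ip I w z z))" if "k \<in> I"
        for k and z :: "(real \<Rightarrow> complex) \<times> ('a \<Rightarrow> complex)"
      proof (rule real_le_rsqrt)
        have "w k * (norm (snd z k))\<^sup>2 \<le> (\<Sum>k\<in>I. w k * (norm (snd z k))\<^sup>2)"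
          using that I w0 by (intro member_le_sum) auto
        then show "(sqrt (w k) * norm (snd z k))\<^sup>2 \<le> Re (pair_ip I w z z)"
          unfolding Re_pair_ip_self using w[OF that]
          by (simp add: power_mult_distrib add_increasing)
      qed
      have "\<exists>N. \<forall>m\<ge>N. \<forall>n\<ge>N. L2s.nrm (fst (u m) - fst (u n)) < \<epsilon>" if "\<epsilon> > 0" for \<epsilon>
        using cauchy[OF that] le1[of "u _ - u _"] unfolding L2s_nrm fst_diff by (meson order_le_less_trans)
      then obtain g where g: "g \<in> L2" and lim_g: "(\<lambda>n. L2s.nrm (fst (u n) - g)) \<longlonglongrightarrow> 0"
        using L2s.Cauchy_limit[of "\<lambda>n. fst (u n)"] fst_L2 by blast
      have "\<exists>b. (\<lambda>n. snd (u n) k) \<longlonglongrightarrow> b" if k: "k \<in> I" for k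
      proof -
        have "Cauchy (\<lambda>n. snd (u n) k)"
        proof (rule CauchyI)
          fix e :: real assume e: "e > 0"
          then have "sqrt (w k) * e > 0" using w[OF k] by simp
          from cauchy[OF this] obtain N where N: "\<And>m n. m \<ge> N \<Longrightarrow> n \<ge> N \<Longrightarrow>
            sqrt (Re (pair_ip I w (u m - u n) (u m - u n))) < sqrt (w k) * e" by blast
          show "\<exists>M. \<forall>m\<ge>M. \<forall>n\<ge>M. norm (snd (u m) k - snd (u n) k) < e"
          proof (intro exI[of _ N] allI impI)
            fix m n assume "N \<le> m" "N \<le> n"
            then have "sqrt (w k) * norm (snd (u m - u n) k) < sqrt (w k) * e"
              using N le2[OF k, of "u m - u n"] by (meson order_le_less_trans)
            then have "norm (snd (u m - u n) k) < e"
              by (rule mult_left_less_imp_less) (use w[OF k] in simp)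
            then show "norm (snd (u m) k - snd (u n) k) < e" by simp
          qed
        qed
        then show ?thesis using Cauchy_convergent_iff convergent_def by blast
      qed
      then obtain b where b: "\<And>k. k \<in> I \<Longrightarrow> (\<lambda>n. snd (u n) k) \<longlonglongrightarrow> b k" by metis
      have "(\<lambda>n. sqrt ((L2_norm (fst (u n) - g))\<^sup>2 + (\<Sum>k\<in>I. w k * (norm (snd (u n) k - b k))\<^sup>2)))
          \<longlonglongrightarrow> sqrt (0\<^sup>2 + (\<Sum>k\<in>I. w k * (norm (b k - b k))\<^sup>2))"
        using lim_g b unfolding L2s_nrm by (intro tendsto_intros) auto
      then have "(\<lambda>n. sqrt (Re (pair_ip I w (u n - (g, b)) (u n - (g, b))))) \<longlonglongrightarrow> 0"
        unfolding Re_pair_ip_self by simp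
      then show ?thesis using g by (intro bexI[of _ "(g, b)"]) (auto simp: pair_carrier_def)
    qed
  qed
qed

lemma finite_bounded_imp_convergent_subsequence:
  fixes b :: "nat \<Rightarrow> 'k \<Rightarrow> complex"
  assumes "finite I" "\<And>n i. i \<in> I \<Longrightarrow> norm (b n i) \<le> R"
  obtains r c where "strict_mono r" "\<And>i. i \<in> I \<Longrightarrow> (\<lambda>n. b (r n) i) \<longlonglongrightarrow> c i"
  using assms
proof (induction I arbitrary: thesis rule: finite_induct)
  case empty
  then show ?case using strict_mono_id by (metis empty_iff)
next
  case (insert k I)
  obtain r c where r: "strict_mono r" and c: "\<And>i. i \<in> I \<Longrightarrow> (\<lambda>n. b (r n) i) \<longlonglongrightarrow> c i"
    using insert.IH insert.prems(2) by (metis insertCI)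
  have "seq_compact (cball (0::complex) R)" by (simp add: compact_eq_seq_compact_metric[symmetric])
  moreover have "\<forall>n. b (r n) k \<in> cball 0 R" using insert.prems(2) by simp
  ultimately obtain r' l where r': "strict_mono r'" and l: "((\<lambda>n. b (r n) k) \<circ> r') \<longlonglongrightarrow> l"
    unfolding seq_compact_def by metis
  show ?case
  proof (rule insert.prems(1)[of "r \<circ> r'" "c(k := l)"])
    show "strict_mono (r \<circ> r')" by (rule strict_mono_o[OF r r'])
    show "(\<lambda>n. b ((r \<circ> r') n) i) \<longlonglongrightarrow> (c(k := l)) i" if "i \<in> insert k I" for i
    proof (cases "i = k")
      case True
      then show ?thesis using l by (simp add: o_def)
    next
      case False
      then show ?thesis using LIMSEQ_subseq_LIMSEQ[OF c r', of i] that by (simp add: o_def)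
    qed
  qed
qed

lemma L2_mult_bounded:
  assumes g: "g \<in> L2" and k: "k \<in> borel_measurable I0pi" and K: "\<And>x. x \<in> {0..pi} \<Longrightarrow> norm (k x) \<le> K"
  shows "(\<lambda>x. g x * k x) \<in> L2" "L2_norm (\<lambda>x. g x * k x) \<le> K * L2_norm g"
proof -
  have "norm (k 0) \<le> K" by (rule K) simp
  then have K0: "0 \<le> K" using norm_ge_zero order_trans by blast
  have le: "(norm (g x * k x))\<^sup>2 \<le> K\<^sup>2 * (norm (g x))\<^sup>2" if "x \<in> {0<..<pi}" for x
  proof -
    have "(norm (k x))\<^sup>2 \<le> K\<^sup>2" using that by (intro power_mono K) auto
    then have "(norm (g x))\<^sup>2 * (norm (k x))\<^sup>2 \<le> (norm (g x))\<^sup>2 * K\<^sup>2" by (intro mult_left_mono) auto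
    then show ?thesis by (simp add: norm_mult power_mult_distrib mult.commute)
  qed
  have gI: "integrable I0pi (\<lambda>x. K\<^sup>2 * (norm (g x))\<^sup>2)"
    using g by (simp add: L2_def square_integrable_def)
  have m: "g \<in> borel_measurable I0pi" using g by (simp add: L2_def square_integrable_def)
  have I: "integrable I0pi (\<lambda>x. (norm (g x * k x))\<^sup>2)"
  proof (rule Bochner_Integration.integrable_bound[OF gI])
    show "(\<lambda>x. (norm (g x * k x))\<^sup>2) \<in> borel_measurable I0pi" using m k by measurable
    show "AE x in I0pi. norm ((norm (g x * k x))\<^sup>2) \<le> norm (K\<^sup>2 * (norm (g x))\<^sup>2)"
      using le by (intro AE_I2) simp
  qed
  show mem: "(\<lambda>x. g x * k x) \<in> L2"
    unfolding L2_def square_integrable_def using I m k by simp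
  have "(L2_norm (\<lambda>x. g x * k x))\<^sup>2 \<le> (LINT x|I0pi. K\<^sup>2 * (norm (g x))\<^sup>2)"
    unfolding L2_norm_sq using le by (intro integral_mono I gI) simp
  also have "\<dots> = (K * L2_norm g)\<^sup>2" by (simp add: L2_norm_sq power_mult_distrib)
  finally show "L2_norm (\<lambda>x. g x * k x) \<le> K * L2_norm g"
    by (rule power2_le_imp_le) (use K0 L2s.nrm_ge0[OF g] in \<open>simp add: L2s_nrm\<close>)
qed

lemma continuous_measurable_I0pi: "continuous_on {0..pi} g \<Longrightarrow> (g :: real \<Rightarrow> complex) \<in> borel_measurable I0pi"
  using continuous_L2[of g] by (simp add: L2_def square_integrable_def)

section \<open>The form associated with the boundary value problem\<close>

text \<open>Indices of the coordinates outside \<open>L2\<close>: one for each pole at the left (right) endpoint and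
  one for the value at the left (right) endpoint itself.\<close>

datatype bidx = LP nat | LS | RP nat | RS

text \<open>Linearization of the rational boundary functions. In the eigenvalue problem for this
  matrix with weights \<open>bweight\<close>, the equations at \<open>LP k\<close> and
  \<open>RP k\<close> express the pole coordinates by the endpoint values. Eliminating them turns
  the equations at \<open>LS\<close> and \<open>RS\<close> into the conditions with \<open>f\<close>
  and \<open>F\<close>. The entries \<open>-1\<close> on the right match coordinates with
  denominator \<open>pole F k - \<nu>\<close> instead of \<open>\<nu> - pole f k\<close>.\<close>

fun bform :: "bc_function \<Rightarrow> bc_function \<Rightarrow> bidx \<Rightarrow> bidx \<Rightarrow> real" where
  "bform f F (LP k) (LP l) = (if k = l then pole f k / res f k else 0)"
| "bform f F (LP k) LS = 1"
| "bform f F LS (LP k) = 1"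
| "bform f F LS LS = - const_term f"
| "bform f F (RP k) (RP l) = (if k = l then pole F k / res F k else 0)"
| "bform f F (RP k) RS = -1"
| "bform f F RS (RP k) = -1"
| "bform f F RS RS = - const_term F"
| "bform f F _ _ = 0"

lemma bform_sym: "bform f F i j = bform f F j i"
  by (cases i; cases j) auto

text \<open>The coordinate at an endpoint is the value of the function itself, so the slope appears
  rather than its inverse. A vanishing slope gives weight zero, while the coordinate remains
  available to the form.\<close>

fun bweight :: "bc_function \<Rightarrow> bc_function \<Rightarrow> bidx \<Rightarrow> real" where
  "bweight f F (LP k) = inverse (res f k)"
| "bweight f F LS = slope f"
| "bweight f F (RP k) = inverse (res F k)"
| "bweight f F RS = slope F"

type_synonym pairs = "(real \<Rightarrow> complex) \<times> (bidx \<Rightarrow> complex)"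

abbreviation PX :: "pairs set" where "PX \<equiv> pair_carrier"

text \<open>The first component of a vector is the derivative; the function is recovered by
  integration from its initial value, which is kept at \<open>LS\<close>.\<close>

definition traj :: "pairs \<Rightarrow> real \<Rightarrow> complex" where
  "traj v x = snd v LS + prim (fst v) x"

text \<open>The value at the right endpoint is determined by the derivative and the initial value,
  so whatever a vector stores at \<open>RS\<close> is overridden.\<close>

definition btrace :: "pairs \<Rightarrow> bidx \<Rightarrow> complex" where
  "btrace v i = (if i = RS then traj v pi else snd v i)"

definition hembed :: "pairs \<Rightarrow> pairs" where
  "hembed v = (traj v, btrace v)"

lemma traj_0: "traj v 0 = snd v LS"
  by (simp add: traj_def prim_0)

lemma btrace_LS: "btrace v LS = traj v 0" and btrace_RS: "btrace v RS = traj v pi"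
  by (simp_all add: btrace_def traj_0)

lemma PX_fst: "v \<in> PX \<Longrightarrow> fst v \<in> L2"
  by (simp add: pair_carrier_def)

lemma traj_add: "u \<in> PX \<Longrightarrow> v \<in> PX \<Longrightarrow> traj (u + v) x = traj u x + traj v x"
  by (simp add: traj_def prim_add PX_fst L2_absolutely_integrable)

lemma traj_scale: "traj (pair_scale c v) x = c * traj v x"
  by (simp add: traj_def prim_scale distrib_left)

lemma btrace_add: "u \<in> PX \<Longrightarrow> v \<in> PX \<Longrightarrow> btrace (u + v) i = btrace u i + btrace v i"
  by (simp add: btrace_def traj_add)

lemma btrace_scale: "btrace (pair_scale c v) i = c * btrace v i"
  by (simp add: btrace_def traj_scale)

lemma hembed_add: "u \<in> PX \<Longrightarrow> v \<in> PX \<Longrightarrow> hembed (u + v) = hembed u + hembed v"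
  by (intro prod_eqI) (simp_all add: hembed_def fun_eq_iff traj_add btrace_add)

lemma hembed_scale: "hembed (pair_scale c v) = pair_scale c (hembed v)"
  by (intro prod_eqI) (simp_all add: hembed_def fun_eq_iff traj_scale btrace_scale)

lemma continuous_traj: "v \<in> PX \<Longrightarrow> continuous_on {0..pi} (traj v)"
  unfolding traj_def[abs_def] by (intro continuous_on_prim L2_absolutely_integrable PX_fst)

lemma traj_L2: "v \<in> PX \<Longrightarrow> traj v \<in> L2"
  by (intro continuous_L2 continuous_traj)

lemma hembed_mem: "v \<in> PX \<Longrightarrow> hembed v \<in> PX"
  by (simp add: hembed_def pair_carrier_def traj_L2)

lemma norm_traj_diff_le:
  "v \<in> PX \<Longrightarrow> x \<in> {0..pi} \<Longrightarrow> y \<in> {0..pi} \<Longrightarrow>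
    norm (traj v y - traj v x) \<le> sqrt \<bar>y - x\<bar> * L2_norm (fst v)"
  using norm_prim_diff_le[of "fst v" x y] by (simp add: traj_def PX_fst)

lemma norm_traj_le:
  assumes v: "v \<in> PX" and x: "x \<in> {0..pi}"
  shows "norm (traj v x) \<le> norm (snd v LS) + sqrt pi * L2_norm (fst v)"
proof -
  have "norm (traj v x - traj v 0) \<le> sqrt \<bar>x - 0\<bar> * L2_norm (fst v)"
    using v x by (intro norm_traj_diff_le) auto
  also have "\<dots> \<le> sqrt pi * L2_norm (fst v)"
    using x L2s.nrm_ge0[OF PX_fst[OF v]] by (intro mult_right_mono) (auto simp: L2s_nrm)
  finally show ?thesis
    using norm_triangle_ineq2[of "traj v x" "traj v 0"] by (simp add: traj_0)
qed

text \<open>On an interval of length \<open>h\<close> around \<open>x\<close> the function differs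
  from its value at \<open>x\<close> by at most \<open>sqrt h\<close> times the norm of the
  derivative. Averaging the squared inequality over this interval gives the coefficients
  \<open>2 * h \<le> \<delta>\<close> and \<open>2 / h\<close>.\<close>

lemma sobolev:
  assumes "\<delta> > 0"
  obtains C where "C \<ge> 0" "\<And>v x. v \<in> PX \<Longrightarrow> x \<in> {0..pi} \<Longrightarrow>
    (norm (traj v x))\<^sup>2 \<le> \<delta> * (L2_norm (fst v))\<^sup>2 + C * (L2_norm (traj v))\<^sup>2"
proof -
  define h where "h = min pi (\<delta> / 2)"
  have h: "0 < h" "h \<le> pi" "2 * h \<le> \<delta>" using assms by (auto simp: h_def)
  have "(norm (traj v x))\<^sup>2 \<le> \<delta> * (L2_norm (fst v))\<^sup>2 + 2 / h * (L2_norm (traj v))\<^sup>2"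
    if v: "v \<in> PX" and x: "x \<in> {0..pi}" for v x
  proof -
    \<comment> \<open>Left end of a window of length \<open>h\<close> that contains \<open>x\<close>
      and does not leave the interval from \<open>0\<close> to \<open>pi\<close>.\<close>
    define c where "c = min x (pi - h)"
    have c: "0 \<le> c" "c \<le> x" "x \<le> c + h" "c + h \<le> pi" using x h by (auto simp: c_def)
    have sub: "{c..c + h} \<subseteq> {0..pi}" using c h by auto
    define P where "P = L2_norm (fst v)"
    have P: "0 \<le> P" using L2s.nrm_ge0[OF PX_fst[OF v]] by (simp add: P_def L2s_nrm)
    have pt: "(norm (traj v x))\<^sup>2 \<le> 2 * (norm (traj v t))\<^sup>2 + 2 * h * P\<^sup>2" if t: "t \<in> {c..c + h}" for t
    proof -
      have "norm (traj v x - traj v t) \<le> sqrt \<bar>x - t\<bar> * P"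
        unfolding P_def using v x t sub by (intro norm_traj_diff_le) auto
      also have "\<dots> \<le> sqrt h * P" using t c P by (intro mult_right_mono real_sqrt_le_mono) auto
      finally have "norm (traj v x) \<le> norm (traj v t) + sqrt h * P"
        using norm_triangle_ineq2[of "traj v x" "traj v t"] by linarith
      then have "(norm (traj v x))\<^sup>2 \<le> (norm (traj v t) + sqrt h * P)\<^sup>2" by (intro power_mono) auto
      also have "\<dots> \<le> 2 * (norm (traj v t))\<^sup>2 + 2 * (sqrt h * P)\<^sup>2"
        using sum_squares_bound[of "norm (traj v t)" "sqrt h * P"] unfolding power2_sum by linarith
      also have "(sqrt h * P)\<^sup>2 = h * P\<^sup>2" using h by (simp add: power_mult_distrib)
      finally show ?thesis by simp
    qed
    have cont: "continuous_on {0..pi} (\<lambda>t. (norm (traj v t))\<^sup>2)"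
      by (intro continuous_intros continuous_traj v)
    have cont': "continuous_on {c..c + h} (\<lambda>t. (norm (traj v t))\<^sup>2)"
      by (rule continuous_on_subset[OF cont sub])
    have "h * (norm (traj v x))\<^sup>2 = integral {c..c + h} (\<lambda>t. (norm (traj v x))\<^sup>2)"
      using h by simp
    also have "\<dots> \<le> integral {c..c + h} (\<lambda>t. 2 * (norm (traj v t))\<^sup>2 + 2 * h * P\<^sup>2)"
      by (intro integral_le pt integrable_continuous_interval continuous_intros cont')
    also have "\<dots> = 2 * integral {c..c + h} (\<lambda>t. (norm (traj v t))\<^sup>2) + 2 * h * P\<^sup>2 * h"
      using h by (subst Henstock_Kurzweil_Integration.integral_add)
        (auto intro!: integrable_continuous_interval continuous_intros cont')
    also have "integral {c..c + h} (\<lambda>t. (norm (traj v t))\<^sup>2) \<le> integral {0..pi} (\<lambda>t. (norm (traj v t))\<^sup>2)"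
      by (intro integral_subset_le sub integrable_continuous_interval cont cont') auto
    also have "integral {0..pi} (\<lambda>t. (norm (traj v t))\<^sup>2) = (L2_norm (traj v))\<^sup>2"
      unfolding L2_norm_sq using traj_L2[OF v]
      by (intro I0pi_integral[symmetric]) (simp add: L2_def square_integrable_def)
    finally have "h * (norm (traj v x))\<^sup>2 \<le> h * (2 * h * P\<^sup>2 + 2 / h * (L2_norm (traj v))\<^sup>2)"
      using h by (simp add: distrib_left mult_ac)
    then have "(norm (traj v x))\<^sup>2 \<le> 2 * h * P\<^sup>2 + 2 / h * (L2_norm (traj v))\<^sup>2"
      by (rule mult_left_le_imp_le) (rule h)
    moreover have "2 * h * P\<^sup>2 \<le> \<delta> * P\<^sup>2" using h by (intro mult_right_mono) auto
    ultimately show ?thesis by (simp add: P_def)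
  qed
  then show ?thesis using that[of "2 / h"] h by simp
qed

locale bvp =
  fixes s :: "real \<Rightarrow> real" and f F :: bc_function
  assumes s: "square_integrable s" and f: "bc_admissible f" and F: "bc_admissible F"
begin

definition idx :: "bidx set" where
  "idx = LP ` {1..npoles f} \<union> {LS} \<union> RP ` {1..npoles F} \<union> {RS}"

text \<open>Free coordinates of the form domain. The index \<open>RS\<close> is excluded because its
  value is a function of the others, whereas \<open>idxH\<close> below drops the coordinates of
  weight zero.\<close>

definition idxV :: "bidx set" where "idxV = idx - {RS}"
definition idxH :: "bidx set" where "idxH = {i \<in> idx. bweight f F i \<noteq> 0}"

abbreviation wt :: "bidx \<Rightarrow> real" where "wt \<equiv> bweight f F"
abbreviation mm :: "bidx \<Rightarrow> bidx \<Rightarrow> real" where "mm \<equiv> bform f F"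

lemma finite_idx [simp]: "finite idx" "finite idxV" "finite idxH"
  by (auto simp: idx_def idxV_def idxH_def)

lemma idx_simps [simp]: "LS \<in> idx" "RS \<in> idx" "LP k \<in> idx \<longleftrightarrow> k \<in> {1..npoles f}"
  "RP k \<in> idx \<longleftrightarrow> k \<in> {1..npoles F}"
  by (auto simp: idx_def)

lemma res_pos: "k \<in> {1..npoles f} \<Longrightarrow> 0 < res f k" "k \<in> {1..npoles F} \<Longrightarrow> 0 < res F k"
  using f F by (auto simp: bc_admissible_def)

lemma wt_nonneg: "i \<in> idx \<Longrightarrow> 0 \<le> wt i"
  using f F by (cases i) (auto simp: bc_admissible_def res_pos less_imp_le)

lemma wt_pos: "i \<in> idxH \<Longrightarrow> 0 < wt i"
  using wt_nonneg[of i] by (auto simp: idxH_def)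

definition ipV :: "pairs \<Rightarrow> pairs \<Rightarrow> complex" where "ipV = pair_ip idxV (\<lambda>_. 1)"
definition ipH :: "pairs \<Rightarrow> pairs \<Rightarrow> complex" where "ipH = pair_ip idxH wt"

sublocale V: semi_hilbert pair_scale PX ipV
  unfolding ipV_def by (rule semi_hilbert_pair) auto

sublocale H: semi_hilbert pair_scale PX ipH
  unfolding ipH_def by (rule semi_hilbert_pair) (auto simp: wt_pos)

lemma ipH_eq: "ipH u v = L2_inner (fst u) (fst v) + (\<Sum>i\<in>idx. of_real (wt i) * snd u i * cnj (snd v i))"
proof -
  have "(\<Sum>i\<in>idxH. of_real (wt i) * snd u i * cnj (snd v i)) = (\<Sum>i\<in>idx. of_real (wt i) * snd u i * cnj (snd v i))"
    by (intro sum.mono_neutral_left) (auto simp: idxH_def)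
  then show ?thesis by (simp add: ipH_def pair_ip_def)
qed

lemma nrmV_sq: "v \<in> PX \<Longrightarrow> (V.nrm v)\<^sup>2 = (L2_norm (fst v))\<^sup>2 + (\<Sum>i\<in>idxV. (norm (snd v i))\<^sup>2)"
  by (subst V.nrm_sq) (simp_all add: ipV_def Re_pair_ip_self)

lemma nrmH_sq: "v \<in> PX \<Longrightarrow> (H.nrm v)\<^sup>2 = (L2_norm (fst v))\<^sup>2 + (\<Sum>i\<in>idxH. wt i * (norm (snd v i))\<^sup>2)"
  by (subst H.nrm_sq) (simp_all add: ipH_def Re_pair_ip_self)

lemma L2_norm_le_nrmV: "v \<in> PX \<Longrightarrow> L2_norm (fst v) \<le> V.nrm v"
  by (rule power2_le_imp_le) (auto simp: nrmV_sq V.nrm_ge0 intro: sum_nonneg)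

lemma snd_le_nrmV: "v \<in> PX \<Longrightarrow> i \<in> idxV \<Longrightarrow> norm (snd v i) \<le> V.nrm v"
proof (rule power2_le_imp_le)
  assume v: "v \<in> PX" and i: "i \<in> idxV"
  have "(norm (snd v i))\<^sup>2 \<le> (\<Sum>i\<in>idxV. (norm (snd v i))\<^sup>2)"
    using i by (intro member_le_sum) auto
  then show "(norm (snd v i))\<^sup>2 \<le> (V.nrm v)\<^sup>2"
    unfolding nrmV_sq[OF v] using zero_le_power2[of "L2_norm (fst v)"] by linarith
qed (rule V.nrm_ge0)

definition \<kappa> :: real where "\<kappa> = 1 + sqrt pi"

lemma \<kappa>: "1 \<le> \<kappa>" by (simp add: \<kappa>_def)

lemma norm_traj_le_nrmV: "v \<in> PX \<Longrightarrow> x \<in> {0..pi} \<Longrightarrow> norm (traj v x) \<le> \<kappa> * V.nrm v"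
proof -
  assume v: "v \<in> PX" and x: "x \<in> {0..pi}"
  have "sqrt pi * L2_norm (fst v) \<le> sqrt pi * V.nrm v"
    by (intro mult_left_mono L2_norm_le_nrmV v) simp
  moreover have "norm (snd v LS) \<le> V.nrm v" by (intro snd_le_nrmV v) (simp add: idxV_def)
  ultimately show ?thesis
    using norm_traj_le[OF v x] unfolding \<kappa>_def distrib_right by linarith
qed

lemma norm_btrace_le_nrmV: "v \<in> PX \<Longrightarrow> i \<in> idx \<Longrightarrow> norm (btrace v i) \<le> \<kappa> * V.nrm v"
proof (cases "i = RS")
  case True
  then show "v \<in> PX \<Longrightarrow> i \<in> idx \<Longrightarrow> norm (btrace v i) \<le> \<kappa> * V.nrm v"
    using norm_traj_le_nrmV[of v pi] by (simp add: btrace_def)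
next
  case False
  assume v: "v \<in> PX" and i: "i \<in> idx"
  have "norm (btrace v i) \<le> 1 * V.nrm v"
    using snd_le_nrmV[OF v, of i] False i by (simp add: btrace_def idxV_def)
  also have "\<dots> \<le> \<kappa> * V.nrm v" by (intro mult_right_mono \<kappa> V.nrm_ge0 v)
  finally show ?thesis .
qed

definition S :: "real \<Rightarrow> complex" where "S x = of_real (s x)"

lemma S_L2: "S \<in> L2"
  unfolding L2_def S_def using square_integrable_of_real[OF s] by simp

definition St :: "pairs \<Rightarrow> real \<Rightarrow> complex" where "St v x = S x * traj v x"

lemma St_L2: "v \<in> PX \<Longrightarrow> St v \<in> L2"
  unfolding St_def[abs_def]
  by (rule L2_mult_bounded[OF S_L2, of _ "\<kappa> * V.nrm v"])
    (auto intro: continuous_measurable_I0pi continuous_traj norm_traj_le_nrmV)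

lemma St_bound:
  assumes v: "v \<in> PX" and K: "\<And>x. x \<in> {0..pi} \<Longrightarrow> norm (traj v x) \<le> K"
  shows "L2_norm (St v) \<le> K * L2_norm S"
  unfolding St_def[abs_def]
  by (rule L2_mult_bounded(2)[OF S_L2 continuous_measurable_I0pi[OF continuous_traj[OF v]] K])

lemma St_add: "u \<in> PX \<Longrightarrow> v \<in> PX \<Longrightarrow> St (u + v) = St u + St v"
  by (simp add: St_def fun_eq_iff traj_add distrib_left)

lemma St_scale: "St (pair_scale c v) = (\<lambda>x. c * St v x)"
  by (simp add: St_def fun_eq_iff traj_scale)

text \<open>With \<open>y = traj u\<close>, \<open>w = traj v\<close> and \<open>p = y'\<close>, the
  first three terms are the integral of \<open>(p - s y) * cnj w' - p * s * cnj w\<close>: the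
  equation integrated by parts against \<open>w\<close>. The two cross terms together stand for the
  distributional potential \<open>s'\<close>.\<close>

definition B :: "pairs \<Rightarrow> pairs \<Rightarrow> complex" where
  "B u v = L2_inner (fst u) (fst v) - L2_inner (St u) (fst v) - L2_inner (fst u) (St v)
     + (\<Sum>i\<in>idx. \<Sum>j\<in>idx. of_real (mm i j) * btrace u i * cnj (btrace v j))"

sublocale B: hermitian_form pair_scale PX B
proof
  show "B (u + v) w = B u w + B v w" if "u \<in> PX" "v \<in> PX" "w \<in> PX" for u v w
    using that unfolding B_def
    by (simp add: L2s.ip_add_left PX_fst St_add St_L2 btrace_add distrib_left distrib_right sum.distrib)
  show "B (pair_scale c u) v = c * B u v" if "u \<in> PX" "v \<in> PX" for c u v
    using that L2s.ip_scale_left[of "fst u" "fst v" c] L2s.ip_scale_left[of "St u" "fst v" c]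
      L2s.ip_scale_left[of "fst u" "St v" c] unfolding B_def
    by (simp add: PX_fst St_L2 St_scale btrace_scale algebra_simps sum_distrib_left)
  show "B v u = cnj (B u v)" if "u \<in> PX" "v \<in> PX" for u v
  proof -
    have "(\<Sum>i\<in>idx. \<Sum>j\<in>idx. of_real (mm i j) * btrace v i * cnj (btrace u j)) =
        (\<Sum>j\<in>idx. \<Sum>i\<in>idx. of_real (mm i j) * btrace v i * cnj (btrace u j))"
      by (rule sum.swap)
    also have "\<dots> = cnj (\<Sum>i\<in>idx. \<Sum>j\<in>idx. of_real (mm i j) * btrace u i * cnj (btrace v j))"
      unfolding cnj_sum by (intro sum.cong refl) (simp add: bform_sym[of f F] mult_ac)
    finally show ?thesis
      using that L2s.ip_cnj[of "fst u" "fst v"] L2s.ip_cnj[of "St u" "fst v"] L2s.ip_cnj[of "fst u" "St v"]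
      unfolding B_def by (simp add: PX_fst St_L2)
  qed
qed (auto intro: V.zero_mem V.add_mem V.scale_mem)

end

section \<open>Boundedness, coercivity and compactness of the form\<close>

context bvp
begin

lemma L2_norm_traj_le_nrmH: "v \<in> PX \<Longrightarrow> L2_norm (traj v) \<le> H.nrm (hembed v)"
proof (rule power2_le_imp_le)
  assume v: "v \<in> PX"
  have "0 \<le> (\<Sum>i\<in>idxH. wt i * (norm (btrace v i))\<^sup>2)"
    by (intro sum_nonneg) (auto simp: idxH_def wt_nonneg)
  then show "(L2_norm (traj v))\<^sup>2 \<le> (H.nrm (hembed v))\<^sup>2"
    unfolding nrmH_sq[OF hembed_mem[OF v]] by (simp add: hembed_def)
qed (intro H.nrm_ge0 hembed_mem)

lemma L2_norm_nonneg: "g \<in> L2 \<Longrightarrow> 0 \<le> L2_norm g"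
  using L2s.nrm_ge0 by (simp add: L2s_nrm)

lemma bdry_bound:
  assumes u: "u \<in> PX" and v: "v \<in> PX"
  shows "norm (\<Sum>i\<in>idx. \<Sum>j\<in>idx. of_real (mm i j) * btrace u i * cnj (btrace v j)) \<le>
    (\<Sum>i\<in>idx. \<Sum>j\<in>idx. \<bar>mm i j\<bar> * \<kappa>\<^sup>2) * V.nrm u * V.nrm v"
proof -
  have "norm (of_real (mm i j) * btrace u i * cnj (btrace v j)) \<le> \<bar>mm i j\<bar> * \<kappa>\<^sup>2 * V.nrm u * V.nrm v"
    if "i \<in> idx" "j \<in> idx" for i j
  proof -
    have "norm (btrace u i) * norm (btrace v j) \<le> (\<kappa> * V.nrm u) * (\<kappa> * V.nrm v)"
      using that u v \<kappa> V.nrm_ge0[OF u] by (intro mult_mono norm_btrace_le_nrmV mult_nonneg_nonneg) auto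
    then have "\<bar>mm i j\<bar> * (norm (btrace u i) * norm (btrace v j)) \<le> \<bar>mm i j\<bar> * ((\<kappa> * V.nrm u) * (\<kappa> * V.nrm v))"
      by (intro mult_left_mono) auto
    then show ?thesis by (simp add: norm_mult power2_eq_square mult_ac)
  qed
  then show ?thesis
    unfolding sum_distrib_right by (intro order_trans[OF norm_sum] sum_mono)
qed

lemma B_bound: "\<exists>K. \<forall>u\<in>PX. \<forall>v\<in>PX. norm (B u v) \<le> K * V.nrm u * V.nrm v"
proof (intro exI ballI)
  fix u v assume u: "u \<in> PX" and v: "v \<in> PX"
  let ?s = "\<kappa> * L2_norm S" and ?M = "\<Sum>i\<in>idx. \<Sum>j\<in>idx. \<bar>mm i j\<bar> * \<kappa>\<^sup>2"
  have St: "L2_norm (St w) \<le> ?s * V.nrm w" if "w \<in> PX" for w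
    using St_bound[OF that norm_traj_le_nrmV[OF that]] by (simp add: mult_ac)
  have nn: "0 \<le> L2_norm (fst u)" "0 \<le> L2_norm (fst v)" "0 \<le> ?s" "0 \<le> V.nrm u" "0 \<le> V.nrm v"
    using u v \<kappa> by (auto intro!: L2_norm_nonneg PX_fst V.nrm_ge0 S_L2 mult_nonneg_nonneg)
  have sn: "0 \<le> L2_norm (St v)" by (intro L2_norm_nonneg St_L2 v)
  have "norm (L2_inner (fst u) (fst v)) \<le> L2_norm (fst u) * L2_norm (fst v)"
    using L2s.cauchy_schwarz[OF PX_fst[OF u] PX_fst[OF v]] by (simp only: L2s_nrm)
  also have "\<dots> \<le> V.nrm u * V.nrm v"
    by (rule mult_mono[OF L2_norm_le_nrmV[OF u] L2_norm_le_nrmV[OF v] nn(4) nn(2)])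
  finally have 1: "norm (L2_inner (fst u) (fst v)) \<le> V.nrm u * V.nrm v" .
  have "norm (L2_inner (St u) (fst v)) \<le> L2_norm (St u) * L2_norm (fst v)"
    using L2s.cauchy_schwarz[OF St_L2[OF u] PX_fst[OF v]] by (simp only: L2s_nrm)
  also have "\<dots> \<le> (?s * V.nrm u) * V.nrm v"
    by (rule mult_mono[OF St[OF u] L2_norm_le_nrmV[OF v] mult_nonneg_nonneg[OF nn(3,4)] nn(2)])
  finally have 2: "norm (L2_inner (St u) (fst v)) \<le> (?s * V.nrm u) * V.nrm v" .
  have "norm (L2_inner (fst u) (St v)) \<le> L2_norm (fst u) * L2_norm (St v)"
    using L2s.cauchy_schwarz[OF PX_fst[OF u] St_L2[OF v]] by (simp only: L2s_nrm)
  also have "\<dots> \<le> V.nrm u * (?s * V.nrm v)"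
    by (rule mult_mono[OF L2_norm_le_nrmV[OF u] St[OF v] nn(4) sn])
  finally have 3: "norm (L2_inner (fst u) (St v)) \<le> V.nrm u * (?s * V.nrm v)" .
  have "norm (B u v) \<le> norm (L2_inner (fst u) (fst v)) + norm (L2_inner (St u) (fst v)) +
      norm (L2_inner (fst u) (St v)) + norm (\<Sum>i\<in>idx. \<Sum>j\<in>idx. of_real (mm i j) * btrace u i * cnj (btrace v j))"
    unfolding B_def by (intro order_trans[OF norm_triangle_ineq] order_trans[OF norm_triangle_ineq4] add_mono order_refl)
  then have "norm (B u v) \<le> V.nrm u * V.nrm v + (?s * V.nrm u) * V.nrm v + V.nrm u * (?s * V.nrm v) +
      ?M * V.nrm u * V.nrm v"
    using bdry_bound[OF u v] 1 2 3 by linarith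
  also have "\<dots> = (1 + 2 * ?s + ?M) * V.nrm u * V.nrm v" by (simp add: distrib_right)
  finally show "norm (B u v) \<le> (1 + 2 * ?s + ?M) * V.nrm u * V.nrm v" .
qed

lemma hembed_bound: "\<exists>K. \<forall>u\<in>PX. H.nrm (hembed u) \<le> K * V.nrm u"
proof (intro exI ballI)
  fix u assume u: "u \<in> PX"
  let ?a = "L2_norm (\<lambda>_. 1)"
  let ?w = "\<Sum>i\<in>idxH. wt i"
  have "L2_norm (\<lambda>x. 1 * traj u x) \<le> (\<kappa> * V.nrm u) * ?a"
    by (rule L2_mult_bounded(2))
      (auto intro!: continuous_L2 continuous_measurable_I0pi continuous_traj norm_traj_le_nrmV u)
  then have "(L2_norm (traj u))\<^sup>2 \<le> ((\<kappa> * V.nrm u) * ?a)\<^sup>2"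
    by (intro power_mono L2_norm_nonneg traj_L2 u) simp
  moreover have "(\<Sum>i\<in>idxH. wt i * (norm (btrace u i))\<^sup>2) \<le> (\<Sum>i\<in>idxH. wt i * (\<kappa> * V.nrm u)\<^sup>2)"
    using u by (intro sum_mono mult_left_mono power_mono norm_btrace_le_nrmV)
      (auto simp: idxH_def wt_nonneg)
  ultimately have "(H.nrm (hembed u))\<^sup>2 \<le> (\<kappa> * V.nrm u)\<^sup>2 * ?a\<^sup>2 + ?w * (\<kappa> * V.nrm u)\<^sup>2"
    unfolding nrmH_sq[OF hembed_mem[OF u]] by (simp add: hembed_def power_mult_distrib sum_distrib_right)
  also have "\<dots> = (sqrt (?a\<^sup>2 + ?w) * \<kappa> * V.nrm u)\<^sup>2"
  proof -
    have "0 \<le> ?w" by (intro sum_nonneg) (auto simp: idxH_def wt_nonneg)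
    then have "(sqrt (?a\<^sup>2 + ?w))\<^sup>2 = ?a\<^sup>2 + ?w" by simp
    then show ?thesis by (simp only: power_mult_distrib) (simp add: algebra_simps)
  qed
  finally show "H.nrm (hembed u) \<le> sqrt (?a\<^sup>2 + ?w) * \<kappa> * V.nrm u"
  proof (rule power2_le_imp_le)
    have "0 \<le> ?w" by (intro sum_nonneg) (auto simp: idxH_def wt_nonneg)
    then show "0 \<le> sqrt (?a\<^sup>2 + ?w) * \<kappa> * V.nrm u"
      using \<kappa> V.nrm_ge0[OF u] by (intro mult_nonneg_nonneg) auto
  qed
qed

text \<open>Quantities that are small relative to the leading term of the form, up to multiples of the
  norm of the extended space.\<close>

definition small :: "(pairs \<Rightarrow> real) \<Rightarrow> bool" where
  "small g \<longleftrightarrow> (\<forall>\<delta>>0. \<exists>C. \<forall>v\<in>PX. g v \<le> \<delta> * (L2_norm (fst v))\<^sup>2 + C * (H.nrm (hembed v))\<^sup>2)"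

lemma smallD: "small g \<Longrightarrow> \<delta> > 0 \<Longrightarrow>
    \<exists>C. \<forall>v\<in>PX. g v \<le> \<delta> * (L2_norm (fst v))\<^sup>2 + C * (H.nrm (hembed v))\<^sup>2"
  by (simp add: small_def)

lemma small_mono: "small h \<Longrightarrow> (\<And>v. v \<in> PX \<Longrightarrow> g v \<le> h v) \<Longrightarrow> small g"
  unfolding small_def by (meson order_trans)

lemma small_add: assumes g: "small g" and h: "small h" shows "small (\<lambda>v. g v + h v)"
  unfolding small_def
proof (intro allI impI)
  fix \<delta> :: real assume \<delta>: "\<delta> > 0"
  obtain C where C: "\<And>v. v \<in> PX \<Longrightarrow> g v \<le> \<delta> / 2 * (L2_norm (fst v))\<^sup>2 + C * (H.nrm (hembed v))\<^sup>2"
    using smallD[OF g half_gt_zero[OF \<delta>]] by blast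
  obtain D where D: "\<And>v. v \<in> PX \<Longrightarrow> h v \<le> \<delta> / 2 * (L2_norm (fst v))\<^sup>2 + D * (H.nrm (hembed v))\<^sup>2"
    using smallD[OF h half_gt_zero[OF \<delta>]] by blast
  show "\<exists>C. \<forall>v\<in>PX. g v + h v \<le> \<delta> * (L2_norm (fst v))\<^sup>2 + C * (H.nrm (hembed v))\<^sup>2"
  proof (intro exI[of _ "C + D"] ballI)
    fix v assume "v \<in> PX"
    from add_mono[OF C[OF this] D[OF this]]
    show "g v + h v \<le> \<delta> * (L2_norm (fst v))\<^sup>2 + (C + D) * (H.nrm (hembed v))\<^sup>2"
      by (simp add: distrib_right)
  qed
qed

lemma small_cmult: assumes g: "small g" and c: "0 \<le> c" shows "small (\<lambda>v. c * g v)"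
  unfolding small_def
proof (intro allI impI)
  fix \<delta> :: real assume \<delta>: "\<delta> > 0"
  have "\<delta> / (c + 1) > 0" using \<delta> c by simp
  from smallD[OF g this] obtain C
    where C: "\<And>v. v \<in> PX \<Longrightarrow> g v \<le> \<delta> / (c + 1) * (L2_norm (fst v))\<^sup>2 + C * (H.nrm (hembed v))\<^sup>2" by blast
  show "\<exists>C. \<forall>v\<in>PX. c * g v \<le> \<delta> * (L2_norm (fst v))\<^sup>2 + C * (H.nrm (hembed v))\<^sup>2"
  proof (intro exI[of _ "c * C"] ballI)
    fix v assume v: "v \<in> PX"
    have "c * g v \<le> c * (\<delta> / (c + 1) * (L2_norm (fst v))\<^sup>2 + C * (H.nrm (hembed v))\<^sup>2)"
      by (rule mult_left_mono[OF C[OF v] c])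
    moreover have "c * (\<delta> / (c + 1)) \<le> \<delta>"
      using c \<delta> by (simp add: divide_simps mult.commute)
    then have "c * (\<delta> / (c + 1)) * (L2_norm (fst v))\<^sup>2 \<le> \<delta> * (L2_norm (fst v))\<^sup>2"
      by (rule mult_right_mono) simp
    ultimately show "c * g v \<le> \<delta> * (L2_norm (fst v))\<^sup>2 + c * C * (H.nrm (hembed v))\<^sup>2"
      by (simp add: distrib_left mult.assoc)
  qed
qed

lemma small_zero: "small (\<lambda>v. 0)"
  unfolding small_def by (intro allI impI exI[of _ 0]) simp

lemma small_sum: "finite A \<Longrightarrow> (\<And>i. i \<in> A \<Longrightarrow> small (g i)) \<Longrightarrow> small (\<lambda>v. \<Sum>i\<in>A. g i v)"
  by (induction A rule: finite_induct) (auto intro: small_zero small_add)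

text \<open>The first claim is the Sobolev inequality. Its bound is uniform in \<open>x\<close>,
  hence also bounds the supremum of \<open>traj v\<close>, and the norm of \<open>St v\<close> is at
  most this supremum times the norm of \<open>S\<close>.\<close>

lemma small_traj_St:
  "x \<in> {0..pi} \<Longrightarrow> small (\<lambda>v. (norm (traj v x))\<^sup>2)" "small (\<lambda>v. (L2_norm (St v))\<^sup>2)"
proof -
  have sob: "\<exists>C\<ge>0. \<forall>v\<in>PX. \<forall>x\<in>{0..pi}.
      (norm (traj v x))\<^sup>2 \<le> \<delta> * (L2_norm (fst v))\<^sup>2 + C * (H.nrm (hembed v))\<^sup>2" if \<delta>: "\<delta> > 0" for \<delta>
  proof -
    obtain C where C: "C \<ge> 0" "\<And>v x. v \<in> PX \<Longrightarrow> x \<in> {0..pi} \<Longrightarrow>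
      (norm (traj v x))\<^sup>2 \<le> \<delta> * (L2_norm (fst v))\<^sup>2 + C * (L2_norm (traj v))\<^sup>2"
      using sobolev[OF \<delta>] by blast
    have "C * (L2_norm (traj v))\<^sup>2 \<le> C * (H.nrm (hembed v))\<^sup>2" if "v \<in> PX" for v
      using C(1) that by (intro mult_left_mono power_mono L2_norm_traj_le_nrmH L2_norm_nonneg traj_L2)
    then show ?thesis using C(1) by (intro exI[of _ C] conjI ballI order_trans[OF C(2)] add_left_mono)
  qed
  show "small (\<lambda>v. (norm (traj v x))\<^sup>2)" if "x \<in> {0..pi}"
    unfolding small_def using sob that by blast
  \<comment> \<open>The factor is split off so that the supremum bound can be used with its own
    constants; \<open>small_cmult\<close> puts it back. If it vanishes, \<open>St v\<close> has norm
    zero and the bound is trivial.\<close>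
  have "small (\<lambda>v. (L2_norm S)\<^sup>2 * ((L2_norm (St v))\<^sup>2 / (L2_norm S)\<^sup>2))" if "L2_norm S \<noteq> 0"
  proof (rule small_cmult)
    show "small (\<lambda>v. (L2_norm (St v))\<^sup>2 / (L2_norm S)\<^sup>2)"
      unfolding small_def
    proof (intro allI impI)
      fix \<delta> :: real assume "\<delta> > 0"
      from sob[OF this] obtain C where C: "C \<ge> 0" "\<And>v x. v \<in> PX \<Longrightarrow> x \<in> {0..pi} \<Longrightarrow>
        (norm (traj v x))\<^sup>2 \<le> \<delta> * (L2_norm (fst v))\<^sup>2 + C * (H.nrm (hembed v))\<^sup>2" by blast
      show "\<exists>C. \<forall>v\<in>PX. (L2_norm (St v))\<^sup>2 / (L2_norm S)\<^sup>2 \<le> \<delta> * (L2_norm (fst v))\<^sup>2 + C * (H.nrm (hembed v))\<^sup>2"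
      proof (intro exI[of _ C] ballI)
        fix v assume v: "v \<in> PX"
        let ?k = "\<delta> * (L2_norm (fst v))\<^sup>2 + C * (H.nrm (hembed v))\<^sup>2"
        have k0: "0 \<le> ?k" using \<open>\<delta> > 0\<close> C(1) by simp
        have "L2_norm (St v) \<le> sqrt ?k * L2_norm S"
          by (rule St_bound[OF v]) (rule real_le_rsqrt[OF C(2)[OF v]])
        then have "(L2_norm (St v))\<^sup>2 \<le> (sqrt ?k * L2_norm S)\<^sup>2"
          by (intro power_mono L2_norm_nonneg St_L2 v)
        also have "\<dots> = ?k * (L2_norm S)\<^sup>2" using k0 by (simp only: power_mult_distrib real_sqrt_pow2)
        finally show "(L2_norm (St v))\<^sup>2 / (L2_norm S)\<^sup>2 \<le> ?k"
          using \<open>L2_norm S \<noteq> 0\<close> by (simp add: pos_divide_le_eq)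
      qed
    qed
  qed simp
  moreover have "small (\<lambda>v. (L2_norm (St v))\<^sup>2)" if "L2_norm S = 0"
  proof (rule small_mono[OF small_zero])
    fix v assume v: "v \<in> PX"
    have "L2_norm (St v) \<le> (\<kappa> * V.nrm v) * L2_norm S" by (rule St_bound[OF v norm_traj_le_nrmV[OF v]])
    then have "L2_norm (St v) = 0" using that L2_norm_nonneg[OF St_L2[OF v]] by simp
    then show "(L2_norm (St v))\<^sup>2 \<le> 0" by simp
  qed
  ultimately show "small (\<lambda>v. (L2_norm (St v))\<^sup>2)" by (cases "L2_norm S = 0") simp_all
qed

text \<open>Pole coordinates have positive weight and are controlled directly by the ambient norm.
  Endpoint values may have weight zero, and for them the Sobolev inequality is used.\<close>

lemma small_btrace: "i \<in> idx \<Longrightarrow> small (\<lambda>v. (norm (btrace v i))\<^sup>2)"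
proof -
  assume i: "i \<in> idx"
  have pole: "small (\<lambda>v. (norm (btrace v i))\<^sup>2)" if i: "i \<in> idxH"
    unfolding small_def
  proof (intro allI impI exI[of _ "inverse (wt i)"] ballI)
    fix \<delta> :: real and v assume \<delta>: "\<delta> > 0" and v: "v \<in> PX"
    have "wt i * (norm (btrace v i))\<^sup>2 \<le> (\<Sum>i\<in>idxH. wt i * (norm (btrace v i))\<^sup>2)"
      using i by (intro member_le_sum) (auto simp: idxH_def wt_nonneg)
    also have "\<dots> \<le> (H.nrm (hembed v))\<^sup>2"
      unfolding nrmH_sq[OF hembed_mem[OF v]] by (simp add: hembed_def)
    finally have "inverse (wt i) * (wt i * (norm (btrace v i))\<^sup>2) \<le> inverse (wt i) * (H.nrm (hembed v))\<^sup>2"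
      using wt_pos[OF i] by (intro mult_left_mono) auto
    moreover have "0 \<le> \<delta> * (L2_norm (fst v))\<^sup>2" using \<delta> by simp
    ultimately show "(norm (btrace v i))\<^sup>2 \<le> \<delta> * (L2_norm (fst v))\<^sup>2 + inverse (wt i) * (H.nrm (hembed v))\<^sup>2"
      using wt_pos[OF i] by (simp add: mult.assoc[symmetric])
  qed
  show ?thesis
  proof (cases i)
    case (LP k)
    then have "i \<in> idxH" using i res_pos(1)[of k] by (simp add: idxH_def)
    then show ?thesis by (rule pole)
  next
    case (RP k)
    then have "i \<in> idxH" using i res_pos(2)[of k] by (simp add: idxH_def)
    then show ?thesis by (rule pole)
  next
    case LS
    then show ?thesis using small_traj_St(1)[of 0] by (simp add: btrace_LS)
  next
    case RS
    then show ?thesis using small_traj_St(1)[of pi] by (simp add: btrace_RS)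
  qed
qed

text \<open>The cross term is absorbed by \<open>2 a b \<le> 4 a\<^sup>2 + b\<^sup>2 / 4\<close>,
  and all remaining terms are collected in the small quantity \<open>?g\<close>, bounded with
  \<open>\<delta> = 1 / 4\<close>. Of the leading term \<open>1 - 1/4 - 1/4 = 1/2\<close> is left.
  The last summand of \<open>?g\<close> pays for the coordinates in the norm of the form
  domain.\<close>

lemma coercive: "\<exists>C. \<forall>v\<in>PX. 1 / 2 * (V.nrm v)\<^sup>2 \<le> Re (B v v) + C * (H.nrm (hembed v))\<^sup>2"
proof -
  let ?bd = "\<lambda>v. \<Sum>i\<in>idx. \<Sum>j\<in>idx. of_real (mm i j) * btrace v i * cnj (btrace v j)"
  let ?g = "\<lambda>v. 4 * (L2_norm (St v))\<^sup>2 + ((\<Sum>i\<in>idx. \<Sum>j\<in>idx. \<bar>mm i j\<bar> * ((norm (btrace v i))\<^sup>2 + (norm (btrace v j))\<^sup>2))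
      + 1 / 2 * (\<Sum>i\<in>idx. (norm (btrace v i))\<^sup>2))"
  have "small ?g"
    by (intro small_add small_cmult small_sum small_btrace small_traj_St finite_idx) auto
  then obtain C where C: "\<And>v. v \<in> PX \<Longrightarrow> ?g v \<le> 1 / 4 * (L2_norm (fst v))\<^sup>2 + C * (H.nrm (hembed v))\<^sup>2"
    using smallD[of ?g "1 / 4"] by auto
  show ?thesis
  proof (intro exI[of _ C] ballI)
    fix v assume v: "v \<in> PX"
    let ?P = "L2_norm (fst v)"
    have "norm (of_real (mm i j) * btrace v i * cnj (btrace v j)) \<le> \<bar>mm i j\<bar> * ((norm (btrace v i))\<^sup>2 + (norm (btrace v j))\<^sup>2)" for i j
    proof -
      have "2 * norm (btrace v i) * norm (btrace v j) \<le> (norm (btrace v i))\<^sup>2 + (norm (btrace v j))\<^sup>2"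
        by (rule sum_squares_bound)
      moreover have "0 \<le> norm (btrace v i) * norm (btrace v j)" by simp
      ultimately have "norm (btrace v i) * norm (btrace v j) \<le> (norm (btrace v i))\<^sup>2 + (norm (btrace v j))\<^sup>2"
        by linarith
      then have "\<bar>mm i j\<bar> * (norm (btrace v i) * norm (btrace v j)) \<le> \<bar>mm i j\<bar> * ((norm (btrace v i))\<^sup>2 + (norm (btrace v j))\<^sup>2)"
        by (rule mult_left_mono) simp
      then show ?thesis by (simp only: norm_mult norm_of_real complex_mod_cnj mult.assoc)
    qed
    then have bd: "norm (?bd v) \<le> (\<Sum>i\<in>idx. \<Sum>j\<in>idx. \<bar>mm i j\<bar> * ((norm (btrace v i))\<^sup>2 + (norm (btrace v j))\<^sup>2))"
      by (intro order_trans[OF norm_sum] sum_mono)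
    have "norm (L2_inner (St v) (fst v)) \<le> L2_norm (St v) * ?P"
      using L2s.cauchy_schwarz[OF St_L2[OF v] PX_fst[OF v]] by (simp add: L2s_nrm)
    moreover have "2 * (2 * L2_norm (St v)) * (1 / 2 * ?P) \<le> (2 * L2_norm (St v))\<^sup>2 + (1 / 2 * ?P)\<^sup>2"
      by (rule sum_squares_bound)
    then have "2 * (L2_norm (St v) * ?P) \<le> 4 * (L2_norm (St v))\<^sup>2 + 1 / 4 * ?P\<^sup>2"
      by (simp add: power_mult_distrib power_divide mult.commute)
    moreover have "\<bar>Re (L2_inner (St v) (fst v))\<bar> \<le> norm (L2_inner (St v) (fst v))"
      by (rule abs_Re_le_cmod)
    moreover have "Re (B v v) = ?P\<^sup>2 - 2 * Re (L2_inner (St v) (fst v)) + Re (?bd v)"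
    proof -
      have "L2_inner (fst v) (St v) = cnj (L2_inner (St v) (fst v))"
        by (rule L2s.ip_cnj[OF St_L2[OF v] PX_fst[OF v]])
      moreover have "Re (L2_inner (fst v) (fst v)) = ?P\<^sup>2" by (simp add: Re_L2_inner_self L2_norm_sq)
      ultimately show ?thesis unfolding B_def by simp
    qed
    moreover have "\<bar>Re (?bd v)\<bar> \<le> norm (?bd v)" by (rule abs_Re_le_cmod)
    moreover have "(\<Sum>i\<in>idxV. (norm (snd v i))\<^sup>2) \<le> (\<Sum>i\<in>idx. (norm (btrace v i))\<^sup>2)"
    proof -
      have "(\<Sum>i\<in>idxV. (norm (snd v i))\<^sup>2) = (\<Sum>i\<in>idxV. (norm (btrace v i))\<^sup>2)"
        by (intro sum.cong) (auto simp: btrace_def idxV_def)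
      also have "\<dots> \<le> (\<Sum>i\<in>idx. (norm (btrace v i))\<^sup>2)"
        by (intro sum_mono2) (auto simp: idxV_def)
      finally show ?thesis .
    qed
    ultimately show "1 / 2 * (V.nrm v)\<^sup>2 \<le> Re (B v v) + C * (H.nrm (hembed v))\<^sup>2"
      using C[OF v] bd unfolding nrmV_sq[OF v] by argo
  qed
qed

text \<open>Bolzano-Weierstrass handles the finitely many traces and Arzela-Ascoli the trajectories,
  which are uniformly Hoelder continuous. The limit \<open>(g, c)\<close> is only claimed to lie in
  the ambient space, not in the range of \<open>hembed\<close>.\<close>

lemma compact_embedding:
  fixes v :: "nat \<Rightarrow> pairs"
  assumes v: "\<And>n. v n \<in> PX" and R: "\<And>n. V.nrm (v n) \<le> R"
  shows "\<exists>r :: nat \<Rightarrow> nat. strict_mono r \<and>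
    (\<forall>\<epsilon>>0. \<exists>N. \<forall>m\<ge>N. \<forall>n\<ge>N. H.nrm (hembed (v (r m)) - hembed (v (r n))) < \<epsilon>)"
proof -
  have R0: "0 \<le> R" using V.nrm_ge0[OF v, of 0] R[of 0] by linarith
  have tr: "norm (btrace (v n) i) \<le> \<kappa> * R" if "i \<in> idx" for n i
    by (rule order_trans[OF norm_btrace_le_nrmV[OF v that] mult_left_mono[OF R]]) (use \<kappa> in simp)
  have tj: "norm (traj (v n) x) \<le> \<kappa> * R" if "x \<in> {0..pi}" for n x
    by (rule order_trans[OF norm_traj_le_nrmV[OF v that] mult_left_mono[OF R]]) (use \<kappa> in simp)
  obtain r1 c where r1: "strict_mono r1" and c: "\<And>i. i \<in> idx \<Longrightarrow> (\<lambda>n. btrace (v (r1 n)) i) \<longlonglongrightarrow> c i"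
    using finite_bounded_imp_convergent_subsequence[of idx "\<lambda>n. btrace (v n)" "\<kappa> * R"] tr finite_idx(1) by blast
  obtain g r2 where g: "continuous_on {0..pi} g" and r2: "strict_mono (r2 :: nat \<Rightarrow> nat)"
    and unif: "\<And>e. 0 < e \<Longrightarrow> \<exists>N. \<forall>n x. n \<ge> N \<and> x \<in> {0..pi} \<longrightarrow> norm (traj (v (r1 (r2 n))) x - g x) < e"
  proof (rule Arzela_Ascoli[of "{0..pi}" "\<lambda>n. traj (v (r1 n))" "\<kappa> * R"])
    show "\<And>n x. x \<in> {0..pi} \<Longrightarrow> norm (traj (v (r1 n)) x) \<le> \<kappa> * R" by (rule tj)
    fix x e :: real assume x: "x \<in> {0..pi}" and e: "0 < e"
    \<comment> \<open>Inverts the modulus of continuity \<open>sqrt d * R\<close>; the summand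
      \<open>1\<close> covers \<open>R = 0\<close> and gives strict inequality.\<close>
    define d where "d = (e / (R + 1))\<^sup>2"
    have d: "d > 0" using e R0 by (simp add: d_def)
    show "\<exists>d>0. \<forall>n y. y \<in> {0..pi} \<and> norm (x - y) < d \<longrightarrow> norm (traj (v (r1 n)) x - traj (v (r1 n)) y) < e"
    proof (intro exI[of _ d] conjI d allI impI, elim conjE)
      fix n y assume y: "y \<in> {0..pi}" and "norm (x - y) < d"
      then have "sqrt \<bar>x - y\<bar> \<le> sqrt d" by simp
      also have "sqrt d = e / (R + 1)" using e R0 by (simp add: d_def)
      finally have sq: "sqrt \<bar>x - y\<bar> \<le> e / (R + 1)" .
      have "norm (traj (v (r1 n)) x - traj (v (r1 n)) y) \<le> sqrt \<bar>x - y\<bar> * L2_norm (fst (v (r1 n)))"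
        by (rule norm_traj_diff_le[OF v y x])
      also have "\<dots> \<le> e / (R + 1) * R"
        using L2_norm_le_nrmV[OF v, of "r1 n"] R[of "r1 n"] e R0
        by (intro mult_mono sq L2_norm_nonneg PX_fst v) auto
      also have "\<dots> < e" using e R0 by (simp add: pos_divide_less_eq)
      finally show "norm (traj (v (r1 n)) x - traj (v (r1 n)) y) < e" .
    qed
  qed auto
  define r where "r = r1 \<circ> r2"
  have r: "strict_mono r" unfolding r_def by (rule strict_mono_o[OF r1 r2])
  have gc: "(g, c) \<in> PX" using continuous_L2[OF g] by (simp add: pair_carrier_def)
  have Em: "hembed (v n) \<in> PX" for n by (rule hembed_mem[OF v])
  have lim1: "(\<lambda>n. L2_norm (traj (v (r n)) - g)) \<longlonglongrightarrow> 0"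
  proof (rule LIMSEQ_I)
    fix e :: real assume e: "e > 0"
    let ?a = "L2_norm (\<lambda>_. 1)"
    have a0: "0 \<le> ?a" by (intro L2_norm_nonneg continuous_L2 continuous_intros)
    then have "e / (?a + 1) > 0" using e by simp
    from unif[OF this] obtain N where N: "\<And>n x. n \<ge> N \<Longrightarrow> x \<in> {0..pi} \<Longrightarrow>
      norm (traj (v (r n)) x - g x) < e / (?a + 1)" by (auto simp: r_def)
    show "\<exists>N. \<forall>n\<ge>N. norm (L2_norm (traj (v (r n)) - g) - 0) < e"
    proof (intro exI[of _ N] allI impI)
      fix n assume n: "N \<le> n"
      have cont: "continuous_on {0..pi} (\<lambda>x. traj (v (r n)) x - g x)"
        by (intro continuous_intros continuous_traj v g)
      have "L2_norm (\<lambda>x. 1 * (traj (v (r n)) x - g x)) \<le> e / (?a + 1) * ?a"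
        by (rule L2_mult_bounded(2))
          (use N[OF n] cont in \<open>auto intro!: continuous_L2 continuous_measurable_I0pi less_imp_le\<close>)
      also have "\<dots> < e" using e a0 by (simp add: pos_divide_less_eq)
      finally show "norm (L2_norm (traj (v (r n)) - g) - 0) < e"
        using L2_norm_nonneg[OF continuous_L2[OF cont]] by (simp add: fun_diff_def)
    qed
  qed
  have lim2: "(\<lambda>n. btrace (v (r n)) i) \<longlonglongrightarrow> c i" if "i \<in> idx" for i
    using LIMSEQ_subseq_LIMSEQ[OF c[OF that] r2] by (simp add: r_def o_def)
  have *: "(\<lambda>n. sqrt ((L2_norm (traj (v (r n)) - g))\<^sup>2 + (\<Sum>i\<in>idxH. wt i * (norm (btrace (v (r n)) i - c i))\<^sup>2)))
      \<longlonglongrightarrow> sqrt (0\<^sup>2 + (\<Sum>i\<in>idxH. wt i * (norm (c i - c i))\<^sup>2))"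
    by (intro tendsto_intros lim1 lim2) (simp add: idxH_def)
  have lim: "(\<lambda>n. H.nrm (hembed (v (r n)) - (g, c))) \<longlonglongrightarrow> 0"
  proof -
    have "H.nrm z = sqrt ((L2_norm (fst z))\<^sup>2 + (\<Sum>i\<in>idxH. wt i * (norm (snd z i))\<^sup>2))" if "z \<in> PX" for z
      using real_sqrt_unique[OF nrmH_sq[OF that] H.nrm_ge0[OF that]] by simp
    from this[OF H.diff_mem[OF Em gc]] show ?thesis using * by (simp add: hembed_def)
  qed
  have "\<exists>N. \<forall>m\<ge>N. \<forall>n\<ge>N. H.nrm (hembed (v (r m)) - hembed (v (r n))) < \<epsilon>" if \<epsilon>: "\<epsilon> > 0" for \<epsilon>
  proof -
    obtain N where N: "\<And>n. n \<ge> N \<Longrightarrow> norm (H.nrm (hembed (v (r n)) - (g, c)) - 0) < \<epsilon> / 2"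
      using LIMSEQ_D[OF lim half_gt_zero[OF \<epsilon>]] by blast
    have le: "H.nrm (hembed (v (r n)) - (g, c)) < \<epsilon> / 2" if "n \<ge> N" for n
      using N[OF that] by simp
    show ?thesis
    proof (intro exI[of _ N] allI impI)
      fix m n assume mn: "N \<le> m" "N \<le> n"
      have "H.nrm (hembed (v (r m)) - hembed (v (r n))) \<le>
          H.nrm (hembed (v (r m)) - (g, c)) + H.nrm ((g, c) - hembed (v (r n)))"
        by (rule H.nrm_triangle_via[OF Em gc Em])
      also have "H.nrm ((g, c) - hembed (v (r n))) = H.nrm (hembed (v (r n)) - (g, c))"
        by (rule H.nrm_diff_commute[OF gc Em])
      also have "H.nrm (hembed (v (r m)) - (g, c)) + \<dots> < \<epsilon>"
        using le[OF mn(1)] le[OF mn(2)] by linarith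
      finally show "H.nrm (hembed (v (r m)) - hembed (v (r n))) < \<epsilon>" .
    qed
  qed
  then show ?thesis using r by blast
qed

lemma compact_form_bvp: "\<exists>K K' C. compact_form pair_scale PX ipV pair_scale PX ipH B hembed K K' (1 / 2) C"
proof -
  obtain K where K: "\<And>u v. u \<in> PX \<Longrightarrow> v \<in> PX \<Longrightarrow> norm (B u v) \<le> K * V.nrm u * V.nrm v"
    using B_bound by blast
  obtain K' where K': "\<And>u. u \<in> PX \<Longrightarrow> H.nrm (hembed u) \<le> K' * V.nrm u"
    using hembed_bound by blast
  obtain C where C: "\<And>v. v \<in> PX \<Longrightarrow> 1 / 2 * (V.nrm v)\<^sup>2 \<le> Re (B v v) + C * (H.nrm (hembed v))\<^sup>2"
    using coercive by blast
  have "compact_form pair_scale PX ipV pair_scale PX ipH B hembed K K' (1 / 2) C"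
    by (unfold_locales; (rule hembed_mem hembed_add hembed_scale K K' C compact_embedding | simp); assumption)
  then show ?thesis by blast
qed

end

section \<open>Weak and strong eigenvectors\<close>

text \<open>The test function is \<open>h\<close> minus its mean \<open>c\<close>. It is admissible,
  and it is orthogonal both to \<open>h\<close> and to the constant \<open>c\<close>, hence to
  itself.\<close>

lemma du_bois_reymond:
  assumes h: "h \<in> L2" and perp: "\<And>p. p \<in> L2 \<Longrightarrow> prim p pi = 0 \<Longrightarrow> L2_inner h p = 0"
  shows "\<exists>c. AE x in I0pi. h x = c"
proof -
  define c where "c = prim h pi / pi"
  define p where "p x = h x - c" for x
  have cL2: "(\<lambda>_. k) \<in> L2" for k :: complex by (intro continuous_L2 continuous_intros)
  have pL2: "p \<in> L2" unfolding p_def[abs_def] by (intro L2_diff h cL2)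
  have hI: "h integrable_on {0..pi}"
    using L2_absolutely_integrable[OF h] set_lebesgue_integral_eq_integral(1) by blast
  have "prim p pi = prim h pi - integral {0..pi} (\<lambda>_. c)"
    unfolding p_def[abs_def] prim_def using hI
    by (simp add: Henstock_Kurzweil_Integration.integral_diff integrable_const_ivl)
  then have p0: "prim p pi = 0" by (simp add: c_def scaleR_conv_of_real)
  have "L2_inner (\<lambda>_. c) p = c * cnj (prim p pi)"
  proof -
    have "L2_inner (\<lambda>_. c) p = c * cnj (integral\<^sup>L I0pi p)"
      unfolding L2_inner_def by simp
    then show ?thesis by (simp add: I0pi_integral[OF L2_integrable[OF pL2]] prim_def)
  qed
  then have "L2_inner (\<lambda>_. c) p = 0" using p0 by simp
  moreover have "p = h - (\<lambda>_. c)" by (simp add: p_def fun_eq_iff)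
  ultimately have "L2_inner p p = 0"
    using perp[OF pL2 p0] L2s.ip_diff_left[OF h cL2 pL2, of c] by simp
  then have "L2_norm p = 0" by (simp add: L2_norm_def)
  then have "AE x in I0pi. p x = 0" using L2_norm_eq_0_iff[OF pL2] by simp
  then show ?thesis by (intro exI[of _ c]) (simp add: p_def)
qed

lemma bounded_mult_integrable:
  fixes r :: "real \<Rightarrow> complex"
  assumes r: "r absolutely_integrable_on {0..pi}" and g: "continuous_on {0..pi} g"
  shows "integrable I0pi (\<lambda>x. r x * g x)"
proof -
  have rI: "integrable I0pi r" using r by (simp add: I0pi_integrable_iff)
  have gm: "g \<in> borel_measurable I0pi" by (rule continuous_measurable_I0pi[OF g])
  obtain K where K: "\<And>x. x \<in> {0..pi} \<Longrightarrow> norm (g x) \<le> K"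
    using compact_imp_bounded[OF compact_continuous_image[OF g compact_Icc]]
    by (meson bounded_iff imageI)
  show ?thesis
  proof (rule Bochner_Integration.integrable_bound)
    show "integrable I0pi (\<lambda>x. K * norm (r x))" using rI by simp
    show "(\<lambda>x. r x * g x) \<in> borel_measurable I0pi"
      using borel_measurable_integrable[OF rI] gm by (rule borel_measurable_times)
    have "norm (r x * g x) \<le> norm (K * norm (r x))" if "x \<in> {0<..<pi}" for x
    proof -
      have "norm (r x) * norm (g x) \<le> norm (r x) * K" using that by (intro mult_left_mono K) auto
      also have "\<dots> \<le> norm (K * norm (r x))" by (simp add: mult.commute)
      finally show ?thesis by (simp only: norm_mult)
    qed
    then show "AE x in I0pi. norm (r x * g x) \<le> norm (K * norm (r x))" by (intro AE_I2) simp
  qed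
qed

text \<open>The derivative \<open>r\<close> of a quasi-derivative contains products of two
  square-integrable functions, so it is merely integrable. For this reason the second term is a
  plain integral and not an \<open>L2_inner\<close>.\<close>

lemma by_parts:
  assumes q: "abs_continuous_on 0 pi q" and q': "AE x in I0pi. (q has_vector_derivative r x) (at x)"
    and r: "r absolutely_integrable_on {0..pi}" and z: "z \<in> PX"
  shows "L2_inner q (fst z) + (LINT x|I0pi. r x * cnj (traj z x)) = q pi * cnj (traj z pi) - q 0 * cnj (traj z 0)"
proof -
  have zI: "fst z absolutely_integrable_on {0..pi}" by (rule L2_absolutely_integrable[OF PX_fst[OF z]])
  have acz: "abs_continuous_on 0 pi (\<lambda>x. cnj (traj z x))"
    unfolding traj_def[abs_def] by (intro abs_continuous_on_cnj abs_continuous_on_prim zI)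
  have "AE x in I0pi. (traj z has_vector_derivative fst z x) (at x)"
    unfolding traj_def[abs_def] by (rule prim_has_vector_derivative[OF zI])
  then have dz: "AE x in I0pi. ((\<lambda>x. cnj (traj z x)) has_vector_derivative cnj (fst z x)) (at x)"
    by eventually_elim (rule has_vector_derivative_cnj)
  have hi: "((\<lambda>x. q x * cnj (fst z x) + r x * cnj (traj z x)) has_integral
      (q pi * cnj (traj z pi) - q 0 * cnj (traj z 0))) {0..pi}"
    by (rule integration_by_parts_abs_continuous[OF q acz q' dz])
  have qL2: "q \<in> L2" by (intro continuous_L2 abs_continuous_on_imp_continuous_on q)
  have i1: "integrable I0pi (\<lambda>x. q x * cnj (fst z x))" by (rule L2_ip_integrable[OF qL2 PX_fst[OF z]])
  have i2: "integrable I0pi (\<lambda>x. r x * cnj (traj z x))"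
    by (intro bounded_mult_integrable r continuous_on_cnj continuous_traj z)
  have "L2_inner q (fst z) + (LINT x|I0pi. r x * cnj (traj z x)) =
      (LINT x|I0pi. q x * cnj (fst z x) + r x * cnj (traj z x))"
    unfolding L2_inner_def by (rule Bochner_Integration.integral_add[OF i1 i2, symmetric])
  also have "\<dots> = integral {0..pi} (\<lambda>x. q x * cnj (fst z x) + r x * cnj (traj z x))"
    by (rule I0pi_integral[OF Bochner_Integration.integrable_add[OF i1 i2]])
  finally show ?thesis using hi by (simp add: integral_unique)
qed

lemma continuous_AE_const:
  fixes G :: "real \<Rightarrow> complex"
  assumes G: "continuous_on {0..pi} G" and c: "AE x in I0pi. G x = c" and x: "x \<in> {0..pi}"
  shows "G x = c"
proof -
  have cont: "continuous_on {0..pi} (\<lambda>x. (norm (G x - c))\<^sup>2)" by (intro continuous_intros G)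
  have "integral {0..pi} (\<lambda>x. (norm (G x - c))\<^sup>2) = (LINT x|I0pi. (norm (G x - c))\<^sup>2)"
    by (intro I0pi_integral[symmetric])
      (simp add: I0pi_integrable_iff absolutely_integrable_continuous_real cont)
  also have "\<dots> = 0"
    by (rule integral_eq_zero_AE) (use c in \<open>eventually_elim, simp\<close>)
  finally have "\<forall>x\<in>{0..pi}. (norm (G x - c))\<^sup>2 = 0"
    using integral_eq_0_iff[OF cont] by simp
  then show ?thesis using x by simp
qed

section \<open>Equivalence of the weak and the strong formulation\<close>

context bvp
begin

text \<open>Agrees with \<open>weak_eigenvector\<close> of \<open>compact_form\<close>, but can be
  used without first choosing the constants of that locale, which are known only to exist.\<close>

definition weak :: "real \<Rightarrow> pairs \<Rightarrow> bool" where
  "weak \<nu> v \<longleftrightarrow> v \<in> PX \<and> (\<forall>z\<in>PX. B v z = of_real \<nu> * ipH (hembed v) (hembed z))"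

text \<open>The relations between the boundary data \<open>e\<close> and the values \<open>q0\<close>, \<open>q1\<close> of the quasi-derivative at
  the endpoints that are equivalent to the boundary conditions.\<close>

definition brel :: "real \<Rightarrow> (bidx \<Rightarrow> complex) \<Rightarrow> complex \<Rightarrow> complex \<Rightarrow> bool" where
  "brel \<nu> e q0 q1 \<longleftrightarrow> (\<forall>j\<in>idx. (\<Sum>i\<in>idx. of_real (mm i j) * e i) =
     of_real \<nu> * of_real (wt j) * e j + (if j = LS then q0 else if j = RS then - q1 else 0))"

lemma bdry_swap:
  "(\<Sum>i\<in>idx. \<Sum>j\<in>idx. of_real (mm i j) * e i * cnj (e' j)) =
    (\<Sum>j\<in>idx. (\<Sum>i\<in>idx. of_real (mm i j) * e i) * cnj (e' j))"
  by (subst sum.swap) (simp add: sum_distrib_right)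

lemma sum_endpoint: "(\<Sum>j\<in>idx. (if j = LS then a else if j = RS then b else 0) * c j) = a * c LS + (b * c RS :: complex)"
proof -
  have "(\<Sum>j\<in>idx. (if j = LS then a else if j = RS then b else 0) * c j) =
      (\<Sum>j\<in>{LS, RS}. (if j = LS then a else if j = RS then b else 0) * c j)"
    by (intro sum.mono_neutral_right) auto
  then show ?thesis by simp
qed

text \<open>With the derivative \<open>p = q + s y\<close> the differential equation becomes
  \<open>q' = - (s p + \<nu> y)\<close>, so this is the negative derivative of the quasi-derivative
  of a solution.\<close>

definition rate :: "real \<Rightarrow> pairs \<Rightarrow> real \<Rightarrow> complex" where
  "rate \<nu> v x = S x * fst v x + of_real \<nu> * traj v x"

lemma rate_integrable: "v \<in> PX \<Longrightarrow> rate \<nu> v absolutely_integrable_on {0..pi}"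
  unfolding I0pi_integrable_iff[symmetric] rate_def[abs_def]
  using L2_mult_integrable[of S "fst v"] S_L2 PX_fst[of v] L2_integrable[OF traj_L2[of v]]
  by (simp add: L2_def)

lemma LINT_rate:
  assumes v: "v \<in> PX" and z: "z \<in> PX"
  shows "(LINT x|I0pi. rate \<nu> v x * cnj (traj z x)) = L2_inner (fst v) (St z) + of_real \<nu> * L2_inner (traj v) (traj z)"
proof -
  have cS: "cnj (S x) = S x" for x by (simp add: S_def)
  have i1: "integrable I0pi (\<lambda>x. fst v x * cnj (St z x))" by (intro L2_ip_integrable PX_fst v St_L2 z)
  have i2: "integrable I0pi (\<lambda>x. traj v x * cnj (traj z x))" by (intro L2_ip_integrable traj_L2 v z)
  have "(LINT x|I0pi. rate \<nu> v x * cnj (traj z x)) =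
      (LINT x|I0pi. fst v x * cnj (St z x) + of_real \<nu> * (traj v x * cnj (traj z x)))"
    by (intro Bochner_Integration.integral_cong refl) (simp add: rate_def St_def cS algebra_simps)
  also have "\<dots> = (LINT x|I0pi. fst v x * cnj (St z x)) + (LINT x|I0pi. of_real \<nu> * (traj v x * cnj (traj z x)))"
    by (intro Bochner_Integration.integral_add i1 integrable_mult_right i2)
  also have "\<dots> = L2_inner (fst v) (St z) + of_real \<nu> * L2_inner (traj v) (traj z)"
    unfolding L2_inner_def by simp
  finally show ?thesis .
qed

lemma B_eq:
  assumes v: "v \<in> PX" and z: "z \<in> PX"
  shows "B v z = L2_inner (fst v - St v) (fst z) - L2_inner (fst v) (St z)
    + (\<Sum>j\<in>idx. (\<Sum>i\<in>idx. of_real (mm i j) * btrace v i) * cnj (btrace z j))"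
  unfolding B_def bdry_swap using v z by (simp add: L2s.ip_diff_left PX_fst St_L2)

lemma ipH_hembed: "ipH (hembed u) (hembed v) = L2_inner (traj u) (traj v) +
    (\<Sum>i\<in>idx. of_real (wt i) * btrace u i * cnj (btrace v i))"
  by (simp add: ipH_eq hembed_def)

text \<open>Integrating the quasi-derivative by parts against a test trajectory gives the integral
  terms of the form and of the inner product. The endpoint terms that remain are exactly those
  supplied by \<open>brel\<close>.\<close>

lemma strong_imp_weak:
  assumes sol: "is_solution s (of_real \<nu>) y q" and p: "p \<in> L2" and pq: "AE x in I0pi. p x = q x + S x * y x"
    and a: "a LS = y 0" and y: "\<And>x. x \<in> {0..pi} \<Longrightarrow> traj (p, a) x = y x"
    and rel: "brel \<nu> (btrace (p, a)) (q 0) (q pi)"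
  shows "weak \<nu> (p, a)"
  unfolding weak_def
proof (intro conjI ballI)
  let ?v = "(p, a)"
  show v: "?v \<in> PX" using p by (simp add: pair_carrier_def)
  have qac: "abs_continuous_on 0 pi q"
    using sol by (simp add: is_solution_def is_quasi_derivative_def)
  have "AE x in I0pi. \<exists>q'. (q has_vector_derivative q') (at x) \<and>
        - q' - of_real (s x) * q x - of_real ((s x)\<^sup>2) * y x = of_real \<nu> * y x"
    using sol by (simp add: is_solution_def)
  then have dq: "AE x in I0pi. (q has_vector_derivative (- rate \<nu> ?v x)) (at x)"
    using pq AE_space[of I0pi]
  proof eventually_elim
    case (elim x)
    then obtain q' where q': "(q has_vector_derivative q') (at x)"
      "- q' - of_real (s x) * q x - of_real ((s x)\<^sup>2) * y x = of_real \<nu> * y x" by blast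
    have "traj ?v x = y x" using elim(3) by (intro y) simp
    then have "rate \<nu> ?v x = of_real (s x) * (q x + of_real (s x) * y x) + of_real \<nu> * y x"
      using elim(2) by (simp add: rate_def S_def)
    moreover have "q' = - (- q' - of_real (s x) * q x - of_real ((s x)\<^sup>2) * y x)
        - of_real (s x) * q x - of_real ((s x)\<^sup>2) * y x" by simp
    then have "q' = - (of_real \<nu> * y x) - of_real (s x) * q x - of_real ((s x)\<^sup>2) * y x"
      unfolding q'(2) .
    ultimately have "- rate \<nu> ?v x = q'" by (simp add: algebra_simps power2_eq_square)
    then show ?case using q'(1) by simp
  qed
  fix z assume z: "z \<in> PX"
  have neg: "(\<lambda>x. - rate \<nu> ?v x) absolutely_integrable_on {0..pi}"
    using rate_integrable[OF v, of \<nu>] unfolding I0pi_integrable_iff[symmetric]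
    by (rule Bochner_Integration.integrable_minus)
  have "L2_inner q (fst z) + (LINT x|I0pi. - rate \<nu> ?v x * cnj (traj z x)) = q pi * cnj (traj z pi) - q 0 * cnj (traj z 0)"
    by (rule by_parts[OF qac dq neg z])
  moreover have "(LINT x|I0pi. - rate \<nu> ?v x * cnj (traj z x)) =
      - (L2_inner (fst ?v) (St z) + of_real \<nu> * L2_inner (traj ?v) (traj z))"
    unfolding LINT_rate[OF v z, symmetric] mult_minus_left by (rule Bochner_Integration.integral_minus)
  ultimately have 1: "L2_inner q (fst z) = q pi * cnj (traj z pi) - q 0 * cnj (traj z 0)
      + L2_inner p (St z) + of_real \<nu> * L2_inner (traj ?v) (traj z)"
    by (simp add: algebra_simps)
  have "L2_inner q (fst z) = L2_inner (fst ?v - St ?v) (fst z)"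
    unfolding L2_inner_def
  proof (rule integral_cong_AE)
    have "q \<in> borel_measurable I0pi"
      by (intro continuous_measurable_I0pi abs_continuous_on_imp_continuous_on qac)
    moreover have m: "fst z \<in> borel_measurable I0pi" "fst ?v - St ?v \<in> borel_measurable I0pi"
      using PX_fst[OF z] L2s.diff_mem[OF PX_fst[OF v] St_L2[OF v]]
      by (auto simp: L2_def square_integrable_def)
    moreover have "(\<lambda>x. cnj (fst z x)) \<in> borel_measurable I0pi"
      by (rule borel_measurable_continuous_on[OF continuous_on_cnj[OF continuous_on_id] m(1)])
    ultimately show "(\<lambda>x. q x * cnj (fst z x)) \<in> borel_measurable I0pi"
      "(\<lambda>x. (fst ?v - St ?v) x * cnj (fst z x)) \<in> borel_measurable I0pi"
      by - (rule borel_measurable_times, assumption, assumption)+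
    show "AE x in I0pi. q x * cnj (fst z x) = (fst ?v - St ?v) x * cnj (fst z x)"
      using pq AE_space[of I0pi]
    proof eventually_elim
      case (elim x)
      have "traj ?v x = y x" using elim(2) by (intro y) simp
      then show ?case using elim(1) by (simp add: St_def)
    qed
  qed
  with 1 have 2: "L2_inner (fst ?v - St ?v) (fst z) - L2_inner (fst ?v) (St z) =
      q pi * cnj (btrace z RS) - q 0 * cnj (btrace z LS) + of_real \<nu> * L2_inner (traj ?v) (traj z)"
    by (simp add: btrace_LS btrace_RS)
  have "(\<Sum>j\<in>idx. (\<Sum>i\<in>idx. of_real (mm i j) * btrace ?v i) * cnj (btrace z j)) =
      (\<Sum>j\<in>idx. of_real \<nu> * (of_real (wt j) * btrace ?v j * cnj (btrace z j)) +
        (if j = LS then q 0 else if j = RS then - q pi else 0) * cnj (btrace z j))"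
    using rel unfolding brel_def by (intro sum.cong refl) (simp add: distrib_right mult.assoc)
  also have "\<dots> = of_real \<nu> * (\<Sum>j\<in>idx. of_real (wt j) * btrace ?v j * cnj (btrace z j)) +
      (q 0 * cnj (btrace z LS) + - q pi * cnj (btrace z RS))"
    unfolding sum.distrib sum_distrib_left[symmetric] sum_endpoint ..
  finally show "B ?v z = of_real \<nu> * ipH (hembed ?v) (hembed z)"
    unfolding B_eq[OF v z] ipH_hembed 2 by (simp add: distrib_left)
qed

text \<open>Boundary data can be prescribed freely. A constant derivative of size
  \<open>1 / pi\<close> moves the right endpoint value: up to one for the index \<open>RS\<close>,
  back down to zero for the index \<open>LS\<close>.\<close>

lemma btrace_unit:
  assumes "i \<in> idx"
  obtains u where "u \<in> PX" "btrace u = (\<lambda>j. if j = i then 1 else 0)"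
proof -
  have c: "(\<lambda>_. k) \<in> L2" for k :: complex by (intro continuous_L2 continuous_intros)
  have pc: "prim (\<lambda>_. k) pi = of_real pi * k" for k :: complex by (simp add: prim_def scaleR_conv_of_real)
  show thesis
  proof (cases "i = RS")
    case True
    then show thesis
      by (intro that[of "((\<lambda>_. 1 / of_real pi), (\<lambda>_. 0))"])
        (auto simp: pair_carrier_def c btrace_def traj_def pc fun_eq_iff)
  next
    case False
    show thesis
      using False by (intro that[of "((\<lambda>_. if i = LS then - 1 / of_real pi else 0), (\<lambda>j. if j = i then 1 else 0))"])
        (auto simp: pair_carrier_def c btrace_def traj_def pc fun_eq_iff)
  qed
qed

text \<open>Test vectors without boundary data show, by du Bois-Reymond, that \<open>h\<close> is
  almost everywhere a constant \<open>c\<close>. Thus \<open>c - P\<close> is an absolutely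
  continuous representative of the quasi-derivative, and the differential equation is read off from
  the derivative of \<open>P\<close>. Test vectors with a single boundary coordinate then yield the
  equations of \<open>brel\<close> one by one.\<close>

lemma weak_imp_strong:
  assumes w: "weak \<nu> v"
  obtains q where "is_solution s (of_real \<nu>) (traj v) q" "brel \<nu> (btrace v) (q 0) (q pi)"
proof -
  have v: "v \<in> PX" and weak: "\<And>z. z \<in> PX \<Longrightarrow> B v z = of_real \<nu> * ipH (hembed v) (hembed z)"
    using w by (auto simp: weak_def)
  define P where "P = prim (rate \<nu> v)"
  have RI: "rate \<nu> v absolutely_integrable_on {0..pi}" by (rule rate_integrable[OF v])
  have Pac: "abs_continuous_on 0 pi (\<lambda>x. c + P x)" for c
    unfolding P_def by (rule abs_continuous_on_prim[OF RI])
  have dP: "AE x in I0pi. ((\<lambda>x. c + P x) has_vector_derivative rate \<nu> v x) (at x)" for c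
    unfolding P_def by (rule prim_has_vector_derivative[OF RI])
  have P0: "P 0 = 0" by (simp add: P_def prim_0)
  have PL2: "P \<in> L2" using continuous_L2[OF abs_continuous_on_imp_continuous_on[OF Pac[of 0]]] by simp
  define h where "h = fst v - St v + P"
  have hL2: "h \<in> L2" unfolding h_def by (intro L2s.add_mem L2s.diff_mem PX_fst v St_L2 PL2)
  \<comment> \<open>The boundary part of the weak equation: the residual of the linear system of
    \<open>brel\<close> without its endpoint terms, paired with the trace of
    \<open>z\<close>.\<close>
  define gap where "gap z = (\<Sum>j\<in>idx. ((\<Sum>i\<in>idx. of_real (mm i j) * btrace v i) - of_real \<nu> * of_real (wt j) * btrace v j) * cnj (btrace z j))" for z
  have eq: "L2_inner h (fst z) - P pi * cnj (btrace z RS) + gap z = 0" if z: "z \<in> PX" for z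
  proof -
    have "L2_inner P (fst z) + (LINT x|I0pi. rate \<nu> v x * cnj (traj z x)) = P pi * cnj (traj z pi) - P 0 * cnj (traj z 0)"
      using by_parts[OF Pac[of 0] dP[of 0] RI z] by simp
    then have 1: "L2_inner P (fst z) = P pi * cnj (btrace z RS) - L2_inner (fst v) (St z) - of_real \<nu> * L2_inner (traj v) (traj z)"
      unfolding LINT_rate[OF v z] by (simp add: P0 btrace_RS algebra_simps)
    have 2: "L2_inner h (fst z) = L2_inner (fst v - St v) (fst z) + L2_inner P (fst z)"
      unfolding h_def by (intro L2s.ip_add_left L2s.diff_mem PX_fst v z St_L2 PL2)
    have 3: "gap z = (\<Sum>j\<in>idx. (\<Sum>i\<in>idx. of_real (mm i j) * btrace v i) * cnj (btrace z j)) -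
        of_real \<nu> * (\<Sum>j\<in>idx. of_real (wt j) * btrace v j * cnj (btrace z j))"
      unfolding gap_def sum_distrib_left sum_subtractf[symmetric]
      by (intro sum.cong refl) (simp add: left_diff_distrib mult.assoc)
    show ?thesis
      using weak[OF z] unfolding B_eq[OF v z] ipH_hembed 2 1 3 by (simp add: algebra_simps)
  qed
  have "\<exists>c. AE x in I0pi. h x = c"
  proof (rule du_bois_reymond[OF hL2])
    fix p assume p: "p \<in> L2" and p0: "prim p pi = 0"
    have "btrace (p, \<lambda>_. 0) i = 0" for i using p0 by (simp add: btrace_def traj_def)
    then show "L2_inner h p = 0" using eq[of "(p, \<lambda>_. 0)"] p by (simp add: pair_carrier_def gap_def)
  qed
  then obtain c where c: "AE x in I0pi. h x = c" by blast
  define q where "q x = c - P x" for x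
  have qv: "AE x in I0pi. q x = fst v x - S x * traj v x"
    using c by eventually_elim (simp add: q_def h_def St_def algebra_simps)
  have "q = (\<lambda>x. - (- c + P x))" by (simp add: q_def fun_eq_iff)
  then have qac: "abs_continuous_on 0 pi q" using abs_continuous_on_minus[OF Pac[of "- c"]] by simp
  have yac: "abs_continuous_on 0 pi (traj v)"
    unfolding traj_def[abs_def] by (intro abs_continuous_on_prim L2_absolutely_integrable PX_fst v)
  have dy: "AE x in I0pi. (traj v has_vector_derivative fst v x) (at x)"
    unfolding traj_def[abs_def] by (intro prim_has_vector_derivative L2_absolutely_integrable PX_fst v)
  have dq: "AE x in I0pi. (q has_vector_derivative - rate \<nu> v x) (at x)"
    using dP[of "- c"]
  proof eventually_elim
    case (elim x)
    from has_vector_derivative_minus[OF this] show ?case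
      using \<open>q = (\<lambda>x. - (- c + P x))\<close> by simp
  qed
  show thesis
  proof (rule that)
    show "is_solution s (of_real \<nu>) (traj v) q"
      unfolding is_solution_def is_quasi_derivative_def
    proof (intro conjI yac qac)
      show "AE x in I0pi. \<exists>y'. (traj v has_vector_derivative y') (at x) \<and> q x = y' - of_real (s x) * traj v x"
        using dy qv by eventually_elim (auto simp: S_def)
      show "AE x in I0pi. \<exists>q'. (q has_vector_derivative q') (at x) \<and>
          - q' - of_real (s x) * q x - of_real ((s x)\<^sup>2) * traj v x = of_real \<nu> * traj v x"
        using dq qv
      proof eventually_elim
        case (elim x)
        have "rate \<nu> v x = S x * (q x + S x * traj v x) + of_real \<nu> * traj v x"
          using elim(2) by (simp add: rate_def)
        then show ?case
          using elim(1) by (intro exI[of _ "- rate \<nu> v x"]) (simp add: S_def algebra_simps power2_eq_square)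
      qed
    qed
    show "brel \<nu> (btrace v) (q 0) (q pi)"
      unfolding brel_def
    proof
      fix j assume j: "j \<in> idx"
      obtain u where u: "u \<in> PX" and tu: "btrace u = (\<lambda>k. if k = j then 1 else 0)"
        by (rule btrace_unit[OF j])
      have "L2_inner h (fst u) = c * cnj (integral\<^sup>L I0pi (fst u))"
      proof -
        have "L2_inner h (fst u) = (LINT x|I0pi. c * cnj (fst u x))"
          unfolding L2_inner_def
        proof (rule integral_cong_AE)
          have m: "fst u \<in> borel_measurable I0pi" "h \<in> borel_measurable I0pi"
            using PX_fst[OF u] hL2 by (auto simp: L2_def square_integrable_def)
          have "(\<lambda>x. cnj (fst u x)) \<in> borel_measurable I0pi"
            by (rule borel_measurable_continuous_on[OF continuous_on_cnj[OF continuous_on_id] m(1)])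
          then show "(\<lambda>x. h x * cnj (fst u x)) \<in> borel_measurable I0pi"
            "(\<lambda>x. c * cnj (fst u x)) \<in> borel_measurable I0pi"
            using m by (auto intro: borel_measurable_times)
          show "AE x in I0pi. h x * cnj (fst u x) = c * cnj (fst u x)" using c by eventually_elim simp
        qed
        then show ?thesis by simp
      qed
      also have "integral\<^sup>L I0pi (fst u) = btrace u RS - btrace u LS"
        by (simp add: I0pi_integral[OF L2_integrable[OF PX_fst[OF u]]] btrace_LS btrace_RS traj_0)
          (simp add: traj_def prim_def)
      finally have 1: "L2_inner h (fst u) = c * cnj (btrace u RS - btrace u LS)" .
      have "gap u = (\<Sum>k\<in>idx. if k = j then (\<Sum>i\<in>idx. of_real (mm i j) * btrace v i) - of_real \<nu> * of_real (wt j) * btrace v j else 0)"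
        unfolding gap_def tu by (intro sum.cong) auto
      also have "\<dots> = (\<Sum>i\<in>idx. of_real (mm i j) * btrace v i) - of_real \<nu> * of_real (wt j) * btrace v j"
        using j by simp
      finally have 2: "gap u = (\<Sum>i\<in>idx. of_real (mm i j) * btrace v i) - of_real \<nu> * of_real (wt j) * btrace v j" .
      show "(\<Sum>i\<in>idx. of_real (mm i j) * btrace v i) =
          of_real \<nu> * of_real (wt j) * btrace v j + (if j = LS then q 0 else if j = RS then - q pi else 0)"
        using eq[OF u] unfolding 1 2 tu by (auto simp: q_def P0 algebra_simps)
    qed
  qed
qed

text \<open>Trajectories vanishing at both ends make the primitive of \<open>fst w\<close> constant
  by du Bois-Reymond, hence zero, so \<open>fst w\<close> vanishes almost everywhere. Test vectors
  with a unit trace then remove the coordinates of positive weight.\<close>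

lemma hembed_dense:
  assumes w: "w \<in> PX" and perp: "\<And>u. u \<in> PX \<Longrightarrow> ipH w (hembed u) = 0"
  shows "H.nrm w = 0"
proof -
  define G where "G = prim (fst w)"
  have wI: "fst w absolutely_integrable_on {0..pi}" by (intro L2_absolutely_integrable PX_fst w)
  have Gac: "abs_continuous_on 0 pi (\<lambda>x. c + G x)" for c unfolding G_def by (rule abs_continuous_on_prim[OF wI])
  have dG: "AE x in I0pi. ((\<lambda>x. 0 + G x) has_vector_derivative fst w x) (at x)"
    unfolding G_def by (rule prim_has_vector_derivative[OF wI])
  have Gc: "continuous_on {0..pi} G" using abs_continuous_on_imp_continuous_on[OF Gac[of 0]] by simp
  have GL2: "G \<in> L2" by (rule continuous_L2[OF Gc])
  have "\<exists>c. AE x in I0pi. G x = c"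
  proof (rule du_bois_reymond[OF GL2])
    fix p assume p: "p \<in> L2" and p0: "prim p pi = 0"
    let ?u = "(p, \<lambda>_. 0) :: pairs"
    have u: "?u \<in> PX" using p by (simp add: pair_carrier_def)
    have t0: "btrace ?u i = 0" for i using p0 by (simp add: btrace_def traj_def)
    have "L2_inner (fst w) (traj ?u) = 0"
      using perp[OF u] by (simp add: ipH_eq hembed_def t0)
    moreover have "L2_inner G (fst ?u) + (LINT x|I0pi. fst w x * cnj (traj ?u x)) =
        G pi * cnj (traj ?u pi) - G 0 * cnj (traj ?u 0)"
      using by_parts[OF Gac[of 0] dG wI u] by simp
    ultimately show "L2_inner G p = 0"
      using t0[of RS] t0[of LS] by (simp add: L2_inner_def btrace_LS btrace_RS)
  qed
  then obtain c where c: "AE x in I0pi. G x = c" by blast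
  have Gx: "G x = c" if "x \<in> {0..pi}" for x by (rule continuous_AE_const[OF Gc c that])
  have c0: "c = 0" using Gx[of 0] by (simp add: G_def prim_0)
  have "AE x in I0pi. fst w x = 0"
    using dG AE_space[of I0pi]
  proof eventually_elim
    case (elim x)
    then have x: "x \<in> {0<..<pi}" by simp
    have "((\<lambda>x. 0 + G x) has_vector_derivative 0) (at x)"
    proof (rule has_vector_derivative_transform_within_open[of "\<lambda>_. 0" _ _ "{0<..<pi}"])
      show "((\<lambda>_. 0) has_vector_derivative 0) (at x)" by (rule has_vector_derivative_const)
    qed (use x Gx c0 in auto)
    then show ?case using elim(1) vector_derivative_unique_at by blast
  qed
  then have fw: "L2_norm (fst w) = 0" using L2_norm_eq_0_iff[OF PX_fst[OF w]] by simp
  have "snd w i = 0" if i: "i \<in> idxH" for i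
  proof -
    have "i \<in> idx" using i by (simp add: idxH_def)
    then obtain u where u: "u \<in> PX" and tu: "btrace u = (\<lambda>k. if k = i then 1 else 0)"
      by (rule btrace_unit)
    have "L2_inner (fst w) (traj u) = 0"
      using fw by (intro L2s.ip_eq_0_of_nrm PX_fst w traj_L2 u) (simp add: L2s_nrm)
    moreover have "(\<Sum>k\<in>idx. of_real (wt k) * snd w k * cnj (btrace u k)) =
        (\<Sum>k\<in>idx. if k = i then of_real (wt i) * snd w i else 0)"
      unfolding tu by (intro sum.cong) auto
    ultimately have "of_real (wt i) * snd w i = 0"
      using perp[OF u] \<open>i \<in> idx\<close> by (simp add: ipH_eq hembed_def)
    then show ?thesis using wt_pos[OF i] by simp
  qed
  then have "(H.nrm w)\<^sup>2 = 0" unfolding nrmH_sq[OF w] using fw by simp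
  then show ?thesis by simp
qed

end

section \<open>Boundary conditions and simplicity of the eigenvalues\<close>

lemma res_nonzero: "bc_admissible g \<Longrightarrow> k \<in> {1..npoles g} \<Longrightarrow> res g k \<noteq> 0"
  by (force simp: bc_admissible_def)

text \<open>The poles are distinct, so at a pole only the summand of the numerator that omits the
  corresponding factor survives. Hence numerator and denominator have no common zero there, and the
  cleared condition forces the boundary value to vanish.\<close>

lemma bc_numden_at_pole:
  assumes g: "bc_admissible g" and j: "j \<in> {1..npoles g}"
  shows "poly (bc_den g) (of_real (pole g j)) = 0" "poly (bc_num g) (of_real (pole g j)) \<noteq> 0"
proof -
  let ?z = "complex_of_real (pole g j)"
  show den: "poly (bc_den g) ?z = 0"
    unfolding bc_den_def poly_prod using j by (intro prod_zero) auto
  have inj: "pole g k \<noteq> pole g j" if "k \<in> {1..npoles g}" "k \<noteq> j" for k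
    using g j that unfolding bc_admissible_def strict_mono_on_def by (metis linorder_neqE_nat order_less_irrefl)
  have other: "(\<Prod>i\<in>{1..npoles g} - {k}. of_real (pole g i) - ?z) = 0" if "k \<in> {1..npoles g}" "k \<noteq> j" for k
    using that j by (intro prod_zero) auto
  have "poly (bc_num g) ?z = (\<Sum>k=1..npoles g. of_real (res g k) * (\<Prod>i\<in>{1..npoles g} - {k}. of_real (pole g i) - ?z))"
    unfolding bc_num_def using den by (simp add: poly_sum poly_prod)
  also have "\<dots> = of_real (res g j) * (\<Prod>i\<in>{1..npoles g} - {j}. of_real (pole g i) - ?z) +
      (\<Sum>k\<in>{1..npoles g} - {j}. of_real (res g k) * (\<Prod>i\<in>{1..npoles g} - {k}. of_real (pole g i) - ?z))"
    by (rule sum.remove[OF _ j]) simp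
  also have "(\<Sum>k\<in>{1..npoles g} - {j}. of_real (res g k) * (\<Prod>i\<in>{1..npoles g} - {k}. of_real (pole g i) - ?z)) = 0"
  proof (intro sum.neutral ballI)
    fix k assume "k \<in> {1..npoles g} - {j}"
    then have "k \<in> {1..npoles g}" "k \<noteq> j" by auto
    then have "(\<Prod>i\<in>{1..npoles g} - {k}. of_real (pole g i) - ?z) = 0" by (rule other)
    then show "of_real (res g k) * (\<Prod>i\<in>{1..npoles g} - {k}. of_real (pole g i) - ?z) = 0"
      by (simp only: mult_zero_right)
  qed
  also have "of_real (res g j) * (\<Prod>i\<in>{1..npoles g} - {j}. of_real (pole g i) - ?z) + 0 \<noteq> 0"
  proof -
    have "of_real (pole g i) - ?z \<noteq> 0" if "i \<in> {1..npoles g} - {j}" for i using inj[of i] that by simp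
    then have "(\<Prod>i\<in>{1..npoles g} - {j}. of_real (pole g i) - ?z) \<noteq> 0"
      by (simp only: prod_zero_iff finite_Diff finite_atLeastAtMost) blast
    then show ?thesis using res_nonzero[OF g j] by simp
  qed
  finally show "poly (bc_num g) ?z \<noteq> 0" .
qed

lemma bc_den_nonzero:
  assumes "\<And>k. k \<in> {1..npoles g} \<Longrightarrow> \<nu> \<noteq> pole g k"
  shows "poly (bc_den g) (of_real \<nu>) \<noteq> 0"
proof
  assume "poly (bc_den g) (of_real \<nu>) = 0"
  then have "\<exists>k\<in>{1..npoles g}. poly [:of_real (pole g k), -1:] (complex_of_real \<nu>) = 0"
    unfolding bc_den_def poly_prod by (simp only: prod_zero_iff finite_atLeastAtMost)
  then obtain k where k: "k \<in> {1..npoles g}" "poly [:of_real (pole g k), -1:] (complex_of_real \<nu>) = 0" by blast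
  then show False using assms[OF k(1)] by simp
qed

text \<open>Here \<open>\<eta> k\<close> stands for \<open>res g k * y / (\<nu> - pole g k)\<close>. At a pole it is not determined by \<open>y\<close>, and the
  second equation replaces the boundary condition.\<close>

definition bc_coords :: "bc_function \<Rightarrow> real \<Rightarrow> (nat \<Rightarrow> complex) \<Rightarrow> complex \<Rightarrow> complex \<Rightarrow> bool" where
  "bc_coords g \<nu> \<eta> y q \<longleftrightarrow> (\<forall>k\<in>{1..npoles g}. of_real (\<nu> - pole g k) * \<eta> k = of_real (res g k) * y) \<and>
     (\<Sum>k=1..npoles g. \<eta> k) - of_real (const_term g) * y = of_real \<nu> * of_real (slope g) * y + q"

text \<open>Away from the poles the coordinates \<open>\<eta>\<close> can be eliminated, and the
  rational function reappears.\<close>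

lemma bc_coords_regular:
  assumes \<nu>: "\<And>k. k \<in> {1..npoles g} \<Longrightarrow> \<nu> \<noteq> pole g k"
    and \<eta>: "\<And>k. k \<in> {1..npoles g} \<Longrightarrow> of_real (\<nu> - pole g k) * \<eta> k = of_real (res g k) * y"
  shows "(\<Sum>k=1..npoles g. \<eta> k) - of_real (const_term g) * y - of_real \<nu> * of_real (slope g) * y =
    - bc_value g (of_real \<nu>) * y"
proof -
  have "\<eta> k = - (of_real (res g k) / (of_real (pole g k) - of_real \<nu>)) * y" if k: "k \<in> {1..npoles g}" for k
  proof -
    have "complex_of_real (\<nu> - pole g k) \<noteq> 0" using \<nu>[OF k] by simp
    then have "\<eta> k = of_real (res g k) * y / of_real (\<nu> - pole g k)"
      using \<eta>[OF k] by (metis nonzero_mult_div_cancel_left)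
    also have "complex_of_real (\<nu> - pole g k) = - (of_real (pole g k) - of_real \<nu>)" by simp
    finally show ?thesis by (simp only: minus_divide_right[symmetric] minus_divide_left) simp
  qed
  then have "(\<Sum>k=1..npoles g. \<eta> k) = (\<Sum>k=1..npoles g. - (of_real (res g k) / (of_real (pole g k) - of_real \<nu>)) * y)"
    by (rule sum.cong[OF refl])
  also have "\<dots> = - (\<Sum>k=1..npoles g. of_real (res g k) / (of_real (pole g k) - of_real \<nu>)) * y"
    by (simp add: sum_negf sum_distrib_right)
  finally show ?thesis by (simp add: bc_value_def algebra_simps)
qed

text \<open>At a pole the cleared condition means \<open>y = 0\<close>; all other coordinates
  vanish, and the one at the pole equals \<open>q\<close>, which is just the second equation of
  \<open>bc_coords\<close>. At other values the denominator can be cancelled.\<close>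

lemma bc_coordsI:
  assumes g: "bc_admissible g"
    and bc: "poly (bc_den g) (of_real \<nu>) * q + poly (bc_num g) (of_real \<nu>) * y = 0"
  shows "bc_coords g \<nu> (\<lambda>k. if \<nu> = pole g k then q else of_real (res g k) * y / of_real (\<nu> - pole g k)) y q"
    (is "bc_coords g \<nu> ?\<eta> y q")
proof (cases "\<exists>j\<in>{1..npoles g}. \<nu> = pole g j")
  case True
  then obtain j where j: "j \<in> {1..npoles g}" "\<nu> = pole g j" by blast
  have y: "y = 0" using bc bc_numden_at_pole[OF g j(1)] j(2) by simp
  have ne: "\<nu> \<noteq> pole g k" if "k \<in> {1..npoles g}" "k \<noteq> j" for k
    using g j that unfolding bc_admissible_def strict_mono_on_def by (metis linorder_neqE_nat order_less_irrefl)
  have "(\<Sum>k=1..npoles g. ?\<eta> k) = (\<Sum>k=1..npoles g. if k = j then q else 0)"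
  proof (intro sum.cong refl)
    fix k assume "k \<in> {1..npoles g}"
    then show "?\<eta> k = (if k = j then q else 0)" using ne[of k] j(2) y by (cases "k = j") simp_all
  qed
  also have "\<dots> = q" using j(1) by simp
  finally show ?thesis unfolding bc_coords_def y by simp
next
  case False
  then have \<nu>: "\<nu> \<noteq> pole g k" if "k \<in> {1..npoles g}" for k using that by blast
  have \<eta>: "of_real (\<nu> - pole g k) * ?\<eta> k = of_real (res g k) * y" if "k \<in> {1..npoles g}" for k
    using \<nu>[OF that] by simp
  have "poly (bc_den g) (of_real \<nu>) * (q + bc_value g (of_real \<nu>) * y) = 0"
    using bc bc_num_eq_value_mult_den[of g "of_real \<nu>"] \<nu> by (simp add: algebra_simps)
  then have "q = - bc_value g (of_real \<nu>) * y"
    using bc_den_nonzero[of g \<nu>] \<nu> by (simp add: add_eq_0_iff2)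
  with bc_coords_regular[OF \<nu> \<eta>] \<eta> show ?thesis
    unfolding bc_coords_def by (simp add: diff_eq_eq add.commute)
qed

lemma bc_coords_regularD:
  assumes \<nu>: "\<And>k. k \<in> {1..npoles g} \<Longrightarrow> \<nu> \<noteq> pole g k" and c: "bc_coords g \<nu> \<eta> y q"
  shows "q = - bc_value g (of_real \<nu>) * y"
proof -
  have "(\<Sum>k=1..npoles g. \<eta> k) - of_real (const_term g) * y - of_real \<nu> * of_real (slope g) * y = q"
    using c by (simp add: bc_coords_def)
  moreover have "of_real (\<nu> - pole g k) * \<eta> k = of_real (res g k) * y" if "k \<in> {1..npoles g}" for k
    using c that unfolding bc_coords_def by blast
  ultimately show ?thesis using bc_coords_regular[OF \<nu>, of \<eta> y] by simp
qed

lemma bc_coordsD: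
  assumes g: "bc_admissible g" and c: "bc_coords g \<nu> \<eta> y q"
  shows "poly (bc_den g) (of_real \<nu>) * q + poly (bc_num g) (of_real \<nu>) * y = 0"
proof (cases "\<exists>j\<in>{1..npoles g}. \<nu> = pole g j")
  case True
  then obtain j where j: "j \<in> {1..npoles g}" "\<nu> = pole g j" by blast
  have "of_real (\<nu> - pole g j) * \<eta> j = of_real (res g j) * y"
    using c j(1) unfolding bc_coords_def by blast
  then have "y = 0" using j res_nonzero[OF g j(1)] by simp
  then show ?thesis using bc_numden_at_pole(1)[OF g j(1)] j(2) by simp
next
  case False
  then have \<nu>: "\<nu> \<noteq> pole g k" if "k \<in> {1..npoles g}" for k using that by blast
  have "q = - bc_value g (of_real \<nu>) * y" by (rule bc_coords_regularD[OF \<nu> c])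
  then show ?thesis
    using bc_num_eq_value_mult_den[of g "of_real \<nu>"] \<nu> by (simp add: algebra_simps)
qed

text \<open>The point is a value \<open>\<nu>\<close> that is a pole: its own coordinate is not
  determined by \<open>y\<close>, but once the other coordinates vanish it is the whole sum in the
  second equation.\<close>

lemma bc_coords_zero:
  assumes g: "bc_admissible g" and c: "bc_coords g \<nu> \<eta> 0 0" and k: "k \<in> {1..npoles g}"
  shows "\<eta> k = 0"
proof (cases "\<nu> = pole g k")
  case False
  then show ?thesis using c k by (auto simp: bc_coords_def)
next
  case True
  have "\<eta> i = 0" if "i \<in> {1..npoles g} - {k}" for i
  proof -
    have "pole g i \<noteq> \<nu>"
      using g k that True unfolding bc_admissible_def strict_mono_on_def
      by (metis DiffD1 DiffD2 insertI1 linorder_neqE_nat order_less_irrefl)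
    then show ?thesis using c that by (auto simp: bc_coords_def)
  qed
  then have "(\<Sum>i=1..npoles g. \<eta> i) = \<eta> k" using k by (subst sum.remove[of _ k]) auto
  then show ?thesis using c by (simp add: bc_coords_def)
qed

text \<open>The initial data \<open>(y, q)\<close> compatible with one boundary condition lie on a
  line: \<open>y = 0\<close> at a pole, and \<open>q\<close> a fixed multiple of \<open>y\<close>
  elsewhere. This is the source of simplicity of the eigenvalues.\<close>

lemma bc_coords_line:
  assumes g: "bc_admissible g" and c: "bc_coords g \<nu> \<eta> y q" and c': "bc_coords g \<nu> \<eta>' y' q'"
  obtains a b :: complex where "a \<noteq> 0 \<or> b \<noteq> 0" "a * y + b * y' = 0" "a * q + b * q' = 0"
proof -
  have "y = 0 \<and> y' = 0 \<or> (\<exists>m. q = m * y \<and> q' = m * y')"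
  proof (cases "\<exists>j\<in>{1..npoles g}. \<nu> = pole g j")
    case True
    then obtain j where j: "j \<in> {1..npoles g}" "\<nu> = pole g j" by blast
    have "of_real (\<nu> - pole g j) * \<eta> j = of_real (res g j) * y" "of_real (\<nu> - pole g j) * \<eta>' j = of_real (res g j) * y'"
      using c c' j(1) unfolding bc_coords_def by blast+
    then show ?thesis using j res_nonzero[OF g j(1)] by simp
  next
    case False
    then have \<nu>: "\<nu> \<noteq> pole g k" if "k \<in> {1..npoles g}" for k using that by blast
    show ?thesis using bc_coords_regularD[OF \<nu> c] bc_coords_regularD[OF \<nu> c'] by blast
  qed
  then show thesis
  proof
    assume "y = 0 \<and> y' = 0"
    then show thesis
      by (cases "q = 0 \<and> q' = 0") (auto intro: that[of 1 0] that[of q' "- q"] simp: mult.commute)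
  next
    assume "\<exists>m. q = m * y \<and> q' = m * y'"
    then obtain m where "q = m * y" "q' = m * y'" by blast
    then show thesis
      by (cases "y = 0 \<and> y' = 0") (auto intro: that[of 1 0] that[of y' "- y"] simp: mult_ac)
  qed
qed

text \<open>A continuation argument instead of an exponential estimate. Beyond the last point
  \<open>b\<close> up to which \<open>m\<close> vanishes, the integral of \<open>k\<close> stays
  below \<open>1 / 2\<close> on a short interval. At the maximum point \<open>z\<close> of
  \<open>m\<close> there, \<open>bound\<close> gives \<open>m z \<le> m z / 2\<close>, so
  \<open>m\<close> vanishes further than \<open>b\<close>.\<close>

lemma gronwall_zero:
  fixes m k :: "real \<Rightarrow> real"
  assumes m: "continuous_on {0..pi} m" "\<And>x. x \<in> {0..pi} \<Longrightarrow> 0 \<le> m x" "m 0 = 0"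
    and k: "k integrable_on {0..pi}" "\<And>x. x \<in> {0..pi} \<Longrightarrow> 0 \<le> k x"
    and bound: "\<And>a x M. 0 \<le> a \<Longrightarrow> a \<le> x \<Longrightarrow> x \<le> pi \<Longrightarrow> m a = 0 \<Longrightarrow>
      (\<And>t. t \<in> {a..x} \<Longrightarrow> m t \<le> M) \<Longrightarrow> m x \<le> M * integral {a..x} k"
    and x: "x \<in> {0..pi}"
  shows "m x = 0"
proof -
  define Z where "Z = {x \<in> {0..pi}. \<forall>t\<in>{0..x}. m t = 0}"
  have Z0: "0 \<in> Z" using m(3) by (auto simp: Z_def)
  have bdd: "bdd_above Z" by (rule bdd_aboveI[of _ pi]) (auto simp: Z_def)
  define b where "b = Sup Z"
  have b: "0 \<le> b" "b \<le> pi"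
    unfolding b_def by (rule cSup_upper[OF Z0 bdd], rule cSup_least) (use Z0 in blast, simp add: Z_def)
  have below: "m t = 0" if t: "0 \<le> t" "t < b" for t
  proof -
    obtain z where "z \<in> Z" "t < z" using t(2) Z0 bdd less_cSup_iff[of Z t] unfolding b_def by auto
    then show ?thesis using t(1) by (auto simp: Z_def)
  qed
  have mb: "m b = 0"
  proof (cases "b = 0")
    case False
    then have b0: "0 < b" using b by simp
    have "closed {t \<in> {0..pi}. m t = 0}"
      using continuous_closed_preimage_constant[OF m(1) closed_atLeastAtMost, of 0] by simp
    moreover have "b \<in> closure {0..<b}" using b0 by simp
    moreover have "{0..<b} \<subseteq> {t \<in> {0..pi}. m t = 0}" using below b by auto
    ultimately show ?thesis using closure_minimal by blast
  qed (use m(3) in simp)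
  have "b = pi"
  proof (rule ccontr)
    assume "b \<noteq> pi"
    then have bpi: "b < pi" using b by simp
    have kc: "continuous_on {0..pi} (\<lambda>x. integral {0..x} k)"
      by (rule indefinite_integral_continuous_1[OF k(1)])
    have "\<exists>d>0. \<forall>y\<in>{0..pi}. dist y b < d \<longrightarrow> dist (integral {0..y} k) (integral {0..b} k) < 1 / 2"
      by (rule kc[unfolded continuous_on_iff, THEN bspec, THEN spec, THEN mp]) (use b in auto)
    then obtain d where d: "d > 0" and dd: "\<And>y. y \<in> {0..pi} \<Longrightarrow> dist y b < d \<Longrightarrow>
        dist (integral {0..y} k) (integral {0..b} k) < 1 / 2" by blast
    define c where "c = min pi (b + d / 2)"
    have c: "b < c" "c \<le> pi" "c - b < d" using bpi d by (auto simp: c_def)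
    have sub: "{b..c} \<subseteq> {0..pi}" using b c by auto
    obtain z where z: "z \<in> {b..c}" and zmax: "\<And>t. t \<in> {b..c} \<Longrightarrow> m t \<le> m z"
      using continuous_attains_sup[of "{b..c}" m] continuous_on_subset[OF m(1) sub] c by auto
    have "m z \<le> m z * integral {b..z} k"
      using z b c mb by (intro bound zmax) auto
    also have "\<dots> \<le> m z * (1 / 2)"
    proof (rule mult_left_mono)
      have "integral {0..z} k - integral {0..b} k = integral {b..z} k"
        using z b c by (intro integral_diff_eq_integral[OF k(1)]) auto
      moreover have "dist (integral {0..z} k) (integral {0..b} k) < 1 / 2"
        using z b c by (intro dd) (auto simp: dist_real_def)
      ultimately show "integral {b..z} k \<le> 1 / 2" by (simp add: dist_real_def)
      show "0 \<le> m z" using z sub by (intro m(2)) auto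
    qed
    finally have "m z \<le> 0" by simp
    then have "m t = 0" if "t \<in> {b..c}" for t
      using zmax[OF that] m(2)[of t] that sub by force
    then have "\<forall>t\<in>{0..c}. m t = 0" using below by (metis atLeastAtMost_iff not_le)
    then have "c \<in> Z" using c b by (auto simp: Z_def)
    then have "c \<le> b" unfolding b_def by (rule cSup_upper[OF _ bdd])
    then show False using c by simp
  qed
  then show ?thesis using below mb x by (cases "x = pi") auto
qed

section \<open>Uniqueness for the initial value problem and simplicity of eigenvalues\<close>

context bvp
begin

lemma square_s_integrable: "integrable I0pi (\<lambda>x. (s x)\<^sup>2)" "integrable I0pi (\<lambda>x. \<bar>s x\<bar>)"
proof -
  show "integrable I0pi (\<lambda>x. (s x)\<^sup>2)" using square_integrable_sq[OF s] by simp
  have "integrable I0pi (\<lambda>x. norm (s x) * norm (1::real))"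
    by (rule square_integrable_prod_norm[OF s]) (simp add: square_integrable_def finite_measure.integrable_const[OF finite_measure_I0pi])
  then show "integrable I0pi (\<lambda>x. \<bar>s x\<bar>)" by simp
qed

text \<open>The pair \<open>(y, q)\<close> solves a linear first-order system whose coefficients are
  integrable but possibly unbounded, so uniqueness rests on an integral estimate rather than on a
  Lipschitz condition.\<close>

lemma solution_zero:
  assumes sol: "is_solution s z y q" and y0: "y 0 = 0" and q0: "q 0 = 0" and x: "x \<in> {0..pi}"
  shows "y x = 0" "q x = 0"
proof -
  have yac: "abs_continuous_on 0 pi y" and qac: "abs_continuous_on 0 pi q"
    using sol by (auto simp: is_solution_def is_quasi_derivative_def)
  have yc: "continuous_on {0..pi} y" and qc: "continuous_on {0..pi} q"
    by (intro abs_continuous_on_imp_continuous_on yac qac)+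
  define p where "p x = q x + S x * y x" for x
  define r where "r x = - (S x * q x + of_real ((s x)\<^sup>2) * y x + z * y x)" for x
  have dy: "AE x in I0pi. (y has_vector_derivative p x) (at x)"
  proof -
    have "AE x in I0pi. \<exists>y'. (y has_vector_derivative y') (at x) \<and> q x = y' - of_real (s x) * y x"
      using sol by (simp add: is_solution_def is_quasi_derivative_def)
    then show ?thesis by eventually_elim (auto simp: p_def S_def)
  qed
  have dq: "AE x in I0pi. (q has_vector_derivative r x) (at x)"
  proof -
    have "AE x in I0pi. \<exists>q'. (q has_vector_derivative q') (at x) \<and>
        - q' - of_real (s x) * q x - of_real ((s x)\<^sup>2) * y x = z * y x"
      using sol by (simp add: is_solution_def)
    then show ?thesis
    proof eventually_elim
      case (elim x)
      then obtain q' where q': "(q has_vector_derivative q') (at x)"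
        "- q' - of_real (s x) * q x - of_real ((s x)\<^sup>2) * y x = z * y x" by blast
      have "q' = - (- q' - of_real (s x) * q x - of_real ((s x)\<^sup>2) * y x)
          - of_real (s x) * q x - of_real ((s x)\<^sup>2) * y x" by simp
      then have "q' = - (z * y x) - of_real (s x) * q x - of_real ((s x)\<^sup>2) * y x"
        unfolding q'(2) .
      then have "q' = r x" by (simp add: r_def S_def)
      then show ?case using q'(1) by simp
    qed
  qed
  have SI: "S absolutely_integrable_on {0..pi}" by (rule L2_absolutely_integrable[OF S_L2])
  have S2I: "(\<lambda>x. complex_of_real ((s x)\<^sup>2)) absolutely_integrable_on {0..pi}"
    using square_s_integrable(1) unfolding I0pi_integrable_iff[symmetric] by (rule integrable_of_real)
  have pI: "integrable I0pi p"
    unfolding p_def[abs_def]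
    by (intro Bochner_Integration.integrable_add bounded_mult_integrable SI yc L2_integrable continuous_L2 qc)
  have rI: "integrable I0pi r"
    unfolding r_def[abs_def]
    by (intro integrable_minus Bochner_Integration.integrable_add bounded_mult_integrable SI S2I yc qc
        integrable_mult_right L2_integrable continuous_L2)
  have pA: "p absolutely_integrable_on {0..pi}" and rA: "r absolutely_integrable_on {0..pi}"
    using pI rI by (simp_all add: I0pi_integrable_iff)
  define m where "m x = norm (y x) + norm (q x)" for x
  \<comment> \<open>Sum of the moduli of all coefficients in \<open>y' = q + s y\<close> and
    \<open>q' = - s q - s\<^sup>2 y - z y\<close>.\<close>
  define k where "k x = 1 + 2 * \<bar>s x\<bar> + (s x)\<^sup>2 + norm z" for x
  have "integrable I0pi k"
    unfolding k_def[abs_def]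
    by (intro Bochner_Integration.integrable_add integrable_mult_right square_s_integrable
        finite_measure.integrable_const finite_measure_I0pi)
  then have kI: "k integrable_on {0..pi}"
    using set_lebesgue_integral_eq_integral(1) by (auto simp: I0pi_integrable_iff)
  have pr: "norm (p x) + norm (r x) \<le> k x * m x" for x
  proof -
    have "norm (p x) \<le> norm (q x) + \<bar>s x\<bar> * norm (y x)"
      unfolding p_def S_def by (intro order_trans[OF norm_triangle_ineq]) (simp add: norm_mult)
    moreover have "norm (r x) \<le> \<bar>s x\<bar> * norm (q x) + (s x)\<^sup>2 * norm (y x) + norm z * norm (y x)"
      unfolding r_def S_def norm_minus_cancel
      by (intro order_trans[OF norm_triangle_ineq] add_mono order_trans[OF norm_triangle_ineq])
        (simp_all add: norm_mult norm_power)
    moreover have "k x * m x = norm (q x) + \<bar>s x\<bar> * norm (y x) + (\<bar>s x\<bar> * norm (q x) + (s x)\<^sup>2 * norm (y x) + norm z * norm (y x))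
        + (norm (y x) + \<bar>s x\<bar> * norm (y x) + \<bar>s x\<bar> * norm (q x) + (s x)\<^sup>2 * norm (q x) + norm z * norm (q x))"
      by (simp add: k_def m_def algebra_simps)
    moreover have "0 \<le> norm (y x) + \<bar>s x\<bar> * norm (y x) + \<bar>s x\<bar> * norm (q x) + (s x)\<^sup>2 * norm (q x) + norm z * norm (q x)"
      by (intro add_nonneg_nonneg mult_nonneg_nonneg) auto
    ultimately show ?thesis by linarith
  qed
  have "m x = 0"
  proof (rule gronwall_zero[OF _ _ _ kI _ _ x])
    show "continuous_on {0..pi} m" unfolding m_def[abs_def] by (intro continuous_intros yc qc)
    show "0 \<le> m x" for x by (simp add: m_def)
    show "m 0 = 0" by (simp add: m_def y0 q0)
    show "0 \<le> k x" for x by (simp add: k_def)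
    fix a x M assume ax: "0 \<le> a" "a \<le> x" "x \<le> pi" and ma: "m a = 0" and M: "\<And>t. t \<in> {a..x} \<Longrightarrow> m t \<le> M"
    have ya: "y a = 0" "q a = 0" using ma by (auto simp: m_def add_nonneg_eq_0_iff)
    have sub: "{a..x} \<subseteq> {0..pi}" using ax by auto
    have int: "h integrable_on {a..x}" "(\<lambda>t. norm (h t)) integrable_on {a..x}"
      if "h absolutely_integrable_on {0..pi}" for h :: "real \<Rightarrow> complex"
      using absolutely_integrable_on_subinterval[OF that sub] by (auto simp: absolutely_integrable_on_def)
    have "y x = integral {a..x} p"
      using abs_continuous_eq_prim[OF yac dy, of x] abs_continuous_eq_prim[OF yac dy, of a] prim_diff[OF pA ax] ya ax
      by (simp add: y0)
    moreover have "q x = integral {a..x} r"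
      using abs_continuous_eq_prim[OF qac dq, of x] abs_continuous_eq_prim[OF qac dq, of a] prim_diff[OF rA ax] ya ax
      by (simp add: q0)
    ultimately have "m x \<le> integral {a..x} (\<lambda>t. norm (p t)) + integral {a..x} (\<lambda>t. norm (r t))"
      unfolding m_def by (intro add_mono) (simp_all add: integral_norm_bound_integral int pA rA)
    also have "\<dots> = integral {a..x} (\<lambda>t. norm (p t) + norm (r t))"
      by (intro Henstock_Kurzweil_Integration.integral_add[symmetric] int pA rA)
    also have "\<dots> \<le> integral {a..x} (\<lambda>t. M * k t)"
    proof (rule integral_le)
      show "(\<lambda>t. norm (p t) + norm (r t)) integrable_on {a..x}" by (intro integrable_add int pA rA)
      show "(\<lambda>t. M * k t) integrable_on {a..x}"
        using integrable_cmul[OF integrable_subinterval_real[OF kI sub], of M] by simp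
      fix t assume t: "t \<in> {a..x}"
      have "k t * m t \<le> k t * M" by (intro mult_left_mono M t) (simp add: k_def)
      then show "norm (p t) + norm (r t) \<le> M * k t" using pr[of t] by (simp add: mult.commute)
    qed
    finally show "m x \<le> M * integral {a..x} k" by simp
  qed
  then show "y x = 0" "q x = 0" by (auto simp: m_def add_nonneg_eq_0_iff)
qed

lemma sum_idx: "(\<Sum>i\<in>idx. g i) = (\<Sum>k=1..npoles f. g (LP k)) + g LS + (\<Sum>k=1..npoles F. g (RP k)) + (g RS :: complex)"
proof -
  have "(\<Sum>i\<in>idx. g i) = (\<Sum>i\<in>LP ` {1..npoles f}. g i) + (\<Sum>i\<in>{LS}. g i) + (\<Sum>i\<in>RP ` {1..npoles F}. g i) + (\<Sum>i\<in>{RS}. g i)"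
    unfolding idx_def by (subst sum.union_disjoint; (auto; fail)?)+
  also have "(\<Sum>i\<in>LP ` {1..npoles f}. g i) = (\<Sum>k=1..npoles f. g (LP k))"
    by (subst sum.reindex) (auto simp: inj_on_def o_def)
  also have "(\<Sum>i\<in>RP ` {1..npoles F}. g i) = (\<Sum>k=1..npoles F. g (RP k))"
    by (subst sum.reindex) (auto simp: inj_on_def o_def)
  finally show ?thesis by simp
qed

text \<open>The right condition has the opposite sign; replacing the value at \<open>pi\<close> by
  its negative brings it to the form of the left one, so \<open>bc_coords\<close> serves both
  endpoints.\<close>

lemma brel_iff: "brel \<nu> e q0 q1 \<longleftrightarrow>
  bc_coords f \<nu> (\<lambda>k. e (LP k)) (e LS) q0 \<and> bc_coords F \<nu> (\<lambda>k. e (RP k)) (- e RS) q1"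
proof -
  have pole_eq: "of_real (h / r) * a + b = of_real \<nu> * of_real (inverse r) * a \<longleftrightarrow> of_real (\<nu> - h) * a = of_real r * b"
    if "r > 0" for h r :: real and a b :: complex
  proof -
    have r: "complex_of_real r \<noteq> 0" using that by simp
    have "of_real (h / r) * a + b = of_real \<nu> * of_real (inverse r) * a \<longleftrightarrow>
      of_real r * (of_real (h / r) * a + b) = of_real r * (of_real \<nu> * of_real (inverse r) * a)"
      using r by simp
    also have "of_real r * (of_real (h / r) * a + b) = of_real h * a + of_real r * b"
      using r by (simp add: distrib_left)
    also have "of_real r * (of_real \<nu> * of_real (inverse r) * a) = of_real \<nu> * a"
      using r by (simp add: field_simps)
    finally show ?thesis by (auto simp: algebra_simps)
  qed
  have LPsum: "(\<Sum>i\<in>idx. of_real (mm i (LP k)) * e i) = of_real (pole f k / res f k) * e (LP k) + e LS"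
    if k: "k \<in> {1..npoles f}" for k
  proof -
    have "(\<Sum>l=1..npoles f. of_real (mm (LP l) (LP k)) * e (LP l)) =
        (\<Sum>l=1..npoles f. if l = k then of_real (pole f k / res f k) * e (LP k) else 0)"
      by (intro sum.cong) auto
    then show ?thesis using k by (simp add: sum_idx)
  qed
  have RPsum: "(\<Sum>i\<in>idx. of_real (mm i (RP k)) * e i) = of_real (pole F k / res F k) * e (RP k) + - e RS"
    if k: "k \<in> {1..npoles F}" for k
  proof -
    have "(\<Sum>l=1..npoles F. of_real (mm (RP l) (RP k)) * e (RP l)) =
        (\<Sum>l=1..npoles F. if l = k then of_real (pole F k / res F k) * e (RP k) else 0)"
      by (intro sum.cong) auto
    then show ?thesis using k by (simp add: sum_idx)
  qed
  have LSsum: "(\<Sum>i\<in>idx. of_real (mm i LS) * e i) = (\<Sum>k=1..npoles f. e (LP k)) - of_real (const_term f) * e LS"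
    by (simp add: sum_idx)
  have RSsum: "(\<Sum>i\<in>idx. of_real (mm i RS) * e i) = - (\<Sum>k=1..npoles F. e (RP k)) - of_real (const_term F) * e RS"
    by (simp add: sum_idx sum_negf)
  have idx_all: "(\<forall>j\<in>idx. P j) \<longleftrightarrow> (\<forall>k\<in>{1..npoles f}. P (LP k)) \<and> P LS \<and> (\<forall>k\<in>{1..npoles F}. P (RP k)) \<and> P RS" for P
    by (auto simp: idx_def)
  have L: "(\<Sum>i\<in>idx. of_real (mm i (LP k)) * e i) = of_real \<nu> * of_real (wt (LP k)) * e (LP k) \<longleftrightarrow>
      of_real (\<nu> - pole f k) * e (LP k) = of_real (res f k) * e LS" if "k \<in> {1..npoles f}" for k
    unfolding LPsum[OF that] bweight.simps by (rule pole_eq[OF res_pos(1)[OF that]])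
  have R: "(\<Sum>i\<in>idx. of_real (mm i (RP k)) * e i) = of_real \<nu> * of_real (wt (RP k)) * e (RP k) \<longleftrightarrow>
      of_real (\<nu> - pole F k) * e (RP k) = of_real (res F k) * - e RS" if "k \<in> {1..npoles F}" for k
    unfolding RPsum[OF that] bweight.simps by (rule pole_eq[OF res_pos(2)[OF that]])
  have RS': "(- a - b = c - q1) \<longleftrightarrow> (a + b = q1 - c)" for a b c :: complex
  proof -
    have "- a - b = - (a + b)" "c - q1 = - (q1 - c)" by simp_all
    then show ?thesis by (simp only: neg_equal_iff_equal)
  qed
  show ?thesis
    unfolding brel_def idx_all bc_coords_def
    using L R by (simp add: LSsum RSsum RS' conj_ac)
qed

lemma ipH_zero_of_btrace:
  assumes v: "v \<in> PX" and t: "\<And>x. x \<in> {0..pi} \<Longrightarrow> traj v x = 0" and e: "\<And>i. i \<in> idx \<Longrightarrow> btrace v i = 0"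
  shows "H.nrm (hembed v) = 0"
proof -
  have "AE x in I0pi. traj v x = 0" by (rule AE_I2) (simp add: t)
  then have "L2_norm (traj v) = 0" using L2_norm_eq_0_iff[OF traj_L2[OF v]] by simp
  then have "(H.nrm (hembed v))\<^sup>2 = 0"
    unfolding nrmH_sq[OF hembed_mem[OF v]] using e by (simp add: hembed_def idxH_def)
  then show ?thesis by simp
qed

lemma weak_lincomb: "weak \<nu> u \<Longrightarrow> weak \<nu> v \<Longrightarrow> weak \<nu> (pair_scale a u + pair_scale b v)"
  unfolding weak_def
  by (auto simp: V.add_mem V.scale_mem B.ip_add_left B.ip_scale_left hembed_add hembed_scale
      H.ip_add_left H.ip_scale_left H.scale_mem hembed_mem algebra_simps)

text \<open>The quasi-derivative is not part of a weak eigenvector. Its vanishing at the left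
  endpoint is expressed by the last argument of \<open>bc_coords\<close>, after which uniqueness for
  the initial value problem applies.\<close>

lemma weak_zero:
  assumes w: "weak \<nu> v" and c: "bc_coords f \<nu> (\<lambda>k. btrace v (LP k)) (btrace v LS) 0" and e: "btrace v LS = 0"
  shows "H.nrm (hembed v) = 0"
proof -
  obtain q where sol: "is_solution s (of_real \<nu>) (traj v) q" and rel: "brel \<nu> (btrace v) (q 0) (q pi)"
    by (rule weak_imp_strong[OF w])
  have q0: "q 0 = 0" using rel c by (simp add: brel_iff bc_coords_def)
  have t: "traj v x = 0" "q x = 0" if "x \<in> {0..pi}" for x
    using solution_zero[OF sol _ q0 that] e by (simp_all add: btrace_LS)
  show ?thesis
  proof (rule ipH_zero_of_btrace)
    show "v \<in> PX" using w by (simp add: weak_def)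
    show "traj v x = 0" if "x \<in> {0..pi}" for x by (rule t(1)[OF that])
    have eRS: "btrace v RS = 0" using t(1)[of pi] by (simp add: btrace_RS)
    have "bc_coords F \<nu> (\<lambda>k. btrace v (RP k)) 0 0" using rel t(2)[of pi] eRS by (simp add: brel_iff)
    then have R: "btrace v (RP k) = 0" if "k \<in> {1..npoles F}" for k by (rule bc_coords_zero[OF F _ that])
    have "bc_coords f \<nu> (\<lambda>k. btrace v (LP k)) 0 0" using c e by simp
    then have L: "btrace v (LP k) = 0" if "k \<in> {1..npoles f}" for k by (rule bc_coords_zero[OF f _ that])
    show "btrace v i = 0" if "i \<in> idx" for i using that L R e eRS by (cases i) auto
  qed
qed

text \<open>The left boundary condition confines the initial data of both eigenvectors to one line,
  so a nontrivial combination has zero initial data and is null by \<open>weak_zero\<close>.\<close>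

lemma weak_simple:
  assumes u: "weak \<nu> u" and v: "weak \<nu> v"
  obtains a b where "a \<noteq> 0 \<or> b \<noteq> 0" "H.nrm (pair_scale a (hembed u) + pair_scale b (hembed v)) = 0"
proof -
  have uX: "u \<in> PX" and vX: "v \<in> PX" using u v by (auto simp: weak_def)
  obtain q where "brel \<nu> (btrace u) (q 0) (q pi)" by (rule weak_imp_strong[OF u])
  then have cu: "bc_coords f \<nu> (\<lambda>k. btrace u (LP k)) (btrace u LS) (q 0)" by (simp add: brel_iff)
  obtain q' where "brel \<nu> (btrace v) (q' 0) (q' pi)" by (rule weak_imp_strong[OF v])
  then have cv: "bc_coords f \<nu> (\<lambda>k. btrace v (LP k)) (btrace v LS) (q' 0)" by (simp add: brel_iff)
  obtain a b where ab: "a \<noteq> 0 \<or> b \<noteq> 0" "a * btrace u LS + b * btrace v LS = 0" "a * q 0 + b * q' 0 = 0"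
    by (rule bc_coords_line[OF f cu cv])
  let ?w = "pair_scale a u + pair_scale b v"
  have tw: "btrace ?w i = a * btrace u i + b * btrace v i" for i
    using uX vX by (simp add: btrace_add btrace_scale V.scale_mem)
  have "bc_coords f \<nu> (\<lambda>k. btrace ?w (LP k)) (btrace ?w LS) (a * q 0 + b * q' 0)"
    unfolding bc_coords_def
  proof (intro conjI ballI)
    fix k assume k: "k \<in> {1..npoles f}"
    have "of_real (\<nu> - pole f k) * btrace ?w (LP k) =
        a * (of_real (\<nu> - pole f k) * btrace u (LP k)) + b * (of_real (\<nu> - pole f k) * btrace v (LP k))"
      unfolding tw by (simp add: distrib_left mult.left_commute)
    also have "\<dots> = a * (of_real (res f k) * btrace u LS) + b * (of_real (res f k) * btrace v LS)"
      using cu cv k by (simp only: bc_coords_def)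
    also have "\<dots> = of_real (res f k) * btrace ?w LS"
      unfolding tw by (simp add: distrib_left mult.left_commute)
    finally show "of_real (\<nu> - pole f k) * btrace ?w (LP k) = of_real (res f k) * btrace ?w LS" .
  next
    have "(\<Sum>k=1..npoles f. btrace ?w (LP k)) - of_real (const_term f) * btrace ?w LS =
        a * ((\<Sum>k=1..npoles f. btrace u (LP k)) - of_real (const_term f) * btrace u LS) +
        b * ((\<Sum>k=1..npoles f. btrace v (LP k)) - of_real (const_term f) * btrace v LS)"
      unfolding tw sum.distrib sum_distrib_left[symmetric] by (simp add: algebra_simps)
    also have "\<dots> = a * (of_real \<nu> * of_real (slope f) * btrace u LS + q 0) +
        b * (of_real \<nu> * of_real (slope f) * btrace v LS + q' 0)"
      using cu cv by (simp only: bc_coords_def)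
    also have "\<dots> = of_real \<nu> * of_real (slope f) * btrace ?w LS + (a * q 0 + b * q' 0)"
      unfolding tw by (simp add: algebra_simps)
    finally show "(\<Sum>k=1..npoles f. btrace ?w (LP k)) - of_real (const_term f) * btrace ?w LS =
        of_real \<nu> * of_real (slope f) * btrace ?w LS + (a * q 0 + b * q' 0)" .
  qed
  then have "bc_coords f \<nu> (\<lambda>k. btrace ?w (LP k)) (btrace ?w LS) 0" using ab(3) by simp
  moreover have "btrace ?w LS = 0" using ab(2) by (simp add: tw)
  ultimately have "H.nrm (hembed ?w) = 0" using weak_lincomb[OF u v] weak_zero by blast
  then have "H.nrm (pair_scale a (hembed u) + pair_scale b (hembed v)) = 0"
    using uX vX by (simp add: hembed_add hembed_scale V.scale_mem)
  with ab(1) show thesis by (rule that)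
qed

text \<open>An eigenfunction must be nonzero as a function, whereas the assumed norm could sit in
  the boundary coordinates alone. If \<open>traj v\<close> vanished, so would its quasi-derivative,
  and \<open>weak_zero\<close> would annihilate these coordinates too.\<close>

lemma weak_imp_eigenvalue:
  assumes w: "weak \<nu> v" and n: "H.nrm (hembed v) \<noteq> 0"
  shows "of_real \<nu> \<in> eigenvalues s f F"
proof -
  obtain q where sol: "is_solution s (of_real \<nu>) (traj v) q" and rel: "brel \<nu> (btrace v) (q 0) (q pi)"
    by (rule weak_imp_strong[OF w])
  have c: "bc_coords f \<nu> (\<lambda>k. btrace v (LP k)) (traj v 0) (q 0)" "bc_coords F \<nu> (\<lambda>k. btrace v (RP k)) (- traj v pi) (q pi)"
    using rel by (simp_all add: brel_iff btrace_LS btrace_RS)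
  have "\<exists>x\<in>{0..pi}. traj v x \<noteq> 0"
  proof (rule ccontr)
    assume "\<not> (\<exists>x\<in>{0..pi}. traj v x \<noteq> 0)"
    then have z: "traj v x = 0" if "x \<in> {0..pi}" for x using that by blast
    have qac: "abs_continuous_on 0 pi q" using sol by (simp add: is_solution_def is_quasi_derivative_def)
    have "AE x in I0pi. \<exists>y'. (traj v has_vector_derivative y') (at x) \<and> q x = y' - of_real (s x) * traj v x"
      using sol by (simp add: is_solution_def is_quasi_derivative_def)
    then have "AE x in I0pi. q x = 0"
      using AE_space[of I0pi]
    proof eventually_elim
      case (elim x)
      then obtain y' where y': "(traj v has_vector_derivative y') (at x)" "q x = y' - of_real (s x) * traj v x" by blast
      have x: "x \<in> {0<..<pi}" using elim(2) by simp
      have "(traj v has_vector_derivative 0) (at x)"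
      proof (rule has_vector_derivative_transform_within_open[of "\<lambda>_. 0" _ _ "{0<..<pi}"])
        show "((\<lambda>_. 0) has_vector_derivative 0) (at x)" by (rule has_vector_derivative_const)
      qed (use x z in auto)
      then have "y' = 0" using y'(1) vector_derivative_unique_at by blast
      then show ?case using y'(2) z[of x] x by simp
    qed
    then have "q x = 0" if "x \<in> {0..pi}" for x
      using continuous_AE_const[OF abs_continuous_on_imp_continuous_on[OF qac]] that by blast
    then have "q 0 = 0" by simp
    then have "bc_coords f \<nu> (\<lambda>k. btrace v (LP k)) (btrace v LS) 0" "btrace v LS = 0"
      using c(1) z[of 0] by (simp_all add: btrace_LS)
    then show False using weak_zero[OF w] n by blast
  qed
  moreover have "poly (bc_den f) (of_real \<nu>) * q 0 + poly (bc_num f) (of_real \<nu>) * traj v 0 = 0"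
    by (rule bc_coordsD[OF f c(1)])
  moreover have "poly (bc_den F) (of_real \<nu>) * q pi - poly (bc_num F) (of_real \<nu>) * traj v pi = 0"
    using bc_coordsD[OF F c(2)] by simp
  ultimately have "is_eigenfunction s f F (of_real \<nu>) (traj v) q"
    using sol by (simp add: is_eigenfunction_def)
  then show ?thesis unfolding eigenvalues_def by blast
qed

text \<open>Unlike in \<open>boundary_vec\<close>, the endpoint entries carry no slope factor and
  are present even when the slope is zero.\<close>

definition eigen_coords :: "real \<Rightarrow> (real \<Rightarrow> complex) \<Rightarrow> (real \<Rightarrow> complex) \<Rightarrow> bidx \<Rightarrow> complex" where
  "eigen_coords \<nu> y q i = (case i of
      LP k \<Rightarrow> if \<nu> = pole f k then q 0 else of_real (res f k) * y 0 / of_real (\<nu> - pole f k)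
    | LS \<Rightarrow> y 0
    | RP k \<Rightarrow> if \<nu> = pole F k then q pi else of_real (res F k) * y pi / of_real (pole F k - \<nu>)
    | RS \<Rightarrow> y pi)"

lemma eigenfunction_weak:
  assumes ev: "is_eigenfunction s f F (of_real \<nu>) y q"
  obtains v where "weak \<nu> v" "\<And>x. x \<in> {0..pi} \<Longrightarrow> traj v x = y x" "btrace v = eigen_coords \<nu> y q"
proof -
  have sol: "is_solution s (of_real \<nu>) y q"
    and bc: "poly (bc_den f) (of_real \<nu>) * q 0 + poly (bc_num f) (of_real \<nu>) * y 0 = 0"
      "poly (bc_den F) (of_real \<nu>) * q pi + poly (bc_num F) (of_real \<nu>) * (- y pi) = 0"
    using ev by (simp_all add: is_eigenfunction_def)
  have yac: "abs_continuous_on 0 pi y" and qac: "abs_continuous_on 0 pi q"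
    using sol by (auto simp: is_solution_def is_quasi_derivative_def)
  have yc: "continuous_on {0..pi} y" and qc: "continuous_on {0..pi} q"
    by (intro abs_continuous_on_imp_continuous_on yac qac)+
  \<comment> \<open>The derivative of \<open>y\<close>, solved for in the definition of the
    quasi-derivative. It is square-integrable because \<open>y\<close> and \<open>q\<close> are
    continuous.\<close>
  define p where "p x = q x + S x * y x" for x
  obtain K where K: "\<And>x. x \<in> {0..pi} \<Longrightarrow> norm (y x) \<le> K"
    using compact_imp_bounded[OF compact_continuous_image[OF yc compact_Icc]]
    by (meson bounded_iff imageI)
  have pL2: "p \<in> L2"
    unfolding p_def[abs_def]
    by (intro L2_add continuous_L2 qc L2_mult_bounded(1)[OF S_L2 continuous_measurable_I0pi[OF yc] K])
  have dy: "AE x in I0pi. (y has_vector_derivative p x) (at x)"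
  proof -
    have "AE x in I0pi. \<exists>y'. (y has_vector_derivative y') (at x) \<and> q x = y' - of_real (s x) * y x"
      using sol by (simp add: is_solution_def is_quasi_derivative_def)
    then show ?thesis by eventually_elim (auto simp: p_def S_def)
  qed
  let ?v = "(p, eigen_coords \<nu> y q)"
  have tv: "traj ?v x = y x" if "x \<in> {0..pi}" for x
    using abs_continuous_eq_prim[OF yac dy that] by (simp add: traj_def eigen_coords_def)
  have bt: "btrace ?v = eigen_coords \<nu> y q"
    using tv[of pi] by (auto simp: btrace_def fun_eq_iff eigen_coords_def)
  have "bc_coords f \<nu> (\<lambda>k. eigen_coords \<nu> y q (LP k)) (eigen_coords \<nu> y q LS) (q 0)"
    using bc_coordsI[OF f bc(1)] by (simp add: eigen_coords_def)
  moreover have "bc_coords F \<nu> (\<lambda>k. eigen_coords \<nu> y q (RP k)) (- eigen_coords \<nu> y q RS) (q pi)"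
  proof -
    have eq: "of_real (res F k) * - y pi / of_real (\<nu> - pole F k) = of_real (res F k) * y pi / complex_of_real (pole F k - \<nu>)" for k
    proof -
      have "complex_of_real (\<nu> - pole F k) = - of_real (pole F k - \<nu>)" by simp
      then show ?thesis by (simp only: minus_divide_divide mult_minus_right)
    qed
    show ?thesis using bc_coordsI[OF F bc(2)] unfolding eq by (simp add: eigen_coords_def)
  qed
  ultimately have rel: "brel \<nu> (btrace ?v) (q 0) (q pi)" unfolding bt brel_iff by blast
  have "weak \<nu> ?v"
    by (rule strong_imp_weak[OF sol pL2 _ _ tv rel]) (simp_all add: p_def eigen_coords_def)
  then show thesis using tv bt by (rule that)
qed

end

section \<open>Riesz bases\<close>

context hermitian_form
begin

definition combs :: "(nat \<Rightarrow> 'v) \<Rightarrow> nat set \<Rightarrow> 'v set" where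
  "combs x J = range (\<lambda>c. \<Sum>j\<in>J. c j *s x j)"

lemma combsI: "(\<Sum>j\<in>J. c j *s x j) \<in> combs x J"
  by (simp add: combs_def)

lemma combsE: "u \<in> combs x J \<Longrightarrow> (\<And>c. u = (\<Sum>j\<in>J. c j *s x j) \<Longrightarrow> P) \<Longrightarrow> P"
  unfolding combs_def by (erule rangeE)

lemma combs_scale: "u \<in> combs x J \<Longrightarrow> a *s u \<in> combs x J"
proof -
  assume "u \<in> combs x J"
  then obtain c where "u = (\<Sum>j\<in>J. c j *s x j)" by (auto simp: combs_def)
  then have "a *s u = (\<Sum>j\<in>J. (a * c j) *s x j)" by (simp add: scale_sum_right)
  then show ?thesis by (simp add: combsI)
qed

lemma combs_add: "u \<in> combs x J \<Longrightarrow> v \<in> combs x J \<Longrightarrow> u + v \<in> combs x J"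
proof -
  assume "u \<in> combs x J" "v \<in> combs x J"
  then obtain c d where "u = (\<Sum>j\<in>J. c j *s x j)" "v = (\<Sum>j\<in>J. d j *s x j)" by (auto simp: combs_def)
  then have "u + v = (\<Sum>j\<in>J. (c j + d j) *s x j)" by (simp add: scale_left_distrib sum.distrib)
  then show ?thesis by (simp add: combsI)
qed

lemma combs_zero: "0 \<in> combs x J"
  using combsI[of "\<lambda>_. 0" x J] by simp

lemma combs_sum: "(\<And>i. i \<in> I \<Longrightarrow> u i \<in> combs x J) \<Longrightarrow> (\<Sum>i\<in>I. u i) \<in> combs x J"
  by (induction I rule: infinite_finite_induct) (auto intro: combs_zero combs_add)

lemma combs_mono: "u \<in> combs x J \<Longrightarrow> J \<subseteq> K \<Longrightarrow> finite K \<Longrightarrow> u \<in> combs x K"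
proof -
  assume u: "u \<in> combs x J" and JK: "J \<subseteq> K" "finite K"
  from u obtain c where c: "u = (\<Sum>j\<in>J. c j *s x j)" by (auto simp: combs_def)
  also have "\<dots> = (\<Sum>j\<in>K. (if j \<in> J then c j else 0) *s x j)"
    using JK by (intro sum.mono_neutral_cong_left) auto
  finally show ?thesis by (simp add: combsI)
qed

lemma combs_generator: "j \<in> J \<Longrightarrow> finite J \<Longrightarrow> x j \<in> combs x J"
  using combs_mono[OF combsI[of "\<lambda>_. 1" x "{j}"], of J] by simp

end

section \<open>Gram-Schmidt orthonormalization\<close>

context semi_inner
begin

function gram_schmidt :: "(nat \<Rightarrow> 'a) \<Rightarrow> nat set \<Rightarrow> nat \<Rightarrow> 'a" where
  "gram_schmidt x A n =
    (let r = x n - (\<Sum>j\<in>A \<inter> {..<n}. ip (x n) (gram_schmidt x A j) *s gram_schmidt x A j)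
     in inverse (of_real (nrm r)) *s r)"
  by pat_completeness auto
termination by (relation "Wellfounded.measure (\<lambda>(x, A, n). n)") auto

declare gram_schmidt.simps [simp del]

text \<open>Independence is required up to vectors of norm zero, so that every residual has positive
  norm and can be normalized. The two triangular relations between the families transfer totality to
  \<open>e\<close> and let finite expansions in \<open>e\<close> be rewritten in
  \<open>x\<close>.\<close>

lemma gram_schmidt_properties:
  assumes x: "\<And>n. n \<in> A \<Longrightarrow> x n \<in> X"
    and indep: "\<And>J c. finite J \<Longrightarrow> J \<subseteq> A \<Longrightarrow> nrm (\<Sum>j\<in>J. c j *s x j) = 0 \<Longrightarrow> \<forall>j\<in>J. c j = 0"
  defines "e \<equiv> gram_schmidt x A"
  shows "orthonormal A e" "\<And>n. n \<in> A \<Longrightarrow> e n \<in> combs x (A \<inter> {..n})"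
    "\<And>n. n \<in> A \<Longrightarrow> x n \<in> combs e (A \<inter> {..n})"
proof -
  define r where "r n = x n - (\<Sum>j\<in>A \<inter> {..<n}. ip (x n) (e j) *s e j)" for n
  have e_eq: "e n = inverse (of_real (nrm (r n))) *s r n" for n
    unfolding e_def r_def by (subst gram_schmidt.simps) (simp add: Let_def)
  have main: "orthonormal (A \<inter> {..n}) e \<and> (\<forall>m\<in>A \<inter> {..n}. e m \<in> combs x (A \<inter> {..m}) \<and> nrm (r m) \<noteq> 0)" for n
  proof (induction n rule: less_induct)
    case (less n)
    have on: "orthonormal (A \<inter> {..<n}) e"
      unfolding orthonormal_def
    proof (intro conjI ballI)
      fix i assume i: "i \<in> A \<inter> {..<n}"
      then show "e i \<in> X" using less.IH[of i] by (auto simp: orthonormal_def)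
    next
      fix i j assume ij: "i \<in> A \<inter> {..<n}" "j \<in> A \<inter> {..<n}"
      then have "max i j < n" by auto
      from less.IH[OF this] show "ip (e i) (e j) = (if i = j then 1 else 0)"
        using ij by (simp add: orthonormal_def)
    qed
    have co: "e m \<in> combs x (A \<inter> {..m}) \<and> nrm (r m) \<noteq> 0" if "m \<in> A \<inter> {..<n}" for m
      using less.IH[of m] that by auto
    show ?case
    proof (cases "n \<in> A")
      case False
      then have "A \<inter> {..n} = A \<inter> {..<n}" by (auto simp: le_less)
      then show ?thesis using on co by simp
    next
      case True
      let ?p = "\<Sum>j\<in>A \<inter> {..<n}. ip (x n) (e j) *s e j"
      have eX: "e j \<in> X" if "j \<in> A \<inter> {..<n}" for j using on that by (rule orthonormal_mem)
      have pX: "?p \<in> X" using eX by (intro lincomb_mem) auto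
      have rX: "r n \<in> X" unfolding r_def by (intro diff_mem x True pX)
      have "?p \<in> combs x (A \<inter> {..<n})"
      proof (intro combs_sum combs_scale)
        fix j assume j: "j \<in> A \<inter> {..<n}"
        have "e j \<in> combs x (A \<inter> {..j})" using co[OF j] by simp
        then show "e j \<in> combs x (A \<inter> {..<n})" by (rule combs_mono) (use j in auto)
      qed
      then obtain c where c: "?p = (\<Sum>j\<in>A \<inter> {..<n}. c j *s x j)" by (auto simp: combs_def)
      have ins: "A \<inter> {..n} = insert n (A \<inter> {..<n})" using True by (auto simp: le_less)
      have r_comb: "r n = (\<Sum>j\<in>A \<inter> {..n}. (if j = n then 1 else - c j) *s x j)"
        unfolding ins r_def c by (simp add: sum_negf scale_minus_left)
      have r0: "nrm (r n) \<noteq> 0"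
      proof
        assume "nrm (r n) = 0"
        then have "\<forall>j\<in>A \<inter> {..n}. (if j = n then 1 else - c j) = 0"
          unfolding r_comb by (intro indep) auto
        then show False using True by force
      qed
      have en: "e n \<in> combs x (A \<inter> {..n})"
        unfolding e_eq by (intro combs_scale) (simp add: r_comb combsI)
      have enX: "e n \<in> X" unfolding e_eq by (intro scale_mem rX)
      have rorth: "ip (r n) (e k) = 0" if k: "k \<in> A \<inter> {..<n}" for k
      proof -
        have "ip ?p (e k) = ip (x n) (e k)"
          using k by (subst ip_lincomb_orthonormal[OF on]) auto
        then show ?thesis unfolding r_def using k by (simp add: ip_diff_left x True pX eX)
      qed
      then have eorth: "ip (e n) (e k) = 0" "ip (e k) (e n) = 0" if k: "k \<in> A \<inter> {..<n}" for k
        using k ip_cnj[OF enX eX[OF k]] unfolding e_eq[of n] by (simp_all add: ip_scale_left rX eX)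
      have enn: "ip (e n) (e n) = 1"
      proof -
        have "nrm (e n) = 1" unfolding e_eq using r0 nrm_ge0[OF rX] by (simp add: nrm_scale rX norm_inverse)
        then show ?thesis by (simp add: ip_self enX)
      qed
      have "orthonormal (A \<inter> {..n}) e"
        unfolding orthonormal_def ins using on eorth enn enX by (auto simp: orthonormal_def)
      moreover have "\<forall>m\<in>A \<inter> {..n}. e m \<in> combs x (A \<inter> {..m}) \<and> nrm (r m) \<noteq> 0"
        unfolding ins using co en r0 by auto
      ultimately show ?thesis by blast
    qed
  qed
  show on: "orthonormal A e"
    unfolding orthonormal_def
  proof (intro conjI ballI)
    show "e i \<in> X" if "i \<in> A" for i using main[of i] that by (auto simp: orthonormal_def)
    show "ip (e i) (e j) = (if i = j then 1 else 0)" if "i \<in> A" "j \<in> A" for i j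
    proof -
      have "max i j \<in> A" using that by (simp add: max_def)
      then show ?thesis using main[of "max i j"] that by (simp add: orthonormal_def)
    qed
  qed
  show "e n \<in> combs x (A \<inter> {..n})" if "n \<in> A" for n using main[of n] that by auto
  show "x n \<in> combs e (A \<inter> {..n})" if n: "n \<in> A" for n
  proof -
    have "nrm (r n) \<noteq> 0" using main[of n] n by auto
    then have eq: "of_real (nrm (r n)) *s e n = r n" unfolding e_eq by simp
    have "of_real (nrm (r n)) *s e n \<in> combs e (A \<inter> {..n})"
      using n by (intro combs_scale combs_generator) auto
    then have "r n \<in> combs e (A \<inter> {..n})" unfolding eq .
    moreover have "(\<Sum>j\<in>A \<inter> {..<n}. ip (x n) (e j) *s e j) \<in> combs e (A \<inter> {..n})"
      by (rule combs_mono[OF combsI]) auto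
    ultimately have "r n + (\<Sum>j\<in>A \<inter> {..<n}. ip (x n) (e j) *s e j) \<in> combs e (A \<inter> {..n})" by (rule combs_add)
    then show ?thesis by (simp add: r_def)
  qed
qed

lemma limit_unique:
  assumes "\<And>n::nat. u n \<in> X" "v \<in> X" "w \<in> X"
    and "(\<lambda>n. nrm (u n - v)) \<longlonglongrightarrow> 0" "(\<lambda>n. nrm (u n - w)) \<longlonglongrightarrow> 0"
  shows "nrm (v - w) = 0"
proof -
  have "(\<lambda>n. nrm (u n - v) + nrm (u n - w)) \<longlonglongrightarrow> 0" using tendsto_add[OF assms(4,5)] by simp
  moreover have "nrm (v - w) \<le> nrm (u n - v) + nrm (u n - w)" for n
    using nrm_triangle_via[OF assms(2,1,3), of n] nrm_diff_commute[OF assms(1,2), of n] by simp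
  ultimately have "nrm (v - w) \<le> 0" by (intro LIMSEQ_le_const) auto
  then show ?thesis using nrm_ge0[OF diff_mem[OF assms(2,3)]] by simp
qed

end

context semi_hilbert
begin

text \<open>Bundles an orthonormal total family, an operator mapping it to \<open>\<psi>\<close> and
  the inverse operator. All identities hold up to norm zero and become equalities almost everywhere
  only in \<open>L2\<close>.\<close>

definition riesz_data :: "nat set \<Rightarrow> (nat \<Rightarrow> 'a) \<Rightarrow> real \<Rightarrow> (nat \<Rightarrow> 'a) \<Rightarrow> ('a \<Rightarrow> 'a) \<Rightarrow> ('a \<Rightarrow> 'a) \<Rightarrow> bool" where
  "riesz_data A \<psi> C e T S \<longleftrightarrow>
    orthonormal A e \<and> (\<forall>u\<in>X. (\<forall>n\<in>A. ip u (e n) = 0) \<longrightarrow> nrm u = 0) \<and>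
    (\<forall>g\<in>X. T g \<in> X) \<and> (\<forall>g\<in>X. nrm (T g) \<le> nrm g) \<and>
    (\<forall>g\<in>X. \<forall>k\<in>X. \<forall>a b. nrm (T (a *s g + b *s k) - (a *s T g + b *s T k)) = 0) \<and>
    (\<forall>g\<in>X. S g \<in> X) \<and> (\<forall>g\<in>X. nrm (S g) \<le> C * nrm g) \<and>
    (\<forall>g\<in>X. \<forall>k\<in>X. \<forall>a b. nrm (S (a *s g + b *s k) - (a *s S g + b *s S k)) = 0) \<and>
    (\<forall>g\<in>X. nrm (S (T g) - g) = 0) \<and> (\<forall>g\<in>X. nrm (T (S g) - g) = 0) \<and>
    (\<forall>n\<in>A. nrm (T (e n) - \<psi> n) = 0)"

text \<open>The orthonormal family is the Gram-Schmidt orthonormalization of the sequence. Since its members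
  are finite combinations of members of the sequence, surjectivity of the operator needs no projection
  theorem.\<close>

lemma riesz_basis_operators:
  fixes \<psi> :: "nat \<Rightarrow> 'a"
  assumes \<psi>: "\<And>n. n \<in> A \<Longrightarrow> \<psi> n \<in> X"
    and upper: "\<And>J c. finite J \<Longrightarrow> J \<subseteq> A \<Longrightarrow> (nrm (\<Sum>j\<in>J. c j *s \<psi> j))\<^sup>2 \<le> (\<Sum>j\<in>J. (norm (c j))\<^sup>2)"
    and lower: "\<And>J c. finite J \<Longrightarrow> J \<subseteq> A \<Longrightarrow> (\<Sum>j\<in>J. (norm (c j))\<^sup>2) \<le> C\<^sup>2 * (nrm (\<Sum>j\<in>J. c j *s \<psi> j))\<^sup>2"
    and C: "C \<ge> 0"
    and total: "\<And>u. u \<in> X \<Longrightarrow> (\<And>n. n \<in> A \<Longrightarrow> ip u (\<psi> n) = 0) \<Longrightarrow> nrm u = 0"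
  shows "\<exists>e T S. riesz_data A \<psi> C e T S"
proof -
  define e where "e = gram_schmidt \<psi> A"
  have indep: "\<forall>j\<in>J. c j = 0" if "finite J" "J \<subseteq> A" "nrm (\<Sum>j\<in>J. c j *s \<psi> j) = 0" for J c
  proof -
    have "(\<Sum>j\<in>J. (norm (c j))\<^sup>2) = 0"
      using lower[OF that(1,2), of c] that(3) by (intro antisym sum_nonneg) auto
    then show ?thesis using that(1) by (simp add: sum_nonneg_eq_0_iff)
  qed
  have on: "orthonormal A e"
    unfolding e_def by (rule gram_schmidt_properties(1); (rule \<psi> | rule indep); assumption)
  have e\<psi>: "e n \<in> combs \<psi> (A \<inter> {..n})" if "n \<in> A" for n
    unfolding e_def by (rule gram_schmidt_properties(2)[OF _ _ that]; (rule \<psi> | rule indep); assumption)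
  have \<psi>e: "\<psi> n \<in> combs e (A \<inter> {..n})" if "n \<in> A" for n
    unfolding e_def by (rule gram_schmidt_properties(3)[OF _ _ that]; (rule \<psi> | rule indep); assumption)
  have eX: "e n \<in> X" if "n \<in> A" for n using on that by (rule orthonormal_mem)
  have e_total: "nrm u = 0" if u: "u \<in> X" and z: "\<And>n. n \<in> A \<Longrightarrow> ip u (e n) = 0" for u
  proof (rule total[OF u])
    fix n assume n: "n \<in> A"
    obtain c where "\<psi> n = (\<Sum>j\<in>A \<inter> {..n}. c j *s e j)" using \<psi>e[OF n] by (rule combsE)
    then show "ip u (\<psi> n) = 0" using u z eX by (subst \<open>\<psi> n = _\<close>, subst ip_lincomb_right) auto
  qed
  \<comment> \<open>\<open>t g n\<close> is a partial sum of the expansion of \<open>g\<close> in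
    the orthonormal family, and \<open>p g n\<close> is the same combination of the given sequence.
    The operator \<open>T\<close> is obtained as the limit of \<open>p g n\<close>, and the two
    bounds on combinations compare these sums.\<close>
  define p where "p g n = (\<Sum>j\<in>A \<inter> {..<n}. ip g (e j) *s \<psi> j)" for g and n :: nat
  define t where "t g n = (\<Sum>j\<in>A \<inter> {..<n}. ip g (e j) *s e j)" for g and n :: nat
  have pX: "p g n \<in> X" for g n unfolding p_def using \<psi> by (intro lincomb_mem) auto
  have tX: "t g n \<in> X" for g n unfolding t_def using eX by (intro lincomb_mem) auto
  have "\<exists>v. v \<in> X \<and> (\<lambda>n. nrm (p g n - v)) \<longlonglongrightarrow> 0" if g: "g \<in> X" for g
  proof (rule bessel_series_converges[of A \<psi> "\<lambda>j. ip g (e j)" "(nrm g)\<^sup>2"])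
    show "\<psi> n \<in> X" if "n \<in> A" for n by (rule \<psi>[OF that])
    show "(nrm (\<Sum>j\<in>J. c j *s \<psi> j))\<^sup>2 \<le> (\<Sum>j\<in>J. (norm (c j))\<^sup>2)" if "finite J" "J \<subseteq> A" for J c
      by (rule upper[OF that])
    show "(\<Sum>j\<in>J. (norm (ip g (e j)))\<^sup>2) \<le> (nrm g)\<^sup>2" if "finite J" "J \<subseteq> A" for J
      by (rule bessel[OF on that g])
  qed (auto simp: p_def)
  then obtain T where TX: "\<And>g. g \<in> X \<Longrightarrow> T g \<in> X"
    and T: "\<And>g. g \<in> X \<Longrightarrow> (\<lambda>n. nrm (p g n - T g)) \<longlonglongrightarrow> 0" by metis
  have Tnrm: "(\<lambda>n. nrm (p g n)) \<longlonglongrightarrow> nrm (T g)" if "g \<in> X" for g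
    by (rule nrm_tendsto[OF pX TX[OF that] T[OF that]])
  have tnrm: "(\<lambda>n. nrm (t g n)) \<longlonglongrightarrow> nrm g" if "g \<in> X" for g
    by (rule nrm_tendsto[OF tX that]) (use orthonormal_expansion[OF on e_total that] in \<open>simp add: t_def\<close>)
  have pt: "(nrm (p g n))\<^sup>2 \<le> (nrm (t g n))\<^sup>2" "(nrm (t g n))\<^sup>2 \<le> (C * nrm (p g n))\<^sup>2" for g n
    unfolding p_def t_def using upper[of "A \<inter> {..<n}"] lower[of "A \<inter> {..<n}"]
    by (simp_all add: nrm_lincomb_orthonormal[OF on] power_mult_distrib)
  have T_le: "nrm (T g) \<le> nrm g" if g: "g \<in> X" for g
  proof (rule LIMSEQ_le[OF Tnrm[OF g] tnrm[OF g]], intro exI allI impI)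
    show "nrm (p g n) \<le> nrm (t g n)" for n by (rule power2_le_imp_le[OF pt(1) nrm_ge0[OF tX]])
  qed
  have T_ge: "nrm g \<le> C * nrm (T g)" if g: "g \<in> X" for g
  proof (rule LIMSEQ_le[OF tnrm[OF g] tendsto_mult_left[OF Tnrm[OF g], of C]], intro exI allI impI)
    show "nrm (t g n) \<le> C * nrm (p g n)" for n
      by (rule power2_le_imp_le[OF pt(2)]) (intro mult_nonneg_nonneg C nrm_ge0 pX)
  qed
  have T_lin: "nrm (T (a *s g + b *s k) - (a *s T g + b *s T k)) = 0" if g: "g \<in> X" and k: "k \<in> X" for g k a b
  proof (rule limit_unique[OF pX])
    have gk: "a *s g + b *s k \<in> X" by (intro add_mem scale_mem g k)
    show "T (a *s g + b *s k) \<in> X" "(\<lambda>n. nrm (p (a *s g + b *s k) n - T (a *s g + b *s k))) \<longlonglongrightarrow> 0"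
      by (rule TX[OF gk]) (rule T[OF gk])
    show "a *s T g + b *s T k \<in> X" by (intro add_mem scale_mem TX g k)
    have p_lin: "p (a *s g + b *s k) n = a *s p g n + b *s p k n" for n
      unfolding p_def scale_sum_right sum.distrib[symmetric] using g k eX
      by (intro sum.cong refl) (simp add: ip_add_left ip_scale_left scale_mem scale_left_distrib)
    show "(\<lambda>n. nrm (p (a *s g + b *s k) n - (a *s T g + b *s T k))) \<longlonglongrightarrow> 0"
    proof (rule Lim_null_comparison)
      show "(\<lambda>n. norm a * nrm (p g n - T g) + norm b * nrm (p k n - T k)) \<longlonglongrightarrow> 0"
        using tendsto_add[OF tendsto_mult_left[OF T[OF g], of "norm a"] tendsto_mult_left[OF T[OF k], of "norm b"]]
        by simp
      show "\<forall>\<^sub>F n in sequentially. norm (nrm (p (a *s g + b *s k) n - (a *s T g + b *s T k))) \<le>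
          norm a * nrm (p g n - T g) + norm b * nrm (p k n - T k)"
      proof (intro always_eventually allI)
        fix n
        have "p (a *s g + b *s k) n - (a *s T g + b *s T k) = a *s (p g n - T g) + b *s (p k n - T k)"
          by (simp add: p_lin scale_right_diff_distrib)
        moreover have "nrm (a *s (p g n - T g) + b *s (p k n - T k)) \<le> nrm (a *s (p g n - T g)) + nrm (b *s (p k n - T k))"
          by (intro nrm_triangle scale_mem diff_mem pX TX g k)
        moreover have "0 \<le> nrm (a *s (p g n - T g) + b *s (p k n - T k))"
          by (intro nrm_ge0 add_mem scale_mem diff_mem pX TX g k)
        ultimately show "norm (nrm (p (a *s g + b *s k) n - (a *s T g + b *s T k))) \<le>
            norm a * nrm (p g n - T g) + norm b * nrm (p k n - T k)"
          using g k by (simp add: nrm_scale diff_mem pX TX)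
      qed
    qed
  qed
  have T_diff: "nrm (T (g - k) - (T g - T k)) = 0" if "g \<in> X" "k \<in> X" for g k
    using T_lin[OF that, of 1 "-1"] by (simp add: scale_minus_left)
  have T_comb: "nrm (T (\<Sum>j\<in>J. c j *s e j) - (\<Sum>j\<in>J. c j *s \<psi> j)) = 0" if J: "finite J" "J \<subseteq> A" for J c
  proof -
    let ?u = "\<Sum>j\<in>J. c j *s e j"
    have uX: "?u \<in> X" using J eX by (intro lincomb_mem) auto
    have vX: "(\<Sum>j\<in>J. c j *s \<psi> j) \<in> X" using J \<psi> by (intro lincomb_mem) auto
    obtain N where N: "J \<subseteq> {..<N}" using finite_nat_iff_bounded J(1) by blast
    have "p ?u n = (\<Sum>j\<in>J. c j *s \<psi> j)" if "n \<ge> N" for n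
    proof -
      have "p ?u n = (\<Sum>j\<in>A \<inter> {..<n}. (if j \<in> J then c j else 0) *s \<psi> j)"
        unfolding p_def by (intro sum.cong refl) (simp add: ip_lincomb_orthonormal[OF on J])
      also have "\<dots> = (\<Sum>j\<in>J. c j *s \<psi> j)"
        using N that J by (intro sum.mono_neutral_cong_right) auto
      finally show ?thesis .
    qed
    then have "\<forall>\<^sub>F n in sequentially. nrm (p ?u n - (\<Sum>j\<in>J. c j *s \<psi> j)) = 0"
      unfolding eventually_sequentially by (intro exI[of _ N]) (simp add: nrm_zero)
    then have "(\<lambda>n. nrm (p ?u n - (\<Sum>j\<in>J. c j *s \<psi> j))) \<longlonglongrightarrow> 0" by (rule tendsto_eventually)
    then show ?thesis by (rule limit_unique[OF pX TX[OF uX] vX T[OF uX]])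
  qed
  \<comment> \<open>A partial sum \<open>t h n\<close> is a finite combination of the given
    sequence, hence the image under \<open>T\<close> of the same combination \<open>g n\<close> of
    \<open>e\<close>. By \<open>T_ge\<close> the preimages form a Cauchy sequence, and the image of
    their limit is \<open>h\<close> up to norm zero.\<close>
  have surj: "\<exists>g\<in>X. nrm (T g - h) = 0" if h: "h \<in> X" for h
  proof -
    have "\<exists>c. t h n = (\<Sum>j\<in>A \<inter> {..<n}. c j *s \<psi> j)" for n
    proof -
      have "t h n \<in> combs \<psi> (A \<inter> {..<n})"
        unfolding t_def
      proof (intro combs_sum combs_scale)
        fix j assume "j \<in> A \<inter> {..<n}"
        then have "j \<in> A" "A \<inter> {..j} \<subseteq> A \<inter> {..<n}" by auto
        then show "e j \<in> combs \<psi> (A \<inter> {..<n})" by (intro combs_mono[OF e\<psi>]) auto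
      qed
      then show ?thesis by (auto simp: combs_def)
    qed
    then obtain c where c: "\<And>n. t h n = (\<Sum>j\<in>A \<inter> {..<n}. c n j *s \<psi> j)" by metis
    define g where "g n = (\<Sum>j\<in>A \<inter> {..<n}. c n j *s e j)" for n
    have gX: "g n \<in> X" for n unfolding g_def using eX by (intro lincomb_mem) auto
    have Tg: "nrm (T (g n) - t h n) = 0" for n unfolding g_def c by (rule T_comb) auto
    have lim_t: "(\<lambda>n. nrm (t h n - h)) \<longlonglongrightarrow> 0"
      using orthonormal_expansion[OF on e_total h] by (simp add: t_def)
    have gdiff: "nrm (g m - g n) \<le> C * (nrm (t h m - h) + nrm (t h n - h))" for m n
    proof -
      have "nrm (T (g m - g n)) \<le> nrm (T (g m) - T (g n)) + nrm (T (g m - g n) - (T (g m) - T (g n)))"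
        by (intro nrm_triangle_diff diff_mem TX gX)
      also have "\<dots> = nrm (T (g m) - T (g n))" by (simp add: T_diff gX)
      also have "\<dots> \<le> nrm (T (g m) - t h m) + nrm (t h m - T (g n))"
        by (intro nrm_triangle_via TX gX tX)
      also have "nrm (t h m - T (g n)) \<le> nrm (t h m - t h n) + nrm (t h n - T (g n))"
        by (intro nrm_triangle_via TX gX tX)
      also have "nrm (t h n - T (g n)) = 0" using Tg[of n] nrm_diff_commute[OF TX[OF gX] tX, of n h n] by simp
      also have "nrm (t h m - t h n) \<le> nrm (t h m - h) + nrm (h - t h n)"
        by (intro nrm_triangle_via tX h)
      also have "nrm (h - t h n) = nrm (t h n - h)" by (rule nrm_diff_commute[OF h tX])
      finally have "nrm (T (g m - g n)) \<le> nrm (t h m - h) + nrm (t h n - h)" using Tg[of m] by simp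
      then have "C * nrm (T (g m - g n)) \<le> C * (nrm (t h m - h) + nrm (t h n - h))" by (rule mult_left_mono[OF _ C])
      then show ?thesis using T_ge[OF diff_mem[OF gX gX], of m n] by linarith
    qed
    have "\<exists>N. \<forall>m\<ge>N. \<forall>n\<ge>N. nrm (g m - g n) < \<epsilon>" if \<epsilon>: "\<epsilon> > 0" for \<epsilon>
    proof -
      have "\<epsilon> / (2 * C + 1) > 0" using \<epsilon> C by simp
      from LIMSEQ_D[OF lim_t this] obtain N
        where N: "\<And>n. n \<ge> N \<Longrightarrow> norm (nrm (t h n - h) - 0) < \<epsilon> / (2 * C + 1)" by blast
      show ?thesis
      proof (intro exI[of _ N] allI impI)
        fix m n assume mn: "N \<le> m" "N \<le> n"
        have "nrm (t h m - h) + nrm (t h n - h) \<le> 2 * (\<epsilon> / (2 * C + 1))"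
          using N[OF mn(1)] N[OF mn(2)] by simp
        then have "C * (nrm (t h m - h) + nrm (t h n - h)) \<le> C * (2 * (\<epsilon> / (2 * C + 1)))"
          by (rule mult_left_mono[OF _ C])
        also have "\<dots> = \<epsilon> * (2 * C / (2 * C + 1))" by simp
        also have "\<dots> < \<epsilon> * 1" using \<epsilon> C by (intro mult_strict_left_mono) auto
        finally show "nrm (g m - g n) < \<epsilon>" using gdiff[of m n] by simp
      qed
    qed
    then obtain g' where g': "g' \<in> X" and lim: "(\<lambda>n. nrm (g n - g')) \<longlonglongrightarrow> 0"
      using Cauchy_limit[of g] gX by blast
    have "(\<lambda>n. nrm (T (g n) - T g')) \<longlonglongrightarrow> 0"
    proof (rule Lim_null_comparison[OF _ lim], intro always_eventually allI)
      fix n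
      have "nrm (T (g n) - T g') \<le> nrm (T (g n - g')) + nrm ((T (g n) - T g') - T (g n - g'))"
        by (intro nrm_triangle_diff diff_mem TX gX g')
      also have "nrm ((T (g n) - T g') - T (g n - g')) = nrm (T (g n - g') - (T (g n) - T g'))"
        by (intro nrm_diff_commute diff_mem TX gX g')
      also have "nrm (T (g n - g') - (T (g n) - T g')) = 0" by (intro T_diff gX g')
      also have "nrm (T (g n - g')) \<le> nrm (g n - g')" by (intro T_le diff_mem gX g')
      finally show "norm (nrm (T (g n) - T g')) \<le> nrm (g n - g')"
        by (simp add: nrm_ge0 diff_mem TX gX g')
    qed
    moreover have "(\<lambda>n. nrm (T (g n) - h)) \<longlonglongrightarrow> 0"
    proof (rule Lim_null_comparison[OF _ lim_t], intro always_eventually allI)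
      fix n
      show "norm (nrm (T (g n) - h)) \<le> nrm (t h n - h)"
        using nrm_triangle_via[OF TX[OF gX] tX h, of n h n] Tg[of n] by (simp add: nrm_ge0 diff_mem TX gX h)
    qed
    ultimately have "nrm (T g' - h) = 0"
      using limit_unique[of "\<lambda>n. T (g n)" "T g'" h] TX gX g' h by blast
    then show ?thesis using g' by blast
  qed
  then obtain S where SX: "\<And>h. h \<in> X \<Longrightarrow> S h \<in> X" and TS: "\<And>h. h \<in> X \<Longrightarrow> nrm (T (S h) - h) = 0"
    by metis
  have inj: "nrm (g - k) = 0" if g: "g \<in> X" and k: "k \<in> X" and z: "nrm (T g - T k) = 0" for g k
  proof -
    have "nrm (T (g - k)) \<le> nrm (T g - T k) + nrm (T (g - k) - (T g - T k))"
      by (intro nrm_triangle_diff diff_mem TX g k)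
    then have "nrm (T (g - k)) = 0"
      using z T_diff[OF g k] nrm_ge0[OF TX[OF diff_mem[OF g k]]] by simp
    then show ?thesis using T_ge[OF diff_mem[OF g k]] nrm_ge0[OF diff_mem[OF g k]] by simp
  qed
  have S_le: "nrm (S h) \<le> C * nrm h" if h: "h \<in> X" for h
  proof -
    have "nrm (T (S h)) \<le> nrm h + nrm (T (S h) - h)" by (intro nrm_triangle_diff TX SX h)
    then have "nrm (T (S h)) \<le> nrm h" using TS[OF h] by simp
    then have "C * nrm (T (S h)) \<le> C * nrm h" by (rule mult_left_mono[OF _ C])
    then show ?thesis using T_ge[OF SX[OF h]] by linarith
  qed
  have S_lin: "nrm (S (a *s g + b *s k) - (a *s S g + b *s S k)) = 0" if g: "g \<in> X" and k: "k \<in> X" for g k a b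
  proof -
    \<comment> \<open>Linearity of the inverse is inherited from \<open>T\<close>:
      \<open>T (S u)\<close>, \<open>u\<close>, \<open>w\<close> and \<open>T v\<close> are at
      mutual distance zero, and \<open>T\<close> is injective up to norm zero.\<close>
    define u v w where "u = a *s g + b *s k" and "v = a *s S g + b *s S k" and "w = a *s T (S g) + b *s T (S k)"
    have u: "u \<in> X" and v: "v \<in> X" and w: "w \<in> X"
      unfolding u_def v_def w_def by (intro add_mem scale_mem TX SX g k)+
    have z: "nrm (g - T (S g)) = 0" "nrm (k - T (S k)) = 0"
      using TS[OF g] TS[OF k] nrm_diff_commute[OF TX[OF SX[OF g]] g] nrm_diff_commute[OF TX[OF SX[OF k]] k]
      by simp_all
    have "u - w = a *s (g - T (S g)) + b *s (k - T (S k))"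
      by (simp add: u_def w_def scale_right_diff_distrib)
    also have "nrm \<dots> \<le> nrm (a *s (g - T (S g))) + nrm (b *s (k - T (S k)))"
      by (intro nrm_triangle scale_mem diff_mem TX SX g k)
    also have "\<dots> = 0"
      using z by (simp add: nrm_scale diff_mem TX SX g k)
    finally have 1: "nrm (u - w) \<le> 0" .
    have 2: "nrm (w - T v) = 0"
      using T_lin[OF SX[OF g] SX[OF k], of a b] nrm_diff_commute[OF TX[OF v] w] by (simp add: v_def w_def)
    have "nrm (T (S u) - T v) \<le> 0"
      using nrm_triangle_via[OF TX[OF SX[OF u]] u TX[OF v]] nrm_triangle_via[OF u w TX[OF v]] 1 2 TS[OF u]
      by linarith
    then have "nrm (T (S u) - T v) = 0"
      using nrm_ge0[OF diff_mem[OF TX[OF SX[OF u]] TX[OF v]]] by simp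
    then show ?thesis
      unfolding u_def[symmetric] v_def[symmetric] by (rule inj[OF SX[OF u] v])
  qed
  have ST: "nrm (S (T g) - g) = 0" if g: "g \<in> X" for g
    by (rule inj[OF SX[OF TX[OF g]] g TS[OF TX[OF g]]])
  have Te: "nrm (T (e n) - \<psi> n) = 0" if "n \<in> A" for n
    using T_comb[of "{n}" "\<lambda>_. 1"] that by simp
  have "riesz_data A \<psi> C e T S"
    unfolding riesz_data_def
  proof (intro conjI allI ballI impI)
    show "orthonormal A e" by (rule on)
    show "nrm u = 0" if "u \<in> X" "\<forall>n\<in>A. ip u (e n) = 0" for u
      by (rule e_total[OF that(1)]) (rule bspec[OF that(2)])
    show "T g \<in> X" "nrm (T g) \<le> nrm g" "S g \<in> X" "nrm (S g) \<le> C * nrm g"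
      "nrm (S (T g) - g) = 0" "nrm (T (S g) - g) = 0" if "g \<in> X" for g
      by (rule TX[OF that] T_le[OF that] SX[OF that] S_le[OF that] ST[OF that] TS[OF that])+
    show "nrm (T (a *s g + b *s k) - (a *s T g + b *s T k)) = 0" if "g \<in> X" "k \<in> X" for g k a b
      by (rule T_lin[OF that])
    show "nrm (S (a *s g + b *s k) - (a *s S g + b *s S k)) = 0" if "g \<in> X" "k \<in> X" for g k a b
      by (rule S_lin[OF that])
    show "nrm (T (e n) - \<psi> n) = 0" if "n \<in> A" for n by (rule Te[OF that])
  qed
  then show ?thesis by blast
qed

end

lemma L2_norm_diff_eq_0: "g \<in> L2 \<Longrightarrow> h \<in> L2 \<Longrightarrow> L2_norm (g - h) = 0 \<longleftrightarrow> (AE x in I0pi. g x = h x)"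
  using L2_norm_eq_0_iff[OF L2s.diff_mem] by simp

text \<open>The upper constant is one because the result is meant for first components of
  orthonormal vectors. The work lies in turning statements about norm zero into equalities almost
  everywhere.\<close>

theorem L2_Riesz_basis_of_bounds:
  fixes \<psi> :: "nat \<Rightarrow> real \<Rightarrow> complex"
  assumes \<psi>: "\<And>n. n \<in> A \<Longrightarrow> \<psi> n \<in> L2"
    and upper: "\<And>J c. finite J \<Longrightarrow> J \<subseteq> A \<Longrightarrow> (L2_norm (\<Sum>j\<in>J. (\<lambda>x. c j * \<psi> j x)))\<^sup>2 \<le> (\<Sum>j\<in>J. (norm (c j))\<^sup>2)"
    and lower: "\<And>J c. finite J \<Longrightarrow> J \<subseteq> A \<Longrightarrow>
      (\<Sum>j\<in>J. (norm (c j))\<^sup>2) \<le> C\<^sup>2 * (L2_norm (\<Sum>j\<in>J. (\<lambda>x. c j * \<psi> j x)))\<^sup>2"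
    and C: "C \<ge> 0"
    and total: "\<And>u. u \<in> L2 \<Longrightarrow> (\<And>n. n \<in> A \<Longrightarrow> L2_inner u (\<psi> n) = 0) \<Longrightarrow> L2_norm u = 0"
  shows "L2_Riesz_basis A \<psi>"
proof -
  have "\<exists>e T S. L2s.riesz_data A \<psi> C e T S"
  proof (rule L2s.riesz_basis_operators)
    show "\<psi> n \<in> L2" if "n \<in> A" for n by (rule \<psi>[OF that])
    show "(L2s.nrm (\<Sum>j\<in>J. (\<lambda>x. c j * \<psi> j x)))\<^sup>2 \<le> (\<Sum>j\<in>J. (norm (c j))\<^sup>2)"
      if "finite J" "J \<subseteq> A" for J c unfolding L2s_nrm by (rule upper[OF that])
    show "(\<Sum>j\<in>J. (norm (c j))\<^sup>2) \<le> C\<^sup>2 * (L2s.nrm (\<Sum>j\<in>J. (\<lambda>x. c j * \<psi> j x)))\<^sup>2"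
      if "finite J" "J \<subseteq> A" for J c unfolding L2s_nrm by (rule lower[OF that])
    show "C \<ge> 0" by (rule C)
    show "L2s.nrm u = 0" if "u \<in> L2" "\<And>n. n \<in> A \<Longrightarrow> L2_inner u (\<psi> n) = 0" for u
      unfolding L2s_nrm by (rule total[OF that])
  qed
  then obtain e T S where data: "L2s.riesz_data A \<psi> C e T S" by (elim exE)
  note data = data[unfolded L2s.riesz_data_def L2s_nrm]
  note d1 = data[THEN conjunct2] note d2 = d1[THEN conjunct2] note d3 = d2[THEN conjunct2]
  note d4 = d3[THEN conjunct2] note d5 = d4[THEN conjunct2] note d6 = d5[THEN conjunct2]
  note d7 = d6[THEN conjunct2] note d8 = d7[THEN conjunct2] note d9 = d8[THEN conjunct2]
  note d10 = d9[THEN conjunct2]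
  have on: "L2s.orthonormal A e" by (rule data[THEN conjunct1])
  have tot: "L2_norm u = 0" if "u \<in> L2" "\<And>n. n \<in> A \<Longrightarrow> L2_inner u (e n) = 0" for u
    by (rule d1[THEN conjunct1, THEN bspec, THEN mp, OF that(1)]) (intro ballI that(2))
  note T = d2[THEN conjunct1, THEN bspec] d3[THEN conjunct1, THEN bspec]
    d4[THEN conjunct1, THEN bspec, THEN bspec, THEN spec, THEN spec]
  note S = d5[THEN conjunct1, THEN bspec] d6[THEN conjunct1, THEN bspec]
    d7[THEN conjunct1, THEN bspec, THEN bspec, THEN spec, THEN spec]
  note ST = d8[THEN conjunct1, THEN bspec] and TS = d9[THEN conjunct1, THEN bspec] and Te = d10[THEN bspec]
  have eL2: "e n \<in> L2" if "n \<in> A" for n using on that by (rule L2s.orthonormal_mem)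
  have basis: "L2_orthonormal_basis A e"
    unfolding L2_orthonormal_basis_def
  proof (intro conjI ballI allI impI)
    show "e n \<in> L2" if "n \<in> A" for n by (rule eL2[OF that])
    show "L2_inner (e m) (e n) = (if m = n then 1 else 0)" if "m \<in> A" "n \<in> A" for m n
      using on that by (simp add: L2s.orthonormal_def)
    fix g and \<epsilon> :: real assume g: "g \<in> L2" and \<epsilon>: "\<epsilon> > 0"
    have "(\<lambda>n. L2s.nrm ((\<Sum>j\<in>A \<inter> {..<n}. (\<lambda>x. L2_inner g (e j) * e j x)) - g)) \<longlonglongrightarrow> 0"
      by (rule L2s.orthonormal_expansion[OF on _ g]) (simp add: L2s_nrm tot)
    from LIMSEQ_D[OF this \<epsilon>] obtain n
      where "norm (L2s.nrm ((\<Sum>j\<in>A \<inter> {..<n}. (\<lambda>x. L2_inner g (e j) * e j x)) - g) - 0) < \<epsilon>" by blast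
    then have lt: "L2_norm ((\<Sum>j\<in>A \<inter> {..<n}. (\<lambda>x. L2_inner g (e j) * e j x)) - g) < \<epsilon>" by (simp add: L2s_nrm)
    have mem: "(\<Sum>j\<in>A \<inter> {..<n}. (\<lambda>x. L2_inner g (e j) * e j x)) \<in> L2"
      using eL2 by (intro L2s.lincomb_mem) auto
    have "L2_norm (g - (\<Sum>j\<in>A \<inter> {..<n}. (\<lambda>x. L2_inner g (e j) * e j x))) < \<epsilon>"
      using lt L2s.nrm_diff_commute[OF g mem] by (simp add: L2s_nrm)
    moreover have "g - (\<Sum>j\<in>A \<inter> {..<n}. (\<lambda>x. L2_inner g (e j) * e j x)) =
        (\<lambda>x. g x - (\<Sum>j\<in>A \<inter> {..<n}. L2_inner g (e j) * e j x))"
    proof -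
      have "(\<Sum>j\<in>J. (\<lambda>x. L2_inner g (e j) * e j x)) x = (\<Sum>j\<in>J. L2_inner g (e j) * e j x)" for J x
        by (induction J rule: infinite_finite_induct) auto
      then show ?thesis by (simp add: fun_eq_iff)
    qed
    ultimately show "\<exists>J c. finite J \<and> J \<subseteq> A \<and> L2_norm (\<lambda>x. g x - (\<Sum>n\<in>J. c n * e n x)) < \<epsilon>"
      by (intro exI[of _ "A \<inter> {..<n}"] exI[of _ "\<lambda>j. L2_inner g (e j)"]) auto
  qed
  have bounded: "L2_bounded_operator R"
    if R: "\<And>g. g \<in> L2 \<Longrightarrow> R g \<in> L2" "\<And>g. g \<in> L2 \<Longrightarrow> L2_norm (R g) \<le> D * L2_norm g"
      "\<And>g k a b. g \<in> L2 \<Longrightarrow> k \<in> L2 \<Longrightarrow>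
        L2_norm (R ((\<lambda>x. a * g x) + (\<lambda>x. b * k x)) - ((\<lambda>x. a * R g x) + (\<lambda>x. b * R k x))) = 0" for R D
    unfolding L2_bounded_operator_def
  proof (intro conjI ballI allI)
    show "R g \<in> L2" if "g \<in> L2" for g by (rule R(1)[OF that])
    show "\<exists>D. \<forall>g\<in>L2. L2_norm (R g) \<le> D * L2_norm g" using R(2) by blast
    fix g k and a b :: complex assume g: "g \<in> L2" and k: "k \<in> L2"
    have "L2_norm (R (\<lambda>x. a * g x + b * k x) - (\<lambda>x. a * R g x + b * R k x)) = 0"
      using R(3)[OF g k, of a b] by (simp add: plus_fun_def)
    moreover have "R (\<lambda>x. a * g x + b * k x) \<in> L2" "(\<lambda>x. a * R g x + b * R k x) \<in> L2"
      by (intro R(1) L2_add L2_scale g k)+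
    ultimately show "AE x in I0pi. R (\<lambda>t. a * g t + b * k t) x = a * R g x + b * R k x"
      by (simp add: L2_norm_diff_eq_0)
  qed
  have "L2_bounded_invertible T"
    unfolding L2_bounded_invertible_def
  proof (intro conjI exI[of _ S] ballI)
    show "L2_bounded_operator T" by (rule bounded[of T 1]) (simp_all only: T mult_1)
    show "L2_bounded_operator S" by (rule bounded[of S C]) (simp_all only: S)
    show "AE x in I0pi. S (T g) x = g x" "AE x in I0pi. T (S g) x = g x" if "g \<in> L2" for g
      using ST[OF that] TS[OF that] that by (simp_all add: L2_norm_diff_eq_0 S T)
  qed
  moreover have "AE x in I0pi. \<psi> n x = T (e n) x" if n: "n \<in> A" for n
  proof -
    have "AE x in I0pi. T (e n) x = \<psi> n x"
      using Te[OF n] by (simp add: L2_norm_diff_eq_0 T(1) eL2 n \<psi>)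
    then show ?thesis by eventually_elim simp
  qed
  ultimately show ?thesis unfolding L2_Riesz_basis_def using basis \<psi> by blast
qed

section \<open>Riesz bases of first components\<close>

lemma L2_norm_cong_AE:
  assumes "g \<in> L2" "h \<in> L2" "AE x in I0pi. g x = h x"
  shows "L2_norm g = L2_norm h"
proof -
  have "L2_norm (g - h) = 0" "L2_norm (h - g) = 0"
    using assms L2_norm_diff_eq_0[of g h] L2s.nrm_diff_commute[of g h] by (simp_all add: L2s_nrm)
  then show ?thesis
    using L2s.nrm_triangle_diff[OF assms(1,2)] L2s.nrm_triangle_diff[OF assms(2,1)] by (simp add: L2s_nrm)
qed

text \<open>The coefficients are measured by the combination of the orthonormal basis; applying
  \<open>T\<close> and then its bounded inverse bounds this by the same combination of the Riesz
  basis.\<close>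

lemma L2_Riesz_basis_lower_bound:
  fixes \<psi> :: "nat \<Rightarrow> real \<Rightarrow> complex"
  assumes "L2_Riesz_basis A \<psi>"
  obtains C where "\<And>J c. finite J \<Longrightarrow> J \<subseteq> A \<Longrightarrow>
    (\<Sum>j\<in>J. (norm (c j))\<^sup>2) \<le> C\<^sup>2 * (L2_norm (\<Sum>j\<in>J. (\<lambda>x. c j * \<psi> j x)))\<^sup>2"
proof -
  obtain e T where \<psi>: "\<And>n. n \<in> A \<Longrightarrow> \<psi> n \<in> L2" and basis: "L2_orthonormal_basis A e"
    and inv: "L2_bounded_invertible T" and Te: "\<And>n. n \<in> A \<Longrightarrow> AE x in I0pi. \<psi> n x = T (e n) x"
    using assms unfolding L2_Riesz_basis_def by blast
  obtain S where T: "L2_bounded_operator T" and S: "L2_bounded_operator S"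
    and ST: "\<And>g. g \<in> L2 \<Longrightarrow> AE x in I0pi. S (T g) x = g x"
    using inv unfolding L2_bounded_invertible_def by blast
  have TL2: "T g \<in> L2" if "g \<in> L2" for g using T that by (simp add: L2_bounded_operator_def)
  have T_lin: "AE x in I0pi. T (\<lambda>t. a * g t + b * k t) x = a * T g x + b * T k x"
    if "g \<in> L2" "k \<in> L2" for g k a b
    using T that by (simp add: L2_bounded_operator_def)
  have SL2: "S g \<in> L2" if "g \<in> L2" for g using S that by (simp add: L2_bounded_operator_def)
  obtain C where C: "\<And>g. g \<in> L2 \<Longrightarrow> L2_norm (S g) \<le> C * L2_norm g"
    using S unfolding L2_bounded_operator_def by blast
  have on: "L2s.orthonormal A e"
    using basis by (simp add: L2_orthonormal_basis_def L2s.orthonormal_def)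
  have e: "e n \<in> L2" if "n \<in> A" for n by (rule L2s.orthonormal_mem[OF on that])
  have lin: "AE x in I0pi. T (\<Sum>j\<in>J. (\<lambda>x. c j * e j x)) x = (\<Sum>j\<in>J. (\<lambda>x. c j * \<psi> j x)) x"
    if "finite J" "J \<subseteq> A" for J c
    using that
  proof (induction J)
    case empty
    \<comment> \<open>Linearity with both coefficients zero is what yields that \<open>T\<close>
      maps the zero function to a null function.\<close>
    have "AE x in I0pi. T (\<lambda>t. 0 * (0::complex) + 0 * 0) x = 0 * T (\<lambda>_. 0) x + 0 * T (\<lambda>_. 0) x"
      using T_lin[of "\<lambda>_. 0" "\<lambda>_. 0" 0 0] zero_L2 by (simp add: zero_fun_def)
    then show ?case by (simp add: zero_fun_def)
  next
    case (insert i J)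
    let ?u = "\<Sum>j\<in>J. (\<lambda>x. c j * e j x)"
    have u: "?u \<in> L2" using insert.prems e by (intro L2s.lincomb_mem) auto
    have i: "i \<in> A" and IH: "AE x in I0pi. T ?u x = (\<Sum>j\<in>J. (\<lambda>x. c j * \<psi> j x)) x"
      using insert by auto
    have eq: "(\<Sum>j\<in>insert i J. (\<lambda>x. c j * e j x)) = (\<lambda>t. c i * e i t + 1 * ?u t)"
      using insert.hyps by (simp add: plus_fun_def)
    show ?case
      unfolding eq using T_lin[OF e[OF i] u, of "c i" 1] IH Te[OF i]
    proof eventually_elim
      case (elim x)
      then show ?case using insert.hyps by simp
    qed
  qed
  show thesis
  proof (rule that[of C])
    fix J and c :: "nat \<Rightarrow> complex" assume J: "finite J" "J \<subseteq> A"
    let ?u = "\<Sum>j\<in>J. (\<lambda>x. c j * e j x)" and ?v = "\<Sum>j\<in>J. (\<lambda>x. c j * \<psi> j x)"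
    have u: "?u \<in> L2" and v: "?v \<in> L2" using J e \<psi> by (auto intro!: L2s.lincomb_mem)
    have "L2_norm ?u = L2_norm (S (T ?u))"
      by (rule L2_norm_cong_AE[OF SL2[OF TL2[OF u]] u ST[OF u], symmetric])
    also have "\<dots> \<le> C * L2_norm (T ?u)" by (rule C[OF TL2[OF u]])
    also have "L2_norm (T ?u) = L2_norm ?v"
      by (rule L2_norm_cong_AE[OF TL2[OF u] v lin[OF J]])
    finally have "(L2_norm ?u)\<^sup>2 \<le> (C * L2_norm ?v)\<^sup>2"
      using L2s.nrm_ge0[OF u] by (intro power_mono) (simp_all add: L2s_nrm)
    then show "(\<Sum>j\<in>J. (norm (c j))\<^sup>2) \<le> C\<^sup>2 * (L2_norm ?v)\<^sup>2"
      using L2s.nrm_lincomb_orthonormal[OF on J, of c] by (simp add: L2s_nrm power_mult_distrib)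
  qed
qed

lemma L2_Riesz_basis_cong:
  assumes eq: "\<And>n x. x \<in> {0..pi} \<Longrightarrow> \<phi> n x = \<psi> n x"
  shows "L2_Riesz_basis A \<phi> \<longleftrightarrow> L2_Riesz_basis A \<psi>"
proof -
  have eq': "\<phi> n x = \<psi> n x" if "x \<in> space I0pi" for n x using that by (intro eq) auto
  have "\<phi> n \<in> L2 \<longleftrightarrow> \<psi> n \<in> L2" for n
    unfolding L2_def square_integrable_def mem_Collect_eq
    using measurable_cong[of I0pi "\<phi> n" "\<psi> n" borel]
      Bochner_Integration.integrable_cong[OF refl, of I0pi "\<lambda>x. (norm (\<phi> n x))\<^sup>2" "\<lambda>x. (norm (\<psi> n x))\<^sup>2"]
    by (simp add: eq')
  moreover have "(AE x in I0pi. \<phi> n x = g x) \<longleftrightarrow> (AE x in I0pi. \<psi> n x = g x)" for n g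
    by (intro AE_cong) (simp add: eq')
  ultimately show ?thesis unfolding L2_Riesz_basis_def by simp
qed

context bvp
begin

lemma fst_lincomb: "fst (\<Sum>j\<in>J. pair_scale (c j) (\<phi> j :: pairs)) = (\<Sum>j\<in>J. (\<lambda>x. c j * fst (\<phi> j) x))"
  by (induction J rule: infinite_finite_induct) auto

lemma snd_lincomb: "snd (\<Sum>j\<in>J. pair_scale (c j) (\<phi> j :: pairs)) i = (\<Sum>j\<in>J. c j * snd (\<phi> j) i)"
  by (induction J rule: infinite_finite_induct) auto

lemma ipH_idxH: "ipH u v = L2_inner (fst u) (fst v) + (\<Sum>i\<in>idxH. of_real (wt i) * snd u i * cnj (snd v i))"
  by (simp add: ipH_def pair_ip_def)

lemma snd_eq_0_of_nrmH:
  assumes w: "w \<in> PX" and n: "H.nrm w = 0"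
  shows "L2_norm (fst w) = 0" "i \<in> idxH \<Longrightarrow> snd w i = 0"
proof -
  have nn: "0 \<le> wt i * (norm (snd w i))\<^sup>2" if "i \<in> idxH" for i using wt_pos[OF that] by simp
  have sum0: "(L2_norm (fst w))\<^sup>2 + (\<Sum>i\<in>idxH. wt i * (norm (snd w i))\<^sup>2) = 0"
    using nrmH_sq[OF w] n by simp
  have "0 \<le> (\<Sum>i\<in>idxH. wt i * (norm (snd w i))\<^sup>2)" by (rule sum_nonneg) (rule nn)
  then have "(\<Sum>i\<in>idxH. wt i * (norm (snd w i))\<^sup>2) = 0" and "(L2_norm (fst w))\<^sup>2 = 0"
    using sum0 zero_le_power2[of "L2_norm (fst w)"] by linarith+
  then show "L2_norm (fst w) = 0" "i \<in> idxH \<Longrightarrow> snd w i = 0"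
    using sum_nonneg_eq_0_iff[OF finite_idx(3) nn] wt_pos[of i] by auto
qed

text \<open>The minimization produces eigenvectors of its own. They are matched with the prescribed
  ones because \<open>lam\<close> runs through all eigenvalues and each of them is simple, which is
  the assumption \<open>exhaust\<close> of the abstract result. Orthogonality to the range of
  \<open>hembed\<close> then means norm zero by density.\<close>

lemma orthonormal_total:
  assumes lam: "strict_mono lam" and eigenvalues: "eigenvalues s f F = range (\<lambda>n. of_real (lam n))"
    and v: "\<And>n. weak (lam n) (v n)" and nv: "\<And>n. H.nrm (hembed (v n)) = 1"
  shows "H.orthonormal UNIV (\<lambda>n. hembed (v n))"
    and "w \<in> PX \<Longrightarrow> (\<And>n. ipH w (hembed (v n)) = 0) \<Longrightarrow> H.nrm w = 0"
proof -
  obtain K K' C where cf: "compact_form pair_scale PX ipV pair_scale PX ipH B hembed K K' (1 / 2) C"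
    using compact_form_bvp by blast
  have weak_iff: "compact_form.weak_eigenvector PX ipH B hembed \<nu> u \<longleftrightarrow> weak \<nu> u" for \<nu> u
    unfolding compact_form.weak_eigenvector_def[OF cf] weak_def by (rule refl)
  have vX: "v n \<in> PX" for n using v by (simp add: weak_def)
  have "ipH (hembed (v m)) (hembed (v n)) = (if m = n then 1 else 0)" for m n
  proof (cases "m = n")
    case True
    then show ?thesis using H.ip_self[OF hembed_mem[OF vX]] nv by simp
  next
    case False
    then have "lam m \<noteq> lam n" using lam by (simp add: strict_mono_eq)
    then show ?thesis
      using compact_form.weak_eigenvectors_orthogonal[OF cf, unfolded weak_iff, OF v v] False by simp
  qed
  then show on: "H.orthonormal UNIV (\<lambda>n. hembed (v n))"
    by (simp add: H.orthonormal_def hembed_mem vX)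
  have exhaust: "\<exists>j c. \<nu> = lam j \<and> H.nrm (hembed u - pair_scale c (hembed (v j))) = 0"
    if u: "weak \<nu> u" and nu: "H.nrm (hembed u) = 1" for \<nu> u
  proof -
    have "complex_of_real \<nu> \<in> range (\<lambda>n. of_real (lam n))"
      using weak_imp_eigenvalue[OF u] nu eigenvalues by simp
    then obtain j where j: "\<nu> = lam j" by (auto simp del: of_real_eq_iff dest: of_real_eq_iff[THEN iffD1])
    have uX: "hembed u \<in> PX" and vjX: "hembed (v j) \<in> PX"
      using u vX by (simp_all add: hembed_mem weak_def)
    obtain a b where ab: "a \<noteq> 0 \<or> b \<noteq> 0" and z: "H.nrm (pair_scale a (hembed u) + pair_scale b (hembed (v j))) = 0"
      by (rule weak_simple[OF u, of "v j"]) (use v j in simp)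
    \<comment> \<open>Otherwise \<open>b\<close> would be nonzero and the normalized vector of
      \<open>v j\<close> would have norm zero.\<close>
    have a: "a \<noteq> 0"
    proof
      assume a0: "a = 0"
      have eq: "pair_scale 0 (hembed u) + pair_scale b (hembed (v j)) = pair_scale b (hembed (v j))" by simp
      have "H.nrm (pair_scale b (hembed (v j))) = 0" using z unfolding a0 eq .
      then show False using ab a0 nv[of j] H.nrm_scale[OF vjX, of b] by simp
    qed
    have "hembed u - pair_scale (- b / a) (hembed (v j)) =
        pair_scale (1 / a) (pair_scale a (hembed u) + pair_scale b (hembed (v j)))"
      using a by (simp add: V.scale_right_distrib V.scale_minus_left)
    then have "H.nrm (hembed u - pair_scale (- b / a) (hembed (v j))) = 0"
      using z uX vjX by (simp add: H.nrm_scale H.add_mem H.scale_mem)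
    then show ?thesis using j by blast
  qed
  show "H.nrm w = 0" if w: "w \<in> PX" and perp: "\<And>n. ipH w (hembed (v n)) = 0"
  proof (rule hembed_dense[OF w])
    fix u assume u: "u \<in> PX"
    show "ipH w (hembed u) = 0"
      by (rule compact_form.orthogonal_to_eigenvectors[OF cf, unfolded weak_iff,
            OF v on strict_mono_mono[OF lam] exhaust w perp u])
  qed
qed

section \<open>The criterion for an arbitrary orthonormal total family\<close>

context
  fixes \<phi> :: "nat \<Rightarrow> pairs" and \<Theta> :: "nat set"
  assumes on: "H.orthonormal UNIV \<phi>"
    and total: "\<And>w. w \<in> PX \<Longrightarrow> (\<And>n. ipH w (\<phi> n) = 0) \<Longrightarrow> H.nrm w = 0"
    and \<Theta>: "finite \<Theta>"
begin

lemma \<phi>X: "\<phi> n \<in> PX"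
  using on by (simp add: H.orthonormal_def)

lemma \<phi>_norm: "L2_norm (fst (\<phi> n)) \<le> 1"
proof -
  have "H.nrm (\<phi> n) = 1" using on by (simp add: H.orthonormal_def H.nrm_def)
  moreover have "0 \<le> (\<Sum>i\<in>idxH. wt i * (norm (snd (\<phi> n) i))\<^sup>2)"
    using wt_pos by (intro sum_nonneg mult_nonneg_nonneg) (auto intro: less_imp_le)
  ultimately have "(L2_norm (fst (\<phi> n)))\<^sup>2 \<le> 1\<^sup>2" using nrmH_sq[OF \<phi>X, of n] by simp
  then show ?thesis by (rule power2_le_imp_le) simp
qed

text \<open>A combination \<open>?u\<close> of the remaining vectors is orthogonal to
  \<open>\<phi> m\<close> for \<open>m\<close> in \<open>\<Theta>\<close>. These relations, solved
  by \<open>D\<close>, express its coordinates by inner products of its first component, which gives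
  the lower bound. The assumption \<open>inj\<close> serves totality: it excludes a vector
  \<open>(g, 0)\<close> of positive norm in the span of the omitted vectors.\<close>

lemma Riesz_basis_of_left_inverse:
  fixes D :: "bidx \<Rightarrow> nat \<Rightarrow> complex"
  assumes D: "\<And>i j. i \<in> idxH \<Longrightarrow> j \<in> idxH \<Longrightarrow> (\<Sum>m\<in>\<Theta>. D i m * snd (\<phi> m) j) = (if i = j then 1 else 0)"
    and inj: "\<And>c m. (\<And>i. i \<in> idxH \<Longrightarrow> (\<Sum>m\<in>\<Theta>. c m * snd (\<phi> m) i) = 0) \<Longrightarrow> m \<in> \<Theta> \<Longrightarrow> c m = 0"
  shows "L2_Riesz_basis (UNIV - \<Theta>) (\<lambda>n. fst (\<phi> n))"
proof -
  \<comment> \<open>Bound for coordinate \<open>i\<close> relative to the first component: row sum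
    of \<open>D\<close> divided by the weight, as the first component of each
    \<open>\<phi> m\<close> has norm at most one.\<close>
  define k where "k i = (\<Sum>m\<in>\<Theta>. norm (D i m)) / wt i" for i
  define C where "C = sqrt (1 + (\<Sum>i\<in>idxH. wt i * (k i)\<^sup>2))"
  have nn: "0 \<le> (\<Sum>i\<in>idxH. wt i * (k i)\<^sup>2)"
    using wt_pos by (intro sum_nonneg mult_nonneg_nonneg) (auto intro: less_imp_le)
  show ?thesis
  proof (rule L2_Riesz_basis_of_bounds[of _ _ C])
    show "fst (\<phi> n) \<in> L2" for n by (rule PX_fst[OF \<phi>X])
    show "C \<ge> 0" using nn by (simp add: C_def)
  next
    fix J :: "nat set" and c :: "nat \<Rightarrow> complex" assume J: "finite J" "J \<subseteq> UNIV - \<Theta>"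
    let ?u = "\<Sum>j\<in>J. pair_scale (c j) (\<phi> j)"
    have u: "?u \<in> PX" by (intro H.lincomb_mem \<phi>X)
    have nu: "(H.nrm ?u)\<^sup>2 = (\<Sum>j\<in>J. (norm (c j))\<^sup>2)"
      by (rule H.nrm_lincomb_orthonormal[OF on]) (use J in auto)
    have sq: "(H.nrm ?u)\<^sup>2 = (L2_norm (fst ?u))\<^sup>2 + (\<Sum>i\<in>idxH. wt i * (norm (snd ?u i))\<^sup>2)"
      by (rule nrmH_sq[OF u])
    moreover have "0 \<le> (\<Sum>i\<in>idxH. wt i * (norm (snd ?u i))\<^sup>2)"
      using wt_pos by (intro sum_nonneg mult_nonneg_nonneg) (auto intro: less_imp_le)
    ultimately show "(L2_norm (\<Sum>j\<in>J. (\<lambda>x. c j * fst (\<phi> j) x)))\<^sup>2 \<le> (\<Sum>j\<in>J. (norm (c j))\<^sup>2)"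
      using nu by (simp add: fst_lincomb)
    have perp: "ipH ?u (\<phi> m) = 0" if "m \<in> \<Theta>" for m
      using H.ip_lincomb_orthonormal[OF on J(1), of m c] that J by auto
    have bi: "norm (snd ?u i) \<le> k i * L2_norm (fst ?u)" if i: "i \<in> idxH" for i
    proof -
      \<comment> \<open>The Kronecker symbol is inserted and replaced by the product of
        \<open>D\<close> with the coordinate matrix, which brings in the orthogonality relations
        \<open>perp\<close>.\<close>
      have "of_real (wt i) * snd ?u i = (\<Sum>j\<in>idxH. of_real (wt j) * snd ?u j * cnj (if i = j then 1 else 0))"
        using i by (simp add: if_distrib[of cnj] if_distrib[of "(*) _"] sum.delta cong: if_cong)
      also have "\<dots> = (\<Sum>j\<in>idxH. of_real (wt j) * snd ?u j * cnj (\<Sum>m\<in>\<Theta>. D i m * snd (\<phi> m) j))"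
        using i by (intro sum.cong refl) (simp only: D)
      also have "\<dots> = (\<Sum>j\<in>idxH. \<Sum>m\<in>\<Theta>. cnj (D i m) * (of_real (wt j) * snd ?u j * cnj (snd (\<phi> m) j)))"
        by (intro sum.cong refl) (simp add: sum_distrib_left mult_ac)
      also have "\<dots> = (\<Sum>m\<in>\<Theta>. \<Sum>j\<in>idxH. cnj (D i m) * (of_real (wt j) * snd ?u j * cnj (snd (\<phi> m) j)))"
        by (rule sum.swap)
      also have "\<dots> = (\<Sum>m\<in>\<Theta>. cnj (D i m) * - L2_inner (fst ?u) (fst (\<phi> m)))"
      proof (intro sum.cong refl)
        fix m assume "m \<in> \<Theta>"
        from perp[OF this] have "(\<Sum>j\<in>idxH. of_real (wt j) * snd ?u j * cnj (snd (\<phi> m) j)) = - L2_inner (fst ?u) (fst (\<phi> m))"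
          unfolding ipH_idxH by (simp add: add_eq_0_iff)
        then show "(\<Sum>j\<in>idxH. cnj (D i m) * (of_real (wt j) * snd ?u j * cnj (snd (\<phi> m) j))) =
            cnj (D i m) * - L2_inner (fst ?u) (fst (\<phi> m))"
          unfolding sum_distrib_left[symmetric] by simp
      qed
      finally have eq: "of_real (wt i) * snd ?u i = (\<Sum>m\<in>\<Theta>. cnj (D i m) * - L2_inner (fst ?u) (fst (\<phi> m)))" .
      have "wt i * norm (snd ?u i) = norm (of_real (wt i) * snd ?u i)"
        using wt_pos[OF i] by (simp add: norm_mult)
      also have "\<dots> \<le> (\<Sum>m\<in>\<Theta>. norm (cnj (D i m) * - L2_inner (fst ?u) (fst (\<phi> m))))"
        unfolding eq by (rule norm_sum)
      also have "\<dots> \<le> (\<Sum>m\<in>\<Theta>. norm (D i m) * L2_norm (fst ?u))"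
      proof (rule sum_mono)
        fix m
        have "norm (L2_inner (fst ?u) (fst (\<phi> m))) \<le> L2_norm (fst ?u) * L2_norm (fst (\<phi> m))"
          using L2s.cauchy_schwarz[OF PX_fst[OF u] PX_fst[OF \<phi>X]] by (simp add: L2s_nrm)
        also have "\<dots> \<le> L2_norm (fst ?u) * 1"
          by (intro mult_left_mono \<phi>_norm L2_norm_nonneg PX_fst u)
        finally show "norm (cnj (D i m) * - L2_inner (fst ?u) (fst (\<phi> m))) \<le> norm (D i m) * L2_norm (fst ?u)"
          by (simp add: norm_mult mult_left_mono)
      qed
      also have "\<dots> = wt i * (k i * L2_norm (fst ?u))"
        using wt_pos[OF i] by (simp add: k_def sum_distrib_right)
      finally show ?thesis using wt_pos[OF i] by simp
    qed
    have "(\<Sum>i\<in>idxH. wt i * (norm (snd ?u i))\<^sup>2) \<le> (\<Sum>i\<in>idxH. wt i * (k i * L2_norm (fst ?u))\<^sup>2)"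
      using wt_pos bi by (intro sum_mono mult_left_mono power_mono) (auto intro: less_imp_le)
    also have "\<dots> = (\<Sum>i\<in>idxH. wt i * (k i)\<^sup>2) * (L2_norm (fst ?u))\<^sup>2"
      unfolding sum_distrib_right by (intro sum.cong refl) (simp add: power_mult_distrib)
    finally have "(H.nrm ?u)\<^sup>2 \<le> (1 + (\<Sum>i\<in>idxH. wt i * (k i)\<^sup>2)) * (L2_norm (fst ?u))\<^sup>2"
      unfolding sq by (simp add: distrib_right)
    also have "1 + (\<Sum>i\<in>idxH. wt i * (k i)\<^sup>2) = C\<^sup>2" using nn by (simp add: C_def)
    finally show "(\<Sum>j\<in>J. (norm (c j))\<^sup>2) \<le> C\<^sup>2 * (L2_norm (\<Sum>j\<in>J. (\<lambda>x. c j * fst (\<phi> j) x)))\<^sup>2"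
      unfolding nu fst_lincomb .
  next
    \<comment> \<open>The vector \<open>(g, 0)\<close> is orthogonal to all \<open>\<phi> n\<close>
      with \<open>n\<close> outside \<open>\<Theta>\<close>, hence up to norm zero a combination of
      the finitely many omitted vectors. Its zero coordinates then annihilate all
      coefficients.\<close>
    fix g assume g: "g \<in> L2" and perp: "\<And>n. n \<in> UNIV - \<Theta> \<Longrightarrow> L2_inner g (fst (\<phi> n)) = 0"
    define w :: pairs where "w = (g, \<lambda>_. 0)"
    have w: "w \<in> PX" using g by (simp add: w_def pair_carrier_def)
    define c where "c m = ipH w (\<phi> m)" for m
    let ?p = "\<Sum>m\<in>\<Theta>. pair_scale (c m) (\<phi> m)"
    have p: "?p \<in> PX" by (intro H.lincomb_mem \<phi>X)
    have "ipH (w - ?p) (\<phi> n) = 0" for n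
    proof (cases "n \<in> \<Theta>")
      case True
      moreover have "ipH w (\<phi> n) = c n" by (simp add: c_def)
      ultimately show ?thesis
        using H.ip_lincomb_orthonormal[OF on \<Theta>, of n c] by (simp add: H.ip_diff_left[OF w p \<phi>X])
    next
      case False
      then have "ipH w (\<phi> n) = 0" using perp by (simp add: ipH_idxH w_def)
      then show ?thesis
        using False H.ip_lincomb_orthonormal[OF on \<Theta>, of n c] by (simp add: H.ip_diff_left[OF w p \<phi>X])
    qed
    then have z: "H.nrm (w - ?p) = 0" by (intro total H.diff_mem w p)
    have "(\<Sum>m\<in>\<Theta>. c m * snd (\<phi> m) i) = 0" if "i \<in> idxH" for i
    proof -
      have "snd (w - ?p) i = 0" by (rule snd_eq_0_of_nrmH(2)[OF H.diff_mem[OF w p] z that])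
      then show ?thesis by (simp add: snd_lincomb w_def)
    qed
    then have "c m = 0" if "m \<in> \<Theta>" for m using inj that by blast
    then have "?p = 0" by (intro sum.neutral ballI) (simp add: V.scale_zero_left)
    then show "L2_norm g = 0" using snd_eq_0_of_nrmH(1)[OF w] z by (simp add: w_def)
  qed
qed

text \<open>A kernel element \<open>x\<close> gives a vector \<open>u\<close> with zero first
  component whose expansion uses only indices outside \<open>\<Theta>\<close>. The first components
  of the partial sums tend to zero, so the lower Riesz bound makes every coefficient zero; totality
  then gives \<open>u\<close> norm zero, hence \<open>x\<close> vanishes.\<close>

lemma kernel_zero_of_Riesz_basis:
  fixes x :: "bidx \<Rightarrow> complex"
  assumes R: "L2_Riesz_basis (UNIV - \<Theta>) (\<lambda>n. fst (\<phi> n))"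
    and x: "\<And>m. m \<in> \<Theta> \<Longrightarrow> (\<Sum>i\<in>idxH. snd (\<phi> m) i * x i) = 0" and i: "i \<in> idxH"
  shows "x i = 0"
proof -
  \<comment> \<open>Conjugation and division by the weights turn the inner product with
    \<open>\<phi> m\<close> into the conjugate of the sum assumed to vanish.\<close>
  define u :: pairs where "u = ((\<lambda>_. 0), (\<lambda>i. cnj (x i) / of_real (wt i)))"
  have u: "u \<in> PX" using zero_L2 by (simp add: u_def pair_carrier_def zero_fun_def)
  define c where "c n = ipH u (\<phi> n)" for n
  have c\<Theta>: "c m = 0" if "m \<in> \<Theta>" for m
  proof -
    have "c m = (\<Sum>i\<in>idxH. cnj (snd (\<phi> m) i * x i))"
      unfolding c_def ipH_idxH using wt_pos
      by (auto simp: u_def L2_inner_def mult.commute intro!: sum.cong dest!: wt_pos)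
    also have "\<dots> = cnj (\<Sum>i\<in>idxH. snd (\<phi> m) i * x i)" by simp
    finally show ?thesis using x[OF that] by simp
  qed
  obtain C where C: "\<And>J c. finite J \<Longrightarrow> J \<subseteq> UNIV - \<Theta> \<Longrightarrow>
      (\<Sum>j\<in>J. (norm (c j))\<^sup>2) \<le> C\<^sup>2 * (L2_norm (\<Sum>j\<in>J. (\<lambda>x. c j * fst (\<phi> j) x)))\<^sup>2"
    using L2_Riesz_basis_lower_bound[OF R] by blast
  let ?p = "\<lambda>N. \<Sum>j\<in>UNIV \<inter> {..<N}. pair_scale (c j) (\<phi> j)"
  have lim: "(\<lambda>N. H.nrm (?p N - u)) \<longlonglongrightarrow> 0"
    unfolding c_def by (rule H.orthonormal_expansion[OF on _ u]) (auto intro: total)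
  \<comment> \<open>The coefficients in \<open>\<Theta>\<close> are zero, so only admissible indices
    occur, and subtracting \<open>u\<close> does not change the first component.\<close>
  have le: "(norm (c n))\<^sup>2 \<le> C\<^sup>2 * (H.nrm (?p N - u))\<^sup>2" if n: "n \<notin> \<Theta>" "n < N" for n N
  proof -
    have p: "?p N \<in> PX" by (intro H.lincomb_mem \<phi>X)
    have eq: "(\<Sum>j\<in>{..<N} - \<Theta>. (\<lambda>x. c j * fst (\<phi> j) x)) = fst (?p N - u)"
    proof -
      have "fst (?p N - u) = (\<Sum>j\<in>{..<N}. (\<lambda>x. c j * fst (\<phi> j) x))"
        by (simp add: fst_lincomb u_def fun_eq_iff)
      also have "\<dots> = (\<Sum>j\<in>{..<N} - \<Theta>. (\<lambda>x. c j * fst (\<phi> j) x))"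
        by (intro sum.mono_neutral_right) (auto simp: c\<Theta> fun_eq_iff)
      finally show ?thesis ..
    qed
    have "(norm (c n))\<^sup>2 \<le> (\<Sum>j\<in>{..<N} - \<Theta>. (norm (c j))\<^sup>2)"
      using n by (intro member_le_sum) auto
    also have "\<dots> \<le> C\<^sup>2 * (L2_norm (fst (?p N - u)))\<^sup>2"
      using C[of "{..<N} - \<Theta>" c] unfolding eq by auto
    also have "\<dots> \<le> C\<^sup>2 * (H.nrm (?p N - u))\<^sup>2"
    proof (rule mult_left_mono)
      have "0 \<le> (\<Sum>i\<in>idxH. wt i * (norm (snd (?p N - u) i))\<^sup>2)"
        using wt_pos by (intro sum_nonneg mult_nonneg_nonneg) (auto intro: less_imp_le)
      then show "(L2_norm (fst (?p N - u)))\<^sup>2 \<le> (H.nrm (?p N - u))\<^sup>2"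
        using nrmH_sq[OF H.diff_mem[OF p u]] by linarith
    qed simp
    finally show ?thesis .
  qed
  have c0: "ipH u (\<phi> n) = 0" for n
  proof (cases "n \<in> \<Theta>")
    case True
    then show ?thesis using c\<Theta> by (simp add: c_def)
  next
    case False
    have "(\<lambda>N. C\<^sup>2 * (H.nrm (?p N - u))\<^sup>2) \<longlonglongrightarrow> 0"
      using tendsto_mult_left[OF tendsto_power[OF lim, of 2], of "C\<^sup>2"] by simp
    moreover have "\<forall>N\<ge>Suc n. (norm (c n))\<^sup>2 \<le> C\<^sup>2 * (H.nrm (?p N - u))\<^sup>2"
      using le[OF False] by auto
    ultimately have "(norm (c n))\<^sup>2 \<le> 0" by (intro LIMSEQ_le_const) blast+
    then show ?thesis by (simp add: c_def)
  qed
  have "snd u i = 0" by (rule snd_eq_0_of_nrmH(2)[OF u total[OF u c0] i])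
  then show ?thesis using wt_pos[OF i] by (simp add: u_def)
qed

end

end

section \<open>The matrix of boundary vectors\<close>

lemma bij_betw_nth_set: "distinct xs \<Longrightarrow> bij_betw ((!) xs) {..<length xs} (set xs)"
  by (rule bij_betw_nth) auto

lemma mat_of_rows_entry:
  assumes "k < length ns" "l < length xs" "length xs = N"
  shows "mat_of_rows N (map (\<lambda>n. vec_of_list (map (E n) xs)) ns) $$ (k, l) = E (ns ! k) (xs ! l)"
  using assms by (simp add: mat_of_rows_index vec_of_list_index)

text \<open>Both products with the inverse as sums over sets, free of the order of rows and columns.
  The first recovers coordinates from the rows, the second shows independence of the rows.\<close>

lemma invertible_mat_imp_inverse_sums:
  fixes E :: "'n \<Rightarrow> 'i \<Rightarrow> complex"
  assumes inv: "invertible_mat (mat_of_rows N (map (\<lambda>n. vec_of_list (map (E n) xs)) ns))"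
    and ns: "distinct ns" "length ns = N" and xs: "distinct xs" "length xs = N"
  shows "\<exists>D. (\<forall>i\<in>set xs. \<forall>j\<in>set xs. (\<Sum>m\<in>set ns. D i m * E m j) = (if i = j then 1 else 0)) \<and>
    (\<forall>m\<in>set ns. \<forall>n\<in>set ns. (\<Sum>i\<in>set xs. E m i * D i n) = (if m = n then 1 else 0))"
proof -
  define M where "M = mat_of_rows N (map (\<lambda>n. vec_of_list (map (E n) xs)) ns)"
  have M: "M \<in> carrier_mat N N"
    using mat_of_rows_carrier(1)[of N "map (\<lambda>n. vec_of_list (map (E n) xs)) ns"] unfolding M_def length_map ns(2) .
  have entry: "M $$ (k, l) = E (ns ! k) (xs ! l)" if "k < N" "l < N" for k l
    unfolding M_def using that ns xs by (intro mat_of_rows_entry) auto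
  note inv = inv[folded M_def]
  obtain B where MB: "M * B = 1\<^sub>m N" and BM: "B * M = 1\<^sub>m (dim_row B)"
    using inv M unfolding invertible_mat_def inverts_mat_def by auto
  \<comment> \<open>\<open>invertible_mat\<close> does not prescribe the shape of the inverse; it is
    read off from the dimensions of the two products.\<close>
  have "dim_col (M * B) = N" "dim_col (B * M) = dim_row B" by (simp_all only: MB BM index_one_mat)
  then have B: "B \<in> carrier_mat N N" using M by auto
  define p where "p = the_inv_into {..<N} ((!) xs)"
  define r where "r = the_inv_into {..<N} ((!) ns)"
  have bi: "bij_betw ((!) xs) {..<N} (set xs)" and bn: "bij_betw ((!) ns) {..<N} (set ns)"
    using bij_betw_nth_set[OF xs(1)] bij_betw_nth_set[OF ns(1)] xs(2) ns(2) by simp_all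
  have p: "p (xs ! k) = k" if "k < N" for k
    unfolding p_def using bi that by (intro the_inv_into_f_f) (auto simp: bij_betw_def)
  have r: "r (ns ! k) = k" if "k < N" for k
    unfolding r_def using bn that by (intro the_inv_into_f_f) (auto simp: bij_betw_def)
  show ?thesis
  proof (intro exI[of _ "\<lambda>i m. B $$ (p i, r m)"] conjI ballI)
    fix i j assume "i \<in> set xs" "j \<in> set xs"
    then obtain k l where kl: "i = xs ! k" "j = xs ! l" "k < N" "l < N" using xs(2) by (metis in_set_conv_nth)
    have "(\<Sum>m\<in>set ns. B $$ (p i, r m) * E m j) = (\<Sum>t<N. B $$ (k, t) * M $$ (t, l))"
      unfolding sum.reindex_bij_betw[OF bn, symmetric] using kl ns xs
      by (intro sum.cong refl) (simp add: p r entry)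
    also have "\<dots> = (B * M) $$ (k, l)"
      using kl B M by (simp add: scalar_prod_def lessThan_atLeast0)
    also have "\<dots> = (if i = j then 1 else 0)"
      using kl B xs by (simp add: BM nth_eq_iff_index_eq)
    finally show "(\<Sum>m\<in>set ns. B $$ (p i, r m) * E m j) = (if i = j then 1 else 0)" .
  next
    fix m n assume "m \<in> set ns" "n \<in> set ns"
    then obtain k l where kl: "m = ns ! k" "n = ns ! l" "k < N" "l < N" using ns(2) by (metis in_set_conv_nth)
    have "(\<Sum>i\<in>set xs. E m i * B $$ (p i, r n)) = (\<Sum>t<N. M $$ (k, t) * B $$ (t, l))"
      unfolding sum.reindex_bij_betw[OF bi, symmetric] using kl ns xs
      by (intro sum.cong refl) (simp add: p r entry)
    also have "\<dots> = (M * B) $$ (k, l)"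
      using kl B M by (simp add: scalar_prod_def lessThan_atLeast0)
    also have "\<dots> = (if m = n then 1 else 0)"
      using kl ns by (simp add: MB nth_eq_iff_index_eq)
    finally show "(\<Sum>i\<in>set xs. E m i * B $$ (p i, r n)) = (if m = n then 1 else 0)" .
  qed
qed

lemma not_invertible_mat_imp_kernel:
  fixes E :: "'n \<Rightarrow> 'i \<Rightarrow> complex"
  assumes inv: "\<not> invertible_mat (mat_of_rows N (map (\<lambda>n. vec_of_list (map (E n) xs)) ns))"
    and ns: "length ns = N" and xs: "distinct xs" "length xs = N"
  obtains x i where "i \<in> set xs" "x i \<noteq> 0" "\<And>m. m \<in> set ns \<Longrightarrow> (\<Sum>i\<in>set xs. E m i * x i) = 0"
proof -
  define M where "M = mat_of_rows N (map (\<lambda>n. vec_of_list (map (E n) xs)) ns)"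
  have M: "M \<in> carrier_mat N N"
    using mat_of_rows_carrier(1)[of N "map (\<lambda>n. vec_of_list (map (E n) xs)) ns"] unfolding M_def length_map ns .
  have entry: "M $$ (k, l) = E (ns ! k) (xs ! l)" if "k < N" "l < N" for k l
    unfolding M_def using that ns xs by (intro mat_of_rows_entry) auto
  note inv = inv[folded M_def]
  have "Determinant.det M = 0"
  proof (rule ccontr)
    assume "Determinant.det M \<noteq> 0"
    then have "M \<in> Units (ring_mat TYPE(complex) N ())" by (rule det_non_zero_imp_unit[OF M])
    then obtain B where "B \<in> carrier_mat N N" "B * M = 1\<^sub>m N" "M * B = 1\<^sub>m N"
      by (auto simp: Units_def ring_mat_def)
    then have "invertible_mat M"
      using M unfolding invertible_mat_def inverts_mat_def by (intro conjI exI[of _ B]) auto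
    then show False using inv by blast
  qed
  then obtain v where v: "v \<in> carrier_vec N" "v \<noteq> 0\<^sub>v N" "M *\<^sub>v v = 0\<^sub>v N"
    using det_0_iff_vec_prod_zero[OF M] by blast
  obtain k where k: "k < N" "v $ k \<noteq> 0" using v(1,2) by (auto simp: vec_eq_iff)
  define p where "p = the_inv_into {..<N} ((!) xs)"
  have bi: "bij_betw ((!) xs) {..<N} (set xs)"
    using bij_betw_nth_set[OF xs(1)] xs(2) by simp
  have p: "p (xs ! k) = k" if "k < N" for k
    unfolding p_def using bi that by (intro the_inv_into_f_f) (auto simp: bij_betw_def)
  show thesis
  proof (rule that[of "xs ! k" "\<lambda>i. v $ p i"])
    show "xs ! k \<in> set xs" "v $ p (xs ! k) \<noteq> 0" using k xs(2) by (simp_all add: p)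
    fix m assume "m \<in> set ns"
    then obtain t where t: "m = ns ! t" "t < N" using ns by (metis in_set_conv_nth)
    have "(\<Sum>i\<in>set xs. E m i * v $ p i) = (\<Sum>l<N. M $$ (t, l) * v $ l)"
      unfolding sum.reindex_bij_betw[OF bi, symmetric] using t ns xs
      by (intro sum.cong refl) (simp add: p entry)
    also have "\<dots> = (M *\<^sub>v v) $ t"
      using t M v(1) by (simp add: scalar_prod_def lessThan_atLeast0)
    also have "\<dots> = 0" using t by (simp add: v(3))
    finally show "(\<Sum>i\<in>set xs. E m i * v $ p i) = 0" .
  qed
qed

context bvp
begin

definition idxs :: "bidx list" where
  "idxs = map LP [1..<Suc (npoles f)] @ (if slope f = 0 then [] else [LS])
     @ map RP [1..<Suc (npoles F)] @ (if slope F = 0 then [] else [RS])"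

text \<open>The entries of the boundary vectors are the values in \<open>eigen_coords\<close> up to these factors.\<close>

fun coeff :: "bidx \<Rightarrow> real" where
  "coeff (LP k) = 1" | "coeff LS = - slope f" | "coeff (RP k) = 1" | "coeff RS = slope F"

fun weight :: "bidx \<Rightarrow> real" where
  "weight (LP k) = inverse (res f k)" | "weight LS = inverse (slope f)"
| "weight (RP k) = inverse (res F k)" | "weight RS = inverse (slope F)"

lemma distinct_idxs: "distinct idxs"
  by (auto simp: idxs_def distinct_map inj_on_def)

lemma set_idxs: "set idxs = idxH"
proof (rule Set.set_eqI)
  fix i show "i \<in> set idxs \<longleftrightarrow> i \<in> idxH"
    by (cases i) (auto simp: idxs_def idxH_def res_nonzero[OF f] res_nonzero[OF F])
qed

lemma length_idxs: "length idxs = bvp_dim f F"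
  by (simp add: idxs_def bvp_dim_eq[OF f F])

lemma coeff_nonzero: "i \<in> idxH \<Longrightarrow> coeff i \<noteq> 0"
  by (cases i) (auto simp: idxH_def)

lemma weight_coeff: "i \<in> idxH \<Longrightarrow> weight i * (coeff i)\<^sup>2 = wt i"
  by (cases i) (auto simp: idxH_def power2_eq_square)

lemma boundary_vec_eq:
  "boundary_vec f F \<nu> y q = vec_of_list (map (\<lambda>i. of_real (coeff i) * eigen_coords \<nu> y q i) idxs)"
  by (simp add: boundary_vec_def idxs_def eigen_coords_def o_def)

text \<open>An endpoint entry, the value times the slope up to sign, has the inverse slope as
  weight. This contributes the same as the plain value with the slope as weight, so the two
  normalizations agree.\<close>

lemma H_inner_boundary_vec:
  "H_inner f F (y, boundary_vec f F \<nu> y q) (y, boundary_vec f F \<nu> y q) =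
    L2_inner y y + (\<Sum>i\<in>idxH. of_real (wt i) * eigen_coords \<nu> y q i * cnj (eigen_coords \<nu> y q i))"
proof -
  let ?N = "bvp_dim f F" and ?e = "\<lambda>i. of_real (coeff i) * eigen_coords \<nu> y q i"
  let ?v = "boundary_vec f F \<nu> y q"
  have v: "?v $ k = ?e (idxs ! k)" if "k < ?N" for k
    using that by (simp add: boundary_vec_eq vec_of_list_index length_idxs)
  have dv: "dim_vec ?v = ?N" by (rule dim_boundary_vec[OF f F])
  have "map (\<lambda>k. inverse (res f k)) [1..<Suc (npoles f)]
        @ (if slope f = 0 then [] else [inverse (slope f)])
        @ map (\<lambda>k. inverse (res F k)) [1..<Suc (npoles F)]
        @ (if slope F = 0 then [] else [inverse (slope F)]) = map weight idxs"
    by (simp add: idxs_def o_def)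
  then have W: "H_weight f F = mat_diag ?N (\<lambda>k. of_real (weight (idxs ! k)))"
    unfolding H_weight_def Let_def mat_diag_def
    by (intro cong_mat refl) (simp add: length_idxs)
  have Wv: "(H_weight f F *\<^sub>v ?v) $ k = of_real (weight (idxs ! k)) * ?v $ k" if k: "k < ?N" for k
  proof -
    have "(H_weight f F *\<^sub>v ?v) $ k = (\<Sum>l<?N. (if k = l then of_real (weight (idxs ! l)) else 0) * ?v $ l)"
      using k by (simp add: W mat_diag_def scalar_prod_def dv lessThan_atLeast0)
    also have "\<dots> = (\<Sum>l<?N. if l = k then of_real (weight (idxs ! k)) * ?v $ k else 0)"
      by (intro sum.cong) auto
    finally show ?thesis using k by simp
  qed
  have "(H_weight f F *\<^sub>v ?v) \<bullet>c ?v = (\<Sum>k<?N. of_real (weight (idxs ! k)) * ?e (idxs ! k) * cnj (?e (idxs ! k)))"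
    unfolding scalar_prod_def by (simp add: dv Wv v lessThan_atLeast0)
  also have "\<dots> = (\<Sum>i\<in>idxH. of_real (weight i) * ?e i * cnj (?e i))"
    using sum.reindex_bij_betw[OF bij_betw_nth_set[OF distinct_idxs], of "\<lambda>i. of_real (weight i) * ?e i * cnj (?e i)"]
    by (simp add: length_idxs set_idxs)
  also have "\<dots> = (\<Sum>i\<in>idxH. of_real (wt i) * eigen_coords \<nu> y q i * cnj (eigen_coords \<nu> y q i))"
    by (intro sum.cong refl) (simp add: weight_coeff[symmetric] power2_eq_square mult_ac)
  finally show ?thesis by (simp add: H_inner_def)
qed

end

theorem mainTheorem1:
  fixes s :: "real \<Rightarrow> real"
    and f F :: bc_function
    and lam :: "nat \<Rightarrow> real"
    and \<psi> \<psi>1 :: "nat \<Rightarrow> real \<Rightarrow> complex"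
    and ns :: "nat list"
  assumes s: "square_integrable s"
    and f: "bc_admissible f"
    and F: "bc_admissible F"
    and lam_mono: "strict_mono lam"
    and lam_eigenvalues: "eigenvalues s f F = range (\<lambda>n. complex_of_real (lam n))"
    and eigenfunction: "\<And>n. is_eigenfunction s f F (complex_of_real (lam n)) (\<psi> n) (\<psi>1 n)"
    and real_valued: "\<And>n x. x \<in> {0..pi} \<Longrightarrow> \<psi> n x \<in> \<real>"
    and normalized: "\<And>n. H_norm f F (\<psi> n, boundary_vec f F (lam n) (\<psi> n) (\<psi>1 n)) = 1"
    and ns: "distinct ns" "length ns = bvp_dim f F"
  shows "L2_Riesz_basis (UNIV - set ns) \<psi> \<longleftrightarrow>
    invertible_mat (mat_of_rows (bvp_dim f F)
      (map (\<lambda>n. boundary_vec f F (lam n) (\<psi> n) (\<psi>1 n)) ns))"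
proof -
  interpret bvp s f F by (rule bvp.intro[OF s f F])
  have "\<exists>v. weak (lam n) v \<and> (\<forall>x\<in>{0..pi}. traj v x = \<psi> n x) \<and> btrace v = eigen_coords (lam n) (\<psi> n) (\<psi>1 n)" for n
    using eigenfunction_weak[OF eigenfunction[of n]] by metis
  then obtain v where weak: "\<And>n. weak (lam n) (v n)" and tv: "\<And>n x. x \<in> {0..pi} \<Longrightarrow> traj (v n) x = \<psi> n x"
    and bv: "\<And>n. btrace (v n) = eigen_coords (lam n) (\<psi> n) (\<psi>1 n)" by metis
  define \<phi> where "\<phi> n = hembed (v n)" for n
  have \<phi>: "fst (\<phi> n) = traj (v n)" "snd (\<phi> n) = eigen_coords (lam n) (\<psi> n) (\<psi>1 n)" for n
    by (simp_all add: \<phi>_def hembed_def bv)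
  have nv: "H.nrm (hembed (v n)) = 1" for n
  proof -
    have "L2_inner (traj (v n)) (traj (v n)) = L2_inner (\<psi> n) (\<psi> n)"
      unfolding L2_inner_def by (intro Bochner_Integration.integral_cong refl) (simp add: tv)
    then have "ipH (hembed (v n)) (hembed (v n)) =
        H_inner f F (\<psi> n, boundary_vec f F (lam n) (\<psi> n) (\<psi>1 n)) (\<psi> n, boundary_vec f F (lam n) (\<psi> n) (\<psi>1 n))"
      by (simp add: H_inner_boundary_vec ipH_idxH hembed_def bv)
    then show ?thesis using normalized[of n] by (simp add: H_norm_def H.nrm_def)
  qed
  note on = orthonormal_total[OF lam_mono lam_eigenvalues weak nv, folded \<phi>_def]
  define E where "E n i = complex_of_real (coeff i) * snd (\<phi> n) i" for n i
  have M: "map (\<lambda>n. boundary_vec f F (lam n) (\<psi> n) (\<psi>1 n)) ns = map (\<lambda>n. vec_of_list (map (E n) idxs)) ns"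
    by (simp add: boundary_vec_eq E_def[abs_def] \<phi>)
  have "L2_Riesz_basis (UNIV - set ns) \<psi> \<longleftrightarrow> L2_Riesz_basis (UNIV - set ns) (\<lambda>n. fst (\<phi> n))"
    by (rule L2_Riesz_basis_cong) (simp add: \<phi> tv)
  also have "\<dots> \<longleftrightarrow> invertible_mat (mat_of_rows (bvp_dim f F) (map (\<lambda>n. vec_of_list (map (E n) idxs)) ns))"
  proof
    assume inv: "invertible_mat (mat_of_rows (bvp_dim f F) (map (\<lambda>n. vec_of_list (map (E n) idxs)) ns))"
    obtain D where "\<forall>i\<in>idxH. \<forall>j\<in>idxH. (\<Sum>m\<in>set ns. D i m * E m j) = (if i = j then 1 else 0)"
      "\<forall>m\<in>set ns. \<forall>n\<in>set ns. (\<Sum>i\<in>idxH. E m i * D i n) = (if m = n then 1 else 0)"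
      using invertible_mat_imp_inverse_sums[OF inv ns distinct_idxs length_idxs] unfolding set_idxs by (elim exE conjE)
    note D = this[rule_format]
    show "L2_Riesz_basis (UNIV - set ns) (\<lambda>n. fst (\<phi> n))"
    proof (rule Riesz_basis_of_left_inverse[OF on])
      fix i j assume ij: "i \<in> idxH" "j \<in> idxH"
      \<comment> \<open>The matrix \<open>E\<close> is the coordinate matrix times the diagonal
        matrix of \<open>coeff\<close>, so multiplying \<open>D\<close> by the same diagonal matrix
        from the left gives an inverse of the coordinate matrix.\<close>
      have "of_real (coeff j) * (\<Sum>m\<in>set ns. of_real (coeff i) * D i m * snd (\<phi> m) j) =
          of_real (coeff i) * (\<Sum>m\<in>set ns. D i m * E m j)"
        unfolding E_def sum_distrib_left by (intro sum.cong refl) (simp add: mult_ac)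
      then show "(\<Sum>m\<in>set ns. of_real (coeff i) * D i m * snd (\<phi> m) j) = (if i = j then 1 else 0)"
        using D(1)[OF ij] coeff_nonzero[OF ij(1)] coeff_nonzero[OF ij(2)] by (auto split: if_splits)
    next
      fix c n assume c: "\<And>i. i \<in> idxH \<Longrightarrow> (\<Sum>m\<in>set ns. c m * snd (\<phi> m) i) = 0" and n: "n \<in> set ns"
      have "c n = (\<Sum>m\<in>set ns. c m * (if m = n then 1 else 0))"
        using n by (simp add: if_distrib[of "(*) _"] sum.delta cong: if_cong)
      also have "\<dots> = (\<Sum>m\<in>set ns. c m * (\<Sum>i\<in>idxH. E m i * D i n))"
        using n by (intro sum.cong refl) (simp only: D(2))
      also have "\<dots> = (\<Sum>m\<in>set ns. \<Sum>i\<in>idxH. of_real (coeff i) * D i n * (c m * snd (\<phi> m) i))"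
        unfolding E_def sum_distrib_left by (intro sum.cong refl) (simp add: mult_ac)
      also have "\<dots> = (\<Sum>i\<in>idxH. of_real (coeff i) * D i n * (\<Sum>m\<in>set ns. c m * snd (\<phi> m) i))"
        unfolding sum_distrib_left by (rule sum.swap)
      also have "\<dots> = 0" by (intro sum.neutral ballI) (simp add: c)
      finally show "c n = 0" .
    qed simp_all
  next
    assume R: "L2_Riesz_basis (UNIV - set ns) (\<lambda>n. fst (\<phi> n))"
    show "invertible_mat (mat_of_rows (bvp_dim f F) (map (\<lambda>n. vec_of_list (map (E n) idxs)) ns))"
    proof (rule ccontr)
      assume inv: "\<not> invertible_mat (mat_of_rows (bvp_dim f F) (map (\<lambda>n. vec_of_list (map (E n) idxs)) ns))"
      obtain x i where i: "i \<in> idxH" "x i \<noteq> 0" and x: "\<And>m. m \<in> set ns \<Longrightarrow> (\<Sum>i\<in>idxH. E m i * x i) = 0"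
        by (rule not_invertible_mat_imp_kernel[OF inv ns(2) distinct_idxs length_idxs, unfolded set_idxs]) blast
      \<comment> \<open>Absorbing the diagonal factors turns a kernel vector of \<open>E\<close>
        into one of the coordinate matrix.\<close>
      have "of_real (coeff i) * x i = 0"
      proof (rule kernel_zero_of_Riesz_basis[OF on _ R _ i(1)])
        fix m assume "m \<in> set ns"
        from x[OF this] show "(\<Sum>i\<in>idxH. snd (\<phi> m) i * (of_real (coeff i) * x i)) = 0"
          by (simp add: E_def mult_ac)
      qed simp_all
      then show False using i coeff_nonzero[OF i(1)] by simp
    qed
  qed
  finally show ?thesis unfolding M .
qed

end
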